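(* Consider the conservative (staggered) Hermite method of degree $m$ described in the context, with temporal order parameter $q=3m+2$, applied to the $2\pi$-periodic Maxwell system in a uniform dielectric medium in three space dimensions, and assume the time step satisfies $c\,\Delta t<\min_{k}\Delta x_k$. Then at every discrete time $t=t_n$ the approximate solution satisfies $$ \begin{aligned} &|P^{+,h}(\cdot,t+\Delta t)|_m^2+|P^{-,h}(\cdot,t+\Delta t)|_m^2+2|E_N^h(\cdot,t+\Delta t)|_m^2+2|H_N^h(\cdot,t+\Delta t/2)|_m^2\\ &=|Q^{+,h}(\cdot,t+\Delta t/2)|_m^2+|Q^{-,h}(\cdot,t+\Delta t/2)|_m^2+2|H_N^h(\cdot,t+\Delta t/2)|_m^2+2|E_N^h(\cdot,t)|_m^2\\ &=|P^{+,h}(\cdot,t)|_m^2+|P^{-,h}(\cdot,t)|_m^2+2|E_N^h(\cdot,t)|_m^2+2|H_N^h(\cdot,t-\Delta t/2)|_m^2 . \end{aligned} $$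
   Context: **Equations.** $\epsilon,\mu>0$ are constants, $c=(\epsilon\mu)^{-1/2}$, and $\tilde E=\sqrt{\epsilon}E$, $\tilde H=\sqrt{\mu}H$ satisfy $\partial_t\tilde E=c\,\nabla\times\tilde H$, $\partial_t\tilde H=-c\,\nabla\times\tilde E$, with all functions $2\pi$-periodic in each of $x_1,x_2,x_3$; $\mathbb T$ is the periodic domain. **Grids and interpolation.** The primal grid is a uniform periodic Cartesian grid with vertices $\mathbf x_{j}=(x_{1,j_1},x_{2,j_2},x_{3,j_3})$ and spacings $\Delta x_k$ (integer fractions of $2\pi$). The dual grid has vertices $\mathbf x_{j+1/2}=(x_{1,j_1+1/2},x_{2,j_2+1/2},x_{3,j_3+1/2})$, the centers of the primal cells. Fix $m\ge 0$. For a periodic vector function $f$ whose derivatives $D^\alpha f$, $0\le\alpha_1,\alpha_2,\alpha_3\le m$, are continuous, the Hermite-Birkhoff interpolant $\mathcal I_m f$ on a grid (primal or dual) is the function which on each cell of that grid is the unique tensor-product polynomial of degree at most $2m+1$ in each variable satisfying $D^\alpha(\mathcal I_m f)=D^\alpha f$ for all $0\le\alpha_1,\alpha_2,\alpha_3\le m$ at the 8 cell vertices. It is determined by the vertex data $D^\alpha f$. The same symbol $\mathcal I_m$ is used for both grids. **Method.** Let $t_n=n\Delta t$, $t_{n+1/2}=(n+1/2)\Delta t$. The electric data (approximations of $D^\alpha\tilde E(t_n)$, $0\le\alpha_i\le m$) live at primal vertices at times $t_n$; $\tilde E^h(\cdot,t_n)$ is their Hermite-Birkhoff interpolant on the primal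 grid. The magnetic data (approximations of $D^\alpha\tilde H(t_{n+1/2})$) live at dual vertices at times $t_{n+1/2}$; $\tilde H^h(\cdot,t_{n+1/2})$ is their interpolant on the dual grid. Let $q\ge1$ be an integer. Electric update: at each primal vertex $\mathbf x_j$ (the center of a dual cell), let $\tilde W$ be the polynomial that equals $\tilde H^h(\cdot,t_{n+1/2})$ on that dual cell, set $V^1=c\nabla\times\tilde W$, $V^\ell=-c^2\nabla\times\nabla\times V^{\ell-1}$, and $$D^\alpha\tilde E^h(\mathbf x_j,t_{n+1})=D^\alpha\tilde E^h(\mathbf x_j,t_n)+D^\alpha\Big(2\sum_{\ell=1}^q\frac{(\Delta t/2)^{2\ell-1}}{(2\ell-1)!}V^\ell\Big)(\mathbf x_j),\quad 0\le\alpha_i\le m.$$ Magnetic update: at each dual vertex $\mathbf x_{j+1/2}$, let $\tilde V$ be the polynomial that equals $\tilde E^h(\cdot,t_n)$ on the primal cell centered there, set $W^1=-c\nabla\times\tilde V$, $W^\ell=-c^2\nabla\times\nabla\times W^{\ell-1}$, and $$D^\alpha\tilde H^h(\mathbf x_{j+1/2},t_{n+1/2})=D^\alpha\tilde H^h(\mathbf x_{j+1/2},t_{n-1/2})+D^\alpha\Big(2\sum_{\ell=1}^q\frac{(\Delta t/2)^{2\ell-1}}{(2\ell-1)!}W^\ell\Big)(\mathbf x_{j+1/2}),\quad 0\le\alpha_i\le m.$$ **Fourier operators.** For a periodic vector function $U$ with Fourier coefficients $\hat U(k)$, $k\in\mathbb Z^3$, and $\hat k=k/|k|$ for $k\ne0$: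 $\widehat{U_N}(k)=\hat k\hat k^T\hat U(k)$, $U_S=U-U_N$, $\widehat{\mathcal C U}(k)=\hat k\times\hat U(k)$; for $k=0$ the convention is $\widehat{U_N}(0)=\hat U(0)$, $\widehat{U_S}(0)=0$, $\widehat{\mathcal CU}(0)=0$. Also $\widehat{S^{\pm}U}(k)=e^{\pm ic|k|\Delta t/2}\hat U(k)$. Write $E_S^h,E_N^h$ for the components $(\tilde E^h)_S,(\tilde E^h)_N$ and $H_S^h,H_N^h$ for $(\tilde H^h)_S,(\tilde H^h)_N$. Define, for $t=t_n$, $$P^{\pm,h}(\mathbf x,t)=E_S^h(\mathbf x,t)\mp S^{\pm}\mathcal C H_S^h(\mathbf x,t-\Delta t/2),\qquad Q^{\pm,h}(\mathbf x,t+\Delta t/2)=H_S^h(\mathbf x,t+\Delta t/2)\pm S^{\pm}\mathcal C E_S^h(\mathbf x,t).$$ **HB seminorm.** $\langle f,g\rangle_m=\Big\langle\frac{\partial^{3m+3}f}{\partial x_1^{m+1}\partial x_2^{m+1}\partial x_3^{m+1}},\frac{\partial^{3m+3}g}{\partial x_1^{m+1}\partial x_2^{m+1}\partial x_3^{m+1}}\Big\rangle_{(L^2(\mathbb T))^3}$ and $|f|_m^2=\langle f,f\rangle_m$. *)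

theory Defs
  imports "HOL-Analysis.Analysis"
begin

section \<open>Differential operators and tensor-product polynomials\<close>

definition partial ::
    "3 \<Rightarrow> (real ^ 3 \<Rightarrow> 'b::real_normed_vector) \<Rightarrow> real ^ 3 \<Rightarrow> 'b" where
  "partial i f = (\<lambda>x. vector_derivative (\<lambda>h. f (x + axis i h)) (at 0))"

definition mixed_partial ::
    "nat ^ 3 \<Rightarrow> (real ^ 3 \<Rightarrow> 'b::real_normed_vector) \<Rightarrow> real ^ 3 \<Rightarrow> 'b" where
  "mixed_partial \<alpha> f =
     (partial 1 ^^ (\<alpha> $ 1)) ((partial 2 ^^ (\<alpha> $ 2)) ((partial 3 ^^ (\<alpha> $ 3)) f))"

definition curl :: "(real ^ 3 \<Rightarrow> real ^ 3) \<Rightarrow> real ^ 3 \<Rightarrow> real ^ 3" where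
  "curl F = (\<lambda>x. vector
     [partial 2 F x $ 3 - partial 3 F x $ 2,
      partial 3 F x $ 1 - partial 1 F x $ 3,
      partial 1 F x $ 2 - partial 2 F x $ 1])"

definition multi_indices :: "nat \<Rightarrow> (nat ^ 3) set" where
  "multi_indices d = {\<alpha>. \<forall>i. \<alpha> $ i \<le> d}"

definition tensor_poly :: "nat \<Rightarrow> (real ^ 3 \<Rightarrow> real ^ 3) \<Rightarrow> bool" where
  "tensor_poly d p \<longleftrightarrow>
     (\<exists>a :: nat ^ 3 \<Rightarrow> real ^ 3.
        \<forall>x. p x = (\<Sum>\<alpha>\<in>multi_indices d. (\<Prod>i\<in>UNIV. x $ i ^ (\<alpha> $ i)) *\<^sub>R a \<alpha>))"


section \<open>Periodic grids and Hermite-Birkhoff interpolation\<close>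

text \<open>
  A grid is given by the numbers of cells \<open>N $ i\<close> per period in each direction and by
  the position \<open>o'\<close> of its vertex with index \<open>0\<close>.  Vertices are indexed by all of \<open>int ^ 3\<close>;
  vertex data are functions of the vertex index \<open>j\<close> and the order \<open>\<alpha>\<close> of the derivative that
  they represent, and are periodic in \<open>j\<close>.
\<close>

type_synonym vertex_data = "int ^ 3 \<Rightarrow> nat ^ 3 \<Rightarrow> real ^ 3"

definition spacing :: "nat ^ 3 \<Rightarrow> real ^ 3" where
  "spacing N = (\<chi> i. 2 * pi / real (N $ i))"

definition vertex :: "nat ^ 3 \<Rightarrow> real ^ 3 \<Rightarrow> int ^ 3 \<Rightarrow> real ^ 3" where
  "vertex N o' j = (\<chi> i. o' $ i + real_of_int (j $ i) * spacing N $ i)"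

definition dual_origin :: "nat ^ 3 \<Rightarrow> real ^ 3 \<Rightarrow> real ^ 3" where
  "dual_origin N o' = o' + (1 / 2) *\<^sub>R spacing N"

definition periodic_data :: "nat ^ 3 \<Rightarrow> nat \<Rightarrow> vertex_data \<Rightarrow> bool" where
  "periodic_data N m d \<longleftrightarrow>
     (\<forall>i j. \<forall>\<alpha>\<in>multi_indices m. d (j + axis i (int (N $ i))) \<alpha> = d j \<alpha>)"

text \<open>
  Cell \<open>j\<close> of a grid is the cell with vertices \<open>j + \<beta>\<close>, \<open>\<beta> \<in> {0, 1}\<^sup>3\<close>.
  The cell polynomial is a function on the whole space.
\<close>

definition cell_poly ::
    "nat ^ 3 \<Rightarrow> real ^ 3 \<Rightarrow> nat \<Rightarrow> vertex_data \<Rightarrow> int ^ 3 \<Rightarrow> real ^ 3 \<Rightarrow> real ^ 3" where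
  "cell_poly N o' m d j =
     (THE p. tensor_poly (2 * m + 1) p \<and>
        (\<forall>\<beta> :: int ^ 3. (\<forall>i. \<beta> $ i \<in> {0, 1}) \<longrightarrow>
           (\<forall>\<alpha>\<in>multi_indices m. mixed_partial \<alpha> p (vertex N o' (j + \<beta>)) = d (j + \<beta>) \<alpha>)))"

definition cell_of :: "nat ^ 3 \<Rightarrow> real ^ 3 \<Rightarrow> real ^ 3 \<Rightarrow> int ^ 3" where
  "cell_of N o' x = (\<chi> i. \<lfloor>(x $ i - o' $ i) / spacing N $ i\<rfloor>)"

definition hb_interp ::
    "nat ^ 3 \<Rightarrow> real ^ 3 \<Rightarrow> nat \<Rightarrow> vertex_data \<Rightarrow> real ^ 3 \<Rightarrow> real ^ 3" where
  "hb_interp N o' m d = (\<lambda>x. cell_poly N o' m d (cell_of N o' x) x)"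


section \<open>The conservative Hermite method\<close>

text \<open>
  \<open>taylor_term c G l\<close> is the \<open>l\<close>-th iterate, with \<open>taylor_term c G 1 = G\<close>; the starting
  field \<open>G\<close> is \<open>c \<nabla> \<times> W\<close> in the electric and \<open>-c \<nabla> \<times> V\<close> in the magnetic update.
\<close>

definition taylor_term ::
    "real \<Rightarrow> (real ^ 3 \<Rightarrow> real ^ 3) \<Rightarrow> nat \<Rightarrow> real ^ 3 \<Rightarrow> real ^ 3" where
  "taylor_term c G l = ((\<lambda>F x. - (c\<^sup>2) *\<^sub>R curl (curl F) x) ^^ (l - 1)) G"

definition increment ::
    "real \<Rightarrow> real \<Rightarrow> nat \<Rightarrow> (real ^ 3 \<Rightarrow> real ^ 3) \<Rightarrow> real ^ 3 \<Rightarrow> real ^ 3" where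
  "increment c \<Delta>t q G = (\<lambda>x. 2 *\<^sub>R
     (\<Sum>l = 1..q. ((\<Delta>t / 2) ^ (2 * l - 1) / fact (2 * l - 1)) *\<^sub>R taylor_term c G l x))"

text \<open>
  \<open>E n\<close> holds the electric data at time \<open>t\<^sub>n\<close> on the primal grid with origin \<open>o'\<close>, and
  \<open>H n\<close> the magnetic data at time \<open>t\<^sub>n - \<Delta>t / 2\<close> on the dual grid.
  Dual vertex \<open>j\<close> is the center of primal cell \<open>j\<close>, and primal vertex \<open>j\<close> is the
  center of dual cell \<open>j - 1\<close>.
\<close>

definition hermite_method ::
    "real \<Rightarrow> real \<Rightarrow> nat \<Rightarrow> nat ^ 3 \<Rightarrow> real ^ 3 \<Rightarrow> nat
      \<Rightarrow> (nat \<Rightarrow> vertex_data) \<Rightarrow> (nat \<Rightarrow> vertex_data) \<Rightarrow> bool" where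
  "hermite_method c \<Delta>t q N o' m E H \<longleftrightarrow>
     (\<forall>n. periodic_data N m (E n) \<and> periodic_data N m (H n)) \<and>
     (\<forall>n j. \<forall>\<alpha>\<in>multi_indices m.
        let V = cell_poly N o' m (E n) j
        in H (Suc n) j \<alpha> = H n j \<alpha> +
             mixed_partial \<alpha> (increment c \<Delta>t q (\<lambda>x. - c *\<^sub>R curl V x))
               (vertex N (dual_origin N o') j)) \<and>
     (\<forall>n j. \<forall>\<alpha>\<in>multi_indices m.
        let W = cell_poly N (dual_origin N o') m (H (Suc n)) (j - 1)
        in E (Suc n) j \<alpha> = E n j \<alpha> +
             mixed_partial \<alpha> (increment c \<Delta>t q (\<lambda>x. c *\<^sub>R curl W x))
               (vertex N o' j))"


section \<open>Periodic square-integrable functions and Fourier multipliers\<close>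

definition torus :: "(real ^ 3) set" where
  "torus = cbox 0 (\<chi> i. 2 * pi)"

definition periodic :: "(real ^ 3 \<Rightarrow> 'b) \<Rightarrow> bool" where
  "periodic f \<longleftrightarrow> (\<forall>x i. f (x + axis i (2 * pi)) = f x)"

definition periodic_L2 :: "(real ^ 3 \<Rightarrow> complex ^ 3) \<Rightarrow> bool" where
  "periodic_L2 f \<longleftrightarrow> periodic f \<and> f \<in> borel_measurable borel \<and>
     set_integrable lborel torus (\<lambda>x. (norm (f x))\<^sup>2)"

definition L2_inner :: "(real ^ 3 \<Rightarrow> complex ^ 3) \<Rightarrow> (real ^ 3 \<Rightarrow> complex ^ 3) \<Rightarrow> complex" where
  "L2_inner f g = (LINT x:torus|lborel. (\<Sum>i\<in>UNIV. f x $ i * cnj (g x $ i)))"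

definition complexify :: "(real ^ 3 \<Rightarrow> real ^ 3) \<Rightarrow> real ^ 3 \<Rightarrow> complex ^ 3" where
  "complexify f = (\<lambda>x. \<chi> i. complex_of_real (f x $ i))"

definition wavevec :: "int ^ 3 \<Rightarrow> real ^ 3" where
  "wavevec k = (\<chi> i. real_of_int (k $ i))"

definition unit_wavevec :: "int ^ 3 \<Rightarrow> complex ^ 3" where
  "unit_wavevec k = (\<chi> i. complex_of_real (wavevec k $ i / norm (wavevec k)))"

definition fourier_coeff :: "(real ^ 3 \<Rightarrow> complex ^ 3) \<Rightarrow> int ^ 3 \<Rightarrow> complex ^ 3" where
  "fourier_coeff U k =
     (1 / (2 * pi) ^ 3) *\<^sub>R (LINT x:torus|lborel. cis (- (wavevec k \<bullet> x)) *s U x)"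

text \<open>
  The function with the prescribed Fourier coefficients is unique only up to a null set;
  everything below is insensitive to the choice of the representative.
\<close>

definition fourier_multiplier ::
    "(int ^ 3 \<Rightarrow> complex ^ 3 \<Rightarrow> complex ^ 3) \<Rightarrow> (real ^ 3 \<Rightarrow> complex ^ 3)
      \<Rightarrow> real ^ 3 \<Rightarrow> complex ^ 3" where
  "fourier_multiplier M U =
     (SOME V. periodic_L2 V \<and> (\<forall>k. fourier_coeff V k = M k (fourier_coeff U k)))"

text \<open>The product \<open>cross3\<close> of the library is restricted to real vectors.\<close>

definition complex_cross :: "complex ^ 3 \<Rightarrow> complex ^ 3 \<Rightarrow> complex ^ 3" where
  "complex_cross a b = vector
     [a $ 2 * b $ 3 - a $ 3 * b $ 2,
      a $ 3 * b $ 1 - a $ 1 * b $ 3,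
      a $ 1 * b $ 2 - a $ 2 * b $ 1]"

definition N_part :: "(real ^ 3 \<Rightarrow> complex ^ 3) \<Rightarrow> real ^ 3 \<Rightarrow> complex ^ 3" where
  "N_part = fourier_multiplier (\<lambda>k u. if k = 0 then u
     else (\<Sum>i\<in>UNIV. unit_wavevec k $ i * u $ i) *s unit_wavevec k)"

definition S_part :: "(real ^ 3 \<Rightarrow> complex ^ 3) \<Rightarrow> real ^ 3 \<Rightarrow> complex ^ 3" where
  "S_part U = (\<lambda>x. U x - N_part U x)"

definition C_op :: "(real ^ 3 \<Rightarrow> complex ^ 3) \<Rightarrow> real ^ 3 \<Rightarrow> complex ^ 3" where
  "C_op = fourier_multiplier (\<lambda>k u. if k = 0 then 0 else complex_cross (unit_wavevec k) u)"

text \<open>Below, the sign \<open>\<sigma> = \<plusminus>1\<close> selects the upper or lower sign of \<open>S\<^sup>\<plusminus>\<close>, \<open>P\<^sup>\<plusminus>\<close>, \<open>Q\<^sup>\<plusminus>\<close>.\<close>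

definition S_op ::
    "real \<Rightarrow> real \<Rightarrow> real \<Rightarrow> (real ^ 3 \<Rightarrow> complex ^ 3) \<Rightarrow> real ^ 3 \<Rightarrow> complex ^ 3" where
  "S_op c \<Delta>t \<sigma> = fourier_multiplier (\<lambda>k u. cis (\<sigma> * c * norm (wavevec k) * \<Delta>t / 2) *s u)"

definition P_var ::
    "real \<Rightarrow> real \<Rightarrow> real \<Rightarrow> (real ^ 3 \<Rightarrow> complex ^ 3) \<Rightarrow> (real ^ 3 \<Rightarrow> complex ^ 3)
      \<Rightarrow> real ^ 3 \<Rightarrow> complex ^ 3" where
  "P_var c \<Delta>t \<sigma> E H = (\<lambda>x. S_part E x - \<sigma> *\<^sub>R S_op c \<Delta>t \<sigma> (C_op (S_part H)) x)"

definition Q_var ::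
    "real \<Rightarrow> real \<Rightarrow> real \<Rightarrow> (real ^ 3 \<Rightarrow> complex ^ 3) \<Rightarrow> (real ^ 3 \<Rightarrow> complex ^ 3)
      \<Rightarrow> real ^ 3 \<Rightarrow> complex ^ 3" where
  "Q_var c \<Delta>t \<sigma> H E = (\<lambda>x. S_part H x + \<sigma> *\<^sub>R S_op c \<Delta>t \<sigma> (C_op (S_part E)) x)"


section \<open>The Hermite-Birkhoff seminorm\<close>

text \<open>
  The interpolants are in general only of class \<open>C\<^sup>m\<close>, and the Fourier multipliers are nonlocal,
  so the derivative of order \<open>m + 1\<close> in each variable is a weak derivative in \<open>L\<^sup>2\<close> of the torus.
\<close>

definition smooth_periodic :: "(real ^ 3 \<Rightarrow> real) \<Rightarrow> bool" where
  "smooth_periodic \<phi> \<longleftrightarrow>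
     periodic \<phi> \<and> (\<forall>ds :: 3 list. foldr partial ds \<phi> differentiable_on UNIV)"

definition is_weak_deriv ::
    "nat ^ 3 \<Rightarrow> (real ^ 3 \<Rightarrow> complex ^ 3) \<Rightarrow> (real ^ 3 \<Rightarrow> complex ^ 3) \<Rightarrow> bool" where
  "is_weak_deriv \<alpha> f g \<longleftrightarrow> periodic_L2 g \<and>
     (\<forall>\<phi>. smooth_periodic \<phi> \<longrightarrow>
        (LINT x:torus|lborel. \<phi> x *\<^sub>R g x) =
          (- 1) ^ (\<Sum>i\<in>UNIV. \<alpha> $ i) *\<^sub>R (LINT x:torus|lborel. mixed_partial \<alpha> \<phi> x *\<^sub>R f x))"

definition weak_deriv ::
    "nat ^ 3 \<Rightarrow> (real ^ 3 \<Rightarrow> complex ^ 3) \<Rightarrow> real ^ 3 \<Rightarrow> complex ^ 3" where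
  "weak_deriv \<alpha> f = (SOME g. is_weak_deriv \<alpha> f g)"

definition hb_inner ::
    "nat \<Rightarrow> (real ^ 3 \<Rightarrow> complex ^ 3) \<Rightarrow> (real ^ 3 \<Rightarrow> complex ^ 3) \<Rightarrow> complex" where
  "hb_inner m f g = L2_inner (weak_deriv (\<chi> i. m + 1) f) (weak_deriv (\<chi> i. m + 1) g)"

definition hb_seminorm :: "nat \<Rightarrow> (real ^ 3 \<Rightarrow> complex ^ 3) \<Rightarrow> real" where
  "hb_seminorm m f = sqrt (Re (hb_inner m f f))"

end

theory Submission
  imports Defs "HOL-Computational_Algebra.Polynomial"
begin

text \<open>
  Let \<open>e\<close>, \<open>h\<close> be the Fourier coefficients of the electric and magnetic interpolants at the wave vector \<open>k\<close>, and put
  \<open>K(k) = \<Prod>\<^sub>i (\<i> k\<^sub>i)\<^sup>m\<^sup>+\<^sup>1\<close>, \<open>n = k/|k|\<close>, \<open>\<tau> = c \<Delta>t / 2\<close>.  By Parseval the squared seminorm is the sum of \<open>|K|\<^sup>2\<close> times the squared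
  coefficients (\<open>hb_seminorm_sq\<close>).  The operators in \<open>P\<close> and \<open>Q\<close> are Fourier multipliers, and since \<open>u \<mapsto> n \<times> u\<close> is an isometry
  of the solenoidal part, the four squares at an integer time add up, for every \<open>k\<close>, to
  \<open>|K|\<^sup>2 (2|e|\<^sup>2 + 2|h|\<^sup>2 - 2 Re \<langle>e, T h\<rangle>)\<close> with \<open>T u = 2 \<i> sin(\<tau>|k|) n \<times> u\<close> (\<open>characteristic_energy\<close>); at a half-integer time
  \<open>e\<close> and \<open>h\<close> change places and \<open>\<tau>\<close> changes its sign.  The symbol \<open>T\<close> is the exact leapfrog step: the electric field of a solution
  of Maxwell's equations changes by \<open>T h\<close> over one time step.  Subtracting, an update of \<open>e\<close> to \<open>e'\<close> changes the sum by
  \<open>2 Re \<Sum>\<^sub>k |K|\<^sup>2 \<langle>(e' - e) - T h, e' + e\<rangle>\<close> (\<open>energy_balance\<close>).  So the theorem says that the residual of an update is orthogonal,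
  in the Hermite-Birkhoff inner product, to all splines on the grid that is updated (\<open>update_residual_orthogonal\<close>).

  This orthogonality has three sources.

  (1) Integration by parts.  In each cell a spline \<open>v\<close> has degree \<open>2m + 1\<close> in each variable, so \<open>m + 1\<close> integrations by parts in every
  variable reduce the inner product of \<open>g\<close> with \<open>v\<close> to a combination of the values \<open>D\<^sup>\<alpha> g\<close>, \<open>\<alpha>\<^sub>i \<le> m\<close>, at the vertices
  (\<open>mean1_Psi\<close>, \<open>Theta_vertex\<close>, \<open>Theta_spline\<close>).  It remains to compare the vertex data of the increment with those of \<open>T\<close> applied
  to the other field.

  (2) Finite speed of propagation.  \<open>T\<close> is \<open>c \<Delta>t\<close> times the curl of the mean over the sphere of radius \<open>|\<tau>|\<close>, whose symbol is
  \<open>sin(\<tau>|k|) / (\<tau>|k|)\<close> (\<open>sph_symbol\<close>).  Because \<open>c \<Delta>t\<close> is smaller than the spacings, the sphere around a vertex lies in the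
  interior of the dual cell that is centered there, where the other field is a polynomial.

  (3) Exactness of the Taylor polynomial.  For a polynomial of total degree at most \<open>6m + 3\<close> Pizzetti's formula expresses the spherical
  mean by the powers \<open>0, \<dots>, 3m + 1\<close> of the Laplacian; these are the \<open>3m + 2\<close> terms of the update (\<open>Pizzetti\<close>, \<open>increment_eq_sph\<close>).

  The Fourier series of the derivatives \<open>D\<^sup>\<alpha>\<close> of \<open>T h\<close> need not converge at a vertex.  Therefore the comparison in
  \<open>Theta_derivative\<close> replaces derivatives by products of difference quotients and averages of width \<open>\<epsilon>\<close>.  These act locally, have
  bounded symbols \<open>\<Prod>\<^sub>i (\<i> k\<^sub>i)\<^sup>\<beta> (sin(\<epsilon> k\<^sub>i) / (\<epsilon> k\<^sub>i))\<^sup>m\<^sup>+\<^sup>1\<close>, and the limit \<open>\<epsilon> \<rightarrow> 0\<close> is taken by dominated convergence, as both \<open>K v\<close> and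
  \<open>K h\<close> are square summable.
\<close>

section \<open>Orthonormal systems of bounded functions\<close>

lemma borel_measurable_cnj [measurable (raw)]:
  assumes [measurable]: "f \<in> borel_measurable M" shows "(\<lambda>x. cnj (f x)) \<in> borel_measurable M"
  by (rule borel_measurable_continuous_on[OF continuous_on_cnj[OF continuous_on_id]]) simp

text \<open>On a finite measure space bounded functions are square integrable, and so are their products with square-integrable functions.\<close>

locale orthonormal_system = finite_measure M for M :: "'a measure" +
  fixes e :: "'k \<Rightarrow> 'a \<Rightarrow> complex"
  assumes e_meas [measurable]: "\<And>k. e k \<in> borel_measurable M"
    and e_norm: "\<And>k x. cmod (e k x) \<le> 1"
    and e_orth: "\<And>k l. (\<integral>x. e k x * cnj (e l x) \<partial>M) = (if k = l then 1 else 0)"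
begin

text \<open>Square-integrable functions themselves, not classes modulo null sets.\<close>

definition sqi :: "('a \<Rightarrow> complex) \<Rightarrow> bool" where
  "sqi f \<longleftrightarrow> f \<in> borel_measurable M \<and> integrable M (\<lambda>x. (cmod (f x))\<^sup>2)"

definition ip :: "('a \<Rightarrow> complex) \<Rightarrow> ('a \<Rightarrow> complex) \<Rightarrow> complex" where
  "ip f g = (\<integral>x. f x * cnj (g x) \<partial>M)"

definition cf :: "('a \<Rightarrow> complex) \<Rightarrow> 'k \<Rightarrow> complex" where
  "cf f k = ip f (e k)"

definition nrm2 :: "('a \<Rightarrow> complex) \<Rightarrow> real" where
  "nrm2 f = (\<integral>x. (cmod (f x))\<^sup>2 \<partial>M)"

lemma sqiD [measurable_dest]: "sqi f \<Longrightarrow> f \<in> borel_measurable M"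
  by (auto simp: sqi_def)

lemma cmod_mult_le: "cmod (a * b) \<le> ((cmod a)\<^sup>2 + (cmod b)\<^sup>2) / 2"
  using sum_squares_bound[of "cmod a" "cmod b"] by (simp add: norm_mult)

lemma sqi_prod:
  assumes "sqi f" "sqi g" shows "integrable M (\<lambda>x. f x * cnj (g x))"
proof (rule Bochner_Integration.integrable_bound)
  show "integrable M (\<lambda>x. ((cmod (f x))\<^sup>2 + (cmod (g x))\<^sup>2) / 2)"
    using assms by (auto simp: sqi_def)
  show "(\<lambda>x. f x * cnj (g x)) \<in> borel_measurable M"
    using assms[THEN sqiD] by measurable
  show "AE x in M. cmod (f x * cnj (g x)) \<le> norm (((cmod (f x))\<^sup>2 + (cmod (g x))\<^sup>2) / 2)"
    by (rule AE_I2) (metis abs_ge_self cmod_mult_le complex_mod_cnj order_trans real_norm_def)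
qed

lemma sqi_bounded:
  assumes [measurable]: "f \<in> borel_measurable M" and "\<And>x. cmod (f x) \<le> B" shows "sqi f"
  unfolding sqi_def
proof (intro conjI assms(1) integrable_const_bound)
  show "AE x in M. norm ((cmod (f x))\<^sup>2) \<le> B\<^sup>2"
    using assms(2) by (auto intro!: power_mono)
qed simp

lemma sqi_e: "sqi (e k)"
  by (rule sqi_bounded[OF e_meas e_norm])

lemma sqi_add:
  assumes "sqi f" "sqi g" shows "sqi (\<lambda>x. f x + g x)"
  unfolding sqi_def
proof (intro conjI)
  show m: "(\<lambda>x. f x + g x) \<in> borel_measurable M"
    using assms[THEN sqiD] by measurable
  show "integrable M (\<lambda>x. (cmod (f x + g x))\<^sup>2)"
  proof (rule Bochner_Integration.integrable_bound)
    show "integrable M (\<lambda>x. 2 * (cmod (f x))\<^sup>2 + 2 * (cmod (g x))\<^sup>2)"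
      using assms by (auto simp: sqi_def)
    show "(\<lambda>x. (cmod (f x + g x))\<^sup>2) \<in> borel_measurable M" using m by measurable
    show "AE x in M. norm ((cmod (f x + g x))\<^sup>2) \<le> norm (2 * (cmod (f x))\<^sup>2 + 2 * (cmod (g x))\<^sup>2)"
    proof (rule AE_I2)
      fix x
      have "(cmod (f x + g x))\<^sup>2 \<le> (cmod (f x) + cmod (g x))\<^sup>2"
        by (intro power_mono norm_triangle_ineq) auto
      also have "\<dots> \<le> 2 * (cmod (f x))\<^sup>2 + 2 * (cmod (g x))\<^sup>2"
        using sum_squares_bound[of "cmod (f x)" "cmod (g x)"] by (simp add: power2_sum)
      finally show "norm ((cmod (f x + g x))\<^sup>2) \<le> norm (2 * (cmod (f x))\<^sup>2 + 2 * (cmod (g x))\<^sup>2)"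
        by simp
    qed
  qed
qed

lemma sqi_scale: "sqi f \<Longrightarrow> sqi (\<lambda>x. c * f x)"
  by (auto simp: sqi_def norm_mult power_mult_distrib)

lemma sqi_uminus: "sqi f \<Longrightarrow> sqi (\<lambda>x. - f x)"
  using sqi_scale[of f "-1"] by simp

lemma sqi_diff: "sqi f \<Longrightarrow> sqi g \<Longrightarrow> sqi (\<lambda>x. f x - g x)"
  using sqi_add[OF _ sqi_uminus] by simp

lemma sqi_sum: "finite A \<Longrightarrow> (\<And>i. i \<in> A \<Longrightarrow> sqi (f i)) \<Longrightarrow> sqi (\<lambda>x. \<Sum>i\<in>A. f i x)"
  by (induction A rule: finite_induct) (auto intro: sqi_add sqi_bounded[of _ 0])

lemma ip_add: "sqi f \<Longrightarrow> sqi g \<Longrightarrow> sqi h \<Longrightarrow> ip (\<lambda>x. f x + g x) h = ip f h + ip g h"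
  unfolding ip_def by (simp add: distrib_right sqi_prod)

lemma ip_diff: "sqi f \<Longrightarrow> sqi g \<Longrightarrow> sqi h \<Longrightarrow> ip (\<lambda>x. f x - g x) h = ip f h - ip g h"
  unfolding ip_def by (simp add: left_diff_distrib sqi_prod)

lemma ip_scale: "ip (\<lambda>x. c * f x) h = c * ip f h"
  unfolding ip_def by (simp add: mult.assoc)

lemma ip_sum:
  assumes "finite A" "\<And>i. i \<in> A \<Longrightarrow> sqi (f i)" "sqi h"
  shows "ip (\<lambda>x. \<Sum>i\<in>A. f i x) h = (\<Sum>i\<in>A. ip (f i) h)"
  unfolding ip_def sum_distrib_right
  by (rule Bochner_Integration.integral_sum) (use assms sqi_prod in auto)

lemma ip_cnj: "cnj (ip f g) = ip g f"
proof -
  have "ip g f = (\<integral>x. cnj (f x * cnj (g x)) \<partial>M)" unfolding ip_def by (simp add: mult.commute del: integral_cnj)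
  then show ?thesis by (simp add: ip_def del: complex_cnj_mult)
qed

lemma ip_self: "ip f f = of_real (nrm2 f)"
  unfolding ip_def nrm2_def by (simp add: complex_norm_square [symmetric] flip: of_real_power)

lemma nrm2_nonneg: "nrm2 f \<ge> 0"
  unfolding nrm2_def by simp

text \<open>
  Integrate \<open>2|f g| \<le> t\<^sup>2 |f|\<^sup>2 + |g|\<^sup>2 / t\<^sup>2\<close> and optimize over \<open>t\<close>.  The optimal \<open>t\<close> does not exist if one of the norms vanishes, so both
  norms are first enlarged by some \<open>d > 0\<close>.
\<close>

lemma Cauchy_Schwarz:
  assumes f: "sqi f" and g: "sqi g" shows "cmod (ip f g) \<le> sqrt (nrm2 f) * sqrt (nrm2 g)"
proof -
  define A B where "A = nrm2 f" and "B = nrm2 g"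
  have AB: "A \<ge> 0" "B \<ge> 0" by (auto simp: A_def B_def nrm2_nonneg)
  have le: "cmod (ip f g) \<le> (t\<^sup>2 * A + B / t\<^sup>2) / 2" if "t > 0" for t
  proof -
    have "cmod (ip f g) \<le> (\<integral>x. cmod (f x * cnj (g x)) \<partial>M)"
      unfolding ip_def by (rule integral_norm_bound)
    also have "\<dots> \<le> (\<integral>x. (t\<^sup>2 * (cmod (f x))\<^sup>2 + (cmod (g x))\<^sup>2 / t\<^sup>2) / 2 \<partial>M)"
    proof (rule integral_mono)
      show "integrable M (\<lambda>x. cmod (f x * cnj (g x)))" using sqi_prod[OF f g] by (rule integrable_norm)
      show "integrable M (\<lambda>x. (t\<^sup>2 * (cmod (f x))\<^sup>2 + (cmod (g x))\<^sup>2 / t\<^sup>2) / 2)"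
        using f g by (auto simp: sqi_def)
      fix x
      have "cmod (f x * cnj (g x)) = cmod ((of_real t * f x) * (g x / of_real t))"
        using that by (simp add: norm_mult)
      also have "\<dots> \<le> (t\<^sup>2 * (cmod (f x))\<^sup>2 + (cmod (g x))\<^sup>2 / t\<^sup>2) / 2"
        using cmod_mult_le[of "of_real t * f x" "g x / of_real t"] that
        by (simp add: norm_mult norm_divide power_mult_distrib power_divide)
      finally show "cmod (f x * cnj (g x)) \<le> (t\<^sup>2 * (cmod (f x))\<^sup>2 + (cmod (g x))\<^sup>2 / t\<^sup>2) / 2" .
    qed
    also have "\<dots> = (t\<^sup>2 * A + B / t\<^sup>2) / 2"
      unfolding A_def B_def nrm2_def using f g by (simp add: sqi_def)
    finally show ?thesis .
  qed
  have "2 * cmod (ip f g) \<le> 2 * (sqrt A * sqrt B) + d * (sqrt A + sqrt B)" if d: "d > 0" for d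
  proof -
    define a b where "a = sqrt A + d" and "b = sqrt B + d"
    have pos: "a > 0" "b > 0" using AB d by (auto simp: a_def b_def add_nonneg_pos)
    have 1: "A / a \<le> sqrt A" "B / b \<le> sqrt B"
      using AB d pos by (simp_all add: a_def b_def divide_le_eq algebra_simps)
    have "2 * cmod (ip f g) \<le> b * (A / a) + a * (B / b)"
      using le[of "sqrt (b / a)"] pos by (simp add: mult_ac)
    also have "\<dots> \<le> b * sqrt A + a * sqrt B"
      by (intro add_mono mult_left_mono 1) (use pos in auto)
    finally show ?thesis by (simp add: a_def b_def algebra_simps)
  qed
  then have le': "2 * cmod (ip f g) \<le> 2 * (sqrt A * sqrt B) + d * (sqrt A + sqrt B)" if "d > 0" for d
    using that by blast
  have "2 * cmod (ip f g) \<le> 2 * (sqrt A * sqrt B)"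
  proof (rule field_le_epsilon)
    fix r :: real assume r: "r > 0"
    define q where "q = sqrt A + sqrt B"
    have q: "q \<ge> 0" using AB by (simp add: q_def)
    have "r / (q + 1) * q \<le> r" using r q by (simp add: divide_le_eq algebra_simps)
    moreover have "r / (q + 1) > 0" using r q by simp
    ultimately show "2 * cmod (ip f g) \<le> 2 * (sqrt A * sqrt B) + r"
      using le'[of "r / (q + 1)"] by (simp add: q_def)
  qed
  then show ?thesis by (simp add: A_def B_def)
qed

definition expansion :: "('k \<Rightarrow> complex) \<Rightarrow> 'k set \<Rightarrow> 'a \<Rightarrow> complex" where
  "expansion a F = (\<lambda>x. \<Sum>k\<in>F. a k * e k x)"

lemma sqi_expansion: "finite F \<Longrightarrow> sqi (expansion a F)"
  unfolding expansion_def by (intro sqi_sum sqi_scale sqi_e)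

lemma ip_expansion:
  assumes "finite F" "sqi g" shows "ip (expansion a F) g = (\<Sum>k\<in>F. a k * cnj (cf g k))"
  unfolding expansion_def using assms
  by (subst ip_sum) (auto simp: ip_scale cf_def ip_cnj intro!: sqi_scale sqi_e)

lemma cf_e: "cf (e k) l = (if k = l then 1 else 0)"
  unfolding cf_def ip_def by (rule e_orth)

lemma cf_expansion: "finite F \<Longrightarrow> cf (expansion a F) l = (if l \<in> F then a l else 0)"
  unfolding cf_def by (subst ip_expansion) (auto simp: cf_e sqi_e if_distrib cong: if_cong)

lemma nrm2_expansion: "finite F \<Longrightarrow> nrm2 (expansion a F) = (\<Sum>k\<in>F. (cmod (a k))\<^sup>2)"
proof -
  assume F: "finite F"
  have "complex_of_real (nrm2 (expansion a F)) = (\<Sum>k\<in>F. a k * cnj (a k))"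
    unfolding ip_self[symmetric] using F by (subst ip_expansion) (auto simp: sqi_expansion cf_expansion)
  also have "\<dots> = of_real (\<Sum>k\<in>F. (cmod (a k))\<^sup>2)"
    by (simp add: complex_norm_square [symmetric])
  finally show ?thesis using of_real_eq_iff by blast
qed

lemma nrm2_diff:
  assumes f: "sqi f" and g: "sqi g"
  shows "nrm2 (\<lambda>x. f x - g x) = nrm2 f - 2 * Re (ip f g) + nrm2 g"
proof -
  have "nrm2 (\<lambda>x. f x - g x) = (\<integral>x. (cmod (f x))\<^sup>2 - 2 * Re (f x * cnj (g x)) + (cmod (g x))\<^sup>2 \<partial>M)"
    unfolding nrm2_def
    by (intro Bochner_Integration.integral_cong refl)
       (simp only: cmod_power2, simp add: power2_eq_square algebra_simps)
  also have "\<dots> = nrm2 f - 2 * (\<integral>x. Re (f x * cnj (g x)) \<partial>M) + nrm2 g"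
    unfolding nrm2_def
  proof -
    have i: "integrable M (\<lambda>x. (cmod (f x))\<^sup>2)" "integrable M (\<lambda>x. (cmod (g x))\<^sup>2)"
      "integrable M (\<lambda>x. 2 * Re (f x * cnj (g x)))"
      using f g sqi_prod[OF f g, THEN integrable_Re] unfolding sqi_def by (auto simp only: integrable_mult_right)
    show "(\<integral>x. (cmod (f x))\<^sup>2 - 2 * Re (f x * cnj (g x)) + (cmod (g x))\<^sup>2 \<partial>M)
      = (\<integral>x. (cmod (f x))\<^sup>2 \<partial>M) - 2 * (\<integral>x. Re (f x * cnj (g x)) \<partial>M) + (\<integral>x. (cmod (g x))\<^sup>2 \<partial>M)"
      by (simp only: i Bochner_Integration.integral_add Bochner_Integration.integral_diff
        Bochner_Integration.integrable_diff integral_mult_right_zero)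
  qed
  also have "(\<integral>x. Re (f x * cnj (g x)) \<partial>M) = Re (ip f g)"
    unfolding ip_def using sqi_prod[OF f g] by (rule integral_Re)
  finally show ?thesis .
qed

lemma nrm2_diff_expansion:
  assumes f: "sqi f" and F: "finite F"
  shows "nrm2 (\<lambda>x. f x - expansion (cf f) F x) = nrm2 f - (\<Sum>k\<in>F. (cmod (cf f k))\<^sup>2)"
proof -
  have "ip f (expansion (cf f) F) = cnj (\<Sum>k\<in>F. cf f k * cnj (cf f k))"
    using ip_expansion[OF F f] ip_cnj by metis
  also have "\<dots> = of_real (\<Sum>k\<in>F. (cmod (cf f k))\<^sup>2)"
    by (simp add: complex_norm_square [symmetric])
  finally have "Re (ip f (expansion (cf f) F)) = (\<Sum>k\<in>F. (cmod (cf f k))\<^sup>2)" by simp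
  then show ?thesis
    by (simp add: nrm2_diff f F sqi_expansion nrm2_expansion)
qed

lemma Bessel:
  assumes f: "sqi f" and F: "finite F" shows "(\<Sum>k\<in>F. (cmod (cf f k))\<^sup>2) \<le> nrm2 f"
  using nrm2_diff_expansion[OF assms] nrm2_nonneg[of "\<lambda>x. f x - expansion (cf f) F x"] by simp

lemma cf_square_summable: "sqi f \<Longrightarrow> (\<lambda>k. (cmod (cf f k))\<^sup>2) summable_on UNIV"
  by (intro nonneg_bdd_above_summable_on) (auto intro!: bdd_aboveI2 Bessel)

text \<open>
  Choose finite index sets whose tails are at most \<open>4\<^sup>-\<^sup>n\<close>.  The partial sums over them converge almost everywhere,
  and Fatou's lemma shows that the pointwise limit is also their limit in \<open>L\<^sup>2\<close>.
\<close>

lemma Riesz_Fischer: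
  assumes a: "(\<lambda>k. (cmod (a k))\<^sup>2) summable_on UNIV"
  shows "\<exists>f. sqi f \<and> cf f = a \<and> nrm2 f = (\<Sum>\<^sub>\<infinity>k. (cmod (a k))\<^sup>2)"
proof -
  define S where "S = (\<Sum>\<^sub>\<infinity>k. (cmod (a k))\<^sup>2)"
  have "\<exists>F. finite F \<and> S - (1/4) ^ n \<le> (\<Sum>k\<in>F. (cmod (a k))\<^sup>2)" for n
  proof -
    obtain F where "finite F" "dist (\<Sum>k\<in>F. (cmod (a k))\<^sup>2) S \<le> (1/4) ^ n"
      using infsum_finite_approximation[OF a, of "(1/4) ^ n"] unfolding S_def by auto
    then show ?thesis by (intro exI[of _ F]) (auto simp: dist_real_def)
  qed
  then obtain F0 where F0: "\<And>n. finite (F0 n)" "\<And>n. S - (1/4) ^ n \<le> (\<Sum>k\<in>F0 n. (cmod (a k))\<^sup>2)"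
    by metis
  define F where "F n = (\<Union>i\<le>n. F0 i)" for n
  have fin: "finite (F n)" for n by (auto simp: F_def F0)
  have mono: "F i \<subseteq> F j" if "i \<le> j" for i j using that by (fastforce simp: F_def)
  have tail: "(\<Sum>k\<in>F j - F i. (cmod (a k))\<^sup>2) \<le> (1/4) ^ i" if "i \<le> j" for i j
  proof -
    have "S - (1/4) ^ i \<le> (\<Sum>k\<in>F i. (cmod (a k))\<^sup>2)"
      using F0(2)[of i] sum_mono2[of "F i" "F0 i" "\<lambda>k. (cmod (a k))\<^sup>2"] fin by (fastforce simp: F_def)
    moreover have "(\<Sum>k\<in>F j. (cmod (a k))\<^sup>2) \<le> S"
      unfolding S_def by (rule finite_sum_le_infsum[OF a fin]) auto
    moreover have "(\<Sum>k\<in>F j. (cmod (a k))\<^sup>2) = (\<Sum>k\<in>F i. (cmod (a k))\<^sup>2) + (\<Sum>k\<in>F j - F i. (cmod (a k))\<^sup>2)"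
      using sum.subset_diff[OF mono[OF that] fin, of "\<lambda>k. (cmod (a k))\<^sup>2"] by simp
    ultimately show ?thesis by simp
  qed
  define s where "s n = expansion a (F n)" for n
  have s_sqi: "sqi (s n)" for n unfolding s_def by (rule sqi_expansion[OF fin])
  note [measurable] = sqiD[OF s_sqi]
  have s_diff: "(\<lambda>x. s j x - s i x) = expansion a (F j - F i)" if "i \<le> j" for i j
    using sum.subset_diff[OF mono[OF that] fin, of "\<lambda>k. a k * e k x" for x]
    by (auto simp: s_def expansion_def fun_eq_iff)
  have s_nrm: "nrm2 (\<lambda>x. s j x - s i x) \<le> (1/4) ^ i" if "i \<le> j" for i j
    unfolding s_diff[OF that] using tail[OF that] fin by (simp add: nrm2_expansion)
  have s_nn: "(\<integral>\<^sup>+x. ennreal ((cmod (s j x - s i x))\<^sup>2) \<partial>M) \<le> ennreal ((1/4) ^ i)" if "i \<le> j" for i j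
  proof -
    have "(\<integral>\<^sup>+x. ennreal ((cmod (s j x - s i x))\<^sup>2) \<partial>M) = ennreal (nrm2 (\<lambda>x. s j x - s i x))"
      unfolding nrm2_def by (rule nn_integral_eq_integral) (use sqi_diff[OF s_sqi s_sqi] in \<open>auto simp: sqi_def\<close>)
    then show ?thesis using s_nrm[OF that] by (simp add: ennreal_leI)
  qed
  (* almost everywhere convergence: weighting the increments by 2 ^ n keeps their sum integrable *)
  define w where "w n x = 2 ^ n * (cmod (s (Suc n) x - s n x))\<^sup>2" for n x
  have "(\<integral>\<^sup>+x. (\<Sum>n. ennreal (w n x)) \<partial>M) = (\<Sum>n. \<integral>\<^sup>+x. ennreal (w n x) \<partial>M)"
    unfolding w_def by (rule nn_integral_suminf) measurable
  also have "\<dots> \<le> (\<Sum>n. ennreal ((1/2) ^ n))"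
  proof (intro suminf_le summableI)
    fix n
    have "(\<integral>\<^sup>+x. ennreal (w n x) \<partial>M) = ennreal (2 ^ n) * (\<integral>\<^sup>+x. ennreal ((cmod (s (Suc n) x - s n x))\<^sup>2) \<partial>M)"
      unfolding w_def by (subst nn_integral_cmult [symmetric]) (auto simp: ennreal_mult)
    also have "\<dots> \<le> ennreal (2 ^ n) * ennreal ((1/4) ^ n)"
      by (intro mult_left_mono s_nn) auto
    also have "\<dots> = ennreal ((1/2) ^ n)"
      by (simp add: ennreal_mult [symmetric] power_mult_distrib [symmetric])
    finally show "(\<integral>\<^sup>+x. ennreal (w n x) \<partial>M) \<le> ennreal ((1/2) ^ n)" .
  qed
  also have "\<dots> = ennreal (\<Sum>n. (1/2) ^ n)"
    by (rule suminf_ennreal2) (auto simp: summable_geometric)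
  also have "\<dots> < \<infinity>" by simp
  finally have "(\<integral>\<^sup>+x. (\<Sum>n. ennreal (w n x)) \<partial>M) \<noteq> \<infinity>" by simp
  then have AEfin: "AE x in M. (\<Sum>n. ennreal (w n x)) \<noteq> \<infinity>"
    by (intro nn_integral_PInf_AE) (auto simp: w_def)
  have conv: "convergent (\<lambda>n. s n x)" if "(\<Sum>n. ennreal (w n x)) \<noteq> \<infinity>" for x
  proof -
    have "summable (\<lambda>n. w n x)"
      by (rule summable_suminf_not_top) (use that in \<open>auto simp: w_def\<close>)
    then have "summable (\<lambda>n. ((1/2) ^ n + w n x) / 2)"
      by (intro summable_divide summable_add summable_geometric) auto
    then have "summable (\<lambda>n. s (Suc n) x - s n x)"
    proof (rule summable_comparison_test[rotated], intro exI allI impI)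
      fix n
      define b where "b = sqrt (2 ^ n)"
      have b: "b > 0" "b\<^sup>2 = 2 ^ n" by (auto simp: b_def)
      have eq: "norm (s (Suc n) x - s n x) = (1 / b) * (b * norm (s (Suc n) x - s n x))" using b by simp
      have "2 * ((1 / b) * (b * norm (s (Suc n) x - s n x))) \<le> (1 / b)\<^sup>2 + (b * norm (s (Suc n) x - s n x))\<^sup>2"
        using sum_squares_bound[of "1 / b" "b * norm (s (Suc n) x - s n x)"] by (simp only: mult.assoc)
      then have "norm (s (Suc n) x - s n x) \<le> ((1 / b)\<^sup>2 + (b * norm (s (Suc n) x - s n x))\<^sup>2) / 2"
        unfolding eq [symmetric] by (simp only: le_divide_eq_numeral1 mult.commute split: if_splits)
      also have "\<dots> = ((1/2) ^ n + w n x) / 2"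
        by (simp add: power_mult_distrib power_divide b w_def)
      finally show "norm (s (Suc n) x - s n x) \<le> ((1/2) ^ n + w n x) / 2" .
    qed
    then have "convergent (\<lambda>n. \<Sum>i<n. s (Suc i) x - s i x)"
      by (simp add: summable_iff_convergent)
    then have "convergent (\<lambda>n. (\<Sum>i<n. s (Suc i) x - s i x) + s 0 x)"
      by (intro convergent_add convergent_const)
    then show ?thesis by (simp only: sum_lessThan_telescope[of "\<lambda>n. s n x"] diff_add_cancel)
  qed
  define f where "f x = lim (\<lambda>n. s n x)" for x
  have f_meas [measurable]: "f \<in> borel_measurable M" unfolding f_def by measurable
  have lim: "AE x in M. (\<lambda>n. s n x) \<longlonglongrightarrow> f x"
    using AEfin by eventually_elim (unfold f_def convergent_LIMSEQ_iff [symmetric], rule conv)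
  have fs_nn: "(\<integral>\<^sup>+x. ennreal ((cmod (f x - s i x))\<^sup>2) \<partial>M) \<le> ennreal ((1/4) ^ i)" for i
  proof -
    have "(\<integral>\<^sup>+x. ennreal ((cmod (f x - s i x))\<^sup>2) \<partial>M)
        = (\<integral>\<^sup>+x. liminf (\<lambda>j. ennreal ((cmod (s j x - s i x))\<^sup>2)) \<partial>M)"
    proof (rule nn_integral_cong_AE, use lim in eventually_elim)
      fix x assume "(\<lambda>n. s n x) \<longlonglongrightarrow> f x"
      then have "(\<lambda>j. ennreal ((cmod (s j x - s i x))\<^sup>2)) \<longlonglongrightarrow> ennreal ((cmod (f x - s i x))\<^sup>2)"
        by (intro tendsto_intros)
      then show "ennreal ((cmod (f x - s i x))\<^sup>2) = liminf (\<lambda>j. ennreal ((cmod (s j x - s i x))\<^sup>2))"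
        by (rule lim_imp_Liminf [OF trivial_limit_sequentially, symmetric])
    qed
    also have "\<dots> \<le> liminf (\<lambda>j. \<integral>\<^sup>+x. ennreal ((cmod (s j x - s i x))\<^sup>2) \<partial>M)"
      by (rule nn_integral_liminf) measurable
    also have "\<dots> \<le> ennreal ((1/4) ^ i)"
    proof -
      have "eventually (\<lambda>j. (\<integral>\<^sup>+x. ennreal ((cmod (s j x - s i x))\<^sup>2) \<partial>M) \<le> ennreal ((1/4) ^ i)) sequentially"
        using eventually_ge_at_top[of i] by eventually_elim (rule s_nn)
      from Liminf_mono[OF this] show ?thesis by (simp add: Liminf_const)
    qed
    finally show ?thesis .
  qed
  have fs_sqi: "sqi (\<lambda>x. f x - s i x)" for i
    unfolding sqi_def
  proof (intro conjI integrableI_bounded)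
    have "(\<integral>\<^sup>+x. ennreal (norm ((cmod (f x - s i x))\<^sup>2)) \<partial>M) \<le> ennreal ((1/4) ^ i)"
      using fs_nn[of i] by simp
    also have "\<dots> < \<infinity>" by simp
    finally show "(\<integral>\<^sup>+x. ennreal (norm ((cmod (f x - s i x))\<^sup>2)) \<partial>M) < \<infinity>" .
  qed measurable
  have fs_nrm: "nrm2 (\<lambda>x. f x - s i x) \<le> (1/4) ^ i" for i
  proof -
    have "ennreal (nrm2 (\<lambda>x. f x - s i x)) \<le> ennreal ((1/4) ^ i)"
      using fs_nn[of i] fs_sqi[of i] unfolding nrm2_def sqi_def
      by (subst nn_integral_eq_integral [symmetric]) auto
    then show ?thesis by (simp add: ennreal_le_iff)
  qed
  have f_sqi: "sqi f" using sqi_add[OF fs_sqi[of 0] s_sqi[of 0]] by simp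
  have quarter: "(\<lambda>n. (1/4::real) ^ n) \<longlonglongrightarrow> 0" by (rule LIMSEQ_power_zero) simp
  have cf_f: "cf f k = a k" for k
  proof -
    have bound: "cmod (cf f k - (if k \<in> F i then a k else 0)) \<le> sqrt ((1/4) ^ i) * sqrt (nrm2 (e k))" for i
    proof -
      have "cf f k - (if k \<in> F i then a k else 0) = ip (\<lambda>x. f x - s i x) (e k)"
        using cf_expansion[OF fin[of i], of a k] by (simp add: ip_diff f_sqi s_sqi sqi_e) (simp add: s_def cf_def)
      then show ?thesis
        using Cauchy_Schwarz[OF fs_sqi sqi_e, of i k] fs_nrm[of i]
        by (smt (verit) mult_right_mono nrm2_nonneg real_sqrt_ge_zero real_sqrt_le_mono)
    qed
    (* a nonzero coefficient occurs in all late partial sums; otherwise the tail bound is violated *)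
    have "a k = 0" if "\<And>i. k \<notin> F i"
    proof -
      have "(cmod (a k))\<^sup>2 \<le> (1/4) ^ i" for i
      proof -
        have "(\<Sum>l\<in>insert k (F i). (cmod (a l))\<^sup>2) \<le> S"
          unfolding S_def by (rule finite_sum_le_infsum[OF a]) (auto simp: fin)
        moreover have "S - (1/4) ^ i \<le> (\<Sum>k\<in>F i. (cmod (a k))\<^sup>2)"
          using F0(2)[of i] sum_mono2[of "F i" "F0 i" "\<lambda>k. (cmod (a k))\<^sup>2"] fin by (fastforce simp: F_def)
        ultimately show ?thesis using that[of i] fin[of i] by simp
      qed
      then have "(cmod (a k))\<^sup>2 \<le> 0" using LIMSEQ_le_const[OF quarter] by blast
      then show ?thesis by simp
    qed
    then obtain i0 where i0: "i \<ge> i0 \<Longrightarrow> (if k \<in> F i then a k else 0) = a k" for i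
      using mono by (metis subsetD)
    have "(\<lambda>i. sqrt ((1/4) ^ i) * sqrt (nrm2 (e k))) \<longlonglongrightarrow> sqrt 0 * sqrt (nrm2 (e k))"
      by (intro tendsto_intros quarter)
    moreover have "cmod (cf f k - a k) \<le> sqrt ((1/4) ^ i) * sqrt (nrm2 (e k))" if "i \<ge> i0" for i
      using bound[of i] unfolding i0[OF that] .
    ultimately have "cmod (cf f k - a k) \<le> sqrt 0 * sqrt (nrm2 (e k))"
      using LIMSEQ_le_const by blast
    then show ?thesis by simp
  qed
  then have cff: "cf f = a" by auto
  have "nrm2 f = S"
  proof (rule antisym)
    show "S \<le> nrm2 f"
      unfolding S_def using Bessel[OF f_sqi] cff a by (intro infsum_le_finite_sums) auto
    have "nrm2 f \<le> S + (1/4) ^ i" for i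
    proof -
      have "nrm2 f - (\<Sum>k\<in>F i. (cmod (a k))\<^sup>2) \<le> (1/4) ^ i"
        using fs_nrm[of i] nrm2_diff_expansion[OF f_sqi fin[of i]] by (simp add: cff s_def)
      moreover have "(\<Sum>k\<in>F i. (cmod (a k))\<^sup>2) \<le> S"
        unfolding S_def by (rule finite_sum_le_infsum[OF a fin]) auto
      ultimately show ?thesis by simp
    qed
    moreover have "(\<lambda>i. S + (1/4) ^ i) \<longlonglongrightarrow> S + 0" by (intro tendsto_intros quarter)
    ultimately show "nrm2 f \<le> S" using LIMSEQ_le_const[of "\<lambda>i. S + (1/4) ^ i" S "nrm2 f"] by auto
  qed
  with f_sqi cff show ?thesis unfolding S_def by blast
qed

end

locale complete_orthonormal_system = orthonormal_system +
  assumes e_complete: "\<And>f. sqi f \<Longrightarrow> (\<And>k. cf f k = 0) \<Longrightarrow> AE x in M. f x = 0"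
begin

lemma cf_diff: "sqi f \<Longrightarrow> sqi g \<Longrightarrow> cf (\<lambda>x. f x - g x) k = cf f k - cf g k"
  unfolding cf_def by (rule ip_diff[OF _ _ sqi_e])

lemma Parseval_norm:
  assumes f: "sqi f" shows "((\<lambda>k. (cmod (cf f k))\<^sup>2) has_sum nrm2 f) UNIV"
proof -
  obtain g where g: "sqi g" "cf g = cf f" "nrm2 g = (\<Sum>\<^sub>\<infinity>k. (cmod (cf f k))\<^sup>2)"
    using Riesz_Fischer[OF cf_square_summable[OF f]] by auto
  have "AE x in M. f x - g x = 0"
    by (rule e_complete[OF sqi_diff[OF f g(1)]]) (simp add: cf_diff f g)
  then have "nrm2 f = nrm2 g" unfolding nrm2_def
    by (intro integral_cong_AE) (use f g in \<open>auto simp: sqi_def\<close>)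
  with g(3) cf_square_summable[OF f] show ?thesis by simp
qed

text \<open>
  The pairing of \<open>g\<close> with the remainder of a finite expansion of \<open>f\<close> is at most the norm of the remainder times that of \<open>g\<close>.
\<close>

lemma Parseval:
  assumes f: "sqi f" and g: "sqi g"
  shows "((\<lambda>k. cf f k * cnj (cf g k)) has_sum ip f g) UNIV"
  unfolding has_sum_def
proof (rule Lim_null[THEN iffD2], rule Lim_null_comparison)
  let ?b = "\<lambda>F. sqrt (nrm2 f - (\<Sum>k\<in>F. (cmod (cf f k))\<^sup>2)) * sqrt (nrm2 g)"
  have "(?b \<longlongrightarrow> sqrt (nrm2 f - nrm2 f) * sqrt (nrm2 g)) (finite_subsets_at_top UNIV)"
    by (intro tendsto_intros Parseval_norm[OF f, unfolded has_sum_def])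
  then show "(?b \<longlongrightarrow> 0) (finite_subsets_at_top UNIV)" by simp
  show "\<forall>\<^sub>F F in finite_subsets_at_top UNIV. cmod ((\<Sum>k\<in>F. cf f k * cnj (cf g k)) - ip f g) \<le> ?b F"
  proof (rule eventually_finite_subsets_at_top_weakI)
    fix F :: "'b set" assume F: "finite F"
    have "(\<Sum>k\<in>F. cf f k * cnj (cf g k)) - ip f g = - ip (\<lambda>x. f x - expansion (cf f) F x) g"
      using F f g by (simp add: ip_diff sqi_expansion ip_expansion)
    then show "cmod ((\<Sum>k\<in>F. cf f k * cnj (cf g k)) - ip f g) \<le> ?b F"
      using Cauchy_Schwarz[OF sqi_diff[OF f sqi_expansion[OF F, of "cf f"]] g]
      by (simp add: nrm2_diff_expansion[OF f F])
  qed
qed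

end

section \<open>Fourier series on the torus\<close>

subsection \<open>The normalized measure of a period cell\<close>

lemma prod_Basis_vec:
  fixes f :: "3 \<Rightarrow> 'b::comm_monoid_mult"
  shows "(\<Prod>b\<in>(Basis :: (real ^ 3) set). f (axis_index b)) = (\<Prod>i\<in>UNIV. f i)"
proof -
  have B: "(Basis :: (real ^ 3) set) = (\<lambda>i. axis i 1) ` UNIV" by (auto simp: Basis_vec_def)
  show ?thesis unfolding B
    by (subst prod.reindex) (auto simp: inj_on_def axis_eq_axis axis_index_axis)
qed

lemma inner_Basis_vec: "b \<in> Basis \<Longrightarrow> x \<bullet> b = x $ axis_index b" for b x :: "real ^ 3"
  by (auto simp: Basis_vec_def axis_index_axis inner_axis)

lemma lborel_tensor:
  fixes f :: "3 \<Rightarrow> real \<Rightarrow> complex"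
  assumes f: "\<And>i. integrable lborel (f i)"
  shows "integrable lborel (\<lambda>x :: real ^ 3. \<Prod>i\<in>UNIV. f i (x $ i))" (is ?int)
    and "(\<integral>x. (\<Prod>i\<in>UNIV. f i (x $ i)) \<partial>(lborel :: (real ^ 3) measure)) = (\<Prod>i\<in>UNIV. \<integral>t. f i t \<partial>lborel)" (is ?eq)
proof -
  let ?T = "\<lambda>f. \<Sum>b\<in>(Basis :: (real ^ 3) set). f b *\<^sub>R b"
  let ?P = "\<Pi>\<^sub>M b\<in>(Basis :: (real ^ 3) set). (lborel :: real measure)"
  let ?g = "\<lambda>x :: real ^ 3. \<Prod>i\<in>UNIV. f i (x $ i)"
  interpret product_sigma_finite "\<lambda>_ :: real ^ 3. lborel :: real measure" ..
  have [measurable]: "f i \<in> borel_measurable borel" for i using f[of i] by auto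
  have g: "?g (?T h) = (\<Prod>b\<in>Basis. f (axis_index b) (h b))" for h
    by (subst prod_Basis_vec [symmetric], rule prod.cong)
       (auto simp: inner_Basis_vec [symmetric] inner_sum_left inner_Basis if_distrib cong: if_cong)
  have int: "integrable ?P (\<lambda>h. \<Prod>b\<in>Basis. f (axis_index b) (h b))"
    by (rule product_integrable_prod) (auto simp: f)
  have T: "?T \<in> ?P \<rightarrow>\<^sub>M borel" by measurable
  have gm: "?g \<in> borel_measurable borel" by measurable
  show ?int unfolding lborel_eq[where 'a="real ^ 3"] using int
    by (subst integrable_distr_eq[OF T gm]) (simp only: g)
  have "(\<integral>x. ?g x \<partial>lborel) = (\<integral>h. ?g (?T h) \<partial>?P)"
    unfolding lborel_eq[where 'a="real ^ 3"] by (rule integral_distr[OF T gm])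
  also have "\<dots> = (\<integral>h. (\<Prod>b\<in>Basis. f (axis_index b) (h b)) \<partial>?P)" by (simp only: g)
  also have "\<dots> = (\<Prod>b\<in>(Basis :: (real ^ 3) set). \<integral>t. f (axis_index b) t \<partial>lborel)"
    by (rule product_integral_prod) (auto simp: f)
  finally show ?eq using prod_Basis_vec[of "\<lambda>i. \<integral>t. f i t \<partial>lborel"] by simp
qed

lemma torus_iff: "x \<in> torus \<longleftrightarrow> (\<forall>i. 0 \<le> x $ i \<and> x $ i \<le> 2 * pi)"
  by (simp add: torus_def mem_box_cart)

lemma sets_torus [measurable]: "torus \<in> sets borel"
  unfolding torus_def by simp

lemma indicator_torus: "indicator torus x = (\<Prod>i\<in>UNIV. indicator {0..2 * pi} (x $ i) :: real)"
  by (auto simp: indicator_def torus_iff prod_zero_iff split: if_splits)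

text \<open>The Lebesgue measure of one period cell, normalized to total mass one so that the waves are orthonormal.\<close>

definition TM :: "(real ^ 3) measure" where
  "TM = density lborel (\<lambda>x. ennreal (indicator torus x / (2 * pi) ^ 3))"

lemma sets_TM [measurable_cong, simp]: "sets TM = sets borel"
  and space_TM [simp]: "space TM = UNIV"
  by (auto simp: TM_def)

lemma integral_TM:
  fixes f :: "real ^ 3 \<Rightarrow> 'b::{banach, second_countable_topology}"
  assumes "f \<in> borel_measurable borel"
  shows "integral\<^sup>L TM f = (1 / (2 * pi) ^ 3) *\<^sub>R (LINT x:torus|lborel. f x)"
  unfolding TM_def set_lebesgue_integral_def
  by (subst integral_density) (auto simp: assms simp flip: integral_scaleR_right)

lemma integrable_TM:
  fixes f :: "real ^ 3 \<Rightarrow> 'b::{banach, second_countable_topology}"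
  assumes "f \<in> borel_measurable borel"
  shows "integrable TM f \<longleftrightarrow> set_integrable lborel torus f"
proof -
  have "integrable TM f \<longleftrightarrow> integrable lborel (\<lambda>x. (1 / (2 * pi) ^ 3) *\<^sub>R (indicator torus x *\<^sub>R f x))"
    unfolding TM_def by (subst integrable_density) (auto simp: assms)
  also have "\<dots> \<longleftrightarrow> set_integrable lborel torus f"
    unfolding set_integrable_def
    using integrable_scaleR_right[of "(2 * pi) ^ 3" lborel "\<lambda>x. (1 / (2 * pi) ^ 3) *\<^sub>R (indicator torus x *\<^sub>R f x)"]
      integrable_scaleR_right[of "1 / (2 * pi) ^ 3" lborel "\<lambda>x. indicator torus x *\<^sub>R f x"]
    by auto
  finally show ?thesis .
qed

lemma AE_TM: "Measurable.pred borel P \<Longrightarrow> (AE x in TM. P x) \<longleftrightarrow> (AE x in lborel. x \<in> torus \<longrightarrow> P x)"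
  unfolding TM_def by (subst AE_density) (auto simp: indicator_def divide_simps intro!: AE_cong)

definition mean1 :: "(real \<Rightarrow> complex) \<Rightarrow> complex" where
  "mean1 f = (1 / (2 * pi)) *\<^sub>R (LINT t:{0..2 * pi}|lborel. f t)"

lemma TM_tensor:
  fixes f :: "3 \<Rightarrow> real \<Rightarrow> complex"
  assumes f: "\<And>i. set_integrable lborel {0..2 * pi} (f i)" and [measurable]: "\<And>i. f i \<in> borel_measurable borel"
  shows "(\<integral>x. (\<Prod>i\<in>UNIV. f i (x $ i)) \<partial>TM) = (\<Prod>i\<in>UNIV. mean1 (f i))"
proof -
  have "(\<integral>x. (\<Prod>i\<in>UNIV. f i (x $ i)) \<partial>TM)
      = (1 / (2 * pi) ^ 3) *\<^sub>R (\<integral>x. (\<Prod>i\<in>UNIV. indicator {0..2 * pi} (x $ i) *\<^sub>R f i (x $ i)) \<partial>(lborel :: (real ^ 3) measure))"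
    by (subst integral_TM)
       (simp_all add: set_lebesgue_integral_def indicator_torus prod.distrib scaleR_conv_of_real)
  also have "\<dots> = (1 / (2 * pi) ^ 3) *\<^sub>R (\<Prod>i\<in>UNIV. \<integral>t. indicator {0..2 * pi} t *\<^sub>R f i t \<partial>lborel)"
    using f by (subst lborel_tensor) (auto simp: set_integrable_def)
  also have "\<dots> = (\<Prod>i\<in>UNIV. mean1 (f i))"
    unfolding mean1_def set_lebesgue_integral_def
    by (simp add: prod_dividef scaleR_conv_of_real power_divide power_mult_distrib)
  finally show ?thesis .
qed

definition wave :: "int ^ 3 \<Rightarrow> real ^ 3 \<Rightarrow> complex" where
  "wave k x = cis (wavevec k \<bullet> x)"

lemma wavevec_simps [simp]: "wavevec 0 = 0" "wavevec (k + l) = wavevec k + wavevec l"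
  "wavevec (- k) = - wavevec k" "wavevec (k - l) = wavevec k - wavevec l"
  by (auto simp: wavevec_def vec_eq_iff)

lemma wave_0 [simp]: "wave 0 x = 1" by (simp add: wave_def)
lemma wave_add: "wave (k + l) x = wave k x * wave l x"
  by (simp add: wave_def cis_mult inner_add_left)
lemma wave_uminus: "wave (- k) x = cnj (wave k x)"
  by (simp add: wave_def cis_cnj)
lemma wave_diff: "wave k x * cnj (wave l x) = wave (k - l) x"
  using wave_add[of k "- l" x] by (simp add: wave_uminus)
lemma norm_wave [simp]: "cmod (wave k x) = 1" by (simp add: wave_def)
lemma wave_shift: "wave k (x + y) = wave k x * wave k y"
  by (simp add: wave_def cis_mult inner_add_right)

lemma continuous_on_cis [continuous_intros]:
  "continuous_on S f \<Longrightarrow> continuous_on S (\<lambda>x. cis (f x))"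
  unfolding cis_conv_exp by (intro continuous_intros)

lemma continuous_wave [continuous_intros]:
  "continuous_on S f \<Longrightarrow> continuous_on S (\<lambda>x. wave k (f x))"
  unfolding wave_def by (intro continuous_intros)

lemma wave_measurable [measurable]: "wave k \<in> borel_measurable borel"
  by (intro borel_measurable_continuous_onI continuous_intros)

lemma wave_prod: "wave k x = (\<Prod>i\<in>UNIV. cis (real_of_int (k $ i) * x $ i))"
proof -
  have "wave k x = cis (\<Sum>i\<in>UNIV. real_of_int (k $ i) * x $ i)"
    by (simp add: wave_def inner_vec_def wavevec_def)
  also have "\<dots> = (\<Prod>i\<in>UNIV. cis (real_of_int (k $ i) * x $ i))"
    by (simp add: cis_conv_exp exp_sum sum_distrib_left)
  finally show ?thesis .
qed

lemma set_integrable_bounded_interval: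
  fixes f :: "real \<Rightarrow> complex"
  assumes [measurable]: "f \<in> borel_measurable borel" and "\<And>x. cmod (f x) \<le> B"
  shows "set_integrable lborel {a..b} f"
  unfolding set_integrable_def
proof (rule Bochner_Integration.integrable_bound)
  show "integrable lborel (\<lambda>x. B * indicator {a..b} x)"
    by (intro integrable_mult_right integrable_real_indicator) (auto simp: emeasure_lborel_Icc_eq)
  show "AE x in lborel. norm (indicat_real {a..b} x *\<^sub>R f x) \<le> norm (B * indicat_real {a..b} x)"
    using assms(2) by (auto simp: indicator_def intro!: AE_I2) (meson abs_ge_self order_trans)
qed measurable

lemma cis_measurable [measurable]: "cis \<in> borel_measurable borel"
  by (intro borel_measurable_continuous_onI continuous_intros)

lemma has_vector_derivative_cis:
  "((\<lambda>t. cis (a * t)) has_vector_derivative \<i> * of_real a * cis (a * t)) (at t within S)"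
proof -
  have "((\<lambda>z. exp (\<i> * of_real a * z)) has_field_derivative \<i> * of_real a * exp (\<i> * of_real a * of_real t)) (at (of_real t))"
    by (auto intro!: derivative_eq_intros)
  then show ?thesis by (auto simp: cis_conv_exp mult.assoc dest!: has_vector_derivative_real_field)
qed

lemma mean1_cis: "mean1 (\<lambda>t. cis (real_of_int n * t)) = (if n = 0 then 1 else 0)"
proof (cases "n = 0")
  case True then show ?thesis by (simp add: mean1_def set_integral_const)
next
  case False
  have "(LINT t:{0..2 * pi}|lborel. cis (real_of_int n * t)) = integral {0..2 * pi} (\<lambda>t. cis (real_of_int n * t))"
    by (intro set_borel_integral_eq_integral set_integrable_bounded_interval[of _ 1]) auto
  also have "\<dots> = cis (real_of_int n * (2 * pi)) / (\<i> * of_int n) - cis (real_of_int n * 0) / (\<i> * of_int n)"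
    using False
    by (intro integral_unique fundamental_theorem_of_calculus)
       (auto intro!: has_vector_derivative_divide[THEN has_vector_derivative_eq_rhs] has_vector_derivative_cis)
  also have "cis (real_of_int n * (2 * pi)) = 1"
    using cis_multiple_2pi[of "of_int n"] by (simp add: mult_ac)
  finally show ?thesis using False by (simp add: mean1_def)
qed

lemma finite_measure_TM: "finite_measure TM"
proof
  have "emeasure TM UNIV = (\<integral>\<^sup>+x. ennreal (1 / (2 * pi) ^ 3) * indicator torus x \<partial>lborel)"
    unfolding TM_def by (subst emeasure_density) (auto intro!: nn_integral_cong simp: indicator_def)
  also have "\<dots> < \<infinity>"
    using emeasure_lborel_cbox_finite[of "0 :: real ^ 3" "\<chi> i. 2 * pi"] unfolding torus_def
    by (subst nn_integral_cmult_indicator) (auto simp: ennreal_mult_less_top)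
  finally show "emeasure TM (space TM) \<noteq> \<infinity>" by simp
qed

global_interpretation TM: orthonormal_system TM wave
proof -
  interpret finite_measure TM by (rule finite_measure_TM)
  show "orthonormal_system TM wave"
  proof unfold_locales
    show "(\<integral>x. wave k x * cnj (wave l x) \<partial>TM) = (if k = l then 1 else 0)" for k l
    proof -
      have "(\<integral>x. wave k x * cnj (wave l x) \<partial>TM) = (\<integral>x. (\<Prod>i\<in>UNIV. cis (real_of_int ((k - l) $ i) * x $ i)) \<partial>TM)"
        unfolding wave_diff by (simp only: wave_prod)
      also have "\<dots> = (\<Prod>i\<in>UNIV. mean1 (\<lambda>t. cis (real_of_int ((k - l) $ i) * t)))"
        by (rule TM_tensor[of "\<lambda>i t. cis (real_of_int ((k - l) $ i) * t)"])
           (auto intro!: set_integrable_bounded_interval[of _ 1])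
      also have "\<dots> = (\<Prod>i\<in>UNIV. if (k - l) $ i = 0 then 1 else 0)" by (simp only: mean1_cis)
      also have "\<dots> = (if k = l then 1 else 0)" by (auto simp: vec_eq_iff)
      finally show ?thesis .
    qed
  qed auto
qed

subsection \<open>Completeness\<close>

inductive trig_poly :: "(real ^ 3 \<Rightarrow> complex) \<Rightarrow> bool" where
  wave: "trig_poly (wave k)"
| add: "trig_poly f \<Longrightarrow> trig_poly g \<Longrightarrow> trig_poly (\<lambda>x. f x + g x)"
| scale: "trig_poly f \<Longrightarrow> trig_poly (\<lambda>x. c * f x)"

lemma trig_poly_wave_mult: "trig_poly g \<Longrightarrow> trig_poly (\<lambda>x. wave k x * g x)"
proof (induction rule: trig_poly.induct)
  case (wave l) then show ?case using trig_poly.wave[of "k + l"] by (simp add: wave_add[abs_def])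
next
  case (add f g) then show ?case using trig_poly.add by (simp add: distrib_left)
next
  case (scale f c) then show ?case using trig_poly.scale[OF scale.IH, of c] by (simp add: mult_ac)
qed

lemma trig_poly_mult: "trig_poly f \<Longrightarrow> trig_poly g \<Longrightarrow> trig_poly (\<lambda>x. f x * g x)"
proof (induction rule: trig_poly.induct)
  case (wave l) then show ?case by (rule trig_poly_wave_mult)
next
  case (add f f') then show ?case using trig_poly.add by (simp add: distrib_right)
next
  case (scale f c) then show ?case using trig_poly.scale[of "\<lambda>x. f x * g x" c] by (simp add: mult_ac)
qed

lemma trig_poly_const: "trig_poly (\<lambda>x. c)"
  using trig_poly.scale[OF trig_poly.wave[of 0], of c] by simp

lemma trig_poly_sum: "finite A \<Longrightarrow> (\<And>i. i \<in> A \<Longrightarrow> trig_poly (f i)) \<Longrightarrow> trig_poly (\<lambda>x. \<Sum>i\<in>A. f i x)"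
  by (induction A rule: finite_induct) (auto intro: trig_poly.add trig_poly_const)

text \<open>
  The quotient map onto the torus in \<open>\<complex>\<^sup>3\<close>: polynomials on its compact image pull back to trigonometric polynomials, which gives access to
  the Stone-Weierstrass theorem.
\<close>

definition torus_embed :: "real ^ 3 \<Rightarrow> complex ^ 3" where
  "torus_embed x = (\<chi> i. cis (x $ i))"

lemma continuous_torus_embed [continuous_intros]: "continuous_on S torus_embed"
  unfolding torus_embed_def by (intro continuous_intros continuous_on_vec_lambda)

lemma trig_poly_coordinate: "b \<in> Basis \<Longrightarrow> trig_poly (\<lambda>x. of_real (torus_embed x \<bullet> b))"
proof -
  assume "b \<in> Basis"
  then obtain i c where b: "b = axis i c" "c = 1 \<or> c = \<i>" by (auto simp: Basis_vec_def Basis_complex_def)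
  have w: "wavevec (axis i 1) \<bullet> x = x $ i" for x :: "real ^ 3"
  proof -
    have "wavevec (axis i 1) = axis i 1" by (simp add: wavevec_def axis_def vec_eq_iff)
    then show ?thesis by (simp add: inner_axis')
  qed
  have e: "cis (x $ i) = wave (axis i 1) x" "cis (- x $ i) = wave (- axis i 1) x" for x :: "real ^ 3"
    by (simp_all add: wave_def w)
  have 1: "of_real (Re (cis (x $ i))) = (1/2) * wave (axis i 1) x + (1/2) * wave (- axis i 1) x"
    "of_real (Im (cis (x $ i))) = (- \<i>/2) * wave (axis i 1) x + (\<i>/2) * wave (- axis i 1) x" for x
    unfolding e [symmetric] by (auto simp: complex_eq_iff)
  have "trig_poly (\<lambda>x. of_real (Re (cis (x $ i))))" "trig_poly (\<lambda>x. of_real (Im (cis (x $ i))))"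
    unfolding 1 by (intro trig_poly.intros)+
  then show ?thesis using b by (auto simp: torus_embed_def inner_axis inner_complex_def)
qed

lemma trig_poly_polynomial:
  "real_polynomial_function p \<Longrightarrow> trig_poly (\<lambda>x. of_real (p (torus_embed x)))"
proof (induction p rule: real_polynomial_function.induct)
  case (linear p)
  then have lin: "linear p" by (rule bounded_linear.linear)
  have "p z = (\<Sum>b\<in>Basis. (z \<bullet> b) * p b)" for z
  proof -
    have "p z = p (\<Sum>b\<in>Basis. (z \<bullet> b) *\<^sub>R b)" by (simp only: euclidean_representation)
    also have "\<dots> = (\<Sum>b\<in>Basis. (z \<bullet> b) * p b)"
      by (simp only: linear_sum[OF lin] linear_cmul[OF lin] real_scaleR_def)
    finally show ?thesis .
  qed
  then have "(\<lambda>x. complex_of_real (p (torus_embed x))) = (\<lambda>x. complex_of_real (\<Sum>b\<in>Basis. (torus_embed x \<bullet> b) * p b))"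
    by (intro ext arg_cong[where f = complex_of_real])
  also have "\<dots> = (\<lambda>x. \<Sum>b\<in>Basis. complex_of_real (torus_embed x \<bullet> b) * of_real (p b))"
    by (simp only: of_real_mult of_real_sum)
  finally have "(\<lambda>x. complex_of_real (p (torus_embed x))) = (\<lambda>x. \<Sum>b\<in>Basis. complex_of_real (torus_embed x \<bullet> b) * of_real (p b))" .
  then show ?case
    by (simp only:)
       (intro trig_poly_sum trig_poly_mult trig_poly_const trig_poly_coordinate finite_Basis)
next
  case (const c) show ?case by (rule trig_poly_const)
next
  case (add f g) then show ?case by (simp add: trig_poly.add)
next
  case (mult f g) then show ?case by (simp add: trig_poly_mult)
qed

lemma torus_embed_inj:
  assumes "\<And>i. 0 \<le> x $ i \<and> x $ i < 2 * pi" "\<And>i. 0 \<le> y $ i \<and> y $ i < 2 * pi" "torus_embed x = torus_embed y"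
  shows "x = y"
proof (unfold vec_eq_iff, intro allI)
  fix i
  have "cis (x $ i) = cis (y $ i)" using assms(3) by (simp add: torus_embed_def vec_eq_iff)
  then have "sin (x $ i) = sin (y $ i) \<and> cos (x $ i) = cos (y $ i)" by (simp add: complex_eq_iff)
  then obtain n where n: "x $ i = y $ i + 2 * real_of_int n * pi" unfolding sin_cos_eq_iff by (auto simp: mult_ac)
  have "x $ i - y $ i = 2 * pi * real_of_int n" using n by simp
  then have "\<bar>2 * pi * real_of_int n\<bar> < 2 * pi" using assms(1)[of i] assms(2)[of i] by linarith
  then have "\<bar>real_of_int n\<bar> < 1" by (simp add: abs_mult)
  then show "x $ i = y $ i" using n by simp
qed

lemma AE_TM_box: "AE x in TM. x \<in> box 0 (\<chi> i. 2 * pi)"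
proof -
  have "AE x in lborel. x \<in> torus \<longrightarrow> x \<in> box 0 (\<chi> i. 2 * pi)"
  proof (rule AE_I')
    have "negligible (torus - box 0 (\<chi> i. 2 * pi))" unfolding torus_def by (rule negligible_frontier_interval)
    then show "torus - box 0 (\<chi> i. 2 * pi) \<in> null_sets lborel"
      by (simp add: negligible_iff_null_sets null_sets_completion_iff)
  qed auto
  then show ?thesis by (subst AE_TM) auto
qed

lemma integral_trig_poly_0:
  assumes f: "TM.sqi f" and 0: "\<And>k. TM.cf f k = 0" and g: "trig_poly g"
  shows "integrable TM (\<lambda>x. f x * g x) \<and> (\<integral>x. f x * g x \<partial>TM) = 0"
  using g
proof (induction rule: trig_poly.induct)
  case (wave k)
  have "wave k x = cnj (wave (- k) x)" for x by (simp add: wave_uminus)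
  then show ?case using 0[of "- k"] TM.sqi_prod[OF f TM.sqi_e, of "- k"] by (simp add: TM.cf_def TM.ip_def)
next
  case (add g h) then show ?case by (simp add: distrib_left)
next
  case (scale g c) then show ?case by (simp add: mult.left_commute[of _ c])
qed

text \<open>
  The indicator of \<open>K\<close> is the pointwise limit of continuous functions of the embedded point, which are uniform limits of trigonometric
  polynomials; \<open>f\<close> is orthogonal to all of these.  A set in the open cell is used because the embedding identifies opposite faces.
\<close>

lemma integral_compact_0:
  assumes f: "TM.sqi f" and 0: "\<And>k. TM.cf f k = 0" and K: "compact K" "K \<subseteq> box 0 (\<chi> i. 2 * pi)"
  shows "(\<integral>x. indicator K x *\<^sub>R f x \<partial>TM) = 0"
proof (cases "K = {}")
  case False
  define A where "A = torus_embed ` K"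
  have A: "compact A" "A \<noteq> {}" using K False unfolding A_def
    by (auto intro!: compact_continuous_image continuous_torus_embed)
  \<comment> \<open>continuous functions that decrease to the indicator of the closed set \<open>A\<close>\<close>
  define F where "F n z = max 0 (1 - real n * infdist z A)" for n z
  have F01: "0 \<le> F n z" "F n z \<le> 1" for n z by (auto simp: F_def infdist_nonneg)
  have S: "compact (torus_embed ` torus)"
    unfolding torus_def by (intro compact_continuous_image continuous_torus_embed compact_cbox)
  have cont: "continuous_on (torus_embed ` torus) (F n)" for n
    unfolding F_def by (intro continuous_intros)
  have "\<exists>p. real_polynomial_function p \<and> (\<forall>z\<in>torus_embed ` torus. \<bar>F n z - p z\<bar> < inverse (real (Suc n)))" for n
  proof -
    have pos: "0 < inverse (real (Suc n))" by simp
    obtain g where "real_polynomial_function g" "\<And>z. z \<in> torus_embed ` torus \<Longrightarrow> \<bar>F n z - g z\<bar> < inverse (real (Suc n))"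
      using Stone_Weierstrass_real_polynomial_function[OF S cont[of n] pos] by metis
    then show ?thesis by blast
  qed
  then obtain p where p: "\<And>n. real_polynomial_function (p n)"
    "\<And>n z. z \<in> torus_embed ` torus \<Longrightarrow> \<bar>F n z - p n z\<bar> < inverse (real (Suc n))" by metis
  have meas: "(\<lambda>x. p n (torus_embed x)) \<in> borel_measurable borel" for n
    using p(1)[of n]
    by (intro borel_measurable_continuous_onI continuous_on_compose2[OF _ continuous_torus_embed[of UNIV]])
       (auto simp: real_polynomial_function_eq intro!: continuous_on_polymonial_function)
  have lim: "(\<lambda>n. F n (torus_embed x)) \<longlonglongrightarrow> indicator K x" if x: "x \<in> box 0 (\<chi> i. 2 * pi)" for x
  proof (cases "x \<in> K")
    case True
    then have "infdist (torus_embed x) A = 0" by (auto simp: A_def)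
    then show ?thesis using True by (simp add: F_def)
  next
    case False
    have "torus_embed x \<notin> A"
    proof
      assume "torus_embed x \<in> A"
      then obtain y where y: "y \<in> K" "torus_embed x = torus_embed y" by (auto simp: A_def)
      then have "x = y" using x K(2) by (intro torus_embed_inj) (auto simp: mem_box_cart subset_iff less_imp_le)
      with y False show False by simp
    qed
    then have d: "infdist (torus_embed x) A > 0"
      using A by (metis compact_imp_closed in_closed_iff_infdist_zero infdist_nonneg order_le_less)
    obtain n0 where n0: "1 / infdist (torus_embed x) A < real n0" using reals_Archimedean2 by blast
    have "F n (torus_embed x) = 0" if "n \<ge> n0" for n
    proof -
      have "1 / infdist (torus_embed x) A \<le> real n" using n0 that by (meson less_imp_le of_nat_le_iff order_trans)
      then show ?thesis using d by (simp add: F_def divide_le_eq)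
    qed
    then show ?thesis using False
      by (auto intro!: tendsto_eventually eventually_sequentiallyI[of n0])
  qed
  have inT: "torus_embed x \<in> torus_embed ` torus" if "x \<in> box 0 (\<chi> i. 2 * pi)" for x
    using that box_subset_cbox unfolding torus_def by blast
  have [measurable]: "f \<in> borel_measurable borel" using f by (auto simp: TM.sqi_def)
  have [measurable]: "K \<in> sets borel" using K(1) by (simp add: compact_imp_closed)
  have "(\<lambda>n. \<integral>x. f x * of_real (p n (torus_embed x)) \<partial>TM) \<longlonglongrightarrow> (\<integral>x. indicator K x *\<^sub>R f x \<partial>TM)"
  proof (rule integral_dominated_convergence)
    show "integrable TM (\<lambda>x. 2 * cmod (f x))"
      using TM.sqi_prod[OF f TM.sqi_e, of 0] by (intro integrable_mult_right integrable_norm) simp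
    show "AE x in TM. (\<lambda>n. f x * of_real (p n (torus_embed x))) \<longlonglongrightarrow> indicator K x *\<^sub>R f x"
      using AE_TM_box
    proof eventually_elim
      fix x assume x: "x \<in> box 0 ((\<chi> i. 2 * pi) :: real ^ 3)"
      have "(\<lambda>n. F n (torus_embed x) - p n (torus_embed x)) \<longlonglongrightarrow> 0"
        by (rule Lim_null_comparison[OF _ LIMSEQ_inverse_real_of_nat])
           (use p(2)[OF inT[OF x]] in \<open>auto intro!: always_eventually simp: less_imp_le\<close>)
      from tendsto_diff[OF lim[OF x] this]
      have "(\<lambda>n. p n (torus_embed x)) \<longlonglongrightarrow> indicator K x" by simp
      then have "(\<lambda>n. f x * of_real (p n (torus_embed x))) \<longlonglongrightarrow> f x * of_real (indicator K x)"
        by (intro tendsto_intros)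
      then show "(\<lambda>n. f x * of_real (p n (torus_embed x))) \<longlonglongrightarrow> indicator K x *\<^sub>R f x"
        by (simp add: scaleR_conv_of_real mult.commute)
    qed
    show "AE x in TM. norm (f x * of_real (p n (torus_embed x))) \<le> 2 * cmod (f x)" for n
      using AE_TM_box
    proof eventually_elim
      fix x assume x: "x \<in> box 0 ((\<chi> i. 2 * pi) :: real ^ 3)"
      have "inverse (real (Suc n)) \<le> 1" by (simp add: inverse_eq_divide)
      then have "\<bar>p n (torus_embed x)\<bar> \<le> 2"
        using p(2)[OF inT[OF x], of n] F01[of n "torus_embed x"] by linarith
      then show "norm (f x * of_real (p n (torus_embed x))) \<le> 2 * cmod (f x)"
        using mult_left_mono[of "\<bar>p n (torus_embed x)\<bar>" 2 "cmod (f x)"] by (simp add: norm_mult mult.commute)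
    qed
    show "(\<lambda>x. f x * of_real (p n (torus_embed x))) \<in> borel_measurable TM" for n
      using meas[of n] by measurable
  qed measurable
  moreover have "(\<integral>x. f x * of_real (p n (torus_embed x)) \<partial>TM) = 0" for n
    using integral_trig_poly_0[OF f 0 trig_poly_polynomial[OF p(1)[of n]]] by simp
  ultimately show ?thesis by (simp add: LIMSEQ_const_iff)
qed simp

text \<open>By inner regularity the set where \<open>g\<close> is positive is exhausted by compact sets, and these are null sets.\<close>

lemma AE_nonpos_if_compact_integrals_0:
  assumes g: "integrable TM g"
    and 0: "\<And>K. compact K \<Longrightarrow> K \<subseteq> box 0 (\<chi> i. 2 * pi) \<Longrightarrow> (\<integral>x. indicator K x * g x \<partial>TM) = 0"
  shows "AE x in TM. g x \<le> (0::real)"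
proof -
  have [measurable]: "g \<in> borel_measurable borel" using g by auto
  define B where "B = {x \<in> box 0 (\<chi> i. 2 * pi). g x > 0}"
  have B: "B \<in> sets borel" unfolding B_def by measurable
  have "emeasure TM K = 0" if K: "compact K" "K \<subseteq> B" for K
  proof -
    have [measurable]: "K \<in> sets borel" using K(1) by (simp add: compact_imp_closed)
    have int: "integrable TM (\<lambda>x. indicator K x * g x)"
      using g by (rule Bochner_Integration.integrable_bound) (auto simp: indicator_def)
    have "(\<integral>x. indicator K x * g x \<partial>TM) = 0" by (rule 0) (use K in \<open>auto simp: B_def\<close>)
    then have "AE x in TM. indicator K x * g x = 0"
      by (subst (asm) integral_nonneg_eq_0_iff_AE[OF int]) (use K in \<open>auto simp: indicator_def B_def intro!: AE_I2\<close>)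
    then have "AE x in TM. x \<notin> K"
      by eventually_elim (use K in \<open>auto simp: indicator_def B_def split: if_splits\<close>)
    then show ?thesis by (simp add: AE_iff_measurable[of K])
  qed
  moreover have "emeasure TM B = (SUP K\<in>{K. K \<subseteq> B \<and> compact K}. emeasure TM K)"
    by (rule inner_regular) (use B TM.finite_emeasure_space in auto)
  ultimately have "emeasure TM B \<le> 0" by (simp only: SUP_le_iff) simp
  then have "emeasure TM B = 0" by simp
  then have "AE x in TM. x \<notin> B" using B by (simp add: AE_iff_measurable[of B])
  with AE_TM_box show ?thesis by eventually_elim (auto simp: B_def not_less)
qed

global_interpretation TM: complete_orthonormal_system TM wave
proof unfold_locales
  fix f assume f: "TM.sqi f" and 0: "\<And>k. TM.cf f k = 0"
  have int: "integrable TM f" using TM.sqi_prod[OF f TM.sqi_e, of 0] by simp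
  have [measurable]: "f \<in> borel_measurable borel" using f by (auto simp: TM.sqi_def)
  have K: "(\<integral>x. indicator K x * Re (f x) \<partial>TM) = 0 \<and> (\<integral>x. indicator K x * Im (f x) \<partial>TM) = 0"
    if "compact K" "K \<subseteq> box 0 (\<chi> i. 2 * pi)" for K
  proof -
    have [measurable]: "K \<in> sets borel" using that(1) by (simp add: compact_imp_closed)
    have i: "integrable TM (\<lambda>x. indicator K x *\<^sub>R f x)"
      using int by (rule Bochner_Integration.integrable_bound) (auto simp: indicator_def)
    have "(\<integral>x. Re (indicator K x *\<^sub>R f x) \<partial>TM) = 0" "(\<integral>x. Im (indicator K x *\<^sub>R f x) \<partial>TM) = 0"
      using integral_compact_0[OF f 0 that] by (simp_all only: integral_Re[OF i] integral_Im[OF i]) auto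
    then show ?thesis by simp
  qed
  have "AE x in TM. Re (f x) \<le> 0" "AE x in TM. Im (f x) \<le> 0"
    "AE x in TM. - Re (f x) \<le> 0" "AE x in TM. - Im (f x) \<le> 0"
    by (rule AE_nonpos_if_compact_integrals_0; use int K in simp)+
  then show "AE x in TM. f x = 0" by eventually_elim (auto simp: complex_eq_iff)
qed

subsection \<open>Translation invariance on the torus\<close>

lemma lborel_translation:
  fixes g :: "'a::euclidean_space \<Rightarrow> complex"
  assumes [measurable]: "g \<in> borel_measurable borel"
  shows "(\<integral>x. g (a + x) \<partial>lborel) = (\<integral>x. g x \<partial>lborel)"
proof -
  have "(\<integral>x. g x \<partial>lborel) = (\<integral>x. g x \<partial>distr lborel borel ((+) a))" by (simp only: lborel_distr_plus)
  also have "\<dots> = (\<integral>x. g (a + x) \<partial>lborel)" by (rule integral_distr) auto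
  finally show ?thesis ..
qed

lemma AE_coordinate_neq: "AE x in lborel. (x :: real ^ 3) $ i \<noteq> c"
proof (rule AE_I')
  have "negligible {x :: real ^ 3. x \<bullet> axis i 1 = c}"
    by (rule negligible_standard_hyperplane) (auto simp: Basis_vec_def)
  then show "{x :: real ^ 3. x $ i = c} \<in> null_sets lborel"
    by (simp add: inner_axis negligible_iff_null_sets null_sets_completion_iff)
qed auto

lemma integrable_indicator_bounded:
  fixes F :: "real ^ 3 \<Rightarrow> complex"
  assumes [measurable]: "F \<in> borel_measurable borel" "A \<in> sets borel"
    and A: "A \<subseteq> cbox a b" and B: "\<And>x. cmod (F x) \<le> B"
  shows "integrable lborel (\<lambda>x. indicator A x *\<^sub>R F x)"
proof (rule Bochner_Integration.integrable_bound)
  show "integrable lborel (\<lambda>x. B * indicator (cbox a b) x)"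
    by (intro integrable_mult_right integrable_real_indicator) (auto simp: emeasure_lborel_cbox_finite[unfolded infinity_ennreal_def])
  have "0 \<le> B" using B[of 0] norm_ge_zero order_trans by blast
  then show "AE x in lborel. norm (indicator A x *\<^sub>R F x) \<le> norm (B * indicator (cbox a b) x)"
    using A B by (intro AE_I2) (auto simp: indicator_def)
qed measurable

text \<open>The slab that the shift pushes out of the period cell comes back at the opposite face by periodicity.\<close>

lemma TM_shift_small:
  fixes F :: "real ^ 3 \<Rightarrow> complex"
  assumes [measurable]: "F \<in> borel_measurable borel" and B: "\<And>x. cmod (F x) \<le> B"
    and per: "\<And>x. F (x + axis i (2 * pi)) = F x" and h: "0 \<le> h" "h \<le> 2 * pi"
  shows "(\<integral>x. F (x + axis i h) \<partial>TM) = (\<integral>x. F x \<partial>TM)"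
proof -
  define S where "S P = {x :: real ^ 3. P (x $ i) \<and> (\<forall>j. j \<noteq> i \<longrightarrow> 0 \<le> x $ j \<and> x $ j \<le> 2 * pi)}" for P
  have T: "torus = S (\<lambda>t. 0 \<le> t \<and> t \<le> 2 * pi)" by (auto simp: S_def torus_iff)
  have [measurable]: "S (\<lambda>t. a \<le> t \<and> t \<le> b) \<in> sets borel" "S (\<lambda>t. a < t \<and> t \<le> b) \<in> sets borel" for a b
    unfolding S_def by measurable
  have sub: "S P \<subseteq> cbox (\<chi> j. min 0 a) (\<chi> j. max (2 * pi) b)" if "\<And>t. P t \<Longrightarrow> a \<le> t \<and> t \<le> b" for P a b
  proof
    fix x assume x: "x \<in> S P"
    show "x \<in> cbox (\<chi> j. min 0 a) (\<chi> j. max (2 * pi) b)"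
      unfolding mem_box_cart
    proof
      fix j show "(\<chi> j. min 0 a) $ j \<le> x $ j \<and> x $ j \<le> (\<chi> j. max (2 * pi) b) $ j"
        using x that[of "x $ i"] by (cases "j = i") (auto simp: S_def min_le_iff_disj le_max_iff_disj)
    qed
  qed
  have int: "integrable lborel (\<lambda>x. indicator (S (\<lambda>t. a \<le> t \<and> t \<le> b)) x *\<^sub>R F x)"
    "integrable lborel (\<lambda>x. indicator (S (\<lambda>t. a < t \<and> t \<le> b)) x *\<^sub>R F x)" for a b
    by (rule integrable_indicator_bounded[OF assms(1) _ sub[of _ a b] B]; auto)+
  define J where "J A = (\<integral>x. indicator A x *\<^sub>R F x \<partial>lborel)" for A
  have "(\<integral>x. indicator torus x *\<^sub>R F (x + axis i h) \<partial>lborel) = (\<integral>x. indicator torus (axis i (- h) + x) *\<^sub>R F (axis i (- h) + x + axis i h) \<partial>lborel)"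
    by (rule lborel_translation [symmetric]) measurable
  also have "\<dots> = J (S (\<lambda>t. h \<le> t \<and> t \<le> 2 * pi + h))"
    unfolding J_def T
    by (intro Bochner_Integration.integral_cong refl)
       (auto simp: S_def indicator_def axis_def vec_eq_iff intro!: arg_cong[where f = F])
  also have "\<dots> = J (S (\<lambda>t. h \<le> t \<and> t \<le> 2 * pi)) + J (S (\<lambda>t. 2 * pi < t \<and> t \<le> 2 * pi + h))"
    unfolding J_def
    by (subst Bochner_Integration.integral_add [symmetric], rule int, rule int, intro Bochner_Integration.integral_cong refl)
       (use h in \<open>auto simp: S_def indicator_def\<close>)
  also have "J (S (\<lambda>t. 2 * pi < t \<and> t \<le> 2 * pi + h)) = J (S (\<lambda>t. 0 < t \<and> t \<le> h))"
  proof -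
    have "J (S (\<lambda>t. 2 * pi < t \<and> t \<le> 2 * pi + h))
        = (\<integral>x. indicator (S (\<lambda>t. 2 * pi < t \<and> t \<le> 2 * pi + h)) (axis i (2 * pi) + x) *\<^sub>R F (axis i (2 * pi) + x) \<partial>lborel)"
      unfolding J_def by (rule lborel_translation [symmetric]) measurable
    also have "\<dots> = J (S (\<lambda>t. 0 < t \<and> t \<le> h))"
    proof -
      have "indicator (S (\<lambda>t. 2 * pi < t \<and> t \<le> 2 * pi + h)) (axis i (2 * pi) + x) = (indicator (S (\<lambda>t. 0 < t \<and> t \<le> h)) x :: real)" for x
        by (auto simp: S_def indicator_def axis_def)
      moreover have "F (axis i (2 * pi) + x) = F x" for x
        using per[of x] by (simp add: add.commute)
      ultimately show ?thesis unfolding J_def by simp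
    qed
    finally show ?thesis .
  qed
  also have "J (S (\<lambda>t. h \<le> t \<and> t \<le> 2 * pi)) + J (S (\<lambda>t. 0 < t \<and> t \<le> h)) = J torus"
    unfolding J_def T
  proof (subst Bochner_Integration.integral_add [symmetric], rule int, rule int, rule integral_cong_AE)
    show "AE x in lborel. indicator (S (\<lambda>t. h \<le> t \<and> t \<le> 2 * pi)) x *\<^sub>R F x + indicator (S (\<lambda>t. 0 < t \<and> t \<le> h)) x *\<^sub>R F x
        = indicator (S (\<lambda>t. 0 \<le> t \<and> t \<le> 2 * pi)) x *\<^sub>R F x"
      using AE_coordinate_neq[of i h] AE_coordinate_neq[of i 0]
      by eventually_elim (use h in \<open>auto simp: S_def indicator_def\<close>)
  qed measurable
  finally show ?thesis
    by (simp add: integral_TM set_lebesgue_integral_def J_def)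
qed

lemma periodic_shift_multiple:
  fixes F :: "real ^ 3 \<Rightarrow> 'b"
  assumes per: "\<And>x. F (x + axis i (2 * pi)) = F x"
  shows "F (x + axis i (2 * pi * of_int n)) = F x"
proof -
  have nat: "F (x + axis i (2 * pi * of_nat n)) = F x" for n x
  proof (induction n)
    case (Suc n)
    have e: "x + axis i (2 * pi * of_nat (Suc n)) = (x + axis i (2 * pi * of_nat n)) + axis i (2 * pi)"
      by (auto simp: vec_eq_iff axis_def algebra_simps)
    show ?case by (simp only: e per Suc)
  qed (simp add: axis_def vec_eq_iff zero_vec_def[symmetric])
  show ?thesis
  proof (cases n)
    case (nonneg k) then show ?thesis using nat[of x k] by simp
  next
    case (neg k)
    have "real_of_int n = - real (Suc k)" using neg by simp
    then have e: "x = (x + axis i (2 * pi * of_int n)) + axis i (2 * pi * of_nat (Suc k))"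
      by (simp only:) (auto simp: vec_eq_iff axis_def algebra_simps)
    have "F x = F ((x + axis i (2 * pi * of_int n)) + axis i (2 * pi * of_nat (Suc k)))" using e by (rule arg_cong)
    also have "\<dots> = F (x + axis i (2 * pi * of_int n))" by (rule nat)
    finally show ?thesis ..
  qed
qed

lemma TM_shift:
  fixes F :: "real ^ 3 \<Rightarrow> complex"
  assumes [measurable]: "F \<in> borel_measurable borel" and B: "\<And>x. cmod (F x) \<le> B"
    and per: "\<And>x. F (x + axis i (2 * pi)) = F x"
  shows "(\<integral>x. F (x + axis i h) \<partial>TM) = (\<integral>x. F x \<partial>TM)"
proof -
  define n where "n = \<lfloor>h / (2 * pi)\<rfloor>"
  define r where "r = h - 2 * pi * of_int n"
  have r: "0 \<le> r" "r \<le> 2 * pi"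
    using floor_divide_lower[of "2 * pi" h] floor_divide_upper[of "2 * pi" h] by (auto simp: r_def n_def algebra_simps)
  have "F (x + axis i h) = F (x + axis i r)" for x
  proof -
    have "x + axis i h = (x + axis i r) + axis i (2 * pi * of_int n)"
      by (auto simp: vec_eq_iff axis_def r_def)
    then show ?thesis by (simp only: periodic_shift_multiple[of F i, OF per])
  qed
  then show ?thesis using TM_shift_small[OF assms r] by simp
qed

lemma mean1_shift:
  fixes F :: "real \<Rightarrow> complex"
  assumes [measurable]: "F \<in> borel_measurable borel" and B: "\<And>x. cmod (F x) \<le> B"
    and per: "\<And>t. F (t + 2 * pi) = F t"
  shows "mean1 (\<lambda>t. F (t + h)) = mean1 F"
proof -
  have eq: "(\<integral>x. G (x $ 1) \<partial>TM) = mean1 G" if [measurable]: "G \<in> borel_measurable borel" and "\<And>x. cmod (G x) \<le> B" for G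
  proof -
    have "(\<integral>x. (\<Prod>i\<in>UNIV. (if i = 1 then G else (\<lambda>_. 1)) (x $ i)) \<partial>TM) = (\<Prod>i\<in>(UNIV :: 3 set). mean1 (if i = 1 then G else (\<lambda>_. 1)))"
      using that(2) by (intro TM_tensor) (auto intro: set_integrable_bounded_interval[of _ B] set_integrable_bounded_interval[of _ 1])
    moreover have "(\<Prod>i\<in>UNIV. (if i = 1 then G else (\<lambda>_. 1)) (x $ i)) = (\<Prod>i\<in>(UNIV :: 3 set). if i = 1 then G (x $ 1) else 1)" for x :: "real ^ 3"
      by (rule prod.cong) auto
    moreover have "(\<Prod>i\<in>(UNIV :: 3 set). mean1 (if i = 1 then G else (\<lambda>_. 1))) = (\<Prod>i\<in>(UNIV :: 3 set). if i = 1 then mean1 G else 1)"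
      using mean1_cis[of 0] by (intro prod.cong) auto
    ultimately show ?thesis by (simp add: prod.delta)
  qed
  have "mean1 (\<lambda>t. F (t + h)) = (\<integral>x. F (x $ 1 + h) \<partial>TM)" using B by (intro eq [symmetric]) auto
  also have "\<dots> = (\<integral>x. F ((x + axis 1 h) $ 1) \<partial>TM)" by (simp add: axis_def)
  also have "\<dots> = (\<integral>x. F (x $ 1) \<partial>TM)"
    by (rule TM_shift[of _ B]) (use B per in \<open>auto simp: axis_def\<close>)
  also have "\<dots> = mean1 F" using B by (intro eq) auto
  finally show ?thesis .
qed

subsection \<open>Fourier coefficients of derivatives of test functions\<close>

text \<open>The representative of a point in the half-open period cell.\<close>

definition pmod :: "real ^ 3 \<Rightarrow> real ^ 3" where
  "pmod x = (\<chi> i. x $ i - 2 * pi * of_int \<lfloor>x $ i / (2 * pi)\<rfloor>)"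

lemma pmod_bounds: "0 \<le> pmod x $ i" "pmod x $ i < 2 * pi"
proof -
  show "0 \<le> pmod x $ i" "pmod x $ i < 2 * pi"
    using floor_divide_lower[of "2 * pi" "x $ i"] floor_divide_upper[of "2 * pi" "x $ i"]
    by (auto simp: pmod_def algebra_simps)
qed

lemma pmod_torus: "pmod x \<in> torus"
  using pmod_bounds by (auto simp: torus_iff less_imp_le)

lemma pmod_id: "x \<in> box 0 (\<chi> i. 2 * pi) \<Longrightarrow> pmod x = x"
proof -
  assume x: "x \<in> box 0 (\<chi> i. 2 * pi)"
  have "\<lfloor>x $ i / (2 * pi)\<rfloor> = 0" for i
    using x[unfolded mem_box_cart, rule_format, of i] by (simp add: floor_eq_iff divide_less_eq)
  then show ?thesis by (simp add: pmod_def vec_eq_iff)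
qed

lemma pmod_periodic: "periodic f \<Longrightarrow> f (pmod x) = f x"
proof -
  assume f: "periodic f"
  have per: "\<And>y i. f (y + axis i (2 * pi)) = f y" using f by (auto simp: periodic_def)
  define v where "v i = axis i (2 * pi * of_int (- \<lfloor>x $ i / (2 * pi)\<rfloor>))" for i :: 3
  have "pmod x = ((x + v 1) + v 2) + v 3"
    by (auto simp: pmod_def v_def vec_eq_iff axis_def forall_3)
  then show ?thesis by (simp only: v_def periodic_shift_multiple[of f, OF per])
qed

lemma periodic_pmod: "periodic (\<lambda>x. f (pmod x))"
proof -
  have "pmod (x + axis i (2 * pi)) = pmod x" for x i
  proof (unfold vec_eq_iff, intro allI)
    fix j
    have "\<lfloor>(x $ i + 2 * pi) / (2 * pi)\<rfloor> = \<lfloor>x $ i / (2 * pi)\<rfloor> + 1"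
      using floor_add_int[of "x $ i / (2 * pi)" 1] by (simp add: add_divide_distrib)
    then show "pmod (x + axis i (2 * pi)) $ j = pmod x $ j" by (simp add: pmod_def axis_def algebra_simps)
  qed
  then show ?thesis by (simp add: periodic_def)
qed

lemma pmod_measurable [measurable]: "pmod \<in> borel_measurable borel"
proof -
  have "(\<lambda>x :: real ^ 3. x $ i - 2 * pi * real_of_int \<lfloor>x $ i / (2 * pi)\<rfloor>) \<in> borel_measurable borel" for i by measurable
  then show ?thesis
    by (subst borel_measurable_euclidean_space) (auto simp: Basis_vec_def inner_axis pmod_def)
qed

lemma periodic_bounded:
  fixes f :: "real ^ 3 \<Rightarrow> 'b::real_normed_vector"
  assumes "periodic f" "continuous_on UNIV f"
  shows "\<exists>B. \<forall>x. norm (f x) \<le> B"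
proof -
  have "compact (f ` torus)" unfolding torus_def
    by (intro compact_continuous_image compact_cbox continuous_on_subset[OF assms(2)]) auto
  then obtain B where "\<And>x. x \<in> torus \<Longrightarrow> norm (f x) \<le> B" using compact_imp_bounded bounded_iff by (metis imageI)
  then show ?thesis using pmod_periodic[OF assms(1)] pmod_torus by metis
qed

lemma axis_scaleR: "axis i h = h *\<^sub>R axis i (1 :: real)"
  by (auto simp: vec_eq_iff axis_def)

lemma partial_has_derivative:
  fixes f :: "real ^ 3 \<Rightarrow> real"
  assumes "f differentiable_on UNIV"
  shows "((\<lambda>h. f (x + axis i h)) has_real_derivative partial i f (x + axis i h)) (at h)"
proof -
  have d: "((\<lambda>h. f (y + axis i h)) has_real_derivative partial i f y) (at 0)" for y
  proof -
    obtain f' where f': "(f has_derivative f') (at y)"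
      using assms by (auto simp: differentiable_on_def differentiable_def)
    have "((\<lambda>h. f (y + h *\<^sub>R axis i 1)) has_derivative (\<lambda>h. f' (h *\<^sub>R axis i 1))) (at 0)"
      by (rule has_derivative_compose[where g = f and f = "\<lambda>h. y + h *\<^sub>R axis i 1"])
         (auto intro!: derivative_eq_intros f')
    moreover have "f' (h *\<^sub>R axis i 1) = h *\<^sub>R f' (axis i 1)" for h
      using has_derivative_linear[OF f'] by (rule linear_cmul)
    moreover have "(\<lambda>h. f (y + axis i h)) = (\<lambda>h. f (y + h *\<^sub>R axis i 1))"
      by (rule ext) (subst axis_scaleR, rule refl)
    ultimately have "((\<lambda>h. f (y + axis i h)) has_vector_derivative f' (axis i 1)) (at 0)"
      by (simp only: has_vector_derivative_def)
    then show ?thesis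
      unfolding partial_def by (simp add: vector_derivative_at has_real_derivative_iff_has_vector_derivative)
  qed
  have "((\<lambda>t. f ((x + axis i h) + axis i (t - h))) has_real_derivative partial i f (x + axis i h)) (at h)"
    using DERIV_shift[of "\<lambda>t. f ((x + axis i h) + axis i t)" "partial i f (x + axis i h)" h "- h"] d[of "x + axis i h"] by simp
  moreover have "(x + axis i h) + axis i (t - h) = x + axis i t" for t
    by (auto simp: vec_eq_iff axis_def)
  ultimately show ?thesis by simp
qed

lemma wavevec_axis: "wavevec k \<bullet> axis i h = of_int (k $ i) * h"
  by (simp add: inner_axis wavevec_def)

lemma wave_axis: "wave k (axis i h) = cis (of_int (k $ i) * h)"
  by (simp add: wave_def wavevec_axis)

lemma wave_periodic: "wave k (x + axis i (2 * pi)) = wave k x"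
proof -
  have "cis (of_int (k $ i) * (2 * pi)) = 1"
    using cis_multiple_2pi[of "of_int (k $ i)"] by (simp add: mult_ac)
  then show ?thesis by (simp add: wave_shift wave_axis)
qed

text \<open>Pass to the limit in difference quotients: translation invariance moves the difference from \<open>f\<close> onto the wave.\<close>

lemma cf_partial:
  fixes f :: "real ^ 3 \<Rightarrow> real"
  assumes per: "periodic f" and f: "f differentiable_on UNIV" and f': "continuous_on UNIV (partial i f)"
  shows "TM.cf (\<lambda>x. of_real (partial i f x)) k = \<i> * of_int (k $ i) * TM.cf (\<lambda>x. of_real (f x)) k"
proof -
  have cf: "continuous_on UNIV f" using f by (rule differentiable_imp_continuous_on)
  have per': "periodic (partial i f)"
  proof -
    have "f (x + axis j (2 * pi) + axis i h) = f (x + axis i h)" for x j h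
      using per[unfolded periodic_def, rule_format, of "x + axis i h" j] by (simp add: algebra_simps)
    then show ?thesis unfolding periodic_def partial_def by simp
  qed
  obtain B where B: "\<And>x. \<bar>f x\<bar> \<le> B" using periodic_bounded[OF per cf] by auto
  obtain B' where B': "\<And>x. \<bar>partial i f x\<bar> \<le> B'" using periodic_bounded[OF per' f'] by auto
  have [measurable]: "f \<in> borel_measurable borel" "partial i f \<in> borel_measurable borel"
    using cf f' by (auto intro: borel_measurable_continuous_onI)
  have [measurable]: "(\<lambda>x :: real ^ 3. x + axis i h) \<in> borel_measurable borel" for h :: real
    by (intro borel_measurable_continuous_onI continuous_intros)
  define h where "h n = inverse (real (Suc n))" for n
  have h: "h n > 0" for n by (simp add: h_def)
  have h0: "filterlim h (at 0) sequentially"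
    unfolding filterlim_at h_def using LIMSEQ_inverse_real_of_nat by auto
  define q where "q n x = (f (x + axis i (h n)) - f x) / h n" for n x
  have qB: "\<bar>q n x\<bar> \<le> B'" for n x
  proof -
    obtain z where "f (x + axis i (h n)) - f (x + axis i 0) = (h n - 0) * partial i f (x + axis i z)"
      using MVT2[OF h[of n], of "\<lambda>h. f (x + axis i h)" "\<lambda>h. partial i f (x + axis i h)"] partial_has_derivative[OF f] by blast
    moreover have "x + axis i 0 = x" by (auto simp: vec_eq_iff axis_def)
    ultimately show ?thesis using h[of n] B' by (simp add: q_def)
  qed
  have lim1: "(\<lambda>n. q n x) \<longlonglongrightarrow> partial i f x" for x
  proof -
    have "((\<lambda>h. (f (x + axis i (0 + h)) - f (x + axis i 0)) / h) \<longlongrightarrow> partial i f (x + axis i 0)) (at 0)"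
      using partial_has_derivative[OF f, of x i 0] by (simp add: DERIV_def)
    moreover have "x + axis i 0 = x" by (auto simp: vec_eq_iff axis_def)
    ultimately have "((\<lambda>h. (f (x + axis i h) - f x) / h) \<longlongrightarrow> partial i f x) (at 0)" by simp
    from filterlim_compose[OF this h0] show ?thesis unfolding q_def .
  qed
  have lim3: "(\<lambda>n. \<integral>x. of_real (q n x) * cnj (wave k x) \<partial>TM) \<longlonglongrightarrow> (\<integral>x. of_real (partial i f x) * cnj (wave k x) \<partial>TM)"
  proof (rule integral_dominated_convergence[where w = "\<lambda>_. B'"])
    show "AE x in TM. (\<lambda>n. of_real (q n x) * cnj (wave k x)) \<longlonglongrightarrow> of_real (partial i f x) * cnj (wave k x)"
      by (intro AE_I2 tendsto_intros lim1)
    show "AE x in TM. norm (of_real (q n x) * cnj (wave k x)) \<le> B'" for n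
      using qB by (intro AE_I2) (simp add: norm_mult)
  qed (simp_all add: q_def)
  have eq: "(\<integral>x. of_real (q n x) * cnj (wave k x) \<partial>TM)
      = TM.cf (\<lambda>x. of_real (f x)) k * ((cis (of_int (k $ i) * h n) - 1) / of_real (h n))" for n
  proof -
    define G where "G x = of_real (f x) * cnj (wave k x)" for x
    have [measurable]: "G \<in> borel_measurable borel" unfolding G_def by measurable
    have GB: "cmod (G x) \<le> B" for x using B by (simp add: G_def norm_mult)
    have int: "integrable TM G" "integrable TM (\<lambda>x. G (x + axis i (h n)))"
      by (rule TM.integrable_const_bound[of _ B]; simp add: GB)+
    have "of_real (q n x) * cnj (wave k x) = (wave k (axis i (h n)) * G (x + axis i (h n)) - G x) / of_real (h n)" for x
    proof -
      have "wave k (axis i (h n)) * cnj (wave k (axis i (h n))) = 1"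
        using wave_diff[of k "axis i (h n)" k] by simp
      then have "wave k (axis i (h n)) * G (x + axis i (h n)) = of_real (f (x + axis i (h n))) * cnj (wave k x)"
        by (simp add: G_def wave_shift algebra_simps)
      moreover have "of_real (q n x) * cnj (wave k x) = (of_real (f (x + axis i (h n))) * cnj (wave k x) - G x) / of_real (h n)"
        by (simp add: q_def G_def left_diff_distrib diff_divide_distrib)
      ultimately show ?thesis by simp
    qed
    then have "(\<integral>x. of_real (q n x) * cnj (wave k x) \<partial>TM) = (wave k (axis i (h n)) * (\<integral>x. G (x + axis i (h n)) \<partial>TM) - (\<integral>x. G x \<partial>TM)) / of_real (h n)"
      using int by simp
    also have "(\<integral>x. G (x + axis i (h n)) \<partial>TM) = (\<integral>x. G x \<partial>TM)"
      by (rule TM_shift[OF _ GB]) (use per in \<open>auto simp: G_def periodic_def wave_periodic\<close>)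
    finally show ?thesis
      by (simp add: wave_axis TM.cf_def TM.ip_def G_def algebra_simps diff_divide_distrib)
  qed
  have lim2: "(\<lambda>n. TM.cf (\<lambda>x. of_real (f x)) k * ((cis (of_int (k $ i) * h n) - 1) / of_real (h n)))
      \<longlonglongrightarrow> TM.cf (\<lambda>x. of_real (f x)) k * (\<i> * of_int (k $ i))"
  proof (intro tendsto_intros)
    have "((\<lambda>z. exp (\<i> * of_int (k $ i) * z)) has_field_derivative \<i> * of_int (k $ i) * exp (\<i> * of_int (k $ i) * 0)) (at 0)"
      by (auto intro!: derivative_eq_intros)
    then have "((\<lambda>z. (exp (\<i> * of_int (k $ i) * z) - 1) / z) \<longlongrightarrow> \<i> * of_int (k $ i)) (at 0)"
      by (simp add: DERIV_def)
    moreover have "filterlim (\<lambda>n. complex_of_real (h n)) (at 0) sequentially"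
      using h0 tendsto_of_real[of h 0] unfolding filterlim_at by (auto simp: less_imp_neq[OF h, symmetric])
    ultimately have "(\<lambda>n. (exp (\<i> * of_int (k $ i) * of_real (h n)) - 1) / of_real (h n)) \<longlonglongrightarrow> \<i> * of_int (k $ i)"
      by (rule filterlim_compose)
    then show "(\<lambda>n. (cis (of_int (k $ i) * h n) - 1) / of_real (h n)) \<longlonglongrightarrow> \<i> * of_int (k $ i)"
      by (simp add: cis_conv_exp mult.assoc)
  qed
  note lim3[unfolded eq]
  from LIMSEQ_unique[OF this lim2] show ?thesis
    by (simp add: TM.cf_def TM.ip_def mult_ac)
qed

section \<open>Vector fields and the Hermite-Birkhoff seminorm\<close>

subsection \<open>Vector fields\<close>

lemma borel_measurable_TM [simp]: "borel_measurable TM = borel_measurable borel"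
  by (rule measurable_cong_sets) simp_all

lemmas scaleR_complex = scaleR_conv_of_real[where 'a = complex]

definition hip :: "complex ^ 3 \<Rightarrow> complex ^ 3 \<Rightarrow> complex" where
  "hip u v = (\<Sum>i\<in>UNIV. u $ i * cnj (v $ i))"

lemma norm_vec_sq: "(norm (u :: complex ^ 3))\<^sup>2 = (\<Sum>i\<in>UNIV. (cmod (u $ i))\<^sup>2)"
  unfolding norm_vec_def L2_set_def by (intro real_sqrt_pow2 sum_nonneg) simp

lemma hip_self: "hip u u = of_real ((norm u)\<^sup>2)"
  unfolding hip_def norm_vec_sq of_real_sum complex_norm_square ..

lemma borel_measurable_vec:
  fixes U :: "real ^ 3 \<Rightarrow> complex ^ 3"
  shows "U \<in> borel_measurable borel \<longleftrightarrow> (\<forall>i. (\<lambda>x. U x $ i) \<in> borel_measurable borel)"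
proof
  assume [measurable]: "U \<in> borel_measurable borel"
  show "\<forall>i. (\<lambda>x. U x $ i) \<in> borel_measurable borel"
  proof
    fix i
    have "(\<lambda>u :: complex ^ 3. u $ i) \<in> borel_measurable borel"
      by (intro borel_measurable_continuous_onI continuous_intros)
    then show "(\<lambda>x. U x $ i) \<in> borel_measurable borel" by measurable
  qed
next
  assume "\<forall>i. (\<lambda>x. U x $ i) \<in> borel_measurable borel"
  then have [measurable]: "(\<lambda>x. U x $ i) \<in> borel_measurable borel" for i by blast
  have "(\<lambda>x. U x $ i \<bullet> c) \<in> borel_measurable borel" for i c by measurable
  then show "U \<in> borel_measurable borel"
    by (subst borel_measurable_euclidean_space) (auto simp: Basis_vec_def inner_axis)
qed

lemma periodic_L2_iff:
  "periodic_L2 U \<longleftrightarrow> periodic U \<and> (\<forall>i. TM.sqi (\<lambda>x. U x $ i))"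
proof -
  have "set_integrable lborel torus (\<lambda>x. (norm (U x))\<^sup>2) \<longleftrightarrow> (\<forall>i. integrable TM (\<lambda>x. (cmod (U x $ i))\<^sup>2))"
    if U: "\<forall>i. (\<lambda>x. U x $ i) \<in> borel_measurable borel"
  proof -
    have [measurable]: "U \<in> borel_measurable borel" "\<And>i. (\<lambda>x. U x $ i) \<in> borel_measurable borel"
      using U borel_measurable_vec by auto
    have "set_integrable lborel torus (\<lambda>x. (norm (U x))\<^sup>2) \<longleftrightarrow> integrable TM (\<lambda>x. (norm (U x))\<^sup>2)"
      by (rule integrable_TM[symmetric]) measurable
    also have "\<dots> \<longleftrightarrow> (\<forall>i. integrable TM (\<lambda>x. (cmod (U x $ i))\<^sup>2))"
    proof
      assume int: "integrable TM (\<lambda>x. (norm (U x))\<^sup>2)"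
      show "\<forall>i. integrable TM (\<lambda>x. (cmod (U x $ i))\<^sup>2)"
      proof
        fix i show "integrable TM (\<lambda>x. (cmod (U x $ i))\<^sup>2)"
          by (rule Bochner_Integration.integrable_bound[OF int])
             (auto intro!: AE_I2 power_mono Finite_Cartesian_Product.norm_nth_le)
      qed
    next
      assume "\<forall>i. integrable TM (\<lambda>x. (cmod (U x $ i))\<^sup>2)"
      then show "integrable TM (\<lambda>x. (norm (U x))\<^sup>2)"
        unfolding norm_vec_sq by (intro Bochner_Integration.integrable_sum) auto
    qed
    finally show ?thesis .
  qed
  then show ?thesis
    unfolding periodic_L2_def TM.sqi_def by (auto simp: borel_measurable_vec)
qed

lemma periodic_L2D: "periodic_L2 U \<Longrightarrow> TM.sqi (\<lambda>x. U x $ i)"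
  and periodic_L2_periodic: "periodic_L2 U \<Longrightarrow> periodic U"
  and periodic_L2_measurable [measurable_dest]: "periodic_L2 U \<Longrightarrow> U \<in> borel_measurable borel"
  by (simp_all add: periodic_L2_iff) (simp add: TM.sqi_def borel_measurable_vec)

lemma integrable_TM_vec:
  assumes U: "periodic_L2 U" and [measurable]: "g \<in> borel_measurable borel" and B: "\<And>x. cmod (g x) \<le> B"
  shows "integrable TM (\<lambda>x. g x *s U x)"
proof -
  have [measurable]: "U \<in> borel_measurable borel" by (rule periodic_L2_measurable[OF U])
  have [measurable]: "(\<lambda>x. U x $ i) \<in> borel_measurable borel" for i
    using periodic_L2_measurable[OF U] borel_measurable_vec by blast
  have int: "integrable TM (\<lambda>x. (norm (U x))\<^sup>2)"
    using U by (subst integrable_TM) (auto simp: periodic_L2_def)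
  have n: "norm (c *s u) = cmod c * norm u" for c and u :: "complex ^ 3"
    by (simp add: norm_vec_def L2_set_def norm_mult power_mult_distrib sum_distrib_left [symmetric] real_sqrt_mult)
  show ?thesis
  proof (rule Bochner_Integration.integrable_bound)
    show "integrable TM (\<lambda>x. B * (1 + (norm (U x))\<^sup>2))" using int by (intro integrable_mult_right) simp
    show "(\<lambda>x. g x *s U x) \<in> borel_measurable TM"
      using borel_measurable_vec[of "\<lambda>x. g x *s U x"] by simp
    show "AE x in TM. norm (g x *s U x) \<le> norm (B * (1 + (norm (U x))\<^sup>2))"
    proof (rule AE_I2)
      fix x
      have B0: "0 \<le> B" using B[of 0] norm_ge_zero order_trans by blast
      have "2 * norm (U x) \<le> 1 + (norm (U x))\<^sup>2" using sum_squares_bound[of 1 "norm (U x)"] by simp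
      then have "norm (U x) \<le> 1 + (norm (U x))\<^sup>2" using norm_ge_zero[of "U x"] by linarith
      then have "cmod (g x) * norm (U x) \<le> B * (1 + (norm (U x))\<^sup>2)"
        using B[of x] B0 by (intro mult_mono) auto
      then show "norm (g x *s U x) \<le> norm (B * (1 + (norm (U x))\<^sup>2))" by (simp add: n)
    qed
  qed
qed

lemma integral_TM_vec_nth:
  assumes U: "periodic_L2 U" and g: "g \<in> borel_measurable borel" "\<And>x. cmod (g x) \<le> B"
  shows "(\<integral>x. g x *s U x \<partial>TM) $ i = (\<integral>x. g x * U x $ i \<partial>TM)"
  using integral_bounded_linear[OF bounded_linear_vec_nth integrable_TM_vec[OF assms], of i] by simp

lemma fourier_coeff_nth: "periodic_L2 U \<Longrightarrow> fourier_coeff U k $ i = TM.cf (\<lambda>x. U x $ i) k"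
proof -
  assume U: "periodic_L2 U"
  have [measurable]: "U \<in> borel_measurable borel" by (rule periodic_L2_measurable[OF U])
  have [measurable]: "(\<lambda>x. U x $ i) \<in> borel_measurable borel" for i
    using periodic_L2_measurable[OF U] borel_measurable_vec by blast
  have c: "cis (- (wavevec k \<bullet> x)) = cnj (wave k x)" for x by (simp add: wave_def cis_cnj)
  have m: "(\<lambda>x. cnj (wave k x) *s U x) \<in> borel_measurable borel"
    unfolding borel_measurable_vec by simp
  have "fourier_coeff U k = (\<integral>x. cnj (wave k x) *s U x \<partial>TM)"
    unfolding fourier_coeff_def c by (rule integral_TM[OF m, symmetric])
  then show ?thesis
    using integral_TM_vec_nth[OF U, of "\<lambda>x. cnj (wave k x)" 1 i] by (simp add: TM.cf_def TM.ip_def mult.commute)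
qed

lemma L2_inner_eq:
  assumes "periodic_L2 f" "periodic_L2 g"
  shows "L2_inner f g = of_real ((2 * pi) ^ 3) * (\<Sum>i\<in>UNIV. TM.ip (\<lambda>x. f x $ i) (\<lambda>x. g x $ i))"
proof -
  have [measurable]: "(\<lambda>x. f x $ i) \<in> borel_measurable borel" "(\<lambda>x. g x $ i) \<in> borel_measurable borel" for i
    using assms periodic_L2_measurable borel_measurable_vec by blast+
  have "(\<integral>x. (\<Sum>i\<in>UNIV. f x $ i * cnj (g x $ i)) \<partial>TM) = (1 / (2 * pi) ^ 3) *\<^sub>R L2_inner f g"
    unfolding L2_inner_def by (rule integral_TM) measurable
  moreover have "(\<integral>x. (\<Sum>i\<in>UNIV. f x $ i * cnj (g x $ i)) \<partial>TM) = (\<Sum>i\<in>UNIV. TM.ip (\<lambda>x. f x $ i) (\<lambda>x. g x $ i))"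
    unfolding TM.ip_def by (rule Bochner_Integration.integral_sum) (intro TM.sqi_prod periodic_L2D assms)
  ultimately have "of_real ((2 * pi) ^ 3) * (\<Sum>i\<in>UNIV. TM.ip (\<lambda>x. f x $ i) (\<lambda>x. g x $ i)) = (2 * pi) ^ 3 *\<^sub>R ((1 / (2 * pi) ^ 3) *\<^sub>R L2_inner f g)"
    by (simp only: scaleR_conv_of_real)
  then show ?thesis by simp
qed

lemma Parseval_vec:
  assumes f: "periodic_L2 f" and g: "periodic_L2 g"
  shows "((\<lambda>k. hip (fourier_coeff f k) (fourier_coeff g k)) has_sum L2_inner f g / of_real ((2 * pi) ^ 3)) UNIV"
proof -
  have "((\<lambda>k. \<Sum>i\<in>UNIV. TM.cf (\<lambda>x. f x $ i) k * cnj (TM.cf (\<lambda>x. g x $ i) k)) has_sum (\<Sum>i\<in>UNIV. TM.ip (\<lambda>x. f x $ i) (\<lambda>x. g x $ i))) UNIV"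
    unfolding sum_3 by (intro has_sum_add TM.Parseval periodic_L2D f g)
  then show ?thesis by (simp add: hip_def fourier_coeff_nth f g L2_inner_eq)
qed

definition square_summable :: "(int ^ 3 \<Rightarrow> complex ^ 3) \<Rightarrow> bool" where
  "square_summable a \<longleftrightarrow> (\<lambda>k. (norm (a k))\<^sup>2) summable_on UNIV"

lemma square_summable_fourier:
  assumes U: "periodic_L2 U" shows "square_summable (fourier_coeff U)"
proof -
  have "(\<lambda>k. (cmod (TM.cf (\<lambda>x. U x $ 1) k))\<^sup>2 + (cmod (TM.cf (\<lambda>x. U x $ 2) k))\<^sup>2 + (cmod (TM.cf (\<lambda>x. U x $ 3) k))\<^sup>2) summable_on UNIV"
    by (rule summable_on_add[OF summable_on_add]) (rule TM.cf_square_summable[OF periodic_L2D[OF U]])+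
  then show ?thesis unfolding square_summable_def norm_vec_sq sum_3 fourier_coeff_nth[OF U] .
qed

lemma Parseval_norm_vec:
  assumes "periodic_L2 f"
  shows "Re (L2_inner f f) = (2 * pi) ^ 3 * (\<Sum>\<^sub>\<infinity>k. (norm (fourier_coeff f k))\<^sup>2)"
proof -
  have "((\<lambda>k. Re (hip (fourier_coeff f k) (fourier_coeff f k))) has_sum Re (L2_inner f f / of_real ((2 * pi) ^ 3))) UNIV"
    by (rule has_sum_Re[OF Parseval_vec[OF assms assms]])
  then have "((\<lambda>k. (norm (fourier_coeff f k))\<^sup>2) has_sum Re (L2_inner f f) / (2 * pi) ^ 3) UNIV"
    by (simp only: hip_self Re_complex_of_real Re_divide_of_real)
  then have "(\<Sum>\<^sub>\<infinity>k. (norm (fourier_coeff f k))\<^sup>2) = Re (L2_inner f f) / (2 * pi) ^ 3" by (rule infsumI)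
  then show ?thesis by simp
qed

lemma sqi_AE_cong:
  assumes "TM.sqi f" "g \<in> borel_measurable borel" "AE x in TM. f x = g x"
  shows "TM.sqi g \<and> TM.cf g = TM.cf f"
proof -
  have [measurable]: "f \<in> borel_measurable borel" using assms(1) by (auto simp: TM.sqi_def)
  have "integrable TM (\<lambda>x. (cmod (g x))\<^sup>2)"
  proof (rule integrable_cong_AE[THEN iffD1])
    show "integrable TM (\<lambda>x. (cmod (f x))\<^sup>2)" using assms(1) by (simp add: TM.sqi_def)
    show "AE x in TM. (cmod (f x))\<^sup>2 = (cmod (g x))\<^sup>2" using assms(3) by eventually_elim simp
  qed (use assms(2) in measurable)
  moreover have "TM.cf g k = TM.cf f k" for k unfolding TM.cf_def TM.ip_def
    using assms by (intro integral_cong_AE) auto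
  ultimately show ?thesis using assms by (auto simp: TM.sqi_def)
qed

lemma Riesz_Fischer_vec:
  assumes "square_summable a"
  shows "\<exists>V. periodic_L2 V \<and> (\<forall>k. fourier_coeff V k = a k)"
proof -
  have "(\<lambda>k. (cmod (a k $ i))\<^sup>2) summable_on UNIV" for i
    using assms unfolding square_summable_def
    by (rule summable_on_comparison_test) (auto intro!: power_mono Finite_Cartesian_Product.norm_nth_le)
  from TM.Riesz_Fischer[OF this] have "\<exists>f. TM.sqi f \<and> TM.cf f = (\<lambda>k. a k $ i)" for i by blast
  then have "\<forall>i. \<exists>f. TM.sqi f \<and> TM.cf f = (\<lambda>k. a k $ i)" ..
  from choice[OF this] obtain f where f: "\<And>i. TM.sqi (f i)" "\<And>i. TM.cf (f i) = (\<lambda>k. a k $ i)" by blast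
  have [measurable]: "f i \<in> borel_measurable borel" for i using f(1)[of i] by (auto simp: TM.sqi_def)
  define V where "V x = (\<chi> i. f i (pmod x))" for x
  have "TM.sqi (\<lambda>x. f i (pmod x)) \<and> TM.cf (\<lambda>x. f i (pmod x)) = TM.cf (f i)" for i
  proof (rule sqi_AE_cong[OF f(1)])
    show "AE x in TM. f i x = f i (pmod x)" using AE_TM_box by eventually_elim (simp add: pmod_id)
  qed measurable
  then have V: "TM.sqi (\<lambda>x. V x $ i)" "TM.cf (\<lambda>x. V x $ i) k = a k $ i" for i k
    by (simp_all add: V_def f)
  have "periodic V" unfolding V_def using periodic_pmod[of "\<lambda>x. \<chi> i. f i x"] by simp
  with V have "periodic_L2 V" by (simp add: periodic_L2_iff)
  moreover from this have "fourier_coeff V k = a k" for k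
    by (simp add: vec_eq_iff fourier_coeff_nth V)
  ultimately show ?thesis by blast
qed

text \<open>
  A symbol that does not enlarge coefficients preserves square summability, so the Riesz-Fischer theorem supplies the function that the
  definition selects.
\<close>

lemma fourier_multiplier:
  assumes U: "periodic_L2 U" and M: "\<And>k u. norm (M k u) \<le> norm u"
  shows "periodic_L2 (fourier_multiplier M U)"
    and "fourier_coeff (fourier_multiplier M U) k = M k (fourier_coeff U k)"
proof -
  have "square_summable (\<lambda>k. M k (fourier_coeff U k))"
    using square_summable_fourier[OF U] unfolding square_summable_def
    by (rule summable_on_comparison_test) (auto intro!: power_mono M)
  from someI_ex[OF Riesz_Fischer_vec[OF this]]
  show "periodic_L2 (fourier_multiplier M U)"
    and "fourier_coeff (fourier_multiplier M U) k = M k (fourier_coeff U k)"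
    unfolding fourier_multiplier_def by blast+
qed

lemma periodic_L2_combine:
  assumes f: "periodic_L2 f" and g: "periodic_L2 g"
  shows "periodic_L2 (\<lambda>x. f x - a *\<^sub>R g x)"
    and "fourier_coeff (\<lambda>x. f x - a *\<^sub>R g x) k = fourier_coeff f k - a *\<^sub>R fourier_coeff g k"
proof -
  have p: "(\<lambda>x. (f x - a *\<^sub>R g x) $ i) = (\<lambda>x. f x $ i - of_real a * g x $ i)" for i
    by (simp add: scaleR_complex)
  show *: "periodic_L2 (\<lambda>x. f x - a *\<^sub>R g x)"
    using periodic_L2_periodic[OF f] periodic_L2_periodic[OF g]
    unfolding periodic_L2_iff p by (auto simp: periodic_def intro!: TM.sqi_diff TM.sqi_scale periodic_L2D f g)
  have "TM.cf (\<lambda>x. f x $ i - of_real a * g x $ i) k = TM.cf (\<lambda>x. f x $ i) k - of_real a * TM.cf (\<lambda>x. g x $ i) k" for i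
    unfolding TM.cf_def
    by (subst TM.ip_diff) (auto simp: TM.ip_scale intro!: TM.sqi_e TM.sqi_scale periodic_L2D f g)
  then show "fourier_coeff (\<lambda>x. f x - a *\<^sub>R g x) k = fourier_coeff f k - a *\<^sub>R fourier_coeff g k"
    unfolding vec_eq_iff fourier_coeff_nth[OF *] p by (simp add: fourier_coeff_nth f g scaleR_complex)
qed

subsection \<open>Weak derivatives and the seminorm\<close>

definition deriv_symbol :: "nat ^ 3 \<Rightarrow> int ^ 3 \<Rightarrow> complex" where
  "deriv_symbol \<alpha> k = (\<Prod>i\<in>UNIV. (\<i> * of_int (k $ i)) ^ (\<alpha> $ i))"

lemma prod_3: "prod f (UNIV :: 3 set) = f 1 * f 2 * f 3"
  unfolding UNIV_3 by (simp add: mult.assoc)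

lemma cnj_deriv_symbol: "cnj (deriv_symbol \<alpha> k) = (-1) ^ (\<Sum>i\<in>UNIV. \<alpha> $ i) * deriv_symbol \<alpha> k"
proof -
  have "cnj (deriv_symbol \<alpha> k) = (\<Prod>i\<in>UNIV. (-1) ^ (\<alpha> $ i) * (\<i> * of_int (k $ i)) ^ (\<alpha> $ i))"
    by (simp add: deriv_symbol_def power_mult_distrib [symmetric])
  then show ?thesis by (simp add: prod.distrib power_sum deriv_symbol_def)
qed

text \<open>Real waves of arbitrary amplitude and phase; unlike \<open>wave\<close> they are admissible test functions.\<close>

definition trig :: "int ^ 3 \<Rightarrow> complex \<Rightarrow> real ^ 3 \<Rightarrow> real" where
  "trig k z x = Re (z * wave k x)"

lemma trig_has_derivative:
  "(trig k z has_derivative (\<lambda>h. (wavevec k \<bullet> h) * trig k (\<i> * z) x)) (at x)"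
proof -
  have "trig k z = (\<lambda>x. Re z * cos (wavevec k \<bullet> x) - Im z * sin (wavevec k \<bullet> x))" for z
    by (auto simp: trig_def wave_def)
  note * = this
  show ?thesis unfolding * by (auto intro!: derivative_eq_intros simp: algebra_simps)
qed

lemma trig_differentiable: "trig k z differentiable_on UNIV"
  using trig_has_derivative by (auto simp: differentiable_on_def differentiable_def)

lemma partial_trig: "partial i (trig k z) = trig k (\<i> * of_int (k $ i) * z)"
proof
  fix x
  have "((\<lambda>h. trig k z (x + h *\<^sub>R axis i 1)) has_derivative (\<lambda>h. (wavevec k \<bullet> (h *\<^sub>R axis i 1)) * trig k (\<i> * z) (x + 0 *\<^sub>R axis i 1))) (at 0)"
    by (rule has_derivative_compose[where g = "trig k z", OF _ trig_has_derivative]) (auto intro!: derivative_eq_intros)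
  moreover have "(\<lambda>h. trig k z (x + axis i h)) = (\<lambda>h. trig k z (x + h *\<^sub>R axis i 1))"
    by (rule ext) (subst axis_scaleR, rule refl)
  ultimately have "((\<lambda>h. trig k z (x + axis i h)) has_vector_derivative of_int (k $ i) * trig k (\<i> * z) x) (at 0)"
    by (simp add: has_vector_derivative_def wavevec_axis mult_ac)
  then have "partial i (trig k z) x = of_int (k $ i) * trig k (\<i> * z) x"
    unfolding partial_def by (rule vector_derivative_at)
  also have "\<dots> = trig k (\<i> * of_int (k $ i) * z) x" by (simp add: trig_def algebra_simps)
  finally show "partial i (trig k z) x = trig k (\<i> * of_int (k $ i) * z) x" .
qed

lemma partial_power_trig: "(partial i ^^ n) (trig k z) = trig k ((\<i> * of_int (k $ i)) ^ n * z)"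
  by (induction n) (auto simp: partial_trig mult_ac)

lemma mixed_partial_trig: "mixed_partial \<alpha> (trig k z) = trig k (deriv_symbol \<alpha> k * z)"
  by (simp add: mixed_partial_def partial_power_trig deriv_symbol_def prod_3 mult.assoc)

lemma smooth_periodic_trig: "smooth_periodic (trig k z)"
proof -
  have "\<exists>z'. foldr partial ds (trig k z) = trig k z'" for ds
    by (induction ds) (auto simp: partial_trig)
  then show ?thesis unfolding smooth_periodic_def
    by (metis periodic_def trig_def trig_differentiable wave_periodic)
qed

lemma smooth_periodic_partial: "smooth_periodic f \<Longrightarrow> smooth_periodic (partial i f)"
proof -
  assume f: "smooth_periodic f"
  have "periodic (partial i f)" unfolding periodic_def
  proof (intro allI)
    fix x j
    have "f (x + axis j (2 * pi) + axis i h) = f (x + axis i h)" for h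
      using f unfolding smooth_periodic_def periodic_def by (metis add.assoc add.commute)
    then show "partial i f (x + axis j (2 * pi)) = partial i f x" unfolding partial_def by simp
  qed
  moreover have "foldr partial ds (partial i f) differentiable_on UNIV" for ds
    using f[unfolded smooth_periodic_def, THEN conjunct2, rule_format, of "ds @ [i]"] by simp
  ultimately show ?thesis by (simp add: smooth_periodic_def)
qed

lemma smooth_periodic_bounded:
  assumes "smooth_periodic f"
  shows "f \<in> borel_measurable borel" "\<exists>B. \<forall>x. \<bar>f x\<bar> \<le> B"
proof -
  have "continuous_on UNIV f"
    using assms[unfolded smooth_periodic_def, THEN conjunct2, rule_format, of "[]"] by (auto intro: differentiable_imp_continuous_on)
  then show "f \<in> borel_measurable borel" "\<exists>B. \<forall>x. \<bar>f x\<bar> \<le> B"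
    using periodic_bounded[of f] assms by (auto simp: smooth_periodic_def intro: borel_measurable_continuous_onI)
qed

lemma cf_smooth_partial:
  assumes f: "smooth_periodic f"
  shows "TM.cf (\<lambda>x. of_real (partial i f x)) k = \<i> * of_int (k $ i) * TM.cf (\<lambda>x. of_real (f x)) k"
proof (rule cf_partial)
  show "periodic f" using f by (simp add: smooth_periodic_def)
  show "f differentiable_on UNIV" using f[unfolded smooth_periodic_def, THEN conjunct2, rule_format, of "[]"] by simp
  show "continuous_on UNIV (partial i f)"
    using f[unfolded smooth_periodic_def, THEN conjunct2, rule_format, of "[i]"] by (auto intro: differentiable_imp_continuous_on)
qed

lemma cf_partial_power:
  assumes f: "smooth_periodic f"
  shows "smooth_periodic ((partial i ^^ n) f) \<and>
    TM.cf (\<lambda>x. of_real ((partial i ^^ n) f x)) k = (\<i> * of_int (k $ i)) ^ n * TM.cf (\<lambda>x. of_real (f x)) k"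
  by (induction n) (auto simp: f smooth_periodic_partial cf_smooth_partial)

lemma cf_mixed_partial:
  fixes \<alpha> :: "nat ^ 3"
  assumes f: "smooth_periodic f"
  shows "smooth_periodic (mixed_partial \<alpha> f)"
    and "TM.cf (\<lambda>x. of_real (mixed_partial \<alpha> f x)) k = deriv_symbol \<alpha> k * TM.cf (\<lambda>x. of_real (f x)) k"
proof -
  define g h where "g = (partial 3 ^^ (\<alpha> $ 3)) f" and "h = (partial 2 ^^ (\<alpha> $ 2)) g"
  note 3 = cf_partial_power[OF f, where i = 3 and n = "\<alpha> $ 3", folded g_def]
  note 2 = cf_partial_power[OF 3[THEN conjunct1], where i = 2 and n = "\<alpha> $ 2", folded h_def]
  note 1 = cf_partial_power[OF 2[THEN conjunct1], where i = 1 and n = "\<alpha> $ 1"]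
  have e: "mixed_partial \<alpha> f = (partial 1 ^^ (\<alpha> $ 1)) h" by (simp only: mixed_partial_def g_def h_def)
  show "smooth_periodic (mixed_partial \<alpha> f)" unfolding e by (rule 1[THEN conjunct1])
  show "TM.cf (\<lambda>x. of_real (mixed_partial \<alpha> f x)) k = deriv_symbol \<alpha> k * TM.cf (\<lambda>x. of_real (f x)) k"
    unfolding e 1[THEN conjunct2] 2[THEN conjunct2] 3[THEN conjunct2] deriv_symbol_def prod_3 by (simp only: mult.assoc)
qed

lemma test_integral:
  assumes U: "periodic_L2 U" and \<phi>: "smooth_periodic \<phi>"
  shows "(LINT x:torus|lborel. \<phi> x *\<^sub>R U x) $ i = of_real ((2 * pi) ^ 3) * TM.ip (\<lambda>x. U x $ i) (\<lambda>x. of_real (\<phi> x))"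
proof -
  have [measurable]: "(\<lambda>x. U x $ i) \<in> borel_measurable borel" for i
    using U periodic_L2_measurable borel_measurable_vec by blast
  have [measurable]: "\<phi> \<in> borel_measurable borel" using smooth_periodic_bounded[OF \<phi>] by simp
  obtain B where B: "\<And>x. \<bar>\<phi> x\<bar> \<le> B" using smooth_periodic_bounded[OF \<phi>] by auto
  have s: "\<phi> x *\<^sub>R U x = of_real (\<phi> x) *s U x" for x by (simp add: vec_eq_iff scaleR_complex)
  have "(\<integral>x. \<phi> x *\<^sub>R U x \<partial>TM) = (1 / (2 * pi) ^ 3) *\<^sub>R (LINT x:torus|lborel. \<phi> x *\<^sub>R U x)"
    using periodic_L2_measurable[OF U] by (intro integral_TM) measurable
  then have "(LINT x:torus|lborel. \<phi> x *\<^sub>R U x) = (2 * pi) ^ 3 *\<^sub>R (\<integral>x. \<phi> x *\<^sub>R U x \<partial>TM)" by simp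
  moreover have "(\<integral>x. \<phi> x *\<^sub>R U x \<partial>TM) $ i = (\<integral>x. of_real (\<phi> x) * U x $ i \<partial>TM)"
    unfolding s by (rule integral_TM_vec_nth[OF U, of _ B]) (auto simp: B)
  ultimately show ?thesis by (simp add: TM.ip_def mult.commute scaleR_complex)
qed

lemma sqi_smooth: "smooth_periodic \<phi> \<Longrightarrow> TM.sqi (\<lambda>x. of_real (\<phi> x))"
proof -
  assume \<phi>: "smooth_periodic \<phi>"
  have [measurable]: "\<phi> \<in> borel_measurable borel" using smooth_periodic_bounded[OF \<phi>] by simp
  obtain B where B: "\<And>x. \<bar>\<phi> x\<bar> \<le> B" using smooth_periodic_bounded[OF \<phi>] by auto
  show ?thesis by (rule TM.sqi_bounded[of _ B]) (auto simp: B)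
qed

text \<open>
  The test functions \<open>trig\<close> recover the Fourier coefficients, so a weak derivative has the stated ones.  Conversely Parseval turns the
  relation of the coefficients into the identity for every test function.
\<close>

lemma is_weak_deriv_iff:
  assumes f: "periodic_L2 f"
  shows "is_weak_deriv \<alpha> f g \<longleftrightarrow> periodic_L2 g \<and> (\<forall>k. fourier_coeff g k = deriv_symbol \<alpha> k *s fourier_coeff f k)"
proof (cases "periodic_L2 g")
  case g: True
  define s where "s = (- 1 :: complex) ^ (\<Sum>i\<in>UNIV. \<alpha> $ i)"
  have s2: "s * s = 1" unfolding s_def by (simp flip: power_add power_mult_distrib)
  have "((LINT x:torus|lborel. \<phi> x *\<^sub>R g x) = (- 1) ^ (\<Sum>i\<in>UNIV. \<alpha> $ i) *\<^sub>R (LINT x:torus|lborel. mixed_partial \<alpha> \<phi> x *\<^sub>R f x)) \<longleftrightarrow>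
      (\<forall>i. TM.ip (\<lambda>x. g x $ i) (\<lambda>x. of_real (\<phi> x)) = s * TM.ip (\<lambda>x. f x $ i) (\<lambda>x. of_real (mixed_partial \<alpha> \<phi> x)))"
    if \<phi>: "smooth_periodic \<phi>" for \<phi>
    unfolding vec_eq_iff
    by (intro iff_allI) (simp add: test_integral[OF g \<phi>] test_integral[OF f cf_mixed_partial(1)[OF \<phi>]] s_def scaleR_complex)
  then have weak: "is_weak_deriv \<alpha> f g \<longleftrightarrow> (\<forall>\<phi>. smooth_periodic \<phi> \<longrightarrow> (\<forall>i. TM.ip (\<lambda>x. g x $ i) (\<lambda>x. of_real (\<phi> x)) = s * TM.ip (\<lambda>x. f x $ i) (\<lambda>x. of_real (mixed_partial \<alpha> \<phi> x))))"
    using g unfolding is_weak_deriv_def by auto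
  have "is_weak_deriv \<alpha> f g \<longleftrightarrow> (\<forall>k. fourier_coeff g k = deriv_symbol \<alpha> k *s fourier_coeff f k)"
  proof
    assume w: "is_weak_deriv \<alpha> f g"
    show "\<forall>k. fourier_coeff g k = deriv_symbol \<alpha> k *s fourier_coeff f k"
    proof (unfold vec_eq_iff, intro allI)
      fix k i
      have split': "cnj z * TM.cf h k = TM.ip h (\<lambda>x. of_real (trig k z x)) - \<i> * TM.ip h (\<lambda>x. of_real (trig k (z * - \<i>) x))" if "TM.sqi h" for h z
      proof -
        have "cnj z * TM.cf h k = (\<integral>x. cnj z * (h x * cnj (wave k x)) \<partial>TM)"
          unfolding TM.cf_def TM.ip_def by simp
        also have "\<dots> = (\<integral>x. h x * cnj (of_real (trig k z x)) - \<i> * (h x * cnj (of_real (trig k (z * - \<i>) x))) \<partial>TM)"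
          by (intro Bochner_Integration.integral_cong refl) (auto simp: trig_def complex_eq_iff algebra_simps)
        also have "\<dots> = TM.ip h (\<lambda>x. of_real (trig k z x)) - \<i> * TM.ip h (\<lambda>x. of_real (trig k (z * - \<i>) x))"
          unfolding TM.ip_def using TM.sqi_prod[OF that sqi_smooth[OF smooth_periodic_trig]]
          by (subst Bochner_Integration.integral_diff) auto
        finally show ?thesis .
      qed
      have split: "TM.cf h k = TM.ip h (\<lambda>x. of_real (trig k 1 x)) - \<i> * TM.ip h (\<lambda>x. of_real (trig k (- \<i>) x))" if "TM.sqi h" for h
        using split'[OF that, of 1] by simp
      have "TM.ip (\<lambda>x. g x $ i) (\<lambda>x. of_real (trig k z x)) = s * TM.ip (\<lambda>x. f x $ i) (\<lambda>x. of_real (trig k (deriv_symbol \<alpha> k * z) x))" for z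
        using w[unfolded weak] smooth_periodic_trig by (simp add: mixed_partial_trig)
      then have "TM.cf (\<lambda>x. g x $ i) k = s * (cnj (deriv_symbol \<alpha> k) * TM.cf (\<lambda>x. f x $ i) k)"
        unfolding split[OF periodic_L2D[OF g]] split'[OF periodic_L2D[OF f]] by (simp add: algebra_simps)
      also have "\<dots> = (s * s) * deriv_symbol \<alpha> k * TM.cf (\<lambda>x. f x $ i) k"
        by (simp add: cnj_deriv_symbol s_def)
      finally show "fourier_coeff g k $ i = (deriv_symbol \<alpha> k *s fourier_coeff f k) $ i"
        by (simp add: s2 fourier_coeff_nth f g)
    qed
  next
    assume c: "\<forall>k. fourier_coeff g k = deriv_symbol \<alpha> k *s fourier_coeff f k"
    show "is_weak_deriv \<alpha> f g"
      unfolding weak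
    proof (intro allI impI)
      fix \<phi> i assume \<phi>: "smooth_periodic \<phi>"
      have "TM.cf (\<lambda>x. g x $ i) k = deriv_symbol \<alpha> k * TM.cf (\<lambda>x. f x $ i) k" for k
        using c[rule_format, of k] by (simp add: vec_eq_iff fourier_coeff_nth f g)
      then have h1: "((\<lambda>k. deriv_symbol \<alpha> k * TM.cf (\<lambda>x. f x $ i) k * cnj (TM.cf (\<lambda>x. of_real (\<phi> x)) k)) has_sum TM.ip (\<lambda>x. g x $ i) (\<lambda>x. of_real (\<phi> x))) UNIV"
        using TM.Parseval[OF periodic_L2D[OF g, of i] sqi_smooth[OF \<phi>]] by simp
      have h2: "((\<lambda>k. s * (TM.cf (\<lambda>x. f x $ i) k * cnj (deriv_symbol \<alpha> k * TM.cf (\<lambda>x. of_real (\<phi> x)) k))) has_sum s * TM.ip (\<lambda>x. f x $ i) (\<lambda>x. of_real (mixed_partial \<alpha> \<phi> x))) UNIV"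
        using has_sum_cmult_right[OF TM.Parseval[OF periodic_L2D[OF f, of i] sqi_smooth[OF cf_mixed_partial(1)[OF \<phi>]]], of s]
        by (simp only: cf_mixed_partial(2)[OF \<phi>])
      have eq: "(\<lambda>k. s * (TM.cf (\<lambda>x. f x $ i) k * cnj (deriv_symbol \<alpha> k * TM.cf (\<lambda>x. of_real (\<phi> x)) k)))
          = (\<lambda>k. deriv_symbol \<alpha> k * TM.cf (\<lambda>x. f x $ i) k * cnj (TM.cf (\<lambda>x. of_real (\<phi> x)) k))"
      proof
        fix k
        have "s * (x * cnj (deriv_symbol \<alpha> k * y)) = (s * s) * (deriv_symbol \<alpha> k * x * cnj y)" for x y
          by (simp add: cnj_deriv_symbol s_def mult_ac)
        then show "s * (TM.cf (\<lambda>x. f x $ i) k * cnj (deriv_symbol \<alpha> k * TM.cf (\<lambda>x. of_real (\<phi> x)) k))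
          = deriv_symbol \<alpha> k * TM.cf (\<lambda>x. f x $ i) k * cnj (TM.cf (\<lambda>x. of_real (\<phi> x)) k)"
          by (simp only: s2 mult_1)
      qed
      show "TM.ip (\<lambda>x. g x $ i) (\<lambda>x. of_real (\<phi> x)) = s * TM.ip (\<lambda>x. f x $ i) (\<lambda>x. of_real (mixed_partial \<alpha> \<phi> x))"
        by (rule has_sum_unique[OF h1 h2[unfolded eq]])
    qed
  qed
  with g show ?thesis by simp
qed (auto simp: is_weak_deriv_def)

abbreviation top_symbol :: "nat \<Rightarrow> int ^ 3 \<Rightarrow> complex" where
  "top_symbol m \<equiv> deriv_symbol (\<chi> i. m + 1)"

text \<open>The functions whose weak derivative of order \<open>m + 1\<close> in each variable lies in \<open>L\<^sup>2\<close>.\<close>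

definition hb_regular :: "nat \<Rightarrow> (real ^ 3 \<Rightarrow> complex ^ 3) \<Rightarrow> bool" where
  "hb_regular m U \<longleftrightarrow> periodic_L2 U \<and> square_summable (\<lambda>k. top_symbol m k *s fourier_coeff U k)"

text \<open>The weak derivative is selected only up to a null set, but its Fourier coefficients are determined.\<close>

lemma hb_seminorm_sq:
  assumes "hb_regular m U"
  shows "(hb_seminorm m U)\<^sup>2 = (2 * pi) ^ 3 * (\<Sum>\<^sub>\<infinity>k. (norm (top_symbol m k *s fourier_coeff U k))\<^sup>2)"
proof -
  have U: "periodic_L2 U" and ss: "square_summable (\<lambda>k. top_symbol m k *s fourier_coeff U k)"
    using assms by (auto simp: hb_regular_def)
  have "\<exists>g. is_weak_deriv (\<chi> i. m + 1) U g"
    using Riesz_Fischer_vec[OF ss] by (simp add: is_weak_deriv_iff[OF U])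
  then have "is_weak_deriv (\<chi> i. m + 1) U (weak_deriv (\<chi> i. m + 1) U)"
    unfolding weak_deriv_def by (rule someI_ex)
  then have w: "periodic_L2 (weak_deriv (\<chi> i. m + 1) U)"
    "\<And>k. fourier_coeff (weak_deriv (\<chi> i. m + 1) U) k = top_symbol m k *s fourier_coeff U k"
    by (auto simp: is_weak_deriv_iff[OF U])
  have "Re (hb_inner m U U) = (2 * pi) ^ 3 * (\<Sum>\<^sub>\<infinity>k. (norm (top_symbol m k *s fourier_coeff U k))\<^sup>2)"
    unfolding hb_inner_def Parseval_norm_vec[OF w(1)] w(2) ..
  moreover have "\<dots> \<ge> 0" by (intro mult_nonneg_nonneg infsum_nonneg) auto
  ultimately show ?thesis unfolding hb_seminorm_def by simp
qed

section \<open>One-dimensional Hermite splines\<close>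

subsection \<open>Two-point Hermite interpolation\<close>

abbreviation pd :: "nat \<Rightarrow> real poly \<Rightarrow> real poly" where "pd t p \<equiv> (pderiv ^^ t) p"

lemma higher_pderiv_linear_power_mult:
  fixes r :: "real poly"
  shows "t \<le> n \<Longrightarrow> poly (pd t ([:- a, 1:] ^ n * r)) a = (if t = n then fact n * poly r a else 0)"
proof (induction t arbitrary: n r)
  case 0 then show ?case by (cases n) auto
next
  case (Suc t)
  then obtain n' where n: "n = Suc n'" by (cases n) auto
  have X: "pderiv ([:- a, 1:] ^ Suc n') = smult (of_nat (Suc n')) ([:- a, 1:] ^ n')"
    by (simp only: pderiv_power_Suc) (simp add: pderiv_pCons)
  have "pderiv ([:- a, 1:] ^ n * r) = [:- a, 1:] ^ n' * (smult (of_nat (Suc n')) r + [:- a, 1:] * pderiv r)"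
    unfolding n pderiv_mult X by (simp add: algebra_simps)
  then have "pd (Suc t) ([:- a, 1:] ^ n * r) = pd t ([:- a, 1:] ^ n' * (smult (of_nat (Suc n')) r + [:- a, 1:] * pderiv r))"
    by (simp only: funpow_Suc_right o_apply)
  moreover have "poly (smult (of_nat (Suc n')) r + [:- a, 1:] * pderiv r) a = of_nat (Suc n') * poly r a" by simp
  ultimately show ?case using Suc.IH[of n' "smult (of_nat (Suc n')) r + [:- a, 1:] * pderiv r"] Suc.prems
    by (simp only: n) (simp add: algebra_simps)
qed

text \<open>
  Prescribe the derivatives at \<open>a\<close> one after the other: a multiple of \<open>(x - a)\<^sup>n (x - b)\<^sup>m\<^sup>+\<^sup>1\<close> corrects the derivative of order \<open>n\<close> at \<open>a\<close>
  and changes no earlier condition.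
\<close>

lemma hermite_half_exists:
  fixes a b :: real
  assumes "a \<noteq> b"
  shows "\<exists>p. degree p \<le> 2 * m + 1 \<and> (\<forall>t\<le>m. poly (pd t p) a = d t \<and> poly (pd t p) b = 0)"
proof -
  have "\<exists>p. degree p \<le> 2 * m + 1 \<and> (\<forall>t<n. poly (pd t p) a = d t) \<and> (\<forall>t\<le>m. poly (pd t p) b = 0)" if "n \<le> Suc m" for n
    using that
  proof (induction n)
    case 0 then show ?case by (intro exI[of _ 0]) auto
  next
    case (Suc n)
    then obtain p where p: "degree p \<le> 2 * m + 1" "\<And>t. t < n \<Longrightarrow> poly (pd t p) a = d t" "\<And>t. t \<le> m \<Longrightarrow> poly (pd t p) b = 0"
      by auto
    define q where "q = [:- a, 1:] ^ n * [:- b, 1:] ^ Suc m"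
    define c where "c = (d n - poly (pd n p) a) / (fact n * (a - b) ^ Suc m)"
    have "degree q \<le> n + Suc m" unfolding q_def
      by (rule order_trans[OF degree_mult_le]) (simp add: degree_linear_power del: power_Suc)
    then have dq: "degree q \<le> 2 * m + 1" using Suc.prems by simp
    have qa: "t \<le> n \<Longrightarrow> poly (pd t q) a = (if t = n then fact n * (a - b) ^ Suc m else 0)" for t
      unfolding q_def by (subst higher_pderiv_linear_power_mult) (auto simp: poly_power simp del: power_Suc)
    have qb: "t \<le> m \<Longrightarrow> poly (pd t q) b = 0" for t
      unfolding q_def by (subst mult.commute, subst higher_pderiv_linear_power_mult) auto
    show ?case
    proof (intro exI[of _ "p + smult c q"] conjI allI impI)
      show "degree (p + smult c q) \<le> 2 * m + 1"
        using p(1) dq by (intro degree_add_le) (auto intro: order_trans[OF degree_smult_le])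
      show "poly (pd t (p + smult c q)) a = d t" if "t < Suc n" for t
        using that p(2)[of t] qa[of t] assms
        by (cases "t = n") (auto simp: higher_pderiv_add higher_pderiv_smult c_def)
      show "poly (pd t (p + smult c q)) b = 0" if "t \<le> m" for t
        using p(3)[OF that] qb[OF that] by (simp add: higher_pderiv_add higher_pderiv_smult)
    qed
  qed
  from this[of "Suc m"] show ?thesis by (auto simp: less_Suc_eq_le)
qed

lemma linear_power_dvd:
  fixes p :: "real poly"
  assumes "\<And>t. t < n \<Longrightarrow> poly (pd t p) a = 0"
  shows "[:- a, 1:] ^ n dvd p"
  using assms
proof (induction n)
  case (Suc n)
  then obtain r where r: "p = [:- a, 1:] ^ n * r" by (auto simp: dvd_def)
  have "poly (pd n p) a = fact n * poly r a" unfolding r by (subst higher_pderiv_linear_power_mult) auto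
  then have "poly r a = 0" using Suc.prems[of n] by simp
  then have "[:- a, 1:] dvd r" by (simp only: poly_eq_0_iff_dvd)
  then show ?case unfolding r power_Suc2 by (intro mult_dvd_mono dvd_refl)
qed auto

text \<open>Both nodes are zeros of order \<open>m + 1\<close>, which is too many for the degree.\<close>

lemma hermite_unique:
  fixes p :: "real poly"
  assumes "a \<noteq> b" "degree p \<le> 2 * m + 1"
    and 0: "\<And>t. t \<le> m \<Longrightarrow> poly (pd t p) a = 0" "\<And>t. t \<le> m \<Longrightarrow> poly (pd t p) b = 0"
  shows "p = 0"
proof (rule ccontr)
  assume p: "p \<noteq> 0"
  obtain r where r: "p = [:- a, 1:] ^ Suc m * r"
    using linear_power_dvd[of "Suc m" p a] 0 by (auto simp: dvd_def less_Suc_eq_le)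
  have "order b ([:- a, 1:] ^ Suc m) = 0" using assms(1) by (intro order_0I) (auto simp: poly_power)
  moreover have "Suc m \<le> order b p"
    using linear_power_dvd[of "Suc m" p b] 0 p by (auto simp: order_divides less_Suc_eq_le simp del: power_Suc)
  ultimately have "Suc m \<le> order b r" using p unfolding r by (subst (asm) order_mult) auto
  moreover have "r \<noteq> 0" using p r by auto
  ultimately have "Suc m \<le> degree r" using order_degree[of r b] by simp
  moreover have "degree p = Suc m + degree r"
    unfolding r using \<open>r \<noteq> 0\<close> by (subst degree_mult_eq) (auto simp: degree_linear_power simp del: power_Suc)
  ultimately show False using assms(2) by simp
qed

text \<open>The basis polynomial of the unit interval for the derivative of order \<open>s\<close> at the endpoint \<open>\<beta>\<close>.\<close>

definition herm :: "nat \<Rightarrow> int \<Rightarrow> nat \<Rightarrow> real poly" where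
  "herm m \<beta> s = (SOME p. degree p \<le> 2 * m + 1 \<and> (\<forall>t\<le>m.
     poly (pd t p) 0 = of_bool (\<beta> = 0 \<and> t = s) \<and> poly (pd t p) 1 = of_bool (\<beta> = 1 \<and> t = s)))"

lemma herm:
  assumes "\<beta> \<in> {0, 1}"
  shows "degree (herm m \<beta> s) \<le> 2 * m + 1"
    and "t \<le> m \<Longrightarrow> \<beta>' \<in> {0, 1} \<Longrightarrow> poly (pd t (herm m \<beta> s)) (of_int \<beta>') = of_bool (\<beta>' = \<beta> \<and> t = s)"
proof -
  have "\<exists>p. degree p \<le> 2 * m + 1 \<and> (\<forall>t\<le>m.
     poly (pd t p) 0 = of_bool (\<beta> = 0 \<and> t = s) \<and> poly (pd t p) 1 = of_bool (\<beta> = 1 \<and> t = s))"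
    using assms hermite_half_exists[of 0 1 m "\<lambda>t. of_bool (t = s)"]
      hermite_half_exists[of 1 0 m "\<lambda>t. of_bool (t = s)"] by auto
  from someI_ex[OF this] show "degree (herm m \<beta> s) \<le> 2 * m + 1"
    and "t \<le> m \<Longrightarrow> \<beta>' \<in> {0, 1} \<Longrightarrow> poly (pd t (herm m \<beta> s)) (of_int \<beta>') = of_bool (\<beta>' = \<beta> \<and> t = s)"
    unfolding herm_def [symmetric] by auto
qed

lemma hermite_expansion:
  fixes p :: "real poly"
  assumes "degree p \<le> 2 * m + 1"
  shows "p = (\<Sum>\<beta>\<in>{0, 1}. \<Sum>s\<le>m. smult (poly (pd s p) (of_int \<beta>)) (herm m \<beta> s))" (is "p = ?q")
proof -
  have "p - ?q = 0"
  proof (rule hermite_unique[of 0 1 _ m])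
    show "degree (p - ?q) \<le> 2 * m + 1"
      using assms herm(1) by (intro degree_diff_le degree_sum_le) (auto intro: order_trans[OF degree_smult_le])
    have "poly (pd t (p - ?q)) (of_int \<beta>') = 0" if "t \<le> m" "\<beta>' \<in> {0, 1}" for t \<beta>'
    proof -
      have "poly (pd t ?q) (of_int \<beta>') = (\<Sum>\<beta>\<in>{0, 1}. \<Sum>s\<le>m. poly (pd s p) (of_int \<beta>) * of_bool (\<beta>' = \<beta> \<and> t = s))"
        using that by (simp only: higher_pderiv_sum poly_sum higher_pderiv_smult poly_smult)
          (intro sum.cong refl arg_cong2[where f = "(*)"] herm(2), auto)
      also have "\<dots> = (\<Sum>\<beta>\<in>{0, 1}. if \<beta>' = \<beta> then poly (pd t p) (of_int \<beta>) else 0)"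
        using that by (intro sum.cong refl) (auto simp: of_bool_def if_distrib cong: if_cong)
      also have "\<dots> = poly (pd t p) (of_int \<beta>')" using that by auto
      finally show ?thesis
        using higher_pderiv_add[of t "p - ?q" ?q] by simp
    qed
    from this[of _ 0] this[of _ 1] show "t \<le> m \<Longrightarrow> poly (pd t (p - ?q)) 0 = 0" "t \<le> m \<Longrightarrow> poly (pd t (p - ?q)) 1 = 0" for t
      by simp_all
  qed simp
  then show ?thesis by simp
qed

subsection \<open>Integration by parts\<close>

lemma continuous_on_if_vector_derivative:
  assumes "\<And>y. y \<in> S \<Longrightarrow> (f has_vector_derivative f' y) (at y within S)"
  shows "continuous_on S f"
  using assms has_vector_derivative_continuous unfolding continuous_on_eq_continuous_within by blast

text \<open>Here \<open>f j\<close> and \<open>g j\<close> stand for the derivatives of order \<open>j\<close>.\<close>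

lemma iterated_parts:
  fixes f g :: "nat \<Rightarrow> real \<Rightarrow> complex"
  assumes f: "\<And>j y. j \<le> m \<Longrightarrow> y \<in> {0..1} \<Longrightarrow> (f j has_vector_derivative f (Suc j) y) (at y within {0..1})"
    and g: "\<And>j y. j \<le> m \<Longrightarrow> y \<in> {0..1} \<Longrightarrow> (g j has_vector_derivative g (Suc j) y) (at y within {0..1})"
    and cf: "continuous_on {0..1} (f (Suc m))" and cg: "continuous_on {0..1} (g (Suc m))"
  shows "integral {0..1} (\<lambda>y. f 0 y * g (Suc m) y) =
    (\<Sum>j\<le>m. (-1) ^ j * (f j 1 * g (m - j) 1 - f j 0 * g (m - j) 0)) + (-1) ^ Suc m * integral {0..1} (\<lambda>y. f (Suc m) y * g 0 y)"
proof -
  define S where "S y = (\<Sum>j\<le>m. (-1) ^ j * (f j y * g (m - j) y))" for y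
  have S': "(S has_vector_derivative f 0 y * g (Suc m) y - (-1) ^ Suc m * (f (Suc m) y * g 0 y)) (at y within {0..1})"
    if y: "y \<in> {0..1}" for y
  proof -
    have "(S has_vector_derivative (\<Sum>j\<le>m. (-1) ^ j * (f j y * g (Suc (m - j)) y + f (Suc j) y * g (m - j) y))) (at y within {0..1})"
      unfolding S_def
      by (intro has_vector_derivative_sum has_vector_derivative_mult_right has_vector_derivative_mult f g) (use y in auto)
    also have "(\<Sum>j\<le>m. (-1) ^ j * (f j y * g (Suc (m - j)) y + f (Suc j) y * g (m - j) y))
        = (\<Sum>j\<le>m. (-1) ^ j * (f j y * g (Suc m - j) y) - (-1) ^ Suc j * (f (Suc j) y * g (Suc m - Suc j) y))"
      by (intro sum.cong refl) (auto simp: Suc_diff_le algebra_simps)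
    also have "\<dots> = f 0 y * g (Suc m) y - (-1) ^ Suc m * (f (Suc m) y * g 0 y)"
      by (subst sum_telescope) simp
    finally show ?thesis .
  qed
  have contf: "continuous_on {0..1} (f j)" if "j \<le> Suc m" for j
    using that cf continuous_on_if_vector_derivative[of _ "f j" "f (Suc j)", OF f] by (cases "j = Suc m") auto
  have contg: "continuous_on {0..1} (g j)" if "j \<le> Suc m" for j
    using that cg continuous_on_if_vector_derivative[of _ "g j" "g (Suc j)", OF g] by (cases "j = Suc m") auto
  have "((\<lambda>y. f 0 y * g (Suc m) y - (-1) ^ Suc m * (f (Suc m) y * g 0 y)) has_integral S 1 - S 0) {0..1}"
    by (rule fundamental_theorem_of_calculus) (use S' in auto)
  then have "integral {0..1} (\<lambda>y. f 0 y * g (Suc m) y - (-1) ^ Suc m * (f (Suc m) y * g 0 y)) = S 1 - S 0"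
    by (rule integral_unique)
  moreover have "integral {0..1} (\<lambda>y. f 0 y * g (Suc m) y - (-1) ^ Suc m * (f (Suc m) y * g 0 y))
      = integral {0..1} (\<lambda>y. f 0 y * g (Suc m) y) - (-1) ^ Suc m * integral {0..1} (\<lambda>y. f (Suc m) y * g 0 y)"
    by (subst Henstock_Kurzweil_Integration.integral_diff)
       (auto intro!: integrable_continuous_real continuous_intros contf contg)
  moreover have "S 1 - S 0 = (\<Sum>j\<le>m. (-1) ^ j * (f j 1 * g (m - j) 1 - f j 0 * g (m - j) 0))"
    by (simp add: S_def sum_subtractf right_diff_distrib)
  ultimately show ?thesis by (simp add: algebra_simps)
qed

subsection \<open>Periodic piecewise polynomials on a uniform grid\<close>

text \<open>Coordinates: \<open>t = o' + h (\<kappa> + y)\<close> with the cell index \<open>\<kappa>\<close> and the local coordinate \<open>0 \<le> y < 1\<close>.\<close>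

definition step :: "nat \<Rightarrow> real" where "step N = 2 * pi / real N"

lemma step_pos: "N \<ge> 1 \<Longrightarrow> step N > 0" by (simp add: step_def)
lemma step_N: "N \<ge> 1 \<Longrightarrow> step N * real N = 2 * pi" by (simp add: step_def)

text \<open>
  Vertex \<open>l\<close> is the endpoint \<open>\<beta>\<close> of the cells \<open>\<kappa>\<close> with \<open>\<kappa> + \<beta> \<equiv> l\<close> modulo \<open>N\<close>; the function is \<open>P \<beta>\<close> there and zero on all other cells.
  For \<open>N = 1\<close> both endpoints of the only cell belong to the same vertex, hence the sum.
\<close>

definition piecewise :: "nat \<Rightarrow> real \<Rightarrow> (int \<Rightarrow> real poly) \<Rightarrow> int \<Rightarrow> real \<Rightarrow> real" where
  "piecewise N o' P l t = (\<Sum>\<beta>\<in>{0, 1}. of_bool ((\<lfloor>(t - o') / step N\<rfloor> + \<beta> - l) mod int N = 0) *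
     poly (P \<beta>) (frac ((t - o') / step N)))"

definition piece :: "nat \<Rightarrow> (int \<Rightarrow> real poly) \<Rightarrow> int \<Rightarrow> int \<Rightarrow> real poly" where
  "piece N P l \<kappa> = (\<Sum>\<beta>\<in>{0, 1}. smult (of_bool ((\<kappa> + \<beta> - l) mod int N = 0)) (P \<beta>))"

lemma piecewise_cell:
  assumes "N \<ge> 1" "0 \<le> y" "y < 1"
  shows "piecewise N o' P l (o' + step N * (of_int \<kappa> + y)) = poly (piece N P l \<kappa>) y"
proof -
  have u: "(o' + step N * (of_int \<kappa> + y) - o') / step N = of_int \<kappa> + y"
    using step_pos[OF assms(1)] by simp
  have "\<lfloor>of_int \<kappa> + y\<rfloor> = \<kappa>" "frac (of_int \<kappa> + y) = y"
    using assms by (auto simp: floor_unique frac_unique_iff)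
  then show ?thesis unfolding piecewise_def piece_def u by (simp add: poly_sum)
qed

lemma piecewise_measurable [measurable]: "piecewise N o' P l \<in> borel_measurable borel"
proof -
  have [measurable]: "poly p \<in> borel_measurable borel" for p :: "real poly"
    by (intro borel_measurable_continuous_onI continuous_intros)
  show ?thesis unfolding piecewise_def[abs_def] frac_def by measurable
qed

lemma piecewise_periodic:
  assumes "N \<ge> 1" shows "piecewise N o' P l (t + 2 * pi) = piecewise N o' P l t"
proof -
  define u where "u = (t - o') / step N"
  have u: "(t + 2 * pi - o') / step N = u + real N"
    using step_N[OF assms] step_pos[OF assms] by (simp add: u_def field_simps)
  have "\<lfloor>u + real N\<rfloor> = \<lfloor>u\<rfloor> + int N" using floor_add_int[of u "int N"] by simp
  moreover from this have "frac (u + real N) = frac u" by (simp add: frac_def)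
  moreover have "(x + int N + \<beta> - l) mod int N = (x + \<beta> - l) mod int N" for x \<beta>
  proof -
    have "x + int N + \<beta> - l = (x + \<beta> - l) + int N" by simp
    then show ?thesis by (simp only: mod_add_self2)
  qed
  ultimately show ?thesis unfolding piecewise_def u unfolding u_def [symmetric] by simp
qed

lemma piecewise_bounded: "\<exists>B. \<forall>t. \<bar>piecewise N o' P l t\<bar> \<le> B"
proof -
  have "\<exists>B. \<forall>y\<in>{0..1}. \<bar>poly p y\<bar> \<le> B" for p :: "real poly"
  proof -
    have "compact (poly p ` {0..1})" by (intro compact_continuous_image continuous_intros) auto
    from compact_imp_bounded[OF this] show ?thesis by (auto simp: bounded_iff)
  qed
  then have "\<forall>p :: real poly. \<exists>B. \<forall>y\<in>{0..1}. \<bar>poly p y\<bar> \<le> B" by blast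
  from choice[OF this] obtain B where "\<forall>p :: real poly. \<forall>y\<in>{0..1}. \<bar>poly p y\<bar> \<le> B p" by blast
  then have B: "\<And>p y. y \<in> {0..1} \<Longrightarrow> \<bar>poly p y\<bar> \<le> B p" by blast
  have "\<bar>piecewise N o' P l t\<bar> \<le> (\<Sum>\<beta>\<in>{0, 1}. B (P \<beta>))" for t
    unfolding piecewise_def
  proof (intro order_trans[OF sum_abs] sum_mono)
    fix \<beta>
    have "\<bar>poly (P \<beta>) (frac ((t - o') / step N))\<bar> \<le> B (P \<beta>)"
      using frac_ge_0[of "(t - o') / step N"] frac_lt_1[of "(t - o') / step N"] by (intro B) auto
    then show "\<bar>of_bool ((\<lfloor>(t - o') / step N\<rfloor> + \<beta> - l) mod int N = 0) * poly (P \<beta>) (frac ((t - o') / step N))\<bar> \<le> B (P \<beta>)"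
      by (cases "(\<lfloor>(t - o') / step N\<rfloor> + \<beta> - l) mod int N = 0") auto
  qed
  then show ?thesis by blast
qed

lemma piece_pderiv: "pd t (piece N P l \<kappa>) = piece N (\<lambda>\<beta>. pd t (P \<beta>)) l \<kappa>"
  unfolding piece_def by (simp only: higher_pderiv_sum higher_pderiv_smult)

lemma piece_herm:
  assumes "t \<le> m" "\<beta>' \<in> {0, 1}"
  shows "poly (pd t (piece N (\<lambda>\<beta>. herm m \<beta> s) l \<kappa>)) (of_int \<beta>') = of_bool ((\<kappa> + \<beta>' - l) mod int N = 0 \<and> t = s)"
proof -
  have "poly (pd t (piece N (\<lambda>\<beta>. herm m \<beta> s) l \<kappa>)) (of_int \<beta>')
      = (\<Sum>\<beta>\<in>{0, 1}. of_bool ((\<kappa> + \<beta> - l) mod int N = 0) * of_bool (\<beta>' = \<beta> \<and> t = s))"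
    unfolding piece_pderiv unfolding piece_def poly_sum poly_smult
    by (intro sum.cong refl arg_cong2[where f = "(*)"] herm(2)) (use assms in auto)
  then show ?thesis using assms(2) by auto
qed

lemma degree_piece_herm: "degree (piece N (\<lambda>\<beta>. herm m \<beta> s) l \<kappa>) \<le> 2 * m + 1"
  unfolding piece_def using herm(1)
  by (intro degree_sum_le) (auto intro: order_trans[OF degree_smult_le])

text \<open>The periodic spline all of whose vertex data vanish, except for the derivative of order \<open>s\<close> at vertex \<open>l\<close>, which is one.\<close>

definition Phi :: "nat \<Rightarrow> real \<Rightarrow> nat \<Rightarrow> int \<Rightarrow> nat \<Rightarrow> real \<Rightarrow> real" where
  "Phi N o' m l s t = step N ^ s * piecewise N o' (\<lambda>\<beta>. herm m \<beta> s) l t"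

text \<open>The derivative of order \<open>m + 1\<close> of \<open>Phi\<close>, which jumps at the vertices.\<close>

definition Psi :: "nat \<Rightarrow> real \<Rightarrow> nat \<Rightarrow> int \<Rightarrow> nat \<Rightarrow> real \<Rightarrow> real" where
  "Psi N o' m l s t = step N ^ s / step N ^ Suc m * piecewise N o' (\<lambda>\<beta>. pd (Suc m) (herm m \<beta> s)) l t"

lemma Phi_measurable [measurable]: "Phi N o' m l s \<in> borel_measurable borel"
  unfolding Phi_def[abs_def] by measurable
lemma Psi_measurable [measurable]: "Psi N o' m l s \<in> borel_measurable borel"
  unfolding Psi_def[abs_def] by measurable
lemma Phi_periodic: "N \<ge> 1 \<Longrightarrow> Phi N o' m l s (t + 2 * pi) = Phi N o' m l s t"
  unfolding Phi_def by (simp add: piecewise_periodic)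
lemma Psi_periodic: "N \<ge> 1 \<Longrightarrow> Psi N o' m l s (t + 2 * pi) = Psi N o' m l s t"
  unfolding Psi_def by (simp add: piecewise_periodic)

lemma Phi_bounded: "\<exists>B. \<forall>t. \<bar>Phi N o' m l s t\<bar> \<le> B"
  using piecewise_bounded[of N o' "\<lambda>\<beta>. herm m \<beta> s" l] unfolding Phi_def abs_mult
  by (meson abs_ge_zero mult_left_mono)
lemma Psi_bounded: "\<exists>B. \<forall>t. \<bar>Psi N o' m l s t\<bar> \<le> B"
  using piecewise_bounded[of N o' "\<lambda>\<beta>. pd (Suc m) (herm m \<beta> s)" l] unfolding Psi_def abs_mult
  by (meson abs_ge_zero mult_left_mono)

lemma higher_pderiv_0_if_degree:
  fixes p :: "real poly" assumes "degree p < n" shows "pd n p = 0"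
proof (rule poly_eqI)
  fix i show "coeff (pd n p) i = coeff 0 i"
    using assms by (simp add: coeff_higher_pderiv coeff_eq_0)
qed

text \<open>By periodicity the mean may be taken over the period that starts at the vertex \<open>o'\<close>, and that period is a union of cells.\<close>

lemma mean1_cells:
  fixes F :: "real \<Rightarrow> complex"
  assumes N: "N \<ge> 1" and [measurable]: "F \<in> borel_measurable borel" and B: "\<And>x. cmod (F x) \<le> B"
    and per: "\<And>t. F (t + 2 * pi) = F t"
    and G: "\<And>\<kappa>. \<kappa> < N \<Longrightarrow> continuous_on {0..1} (G \<kappa>)"
    and FG: "\<And>\<kappa> y. \<kappa> < N \<Longrightarrow> 0 \<le> y \<Longrightarrow> y < 1 \<Longrightarrow> F (o' + step N * (real \<kappa> + y)) = G \<kappa> y"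
  shows "mean1 F = (\<Sum>\<kappa><N. integral {0..1} (G \<kappa>)) / of_nat N"
proof -
  define h where "h = step N"
  have h: "h > 0" "h * real N = 2 * pi" using step_pos[OF N] step_N[OF N] by (auto simp: h_def)
  define F' where "F' t = F (o' + t)" for t
  have [measurable]: "F' \<in> borel_measurable borel" unfolding F'_def by measurable
  have intF: "integrable lborel (\<lambda>t. indicator {a..<b} t *\<^sub>R F' t)" for a b
  proof -
    have "integrable lborel (\<lambda>t. indicator {a..b} t *\<^sub>R F' t)"
      using set_integrable_bounded_interval[of F' B a b] B by (simp add: F'_def set_integrable_def)
    then show ?thesis
      by (rule Bochner_Integration.integrable_bound) (auto simp: indicator_def)
  qed
  have cell: "(\<integral>t. indicator {h * real \<kappa>..<h * real (Suc \<kappa>)} t *\<^sub>R F' t \<partial>lborel) = of_real h * integral {0..1} (G \<kappa>)"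
    if \<kappa>: "\<kappa> < N" for \<kappa>
  proof -
    have "(\<integral>t. indicator {h * real \<kappa>..<h * real (Suc \<kappa>)} t *\<^sub>R F' t \<partial>lborel)
        = \<bar>h\<bar> *\<^sub>R (\<integral>y. indicator {h * real \<kappa>..<h * real (Suc \<kappa>)} (h * real \<kappa> + h * y) *\<^sub>R F' (h * real \<kappa> + h * y) \<partial>lborel)"
      by (rule lborel_integral_real_affine) (use h in auto)
    also have "(\<integral>y. indicator {h * real \<kappa>..<h * real (Suc \<kappa>)} (h * real \<kappa> + h * y) *\<^sub>R F' (h * real \<kappa> + h * y) \<partial>lborel)
        = (\<integral>y. indicator {0..<1} y *\<^sub>R F' (h * real \<kappa> + h * y) \<partial>lborel)"
    proof (intro Bochner_Integration.integral_cong refl arg_cong2[where f = scaleR])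
      fix y
      have "h * real \<kappa> \<le> h * real \<kappa> + h * y \<longleftrightarrow> 0 \<le> y" "h * real \<kappa> + h * y < h * real (Suc \<kappa>) \<longleftrightarrow> y < 1"
        using h by (auto simp: algebra_simps zero_le_mult_iff)
      then show "indicator {h * real \<kappa>..<h * real (Suc \<kappa>)} (h * real \<kappa> + h * y) = (indicator {0..<1} y :: real)"
        by (simp add: indicator_def)
    qed
    also have "\<dots> = (\<integral>y. indicator {0..1} y *\<^sub>R G \<kappa> y \<partial>lborel)"
    proof (rule integral_cong_AE)
      show "AE y in lborel. indicator {0..<1} y *\<^sub>R F' (h * real \<kappa> + h * y) = indicator {0..1} y *\<^sub>R G \<kappa> y"
        using AE_lborel_singleton[of "1 :: real"]
      proof eventually_elim
        fix y :: real assume "y \<noteq> 1"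
        then show "indicator {0..<1} y *\<^sub>R F' (h * real \<kappa> + h * y) = indicator {0..1} y *\<^sub>R G \<kappa> y"
          using FG[OF \<kappa>, of y] by (auto simp: indicator_def F'_def h_def distrib_left)
      qed
      show "(\<lambda>y. indicator {0..1} y *\<^sub>R G \<kappa> y) \<in> borel_measurable lborel"
        using borel_measurable_continuous_on_indicator[of "{0..1}" "G \<kappa>"] G[OF \<kappa>] by simp
    qed measurable
    also have "\<dots> = integral {0..1} (G \<kappa>)"
      using set_borel_integral_eq_integral(2)[of "{0..1}" "G \<kappa>"] borel_integrable_compact[of "{0..1}" "G \<kappa>"] G[OF \<kappa>]
      by (simp add: set_lebesgue_integral_def set_integrable_def)
    finally show ?thesis using h by (simp add: scaleR_conv_of_real)
  qed
  have "(\<integral>t. indicator {0..<h * real n} t *\<^sub>R F' t \<partial>lborel) = (\<Sum>\<kappa><n. \<integral>t. indicator {h * real \<kappa>..<h * real (Suc \<kappa>)} t *\<^sub>R F' t \<partial>lborel)" for n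
  proof (induction n)
    case (Suc n)
    have "(\<integral>t. indicator {0..<h * real (Suc n)} t *\<^sub>R F' t \<partial>lborel)
        = (\<integral>t. indicator {0..<h * real n} t *\<^sub>R F' t + indicator {h * real n..<h * real (Suc n)} t *\<^sub>R F' t \<partial>lborel)"
    proof (intro Bochner_Integration.integral_cong refl)
      fix t
      have "0 \<le> h * real n" "h * real n \<le> h * real (Suc n)" using h by auto
      then show "indicator {0..<h * real (Suc n)} t *\<^sub>R F' t = indicator {0..<h * real n} t *\<^sub>R F' t + indicator {h * real n..<h * real (Suc n)} t *\<^sub>R F' t"
        by (auto simp: indicator_def)
    qed
    also have "\<dots> = (\<integral>t. indicator {0..<h * real n} t *\<^sub>R F' t \<partial>lborel) + (\<integral>t. indicator {h * real n..<h * real (Suc n)} t *\<^sub>R F' t \<partial>lborel)"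
      by (rule Bochner_Integration.integral_add[OF intF intF])
    finally show ?case using Suc by simp
  qed simp
  from this[of N] have "(\<integral>t. indicator {0..<2 * pi} t *\<^sub>R F' t \<partial>lborel) = of_real h * (\<Sum>\<kappa><N. integral {0..1} (G \<kappa>))"
    unfolding h(2) by (simp add: cell sum_distrib_left del: of_nat_Suc)
  moreover have "(\<integral>t. indicator {0..<2 * pi} t *\<^sub>R F' t \<partial>lborel) = (LINT t:{0..2 * pi}|lborel. F' t)"
    unfolding set_lebesgue_integral_def
  proof (rule integral_cong_AE)
    show "AE t in lborel. indicator {0..<2 * pi} t *\<^sub>R F' t = indicator {0..2 * pi} t *\<^sub>R F' t"
      using AE_lborel_singleton[of "2 * pi"] by eventually_elim (auto simp: indicator_def)
  qed measurable
  ultimately have "mean1 F' = (1 / (2 * pi)) *\<^sub>R (of_real h * (\<Sum>\<kappa><N. integral {0..1} (G \<kappa>)))"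
    by (simp add: mean1_def)
  moreover have "mean1 F' = mean1 F"
    using mean1_shift[of F B o', OF _ B per] by (simp add: F'_def[abs_def] add.commute)
  moreover have "1 / (2 * pi) * h = 1 / real N" using h N by (simp add: field_simps)
  ultimately show ?thesis by (simp add: scaleR_conv_of_real mult.assoc [symmetric] flip: of_real_mult) (simp add: field_simps)
qed

lemma poly_has_vector_derivative:
  fixes p :: "real poly"
  shows "((\<lambda>y. complex_of_real (poly (pd j p) y)) has_vector_derivative of_real (poly (pd (Suc j) p) y)) (at y within S)"
proof -
  have "((\<lambda>y. poly (pd j p) y) has_vector_derivative poly (pd (Suc j) p) y) (at y within S)"
    unfolding has_real_derivative_iff_has_vector_derivative [symmetric]
    by (rule has_field_derivative_at_within) (simp add: poly_DERIV)
  then show ?thesis by (rule bounded_linear.has_vector_derivative[OF bounded_linear_of_real])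
qed

abbreviation hpiece :: "nat \<Rightarrow> nat \<Rightarrow> int \<Rightarrow> nat \<Rightarrow> int \<Rightarrow> real poly" where
  "hpiece N m l s \<equiv> piece N (\<lambda>\<beta>. herm m \<beta> s) l"

lemma Phi_cell: "N \<ge> 1 \<Longrightarrow> 0 \<le> y \<Longrightarrow> y < 1 \<Longrightarrow>
    Phi N o' m l s (o' + step N * (of_int \<kappa> + y)) = step N ^ s * poly (hpiece N m l s \<kappa>) y"
  unfolding Phi_def by (simp add: piecewise_cell)

lemma Psi_cell: "N \<ge> 1 \<Longrightarrow> 0 \<le> y \<Longrightarrow> y < 1 \<Longrightarrow>
    Psi N o' m l s (o' + step N * (of_int \<kappa> + y)) = step N ^ s / step N ^ Suc m * poly (pd (Suc m) (hpiece N m l s \<kappa>)) y"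
  unfolding Psi_def by (simp only: piecewise_cell piece_pderiv)

text \<open>
  The coefficient of the derivative of order \<open>j\<close> of \<open>g\<close> at the endpoint \<open>\<beta>\<close> of cell \<open>\<kappa>\<close> in the mean of \<open>Psi\<close> times the derivative of
  order \<open>m + 1\<close> of \<open>g\<close>; the powers of the step come from the local coordinate.
\<close>

definition weight :: "nat \<Rightarrow> nat \<Rightarrow> int \<Rightarrow> nat \<Rightarrow> int \<Rightarrow> int \<Rightarrow> nat \<Rightarrow> real" where
  "weight N m l s \<kappa> \<beta> j = step N ^ s * step N ^ j / step N ^ (2 * Suc m) * (-1) ^ (m - j) * (if \<beta> = 1 then 1 else - 1) *
     poly (pd (Suc m + (m - j)) (hpiece N m l s \<kappa>)) (of_int \<beta>) / real N"

text \<open>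
  On a cell \<open>Psi\<close> is the derivative of order \<open>m + 1\<close> of a polynomial of degree at most \<open>2m + 1\<close>.  Hence \<open>m + 1\<close> integrations by parts leave
  only boundary terms.  In the assumptions \<open>g \<kappa> j\<close> is the derivative of order \<open>j\<close> on cell \<open>\<kappa>\<close> of a function with \<open>g \<kappa> (m + 1) = G\<close>,
  and \<open>\<gamma>\<close> holds its vertex data, on which neighbouring cells agree.
\<close>

lemma mean1_Psi:
  fixes G :: "real \<Rightarrow> complex" and g :: "nat \<Rightarrow> nat \<Rightarrow> real \<Rightarrow> complex"
  assumes N: "N \<ge> 1" and [measurable]: "G \<in> borel_measurable borel" and B: "\<And>x. cmod (G x) \<le> B"
    and per: "\<And>t. G (t + 2 * pi) = G t"
    and g: "\<And>\<kappa> j y. j \<le> m \<Longrightarrow> y \<in> {0..1} \<Longrightarrow> (g \<kappa> j has_vector_derivative of_real (step N) * g \<kappa> (Suc j) y) (at y within {0..1})"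
    and cg: "\<And>\<kappa>. continuous_on {0..1} (g \<kappa> (Suc m))"
    and G: "\<And>\<kappa> y. \<kappa> < N \<Longrightarrow> 0 \<le> y \<Longrightarrow> y < 1 \<Longrightarrow> G (o' + step N * (real \<kappa> + y)) = g \<kappa> (Suc m) y"
    and \<gamma>: "\<And>\<kappa> \<beta> j. \<kappa> < N \<Longrightarrow> \<beta> \<in> {0, 1} \<Longrightarrow> j \<le> m \<Longrightarrow> g \<kappa> j (of_int \<beta>) = \<gamma> (int \<kappa> + \<beta>) j"
  shows "mean1 (\<lambda>t. of_real (Psi N o' m l s t) * G t) =
    (\<Sum>\<kappa><N. \<Sum>\<beta>\<in>{0, 1}. \<Sum>j\<le>m. of_real (weight N m l s (int \<kappa>) \<beta> j) * \<gamma> (int \<kappa> + \<beta>) j)"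
proof -
  define h where "h = step N"
  have h: "h > 0" using step_pos[OF N] by (simp add: h_def)
  define Q where "Q \<kappa> = hpiece N m l s (int \<kappa>)" for \<kappa>
  define c where "c = h ^ s / h ^ Suc m"
  obtain B' where B': "\<And>t. \<bar>Psi N o' m l s t\<bar> \<le> B'" using Psi_bounded by blast
  have Q0: "pd (Suc (Suc m + m)) (Q \<kappa>) = 0" for \<kappa>
    using degree_piece_herm[of N m s l "int \<kappa>"] by (intro higher_pderiv_0_if_degree) (simp add: Q_def)
  define f where "f \<kappa> j y = complex_of_real (poly (pd (Suc m + j) (Q \<kappa>)) y)" for \<kappa> j y
  define g' where "g' \<kappa> j y = of_real (h ^ j) * g \<kappa> j y" for \<kappa> j y
  have cell: "integral {0..1} (\<lambda>y. f \<kappa> 0 y * g' \<kappa> (Suc m) y) =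
      (\<Sum>j\<le>m. (-1) ^ j * (f \<kappa> j 1 * g' \<kappa> (m - j) 1 - f \<kappa> j 0 * g' \<kappa> (m - j) 0))" for \<kappa>
  proof -
    have f0: "f \<kappa> (Suc m) y = 0" for y using Q0[of \<kappa>] unfolding f_def by simp
    have "integral {0..1} (\<lambda>y. f \<kappa> 0 y * g' \<kappa> (Suc m) y) =
      (\<Sum>j\<le>m. (-1) ^ j * (f \<kappa> j 1 * g' \<kappa> (m - j) 1 - f \<kappa> j 0 * g' \<kappa> (m - j) 0)) +
      (-1) ^ Suc m * integral {0..1} (\<lambda>y. f \<kappa> (Suc m) y * g' \<kappa> 0 y)"
    proof (rule iterated_parts)
      show "(f \<kappa> j has_vector_derivative f \<kappa> (Suc j) y) (at y within {0..1})" for j y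
        unfolding f_def using poly_has_vector_derivative[of "Suc m + j" "Q \<kappa>" y] by simp
      show "(g' \<kappa> j has_vector_derivative g' \<kappa> (Suc j) y) (at y within {0..1})" if "j \<le> m" "y \<in> {0..1}" for j y
        unfolding g'_def using has_vector_derivative_mult_right[OF g[OF that], of "of_real (h ^ j)" \<kappa>] by (simp add: h_def mult_ac)
      show "continuous_on {0..1} (f \<kappa> (Suc m))" unfolding f0[abs_def] by simp
      show "continuous_on {0..1} (g' \<kappa> (Suc m))" unfolding g'_def by (intro continuous_intros cg)
    qed
    then show ?thesis by (simp add: f0)
  qed
  have "mean1 (\<lambda>t. of_real (Psi N o' m l s t) * G t)
      = (\<Sum>\<kappa><N. integral {0..1} (\<lambda>y. of_real c * (f \<kappa> 0 y * g \<kappa> (Suc m) y))) / of_nat N"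
  proof (rule mean1_cells[OF N, where B = "B' * B"])
    show "cmod (of_real (Psi N o' m l s x) * G x) \<le> B' * B" for x
      using B'[of x] B[of x] by (simp add: norm_mult mult_mono')
    show "of_real (Psi N o' m l s (t + 2 * pi)) * G (t + 2 * pi) = of_real (Psi N o' m l s t) * G t" for t
      by (simp add: Psi_periodic[OF N] per)
    show "continuous_on {0..1} (\<lambda>y. of_real c * (f \<kappa> 0 y * g \<kappa> (Suc m) y))" for \<kappa>
      unfolding f_def by (intro continuous_intros cg)
    show "of_real (Psi N o' m l s (o' + step N * (real \<kappa> + y))) * G (o' + step N * (real \<kappa> + y)) = of_real c * (f \<kappa> 0 y * g \<kappa> (Suc m) y)"
      if "\<kappa> < N" "0 \<le> y" "y < 1" for \<kappa> y
      using Psi_cell[OF N that(2,3), of o' m l s "int \<kappa>"] G[OF that] by (simp add: c_def h_def f_def Q_def del: power_Suc)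
  qed measurable
  also have "\<dots> = (\<Sum>\<kappa><N. of_real (c / h ^ Suc m / real N) * integral {0..1} (\<lambda>y. f \<kappa> 0 y * g' \<kappa> (Suc m) y))"
  proof -
    have "integral {0..1} (\<lambda>y. f \<kappa> 0 y * g' \<kappa> (Suc m) y) = of_real (h ^ Suc m) * integral {0..1} (\<lambda>y. f \<kappa> 0 y * g \<kappa> (Suc m) y)" for \<kappa>
      unfolding g'_def mult.left_commute[of "f _ _ _" "of_real (h ^ Suc m)"] by (rule integral_mult_right)
    then show ?thesis using h by (simp add: sum_divide_distrib del: power_Suc)
  qed
  also have "\<dots> = (\<Sum>\<kappa><N. \<Sum>\<beta>\<in>{0, 1}. \<Sum>j\<le>m. of_real (weight N m l s (int \<kappa>) \<beta> j) * \<gamma> (int \<kappa> + \<beta>) j)"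
  proof (rule sum.cong[OF refl])
    fix \<kappa> assume "\<kappa> \<in> {..<N}"
    then have \<kappa>: "\<kappa> < N" by simp
    define a where "a j = (-1) ^ (m - j) * (f \<kappa> (m - j) 1 * g' \<kappa> j 1 - f \<kappa> (m - j) 0 * g' \<kappa> j 0)" for j
    have "(\<Sum>j\<le>m. (-1) ^ j * (f \<kappa> j 1 * g' \<kappa> (m - j) 1 - f \<kappa> j 0 * g' \<kappa> (m - j) 0)) = (\<Sum>j\<le>m. a j)"
      unfolding a_def by (rule sum.reindex_bij_witness[of _ "\<lambda>j. m - j" "\<lambda>j. m - j"]) auto
    then have "of_real (c / h ^ Suc m / real N) * integral {0..1} (\<lambda>y. f \<kappa> 0 y * g' \<kappa> (Suc m) y)
        = (\<Sum>j\<le>m. of_real (c / h ^ Suc m / real N) * a j)"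
      by (simp only: cell sum_distrib_left)
    also have "\<dots> = (\<Sum>j\<le>m. \<Sum>\<beta>\<in>{0, 1}. of_real (weight N m l s (int \<kappa>) \<beta> j) * \<gamma> (int \<kappa> + \<beta>) j)"
    proof (rule sum.cong[OF refl])
      fix j assume "j \<in> {..m}"
      then have j: "j \<le> m" by simp
      define d where "d = c / h ^ Suc m / real N"
      have "d = h ^ s / h ^ (2 * Suc m) / real N"
        by (simp only: d_def c_def mult_2 power_add divide_divide_eq_left)
      then have w: "weight N m l s (int \<kappa>) \<beta> j = d * ((-1) ^ (m - j) * ((if \<beta> = 1 then 1 else - 1) * (h ^ j * poly (pd (Suc m + (m - j)) (Q \<kappa>)) (of_int \<beta>))))" for \<beta>
        by (simp add: weight_def Q_def h_def del: power_Suc)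
      then show "of_real (c / h ^ Suc m / real N) * a j = (\<Sum>\<beta>\<in>{0, 1}. of_real (weight N m l s (int \<kappa>) \<beta> j) * \<gamma> (int \<kappa> + \<beta>) j)"
        using \<gamma>[OF \<kappa> _ j, of 0] \<gamma>[OF \<kappa> _ j, of 1]
        unfolding d_def [symmetric] w by (simp add: a_def g'_def f_def algebra_simps del: power_Suc)
    qed
    also have "\<dots> = (\<Sum>\<beta>\<in>{0, 1}. \<Sum>j\<le>m. of_real (weight N m l s (int \<kappa>) \<beta> j) * \<gamma> (int \<kappa> + \<beta>) j)"
      by (rule sum.swap)
    finally show "of_real (c / h ^ Suc m / real N) * integral {0..1} (\<lambda>y. f \<kappa> 0 y * g' \<kappa> (Suc m) y)
        = (\<Sum>\<beta>\<in>{0, 1}. \<Sum>j\<le>m. of_real (weight N m l s (int \<kappa>) \<beta> j) * \<gamma> (int \<kappa> + \<beta>) j)" .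
  qed
  finally show ?thesis .
qed

lemma cis_cell_derivative:
  "((\<lambda>y. (\<i> * of_real a) ^ j * cis (a * (b + h * y))) has_vector_derivative of_real h * ((\<i> * of_real a) ^ Suc j * cis (a * (b + h * y)))) (at y within S)"
proof -
  define p where "p = cis (a * b)"
  have E: "cis (a * (b + h * y)) = p * cis (a * h * y)" for y
    by (simp only: p_def cis_mult distrib_left mult.assoc)
  have "((\<lambda>y. (\<i> * of_real a) ^ j * p * cis (a * h * y)) has_vector_derivative (\<i> * of_real a) ^ j * p * (\<i> * of_real (a * h) * cis (a * h * y))) (at y within S)"
    by (intro has_vector_derivative_mult_right has_vector_derivative_cis)
  moreover have "of_real h * ((\<i> * of_real a) ^ Suc j * (p * q)) = (\<i> * of_real a) ^ j * p * (\<i> * of_real (a * h) * q)" for q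
    by (simp add: mult_ac)
  ultimately show ?thesis unfolding E by (simp only: mult.assoc)
qed

lemma cis_2pi_periodic: "cis (of_int k * (t + 2 * pi)) = cis (of_int k * t)"
proof -
  have "cis (of_int k * (t + 2 * pi)) = cis (of_int k * t) * cis (2 * pi * of_int k)"
    by (simp add: cis_mult algebra_simps)
  then show ?thesis by (simp add: cis_multiple_2pi)
qed

lemma mean1_Psi_cis:
  assumes N: "N \<ge> 1"
  shows "(\<i> * of_int k) ^ Suc m * mean1 (\<lambda>t. of_real (Psi N o' m l s t) * cis (of_int k * t)) =
    (\<Sum>\<kappa><N. \<Sum>\<beta>\<in>{0, 1}. \<Sum>j\<le>m. of_real (weight N m l s (int \<kappa>) \<beta> j) *
       ((\<i> * of_int k) ^ j * cis (of_int k * (o' + step N * of_int (int \<kappa> + \<beta>)))))"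
proof -
  have "mean1 (\<lambda>t. of_real (Psi N o' m l s t) * ((\<i> * of_int k) ^ Suc m * cis (of_int k * t))) =
    (\<Sum>\<kappa><N. \<Sum>\<beta>\<in>{0, 1}. \<Sum>j\<le>m. of_real (weight N m l s (int \<kappa>) \<beta> j) *
       ((\<i> * of_int k) ^ j * cis (of_int k * (o' + step N * of_int (int \<kappa> + \<beta>)))))"
  proof (rule mean1_Psi[OF N, where B = "cmod ((\<i> * of_int k) ^ Suc m)"
        and g = "\<lambda>\<kappa> j y. (\<i> * of_int k) ^ j * cis (of_int k * ((o' + step N * real \<kappa>) + step N * y))"
        and \<gamma> = "\<lambda>i j. (\<i> * of_int k) ^ j * cis (of_int k * (o' + step N * of_int i))"])
    show "((\<lambda>y. (\<i> * of_int k) ^ j * cis (of_int k * ((o' + step N * real \<kappa>) + step N * y))) has_vector_derivative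
        of_real (step N) * ((\<i> * of_int k) ^ Suc j * cis (of_int k * ((o' + step N * real \<kappa>) + step N * y)))) (at y within {0..1})" for \<kappa> j y
      using cis_cell_derivative[of "of_int k" j "o' + step N * real \<kappa>" "step N" y] by simp
    show "continuous_on {0..1} (\<lambda>y. (\<i> * of_int k) ^ Suc m * cis (of_int k * ((o' + step N * real \<kappa>) + step N * y)))" for \<kappa>
      by (intro continuous_intros)
    show "(\<i> * of_int k) ^ Suc m * cis (of_int k * (t + 2 * pi)) = (\<i> * of_int k) ^ Suc m * cis (of_int k * t)" for t
      by (simp only: cis_2pi_periodic)
    show "(\<i> * of_int k) ^ j * cis (of_int k * ((o' + step N * real \<kappa>) + step N * of_int \<beta>)) = (\<i> * of_int k) ^ j * cis (of_int k * (o' + step N * of_int (int \<kappa> + \<beta>)))" for \<kappa> \<beta> j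
      by (simp add: distrib_left add.assoc)
    show "(\<i> * of_int k) ^ Suc m * cis (of_int k * (o' + step N * (real \<kappa> + y))) = (\<i> * of_int k) ^ Suc m * cis (of_int k * ((o' + step N * real \<kappa>) + step N * y))" for \<kappa> y
      by (simp add: distrib_left add.assoc)
  qed (auto simp: norm_mult)
  moreover have "mean1 (\<lambda>t. of_real (Psi N o' m l s t) * ((\<i> * of_int k) ^ Suc m * cis (of_int k * t)))
      = (\<i> * of_int k) ^ Suc m * mean1 (\<lambda>t. of_real (Psi N o' m l s t) * cis (of_int k * t))"
    unfolding mean1_def mult.left_commute[of "of_real _" "(\<i> * of_int k) ^ Suc m"] by simp
  ultimately show ?thesis by simp
qed

lemma mean1_Psi_Psi:
  assumes N: "N \<ge> 1" and s': "s' \<le> m"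
  shows "mean1 (\<lambda>t. of_real (Psi N o' m l s t) * of_real (Psi N o' m l' s' t)) =
    (\<Sum>\<kappa><N. \<Sum>\<beta>\<in>{0, 1}. \<Sum>j\<le>m. of_real (weight N m l s (int \<kappa>) \<beta> j) *
       of_bool ((int \<kappa> + \<beta> - l') mod int N = 0 \<and> j = s'))"
proof -
  define h where "h = step N"
  have h: "h > 0" using step_pos[OF N] by (simp add: h_def)
  obtain B where B: "\<And>t. \<bar>Psi N o' m l' s' t\<bar> \<le> B" using Psi_bounded by blast
  show ?thesis
  proof (rule mean1_Psi[OF N, where B = B
        and g = "\<lambda>\<kappa> j y. of_real (h ^ s' / h ^ j * poly (pd j (hpiece N m l' s' (int \<kappa>))) y)"
        and \<gamma> = "\<lambda>i j. of_bool ((i - l') mod int N = 0 \<and> j = s')"])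
    show "of_real (Psi N o' m l' s' (t + 2 * pi)) = complex_of_real (Psi N o' m l' s' t)" for t
      by (simp add: Psi_periodic[OF N])
    show "((\<lambda>y. complex_of_real (h ^ s' / h ^ j * poly (pd j (hpiece N m l' s' (int \<kappa>))) y)) has_vector_derivative
        of_real (step N) * of_real (h ^ s' / h ^ Suc j * poly (pd (Suc j) (hpiece N m l' s' (int \<kappa>))) y)) (at y within {0..1})" for \<kappa> j y
      using has_vector_derivative_mult_right[OF poly_has_vector_derivative[of j "hpiece N m l' s' (int \<kappa>)" y "{0..1}"], of "of_real (h ^ s' / h ^ j)"] h
      by (simp add: h_def [symmetric])
    show "continuous_on {0..1} (\<lambda>y. complex_of_real (h ^ s' / h ^ Suc m * poly (pd (Suc m) (hpiece N m l' s' (int \<kappa>))) y))" for \<kappa>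
      by (intro continuous_intros)
    show "complex_of_real (Psi N o' m l' s' (o' + step N * (real \<kappa> + y))) = of_real (h ^ s' / h ^ Suc m * poly (pd (Suc m) (hpiece N m l' s' (int \<kappa>))) y)"
      if "0 \<le> y" "y < 1" for \<kappa> y
      using Psi_cell[OF N that, of o' m l' s' "int \<kappa>"] by (simp add: h_def del: power_Suc)
    show "complex_of_real (h ^ s' / h ^ j * poly (pd j (hpiece N m l' s' (int \<kappa>))) (of_int \<beta>)) = of_bool ((int \<kappa> + \<beta> - l') mod int N = 0 \<and> j = s')"
      if "\<beta> \<in> {0, 1}" "j \<le> m" for \<kappa> \<beta> j
      using piece_herm[OF that(2,1), of N s' l' "int \<kappa>"] h by auto
  qed (use B in auto)
qed

text \<open>
  The spline is of class \<open>C\<^sup>m\<close>, so the boundary terms of neighbouring cells cancel, and those at the ends of the period by periodicity.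
\<close>

lemma mean1_Psi_Phi:
  assumes N: "N \<ge> 1"
  shows "mean1 (\<lambda>t. of_real (Psi N o' m l s t) * cis (of_int k * t)) =
    (- (\<i> * of_int k)) ^ Suc m * mean1 (\<lambda>t. of_real (Phi N o' m l s t) * cis (of_int k * t))"
proof -
  define h where "h = step N"
  have h: "h > 0" "h * real N = 2 * pi" using step_pos[OF N] step_N[OF N] by (auto simp: h_def)
  define f where "f \<kappa> j y = complex_of_real (poly (pd j (hpiece N m l s (int \<kappa>))) y)" for \<kappa> j y
  define g where "g \<kappa> j y = (\<i> * of_int k * of_real h) ^ j * cis (of_int k * ((o' + h * real \<kappa>) + h * y))" for \<kappa> j y
  define \<delta> where "\<delta> i t = complex_of_real (of_bool ((i - l) mod int N = 0 \<and> t = s))" for i t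
  define \<epsilon> where "\<epsilon> i j = (\<i> * of_int k * of_real h) ^ j * cis (of_int k * (o' + h * of_int i))" for i j
  have f_end: "f \<kappa> t 0 = \<delta> (int \<kappa>) t" "f \<kappa> t 1 = \<delta> (int (Suc \<kappa>)) t" if "t \<le> m" for \<kappa> t
    using piece_herm[OF that, of 0 N s l "int \<kappa>"] piece_herm[OF that, of 1 N s l "int \<kappa>"]
    by (auto simp: f_def \<delta>_def algebra_simps)
  have g_end: "g \<kappa> j 0 = \<epsilon> (int \<kappa>) j" "g \<kappa> j 1 = \<epsilon> (int (Suc \<kappa>)) j" for \<kappa> j
    by (auto simp: g_def \<epsilon>_def algebra_simps)
  \<comment> \<open>the boundary term at vertex \<open>i\<close>, common to the two cells that meet there\<close>
  define b where "b i = (\<Sum>j\<le>m. (-1) ^ j * (\<epsilon> (int i) j * \<delta> (int i) (m - j)))" for i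
  have parts: "integral {0..1} (\<lambda>y. f \<kappa> (Suc m) y * g \<kappa> 0 y) = (b (Suc \<kappa>) - b \<kappa>) + (-1) ^ Suc m * integral {0..1} (\<lambda>y. f \<kappa> 0 y * g \<kappa> (Suc m) y)" for \<kappa>
  proof -
    have "integral {0..1} (\<lambda>y. g \<kappa> 0 y * f \<kappa> (Suc m) y) =
        (\<Sum>j\<le>m. (-1) ^ j * (g \<kappa> j 1 * f \<kappa> (m - j) 1 - g \<kappa> j 0 * f \<kappa> (m - j) 0)) + (-1) ^ Suc m * integral {0..1} (\<lambda>y. g \<kappa> (Suc m) y * f \<kappa> 0 y)"
    proof (rule iterated_parts)
      show "(g \<kappa> j has_vector_derivative g \<kappa> (Suc j) y) (at y within {0..1})" for j y
        unfolding g_def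
        using has_vector_derivative_mult_right[OF cis_cell_derivative[of "of_int k" 0 "o' + h * real \<kappa>" h y "{0..1}"], of "(\<i> * of_int k * of_real h) ^ j"]
        by (simp add: mult_ac)
      show "(f \<kappa> j has_vector_derivative f \<kappa> (Suc j) y) (at y within {0..1})" for j y
        unfolding f_def by (rule poly_has_vector_derivative)
      show "continuous_on {0..1} (g \<kappa> (Suc m))" "continuous_on {0..1} (f \<kappa> (Suc m))"
        unfolding f_def g_def by (intro continuous_intros)+
    qed
    moreover have "(\<Sum>j\<le>m. (-1) ^ j * (g \<kappa> j 1 * f \<kappa> (m - j) 1 - g \<kappa> j 0 * f \<kappa> (m - j) 0)) = b (Suc \<kappa>) - b \<kappa>"
      unfolding b_def sum_subtractf [symmetric] by (intro sum.cong refl) (simp add: f_end g_end right_diff_distrib)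
    ultimately show ?thesis by (simp only: mult.commute[of "g _ _ _"])
  qed
  have bN: "b N = b 0"
  proof -
    have "\<delta> (int N) t = \<delta> (int 0) t" for t
    proof -
      have "(int N - l) mod int N = (0 - l) mod int N"
        using mod_add_self1[of "int N" "- l"] by simp
      then show ?thesis by (simp add: \<delta>_def)
    qed
    moreover have "\<epsilon> (int N) j = \<epsilon> (int 0) j" for j
      using cis_2pi_periodic[of k o'] h by (simp add: \<epsilon>_def)
    ultimately show ?thesis by (simp only: b_def)
  qed
  obtain B where B: "\<And>t. \<bar>Psi N o' m l s t\<bar> \<le> B" using Psi_bounded by blast
  obtain B' where B': "\<And>t. \<bar>Phi N o' m l s t\<bar> \<le> B'" using Phi_bounded by blast
  have "mean1 (\<lambda>t. of_real (Psi N o' m l s t) * cis (of_int k * t)) =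
      (\<Sum>\<kappa><N. integral {0..1} (\<lambda>y. of_real (h ^ s / h ^ Suc m) * (f \<kappa> (Suc m) y * g \<kappa> 0 y))) / of_nat N"
  proof (rule mean1_cells[OF N, where B = B])
    show "continuous_on {0..1} (\<lambda>y. of_real (h ^ s / h ^ Suc m) * (f \<kappa> (Suc m) y * g \<kappa> 0 y))" for \<kappa>
      unfolding f_def g_def by (intro continuous_intros)
    show "of_real (Psi N o' m l s (o' + step N * (real \<kappa> + y))) * cis (of_int k * (o' + step N * (real \<kappa> + y))) = of_real (h ^ s / h ^ Suc m) * (f \<kappa> (Suc m) y * g \<kappa> 0 y)"
      if "0 \<le> y" "y < 1" for \<kappa> y
      using Psi_cell[OF N that, of o' m l s "int \<kappa>"] by (simp add: h_def f_def g_def algebra_simps del: power_Suc)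
  qed (use B in \<open>auto simp: norm_mult Psi_periodic[OF N] cis_2pi_periodic\<close>)
  also have "\<dots> = of_real (h ^ s / h ^ Suc m) * ((-1) ^ Suc m * (\<Sum>\<kappa><N. integral {0..1} (\<lambda>y. f \<kappa> 0 y * g \<kappa> (Suc m) y))) / of_nat N"
  proof -
    have "(\<Sum>\<kappa><N. b (Suc \<kappa>) - b \<kappa>) = 0" by (simp add: sum_lessThan_telescope bN)
    then have "(\<Sum>\<kappa><N. integral {0..1} (\<lambda>y. f \<kappa> (Suc m) y * g \<kappa> 0 y)) = (-1) ^ Suc m * (\<Sum>\<kappa><N. integral {0..1} (\<lambda>y. f \<kappa> 0 y * g \<kappa> (Suc m) y))"
      by (simp only: parts sum.distrib sum_distrib_left) simp
    then show ?thesis by (simp only: integral_mult_right sum_distrib_left [symmetric])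
  qed
  also have "\<dots> = (- (\<i> * of_int k)) ^ Suc m * ((\<Sum>\<kappa><N. integral {0..1} (\<lambda>y. of_real (h ^ s) * (f \<kappa> 0 y * g \<kappa> 0 y))) / of_nat N)"
  proof -
    have "g \<kappa> (Suc m) y = (\<i> * of_int k * of_real h) ^ Suc m * g \<kappa> 0 y" for \<kappa> y by (simp add: g_def)
    then have "integral {0..1} (\<lambda>y. f \<kappa> 0 y * g \<kappa> (Suc m) y) = (\<i> * of_int k * of_real h) ^ Suc m * integral {0..1} (\<lambda>y. f \<kappa> 0 y * g \<kappa> 0 y)" for \<kappa>
      by (simp only: mult.left_commute[of "f _ _ _"] integral_mult_right)
    moreover define J where "J = (\<Sum>\<kappa><N. integral {0..1} (\<lambda>y. f \<kappa> 0 y * g \<kappa> 0 y))"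
    ultimately have "(\<Sum>\<kappa><N. integral {0..1} (\<lambda>y. f \<kappa> 0 y * g \<kappa> (Suc m) y)) = (\<i> * of_int k * of_real h) ^ Suc m * J"
      by (simp only: sum_distrib_left)
    moreover have "(\<Sum>\<kappa><N. integral {0..1} (\<lambda>y. of_real (h ^ s) * (f \<kappa> 0 y * g \<kappa> 0 y))) = of_real (h ^ s) * J"
      unfolding J_def by (simp only: integral_mult_right sum_distrib_left)
    moreover have "(- 1) ^ Suc m * (\<i> * of_int k * of_real h) ^ Suc m = (- (\<i> * of_int k)) ^ Suc m * of_real (h ^ Suc m)"
      by (simp only: power_mult_distrib [symmetric] of_real_power) simp
    then have "(- 1) ^ Suc m * ((\<i> * of_int k * of_real h) ^ Suc m * J) = (- (\<i> * of_int k)) ^ Suc m * of_real (h ^ Suc m) * J"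
      by (simp only: mult.assoc [symmetric])
    ultimately show ?thesis using h by (simp add: divide_simps del: power_Suc)
  qed
  also have "(\<Sum>\<kappa><N. integral {0..1} (\<lambda>y. of_real (h ^ s) * (f \<kappa> 0 y * g \<kappa> 0 y))) / of_nat N = mean1 (\<lambda>t. of_real (Phi N o' m l s t) * cis (of_int k * t))"
  proof (rule mean1_cells[OF N, where B = B', symmetric])
    show "continuous_on {0..1} (\<lambda>y. of_real (h ^ s) * (f \<kappa> 0 y * g \<kappa> 0 y))" for \<kappa>
      unfolding f_def g_def by (intro continuous_intros)
    show "of_real (Phi N o' m l s (o' + step N * (real \<kappa> + y))) * cis (of_int k * (o' + step N * (real \<kappa> + y))) = of_real (h ^ s) * (f \<kappa> 0 y * g \<kappa> 0 y)"
      if "0 \<le> y" "y < 1" for \<kappa> y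
      using Phi_cell[OF N that, of o' m l s "int \<kappa>"] by (simp add: h_def f_def g_def algebra_simps)
  qed (use B' in \<open>auto simp: norm_mult Phi_periodic[OF N] cis_2pi_periodic\<close>)
  finally show ?thesis .
qed

text \<open>
  By \<open>mean1_Psi_cis\<close> and \<open>mean1_Psi_Phi\<close> the coefficient times \<open>k\<^sup>2\<^sup>m\<^sup>+\<^sup>2\<close> is a combination of terms of order at most \<open>|k|\<^sup>m\<close>, which leaves a decay of
  at least \<open>k\<^sup>-\<^sup>2\<close>.
\<close>

lemma mean1_Phi_bound:
  assumes N: "N \<ge> 1"
  shows "\<exists>C\<ge>0. \<forall>k. cmod (mean1 (\<lambda>t. of_real (Phi N o' m l s t) * cis (of_int k * t))) \<le> C / (1 + (of_int k)\<^sup>2)"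
proof -
  define \<phi> where "\<phi> k = mean1 (\<lambda>t. of_real (Phi N o' m l s t) * cis (of_int k * t))" for k
  define W where "W = (\<Sum>\<kappa><N. \<Sum>\<beta>\<in>{0, 1}. \<Sum>j\<le>m. \<bar>weight N m l s (int \<kappa>) \<beta> j\<bar>)"
  have W0: "W \<ge> 0" unfolding W_def by (intro sum_nonneg) auto
  have "cmod (\<phi> k) \<le> (2 * W + cmod (\<phi> 0)) / (1 + (of_int k)\<^sup>2)" for k
  proof (cases "k = 0")
    case False
    define a where "a = \<bar>real_of_int k\<bar>"
    have a: "a \<ge> 1" using False by (simp add: a_def)
    have "a ^ Suc m * (a ^ Suc m * cmod (\<phi> k)) = cmod ((\<i> * of_int k) ^ Suc m * mean1 (\<lambda>t. of_real (Psi N o' m l s t) * cis (of_int k * t)))"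
      unfolding mean1_Psi_Phi[OF N] \<phi>_def [symmetric] by (simp add: norm_mult norm_power a_def)
    also have "\<dots> \<le> (\<Sum>\<kappa><N. \<Sum>\<beta>\<in>{0, 1}. \<Sum>j\<le>m. \<bar>weight N m l s (int \<kappa>) \<beta> j\<bar> * a ^ j)"
      unfolding mean1_Psi_cis[OF N]
      by (intro order_trans[OF norm_sum] sum_mono) (simp add: norm_mult norm_power a_def)
    also have "\<dots> \<le> (\<Sum>\<kappa><N. \<Sum>\<beta>\<in>{0, 1}. \<Sum>j\<le>m. \<bar>weight N m l s (int \<kappa>) \<beta> j\<bar> * a ^ m)"
      using a by (intro sum_mono mult_left_mono power_increasing) auto
    also have "\<dots> = W * a ^ m" by (simp only: W_def sum_distrib_right)
    finally have "a ^ m * (a ^ Suc (Suc m) * cmod (\<phi> k)) \<le> a ^ m * W" by (simp add: mult_ac)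
    then have le: "a ^ Suc (Suc m) * cmod (\<phi> k) \<le> W" using a by (simp add: mult_le_cancel_left_pos)
    have "a\<^sup>2 * cmod (\<phi> k) \<le> a ^ Suc (Suc m) * cmod (\<phi> k)"
      using a by (intro mult_right_mono power_increasing) auto
    with le have "a\<^sup>2 * cmod (\<phi> k) \<le> W" by simp
    moreover have "1 * cmod (\<phi> k) \<le> a\<^sup>2 * cmod (\<phi> k)" using a by (intro mult_right_mono) auto
    ultimately have "(1 + a\<^sup>2) * cmod (\<phi> k) \<le> 2 * W + cmod (\<phi> 0)"
      using norm_ge_zero[of "\<phi> 0"] unfolding distrib_right by linarith
    moreover have "1 + a\<^sup>2 > 0" by (simp add: add_pos_nonneg)
    ultimately show ?thesis by (simp add: a_def le_divide_eq mult.commute)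
  qed (use W0 in simp)
  then show ?thesis using W0 unfolding \<phi>_def by (intro exI[of _ "2 * W + cmod (\<phi> 0)"]) (auto simp: \<phi>_def)
qed

section \<open>Tensor-product Hermite interpolation\<close>

subsection \<open>Sums over vector indices\<close>

definition vec_box :: "(3 \<Rightarrow> 'a set) \<Rightarrow> ('a ^ 3) set" where
  "vec_box A = {k. \<forall>i. k $ i \<in> A i}"

lemma vec_box_image: "vec_box A = vec_lambda ` (PiE UNIV A)"
proof
  show "vec_box A \<subseteq> vec_lambda ` (PiE UNIV A)"
  proof
    fix k assume "k \<in> vec_box A"
    then have "k = vec_lambda (\<lambda>i. k $ i)" "(\<lambda>i. k $ i) \<in> PiE UNIV A" by (auto simp: vec_box_def)
    then show "k \<in> vec_lambda ` (PiE UNIV A)" by (rule image_eqI)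
  qed
qed (auto simp: vec_box_def)

lemma finite_vec_box: "(\<And>i. finite (A i)) \<Longrightarrow> finite (vec_box A)"
  unfolding vec_box_image by (intro finite_imageI finite_PiE) auto

lemma prod_sum_vec:
  fixes f :: "3 \<Rightarrow> 'a \<Rightarrow> 'b::comm_semiring_1"
  assumes "\<And>i. finite (A i)"
  shows "(\<Prod>i\<in>UNIV. \<Sum>a\<in>A i. f i a) = (\<Sum>k\<in>vec_box A. \<Prod>i\<in>UNIV. f i (k $ i))"
proof -
  have "(\<Prod>i\<in>UNIV. \<Sum>a\<in>A i. f i a) = (\<Sum>g\<in>PiE UNIV A. \<Prod>i\<in>UNIV. f i (g i))"
    by (rule prod_sum_PiE) (use assms in auto)
  also have "\<dots> = (\<Sum>k\<in>vec_box A. \<Prod>i\<in>UNIV. f i (k $ i))"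
    unfolding vec_box_image by (subst sum.reindex) (auto simp: inj_on_def vec_lambda_inject)
  finally show ?thesis .
qed

lemma multi_indices_box: "multi_indices d = vec_box (\<lambda>_. {..d})"
  by (auto simp: multi_indices_def vec_box_def)

lemma finite_multi_indices [simp]: "finite (multi_indices d)"
  unfolding multi_indices_box by (rule finite_vec_box) auto

definition corners :: "(int ^ 3) set" where "corners = vec_box (\<lambda>_. {0, 1})"

lemma corners_iff: "\<beta> \<in> corners \<longleftrightarrow> (\<forall>i. \<beta> $ i \<in> {0, 1})"
  by (simp add: corners_def vec_box_def)

lemma finite_corners [simp]: "finite corners"
  unfolding corners_def by (rule finite_vec_box) auto

lemma prod_sum_corners_indices:
  fixes f :: "3 \<Rightarrow> int \<Rightarrow> nat \<Rightarrow> 'b::comm_semiring_1"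
  shows "(\<Prod>i\<in>UNIV. \<Sum>\<beta>\<in>{0, 1}. \<Sum>s\<le>m. f i \<beta> s) =
    (\<Sum>\<beta>\<in>corners. \<Sum>s\<in>multi_indices m. \<Prod>i\<in>UNIV. f i (\<beta> $ i) (s $ i))"
proof -
  have "(\<Prod>i\<in>UNIV. \<Sum>\<beta>\<in>{0, 1}. \<Sum>s\<le>m. f i \<beta> s) = (\<Sum>\<beta>\<in>corners. \<Prod>i\<in>UNIV. \<Sum>s\<le>m. f i (\<beta> $ i) s)"
    unfolding corners_def by (rule prod_sum_vec[of "\<lambda>_. {0, 1}" "\<lambda>i \<beta>. \<Sum>s\<le>m. f i \<beta> s"]) auto
  also have "\<dots> = (\<Sum>\<beta>\<in>corners. \<Sum>s\<in>multi_indices m. \<Prod>i\<in>UNIV. f i (\<beta> $ i) (s $ i))"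
    unfolding multi_indices_box by (intro sum.cong refl prod_sum_vec) auto
  finally show ?thesis .
qed

subsection \<open>Derivatives of tensor-product polynomials\<close>

text \<open>Sums of products of univariate polynomials: this form is stable under partial derivatives, which act on single factors.\<close>

definition tensor_sum :: "'r set \<Rightarrow> ('r \<Rightarrow> 3 \<Rightarrow> real poly) \<Rightarrow> ('r \<Rightarrow> 'b::real_normed_vector) \<Rightarrow> real ^ 3 \<Rightarrow> 'b" where
  "tensor_sum R q v x = (\<Sum>r\<in>R. (\<Prod>i\<in>UNIV. poly (q r i) (x $ i)) *\<^sub>R v r)"

lemma partial_tensor_sum:
  "partial i (tensor_sum R q v) = tensor_sum R (\<lambda>r j. if j = i then pderiv (q r j) else q r j) v"
proof
  fix x
  have "((\<lambda>h. (\<Prod>j\<in>UNIV. poly (q r j) ((x + axis i h) $ j)) *\<^sub>R v r) has_vector_derivative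
      (\<Prod>j\<in>UNIV. poly (if j = i then pderiv (q r j) else q r j) (x $ j)) *\<^sub>R v r) (at 0)" for r
  proof -
    define c where "c = (\<Prod>j\<in>UNIV - {i}. poly (q r j) (x $ j))"
    have 1: "(\<Prod>j\<in>UNIV. poly (q r j) ((x + axis i h) $ j)) = poly (q r i) (x $ i + h) * c" for h
      unfolding c_def by (subst prod.remove[of _ i]) (auto simp: axis_def intro!: arg_cong2[where f = "(*)"] prod.cong)
    have 2: "(\<Prod>j\<in>UNIV. poly (if j = i then pderiv (q r j) else q r j) (x $ j)) = poly (pderiv (q r i)) (x $ i) * c"
      unfolding c_def by (subst prod.remove[of _ i]) (auto intro!: arg_cong2[where f = "(*)"] prod.cong)
    have "((\<lambda>h. poly (q r i) (x $ i + h) * c) has_real_derivative poly (pderiv (q r i)) (x $ i) * c) (at 0)"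
      by (auto intro!: derivative_eq_intros)
    then have "((\<lambda>h. poly (q r i) (x $ i + h) * c) has_vector_derivative poly (pderiv (q r i)) (x $ i) * c) (at 0)"
      by (simp only: has_real_derivative_iff_has_vector_derivative)
    from bounded_linear.has_vector_derivative[OF bounded_linear_scaleR_left this]
    show ?thesis unfolding 1 2 .
  qed
  then have "((\<lambda>h. tensor_sum R q v (x + axis i h)) has_vector_derivative
      tensor_sum R (\<lambda>r j. if j = i then pderiv (q r j) else q r j) v x) (at 0)"
    unfolding tensor_sum_def by (intro has_vector_derivative_sum)
  then show "partial i (tensor_sum R q v) x = tensor_sum R (\<lambda>r j. if j = i then pderiv (q r j) else q r j) v x"
    unfolding partial_def by (rule vector_derivative_at)
qed

lemma partial_power_tensor_sum:
  "(partial i ^^ n) (tensor_sum R q v) = tensor_sum R (\<lambda>r j. if j = i then pd n (q r j) else q r j) v"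
proof (induction n)
  case (Suc n)
  have "(\<lambda>r j. if j = i then pderiv (if j = i then pd n (q r j) else q r j) else (if j = i then pd n (q r j) else q r j))
      = (\<lambda>r j. if j = i then pd (Suc n) (q r j) else q r j)" by (auto simp: fun_eq_iff)
  then show ?case by (simp only: funpow.simps o_apply Suc partial_tensor_sum)
next
  case 0
  have "(\<lambda>r j. if j = i then pd 0 (q r j) else q r j) = q" by (auto simp: fun_eq_iff)
  then show ?case by (simp only: funpow.simps id_apply)
qed

lemma mixed_partial_tensor_sum:
  fixes \<alpha> :: "nat ^ 3"
  shows "mixed_partial \<alpha> (tensor_sum R q v) = tensor_sum R (\<lambda>r j. pd (\<alpha> $ j) (q r j)) v"
proof -
  have "(\<lambda>r j. if j = 1 then pd (\<alpha> $ 1) (if j = 2 then pd (\<alpha> $ 2) (if j = 3 then pd (\<alpha> $ 3) (q r j) else q r j)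
      else if j = 3 then pd (\<alpha> $ 3) (q r j) else q r j)
      else if j = 2 then pd (\<alpha> $ 2) (if j = 3 then pd (\<alpha> $ 3) (q r j) else q r j)
      else if j = 3 then pd (\<alpha> $ 3) (q r j) else q r j) = (\<lambda>r j. pd (\<alpha> $ j) (q r j))"
  proof (intro ext)
    fix r and j :: 3
    show "(if j = 1 then pd (\<alpha> $ 1) (if j = 2 then pd (\<alpha> $ 2) (if j = 3 then pd (\<alpha> $ 3) (q r j) else q r j)
      else if j = 3 then pd (\<alpha> $ 3) (q r j) else q r j)
      else if j = 2 then pd (\<alpha> $ 2) (if j = 3 then pd (\<alpha> $ 3) (q r j) else q r j)
      else if j = 3 then pd (\<alpha> $ 3) (q r j) else q r j) = pd (\<alpha> $ j) (q r j)"
      using exhaust_3[of j] by auto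
  qed
  then show ?thesis unfolding mixed_partial_def partial_power_tensor_sum by simp
qed

lemma tensor_poly_iff_tensor_sum:
  "tensor_poly d p \<longleftrightarrow> (\<exists>a. p = tensor_sum (multi_indices d) (\<lambda>\<alpha> i. monom 1 (\<alpha> $ i)) a)"
  unfolding tensor_poly_def tensor_sum_def by (auto simp: poly_monom fun_eq_iff)

lemma tensor_poly_tensor_sum:
  fixes v :: "'r \<Rightarrow> real ^ 3"
  assumes deg: "\<And>r i. r \<in> R \<Longrightarrow> degree (q r i) \<le> d"
  shows "tensor_poly d (tensor_sum R q v)"
  unfolding tensor_poly_def
proof (intro exI allI)
  fix x
  have "(\<Prod>i\<in>UNIV. poly (q r i) (x $ i)) = (\<Sum>\<alpha>\<in>multi_indices d. \<Prod>i\<in>UNIV. coeff (q r i) (\<alpha> $ i) * x $ i ^ (\<alpha> $ i))"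
    if "r \<in> R" for r
  proof -
    have "poly (q r i) (x $ i) = (\<Sum>j\<le>d. coeff (q r i) j * x $ i ^ j)" for i
      unfolding poly_altdef using deg[OF that, of i]
      by (intro sum.mono_neutral_left) (auto intro: coeff_eq_0)
    then show ?thesis unfolding multi_indices_box
      using prod_sum_vec[of "\<lambda>_. {..d}" "\<lambda>i j. coeff (q r i) j * x $ i ^ j"] by simp
  qed
  then have "tensor_sum R q v x = (\<Sum>r\<in>R. (\<Sum>\<alpha>\<in>multi_indices d. (\<Prod>i\<in>UNIV. coeff (q r i) (\<alpha> $ i) * x $ i ^ (\<alpha> $ i))) *\<^sub>R v r)"
    unfolding tensor_sum_def by (intro sum.cong refl) simp
  also have "\<dots> = (\<Sum>\<alpha>\<in>multi_indices d. \<Sum>r\<in>R. (\<Prod>i\<in>UNIV. x $ i ^ (\<alpha> $ i)) *\<^sub>R ((\<Prod>i\<in>UNIV. coeff (q r i) (\<alpha> $ i)) *\<^sub>R v r))"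
    unfolding scaleR_sum_left by (subst sum.swap) (simp add: prod.distrib mult.commute)
  also have "\<dots> = (\<Sum>\<alpha>\<in>multi_indices d. (\<Prod>i\<in>UNIV. x $ i ^ (\<alpha> $ i)) *\<^sub>R (\<Sum>r\<in>R. (\<Prod>i\<in>UNIV. coeff (q r i) (\<alpha> $ i)) *\<^sub>R v r))"
    by (simp only: scaleR_sum_right)
  finally show "tensor_sum R q v x = (\<Sum>\<alpha>\<in>multi_indices d. (\<Prod>i\<in>UNIV. x $ i ^ (\<alpha> $ i)) *\<^sub>R (\<Sum>r\<in>R. (\<Prod>i\<in>UNIV. coeff (q r i) (\<alpha> $ i)) *\<^sub>R v r))" .
qed

subsection \<open>The cell polynomial\<close>

text \<open>
  The basis polynomial of the cell that begins at \<open>a\<close> and has length \<open>h\<close>; the factor \<open>h\<^sup>s\<close> compensates the chain rule.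
\<close>

definition hermc :: "nat \<Rightarrow> real \<Rightarrow> real \<Rightarrow> int \<Rightarrow> nat \<Rightarrow> real poly" where
  "hermc m a h \<beta> s = smult (h ^ s) (pcompose (herm m \<beta> s) [:- a / h, 1 / h:])"

lemma higher_pderiv_pcompose_linear:
  fixes p :: "real poly" shows "pd t (pcompose p [:b, c:]) = smult (c ^ t) (pcompose (pd t p) [:b, c:])"
  by (induction t) (simp_all add: pderiv_smult pderiv_pcompose pderiv_pCons mult_ac)

lemma poly_hermc:
  assumes "h \<noteq> 0" shows "poly (pd t (hermc m a h \<beta> s)) y = h ^ s / h ^ t * poly (pd t (herm m \<beta> s)) ((y - a) / h)"
  unfolding hermc_def higher_pderiv_smult higher_pderiv_pcompose_linear
  by (simp add: poly_pcompose power_divide diff_divide_distrib)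

lemma degree_hermc: "\<beta> \<in> {0, 1} \<Longrightarrow> degree (hermc m a h \<beta> s) \<le> 2 * m + 1"
proof -
  assume "\<beta> \<in> {0, 1}"
  have "degree (hermc m a h \<beta> s) \<le> degree (pcompose (herm m \<beta> s) [:- a / h, 1 / h:])"
    unfolding hermc_def by (rule degree_smult_le)
  also have "\<dots> = degree (herm m \<beta> s) * degree [:- a / h, 1 / h:]" by (rule degree_pcompose)
  also have "\<dots> \<le> degree (herm m \<beta> s) * 1" by (intro mult_left_mono) auto
  also have "\<dots> \<le> 2 * m + 1" using herm(1)[OF \<open>\<beta> \<in> {0, 1}\<close>] by simp
  finally show ?thesis .
qed

lemma hermc_vertex:
  assumes "h \<noteq> 0" "\<beta> \<in> {0, 1}" "\<beta>' \<in> {0, 1}" "t \<le> m"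
  shows "poly (pd t (hermc m a h \<beta> s)) (a + of_int \<beta>' * h) = of_bool (\<beta>' = \<beta> \<and> t = s)"
  unfolding poly_hermc[OF assms(1)] using herm(2)[OF assms(2,4,3)] assms(1) by simp

lemma hermc_expansion:
  fixes p :: "real poly"
  assumes h: "h \<noteq> 0" and deg: "degree p \<le> 2 * m + 1"
  shows "poly p y = (\<Sum>\<beta>\<in>{0, 1}. \<Sum>s\<le>m. poly (pd s p) (a + of_int \<beta> * h) * poly (hermc m a h \<beta> s) y)"
proof -
  define P where "P = pcompose p [:a, h:]"
  have "degree P \<le> degree p * 1"
    unfolding P_def degree_pcompose by (intro mult_left_mono) auto
  then have "P = (\<Sum>\<beta>\<in>{0, 1}. \<Sum>s\<le>m. smult (poly (pd s P) (of_int \<beta>)) (herm m \<beta> s))"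
    using deg by (intro hermite_expansion) simp
  then have "poly P ((y - a) / h) = poly (\<Sum>\<beta>\<in>{0, 1}. \<Sum>s\<le>m. smult (poly (pd s P) (of_int \<beta>)) (herm m \<beta> s)) ((y - a) / h)"
    by (rule arg_cong[where f = "\<lambda>p. poly p ((y - a) / h)"])
  moreover have "poly P ((y - a) / h) = poly p y" using h by (simp add: P_def poly_pcompose)
  moreover have "poly (pd s P) (of_int \<beta>) * poly (herm m \<beta> s) ((y - a) / h) = poly (pd s p) (a + of_int \<beta> * h) * poly (hermc m a h \<beta> s) y" for s \<beta>
    using poly_hermc[OF h, of 0 m a \<beta> s y]
    by (simp add: P_def higher_pderiv_pcompose_linear poly_pcompose)
  ultimately show ?thesis by (simp only: poly_sum poly_smult)
qed

definition cell_formula :: "nat ^ 3 \<Rightarrow> real ^ 3 \<Rightarrow> nat \<Rightarrow> vertex_data \<Rightarrow> int ^ 3 \<Rightarrow> real ^ 3 \<Rightarrow> real ^ 3" where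
  "cell_formula N o' m d j x = (\<Sum>\<beta>\<in>corners. \<Sum>s\<in>multi_indices m.
     (\<Prod>i\<in>UNIV. poly (hermc m (vertex N o' j $ i) (spacing N $ i) (\<beta> $ i) (s $ i)) (x $ i)) *\<^sub>R d (j + \<beta>) s)"

lemma spacing_step: "spacing N $ i = step (N $ i)"
  by (simp add: spacing_def step_def)

lemma vertex_corner: "vertex N o' (j + \<beta>) $ i = vertex N o' j $ i + of_int (\<beta> $ i) * spacing N $ i"
  by (simp add: vertex_def algebra_simps)

lemma cell_formula_tensor_sum:
  "cell_formula N o' m d j = tensor_sum (corners \<times> multi_indices m)
     (\<lambda>(\<beta>, s) i. hermc m (vertex N o' j $ i) (spacing N $ i) (\<beta> $ i) (s $ i)) (\<lambda>(\<beta>, s). d (j + \<beta>) s)"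
  unfolding cell_formula_def tensor_sum_def sum.cartesian_product by (simp add: case_prod_unfold)

lemma cell_formula_interpolates:
  assumes N: "\<And>i. N $ i \<ge> 1" and \<beta>: "\<beta> \<in> corners" and \<alpha>: "\<alpha> \<in> multi_indices m"
  shows "mixed_partial \<alpha> (cell_formula N o' m d j) (vertex N o' (j + \<beta>)) = d (j + \<beta>) \<alpha>"
proof -
  have h: "spacing N $ i \<noteq> 0" for i using step_pos[OF N] by (simp add: spacing_step less_imp_neq[symmetric])
  have "mixed_partial \<alpha> (cell_formula N o' m d j) (vertex N o' (j + \<beta>)) =
      (\<Sum>(\<beta>', s)\<in>corners \<times> multi_indices m. (\<Prod>i\<in>UNIV. of_bool (\<beta> $ i = \<beta>' $ i \<and> \<alpha> $ i = s $ i)) *\<^sub>R d (j + \<beta>') s)"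
    unfolding cell_formula_tensor_sum mixed_partial_tensor_sum
    unfolding tensor_sum_def case_prod_unfold vertex_corner
    by (intro sum.cong refl arg_cong2[where f = scaleR] prod.cong hermc_vertex[OF h])
       (use \<beta> \<alpha> in \<open>auto simp: corners_iff multi_indices_def\<close>)
  also have "\<dots> = (\<Sum>(\<beta>', s)\<in>corners \<times> multi_indices m. if (\<beta>', s) = (\<beta>, \<alpha>) then d (j + \<beta>) \<alpha> else 0)"
  proof (intro sum.cong refl, clarify)
    fix \<beta>' s
    show "(\<Prod>i\<in>UNIV. of_bool (\<beta> $ i = \<beta>' $ i \<and> \<alpha> $ i = s $ i)) *\<^sub>R d (j + \<beta>') s = (if (\<beta>', s) = (\<beta>, \<alpha>) then d (j + \<beta>) \<alpha> else 0)"
    proof (cases "(\<beta>', s) = (\<beta>, \<alpha>)")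
      case False
      have "\<exists>i. \<not> (\<beta> $ i = \<beta>' $ i \<and> \<alpha> $ i = s $ i)"
      proof (rule ccontr)
        assume "\<not> ?thesis"
        then have "\<beta>' = \<beta>" "s = \<alpha>" by (auto simp: vec_eq_iff)
        with False show False by simp
      qed
      then have "(\<Prod>i\<in>UNIV. of_bool (\<beta> $ i = \<beta>' $ i \<and> \<alpha> $ i = s $ i)) = (0 :: real)"
        by (auto simp: prod_zero_iff)
      then show ?thesis using False by simp
    qed simp
  qed
  also have "\<dots> = d (j + \<beta>) \<alpha>"
    using \<beta> \<alpha> by (subst case_prod_unfold, subst prod.collapse, subst sum.delta) auto
  finally show ?thesis .
qed

text \<open>The one-dimensional Hermite expansion in every variable recovers a tensor-product polynomial from its vertex data.\<close>

lemma cell_formula_unique: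
  assumes N: "\<And>i. N $ i \<ge> 1" and p: "tensor_poly (2 * m + 1) p"
    and d: "\<And>\<beta> \<alpha>. \<beta> \<in> corners \<Longrightarrow> \<alpha> \<in> multi_indices m \<Longrightarrow> mixed_partial \<alpha> p (vertex N o' (j + \<beta>)) = d (j + \<beta>) \<alpha>"
  shows "p = cell_formula N o' m d j"
proof
  fix x
  have h: "spacing N $ i \<noteq> 0" for i using step_pos[OF N] by (simp add: spacing_step less_imp_neq[symmetric])
  obtain a where a: "p = tensor_sum (multi_indices (2 * m + 1)) (\<lambda>\<alpha> i. monom 1 (\<alpha> $ i)) a"
    using p by (auto simp: tensor_poly_iff_tensor_sum)
  define c where "c \<alpha> i \<beta> s = poly (pd s (monom 1 (\<alpha> $ i))) (vertex N o' j $ i + of_int \<beta> * spacing N $ i)" for \<alpha> :: "nat ^ 3" and i \<beta> s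
  define H where "H i \<beta> s = poly (hermc m (vertex N o' j $ i) (spacing N $ i) \<beta> s) (x $ i)" for i \<beta> s
  have dat: "(\<Sum>\<alpha>\<in>multi_indices (2 * m + 1). (\<Prod>i\<in>UNIV. c \<alpha> i (\<beta> $ i) (s $ i)) *\<^sub>R a \<alpha>) = d (j + \<beta>) s"
    if "\<beta> \<in> corners" "s \<in> multi_indices m" for \<beta> s
    using d[OF that] unfolding a mixed_partial_tensor_sum tensor_sum_def c_def vertex_corner .
  have "p x = (\<Sum>\<alpha>\<in>multi_indices (2 * m + 1). (\<Prod>i\<in>UNIV. \<Sum>\<beta>\<in>{0, 1}. \<Sum>s\<le>m. c \<alpha> i \<beta> s * H i \<beta> s) *\<^sub>R a \<alpha>)"
    unfolding a tensor_sum_def c_def H_def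
    by (intro sum.cong refl arg_cong2[where f = scaleR] prod.cong hermc_expansion h)
       (auto simp: multi_indices_def intro: order_trans[OF degree_monom_le])
  also have "\<dots> = (\<Sum>\<alpha>\<in>multi_indices (2 * m + 1). \<Sum>\<beta>\<in>corners. \<Sum>s\<in>multi_indices m.
      (\<Prod>i\<in>UNIV. H i (\<beta> $ i) (s $ i)) *\<^sub>R ((\<Prod>i\<in>UNIV. c \<alpha> i (\<beta> $ i) (s $ i)) *\<^sub>R a \<alpha>))"
    unfolding prod_sum_corners_indices scaleR_sum_left by (simp add: prod.distrib mult.commute)
  also have "\<dots> = (\<Sum>\<beta>\<in>corners. \<Sum>s\<in>multi_indices m. \<Sum>\<alpha>\<in>multi_indices (2 * m + 1).
      (\<Prod>i\<in>UNIV. H i (\<beta> $ i) (s $ i)) *\<^sub>R ((\<Prod>i\<in>UNIV. c \<alpha> i (\<beta> $ i) (s $ i)) *\<^sub>R a \<alpha>))"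
    by (subst sum.swap, rule sum.cong[OF refl], rule sum.swap)
  also have "\<dots> = (\<Sum>\<beta>\<in>corners. \<Sum>s\<in>multi_indices m. (\<Prod>i\<in>UNIV. H i (\<beta> $ i) (s $ i)) *\<^sub>R d (j + \<beta>) s)"
    unfolding scaleR_sum_right [symmetric] by (intro sum.cong refl) (simp only: dat)
  finally show "p x = cell_formula N o' m d j x" by (simp only: cell_formula_def H_def)
qed

lemma cell_poly_eq:
  assumes N: "\<And>i. N $ i \<ge> 1"
  shows "cell_poly N o' m d j = cell_formula N o' m d j"
  unfolding cell_poly_def
proof (rule the_equality)
  have "tensor_poly (2 * m + 1) (cell_formula N o' m d j)"
    unfolding cell_formula_tensor_sum
    by (rule tensor_poly_tensor_sum, unfold case_prod_unfold, rule degree_hermc) (auto simp: corners_iff)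
  then show "tensor_poly (2 * m + 1) (cell_formula N o' m d j) \<and>
    (\<forall>\<beta>. (\<forall>i. \<beta> $ i \<in> {0, 1}) \<longrightarrow> (\<forall>\<alpha>\<in>multi_indices m. mixed_partial \<alpha> (cell_formula N o' m d j) (vertex N o' (j + \<beta>)) = d (j + \<beta>) \<alpha>))"
    using cell_formula_interpolates[OF N] by (simp add: corners_iff)
next
  fix p
  assume "tensor_poly (2 * m + 1) p \<and>
    (\<forall>\<beta>. (\<forall>i. \<beta> $ i \<in> {0, 1}) \<longrightarrow> (\<forall>\<alpha>\<in>multi_indices m. mixed_partial \<alpha> p (vertex N o' (j + \<beta>)) = d (j + \<beta>) \<alpha>))"
  then show "p = cell_formula N o' m d j"
    by (intro cell_formula_unique N) (auto simp: corners_iff)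
qed

lemma tensor_poly_cell_poly:
  assumes "\<And>i. N $ i \<ge> 1" shows "tensor_poly (2 * m + 1) (cell_poly N o' m d j)"
  unfolding cell_poly_eq[OF assms] cell_formula_tensor_sum
  by (rule tensor_poly_tensor_sum, unfold case_prod_unfold, rule degree_hermc) (auto simp: corners_iff)

subsection \<open>The interpolant as a sum of tensor products\<close>

lemma periodic_data_multiple:
  assumes d: "periodic_data N m d" and \<alpha>: "\<alpha> \<in> multi_indices m"
  shows "d (j + axis i (int (N $ i) * n)) \<alpha> = d j \<alpha>"
proof -
  have nat: "d (j + axis i (int (N $ i) * int n)) \<alpha> = d j \<alpha>" for n j
  proof (induction n)
    case (Suc n)
    have e: "j + axis i (int (N $ i) * int (Suc n)) = (j + axis i (int (N $ i) * int n)) + axis i (int (N $ i))"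
      by (auto simp: vec_eq_iff axis_def algebra_simps)
    have "d ((j + axis i (int (N $ i) * int n)) + axis i (int (N $ i))) \<alpha> = d (j + axis i (int (N $ i) * int n)) \<alpha>"
      using d \<alpha> unfolding periodic_data_def by blast
    then show ?case by (simp only: e Suc)
  next
    case 0
    have e: "j + axis i (int (N $ i) * int 0) = j" by (auto simp: vec_eq_iff axis_def)
    show ?case by (simp only: e)
  qed
  show ?thesis
  proof (cases n)
    case (nonneg k) then show ?thesis using nat by simp
  next
    case (neg k)
    have e: "j = (j + axis i (int (N $ i) * n)) + axis i (int (N $ i) * int (Suc k))"
      unfolding neg by (auto simp: vec_eq_iff axis_def algebra_simps)
    have "d ((j + axis i (int (N $ i) * n)) + axis i (int (N $ i) * int (Suc k))) \<alpha> = d (j + axis i (int (N $ i) * n)) \<alpha>" by (rule nat)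
    then show ?thesis using e by metis
  qed
qed

definition cells :: "nat ^ 3 \<Rightarrow> (int ^ 3) set" where
  "cells N = vec_box (\<lambda>i. {0..<int (N $ i)})"

lemma finite_cells [simp]: "finite (cells N)"
  unfolding cells_def by (rule finite_vec_box) auto

definition vmod :: "int ^ 3 \<Rightarrow> nat ^ 3 \<Rightarrow> int ^ 3" where
  "vmod j N = (\<chi> i. j $ i mod int (N $ i))"

lemma periodic_data_mod:
  assumes d: "periodic_data N m d" and \<alpha>: "\<alpha> \<in> multi_indices m"
  shows "d (vmod j N) \<alpha> = d j \<alpha>"
proof -
  define v where "v i = axis i (int (N $ i) * (- (j $ i div int (N $ i))))" for i :: 3
  have "vmod j N = ((j + v 1) + v 2) + v 3"
    by (auto simp: vmod_def v_def vec_eq_iff axis_def forall_3 minus_mult_div_eq_mod[symmetric])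
  then show ?thesis by (simp only: v_def periodic_data_multiple[OF d \<alpha>])
qed

lemma vmod_cells: "(\<And>i. N $ i \<ge> 1) \<Longrightarrow> vmod j N \<in> cells N"
  using order_less_le_trans[OF zero_less_one] by (auto simp: cells_def vec_box_def vmod_def Suc_le_eq)

lemma sum_cells_delta:
  fixes F :: "int ^ 3 \<Rightarrow> 'b::real_vector"
  assumes N: "\<And>i. N $ i \<ge> 1"
  shows "(\<Sum>l\<in>cells N. (\<Prod>i\<in>UNIV. of_bool ((j $ i - l $ i) mod int (N $ i) = 0)) *\<^sub>R F l) = F (vmod j N)"
proof -
  have "(\<Prod>i\<in>UNIV. of_bool ((j $ i - l $ i) mod int (N $ i) = 0)) *\<^sub>R F l = (if l = vmod j N then F l else 0)"
    if "l \<in> cells N" for l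
  proof (cases "l = vmod j N")
    case True
    then have "(j $ i - l $ i) mod int (N $ i) = 0" for i by (simp add: vmod_def mod_diff_right_eq)
    then show ?thesis using True by simp
  next
    case False
    then obtain i where i: "l $ i \<noteq> j $ i mod int (N $ i)" by (auto simp: vec_eq_iff vmod_def)
    have "l $ i mod int (N $ i) = l $ i" using that by (auto simp: cells_def vec_box_def)
    then have "(j $ i - l $ i) mod int (N $ i) \<noteq> 0"
      using i mod_eq_dvd_iff[of "j $ i" "int (N $ i)" "l $ i"] by (auto simp: dvd_eq_mod_eq_0)
    then have "(\<Prod>i\<in>UNIV. of_bool ((j $ i - l $ i) mod int (N $ i) = 0)) = (0 :: real)"
      by (auto simp: prod_zero_iff)
    then show ?thesis using False by simp
  qed
  then have "(\<Sum>l\<in>cells N. (\<Prod>i\<in>UNIV. of_bool ((j $ i - l $ i) mod int (N $ i) = 0)) *\<^sub>R F l) = (\<Sum>l\<in>cells N. if l = vmod j N then F l else 0)"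
    by (rule sum.cong[OF refl])
  then show ?thesis using vmod_cells[of N j] N by (simp add: sum.delta)
qed

text \<open>
  On each cell the interpolant is a combination of products of Hermite basis polynomials.  The basis polynomials that belong to one vertex
  modulo the period fit together to a product of the one-dimensional splines \<open>Phi\<close>.
\<close>

lemma hb_interp_tensor:
  assumes N: "\<And>i. N $ i \<ge> 1" and d: "periodic_data N m d"
  shows "hb_interp N o' m d x = (\<Sum>l\<in>cells N. \<Sum>s\<in>multi_indices m.
     (\<Prod>i\<in>UNIV. Phi (N $ i) (o' $ i) m (l $ i) (s $ i) (x $ i)) *\<^sub>R d l s)"
proof -
  define \<kappa> where "\<kappa> = cell_of N o' x"
  define A where "A i \<beta> s = poly (hermc m (vertex N o' \<kappa> $ i) (spacing N $ i) \<beta> s) (x $ i)" for i \<beta> s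
  have h: "spacing N $ i \<noteq> 0" for i using step_pos[OF N] by (simp add: spacing_step less_imp_neq[symmetric])
  have Phi: "Phi (N $ i) (o' $ i) m l s (x $ i) = (\<Sum>\<beta>\<in>{0, 1}. of_bool ((\<kappa> $ i + \<beta> - l) mod int (N $ i) = 0) * A i \<beta> s)" for i l s
  proof -
    have u: "(x $ i - vertex N o' \<kappa> $ i) / spacing N $ i = frac ((x $ i - o' $ i) / step (N $ i))"
      using h[of i] by (simp add: vertex_def frac_def \<kappa>_def cell_of_def spacing_step field_simps)
    have "A i \<beta> s = step (N $ i) ^ s * poly (herm m \<beta> s) (frac ((x $ i - o' $ i) / step (N $ i)))" for \<beta>
      using poly_hermc[OF h, of 0 m "vertex N o' \<kappa> $ i" i \<beta> s "x $ i"] u by (simp add: A_def spacing_step)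
    moreover have "\<lfloor>(x $ i - o' $ i) / step (N $ i)\<rfloor> = \<kappa> $ i" by (simp add: \<kappa>_def cell_of_def spacing_step)
    ultimately show ?thesis by (simp add: Phi_def piecewise_def algebra_simps)
  qed
  have "(\<Sum>l\<in>cells N. \<Sum>s\<in>multi_indices m. (\<Prod>i\<in>UNIV. Phi (N $ i) (o' $ i) m (l $ i) (s $ i) (x $ i)) *\<^sub>R d l s)
      = (\<Sum>l\<in>cells N. \<Sum>s\<in>multi_indices m. \<Sum>\<beta>\<in>corners.
          (\<Prod>i\<in>UNIV. of_bool (((\<kappa> + \<beta>) $ i - l $ i) mod int (N $ i) = 0)) *\<^sub>R ((\<Prod>i\<in>UNIV. A i (\<beta> $ i) (s $ i)) *\<^sub>R d l s))"
  proof (intro sum.cong refl)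
    fix l s
    have "(\<Prod>i\<in>UNIV. Phi (N $ i) (o' $ i) m (l $ i) (s $ i) (x $ i)) =
        (\<Sum>\<beta>\<in>corners. \<Prod>i\<in>UNIV. of_bool ((\<kappa> $ i + \<beta> $ i - l $ i) mod int (N $ i) = 0) * A i (\<beta> $ i) (s $ i))"
      unfolding Phi corners_def
      by (rule prod_sum_vec[of "\<lambda>_. {0, 1}" "\<lambda>i \<beta>. of_bool ((\<kappa> $ i + \<beta> - l $ i) mod int (N $ i) = 0) * A i \<beta> (s $ i)"]) auto
    then show "(\<Prod>i\<in>UNIV. Phi (N $ i) (o' $ i) m (l $ i) (s $ i) (x $ i)) *\<^sub>R d l s = (\<Sum>\<beta>\<in>corners.
          (\<Prod>i\<in>UNIV. of_bool (((\<kappa> + \<beta>) $ i - l $ i) mod int (N $ i) = 0)) *\<^sub>R ((\<Prod>i\<in>UNIV. A i (\<beta> $ i) (s $ i)) *\<^sub>R d l s))"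
      by (simp only: scaleR_sum_left prod.distrib scaleR_scaleR vector_add_component)
  qed
  also have "\<dots> = (\<Sum>\<beta>\<in>corners. \<Sum>s\<in>multi_indices m. \<Sum>l\<in>cells N.
          (\<Prod>i\<in>UNIV. of_bool (((\<kappa> + \<beta>) $ i - l $ i) mod int (N $ i) = 0)) *\<^sub>R ((\<Prod>i\<in>UNIV. A i (\<beta> $ i) (s $ i)) *\<^sub>R d l s))"
    by (subst sum.swap, subst sum.swap[of _ "multi_indices m" corners, symmetric]) (intro sum.cong refl sum.swap)
  also have "\<dots> = (\<Sum>\<beta>\<in>corners. \<Sum>s\<in>multi_indices m. (\<Prod>i\<in>UNIV. A i (\<beta> $ i) (s $ i)) *\<^sub>R d (\<kappa> + \<beta>) s)"
    using N d by (intro sum.cong refl) (simp only: sum_cells_delta periodic_data_mod)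
  also have "\<dots> = hb_interp N o' m d x"
    by (simp only: hb_interp_def cell_poly_eq[OF N] cell_formula_def A_def \<kappa>_def)
  finally show ?thesis ..
qed

section \<open>Fourier coefficients of splines\<close>

subsection \<open>Summability over the lattice\<close>

lemma has_sum_fin_sum:
  fixes f :: "'i \<Rightarrow> 'k \<Rightarrow> 'b::topological_comm_monoid_add"
  assumes "finite A" "\<And>i. i \<in> A \<Longrightarrow> (f i has_sum s i) S"
  shows "((\<lambda>k. \<Sum>i\<in>A. f i k) has_sum (\<Sum>i\<in>A. s i)) S"
  using assms by (induction A rule: finite_induct) (auto intro: has_sum_add)

lemma summable_on_fin_sum:
  fixes f :: "'i \<Rightarrow> 'k \<Rightarrow> 'b::topological_comm_monoid_add"
  assumes "finite A" "\<And>i. i \<in> A \<Longrightarrow> f i summable_on S"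
  shows "(\<lambda>k. \<Sum>i\<in>A. f i k) summable_on S"
  using assms by (induction A rule: finite_induct) (auto intro: summable_on_add)

lemma summable_int_quadratic: "(\<lambda>n :: int. 1 / (1 + (real_of_int n)\<^sup>2)) summable_on UNIV"
proof -
  have nat: "(\<lambda>n :: nat. 1 / (1 + (real n)\<^sup>2)) summable_on UNIV"
  proof (rule norm_summable_imp_summable_on)
    have "summable (\<lambda>n. 1 / (real (Suc n))\<^sup>2)"
      using inverse_power_summable[of 2, where 'a = real] by (subst summable_Suc_iff) (simp add: inverse_eq_divide)
    then have "summable (\<lambda>n. 1 / (1 + (real (Suc n))\<^sup>2))"
      by (rule summable_comparison_test_ev[rotated]) (auto intro!: always_eventually frac_le)
    then have "summable (\<lambda>n. 1 / (1 + (real n)\<^sup>2))" by (subst (asm) summable_Suc_iff)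
    then show "summable (\<lambda>n. norm (1 / (1 + (real n)\<^sup>2)))" by simp
  qed
  have 1: "(\<lambda>n :: int. 1 / (1 + (real_of_int n)\<^sup>2)) summable_on (range int)"
    by (subst summable_on_reindex) (auto simp: o_def nat)
  have 2: "(\<lambda>n :: int. 1 / (1 + (real_of_int n)\<^sup>2)) summable_on (range (\<lambda>n. - int n))"
    by (subst summable_on_reindex) (auto simp: o_def nat inj_on_def)
  have U: "range int \<union> range (\<lambda>n. - int n) = UNIV"
    by (auto intro: int_cases2)
  from summable_on_union[OF 1 2] show ?thesis unfolding U .
qed

lemma summable_vec_prod:
  fixes f :: "int \<Rightarrow> real"
  assumes f: "f summable_on UNIV" and nn: "\<And>n. f n \<ge> 0"
  shows "(\<lambda>k :: int ^ 3. \<Prod>i\<in>UNIV. f (k $ i)) summable_on UNIV"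
proof (rule nonneg_bdd_above_summable_on)
  show "bdd_above (sum (\<lambda>k :: int ^ 3. \<Prod>i\<in>UNIV. f (k $ i)) ` {F. F \<subseteq> UNIV \<and> finite F})"
  proof (rule bdd_aboveI2)
    fix F :: "(int ^ 3) set" assume "F \<in> {F. F \<subseteq> UNIV \<and> finite F}"
    then have F: "finite F" by simp
    define A where "A i = (\<lambda>k. k $ i) ` F" for i
    have A: "finite (A i)" for i using F by (simp add: A_def)
    have "(\<Sum>k\<in>F. \<Prod>i\<in>UNIV. f (k $ i)) \<le> (\<Sum>k\<in>vec_box A. \<Prod>i\<in>UNIV. f (k $ i))"
      by (intro sum_mono2 finite_vec_box A) (auto simp: vec_box_def A_def intro!: prod_nonneg nn)
    also have "\<dots> = (\<Prod>i\<in>UNIV. \<Sum>n\<in>A i. f n)" by (rule prod_sum_vec[OF A, symmetric])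
    also have "\<dots> \<le> (\<Prod>i\<in>(UNIV :: 3 set). infsum f UNIV)"
      by (intro prod_mono conjI sum_nonneg nn finite_sum_le_infsum f A) auto
    finally show "(\<Sum>k\<in>F. \<Prod>i\<in>UNIV. f (k $ i)) \<le> (\<Prod>i\<in>(UNIV :: 3 set). infsum f UNIV)" .
  qed
qed (auto intro!: prod_nonneg nn)

subsection \<open>Fourier coefficients of splines\<close>

definition phi_hat :: "nat \<Rightarrow> real \<Rightarrow> nat \<Rightarrow> int \<Rightarrow> nat \<Rightarrow> int \<Rightarrow> complex" where
  "phi_hat N o' m l s k = mean1 (\<lambda>t. of_real (Phi N o' m l s t) * cis (of_int (- k) * t))"

definition PhiT :: "nat ^ 3 \<Rightarrow> real ^ 3 \<Rightarrow> nat \<Rightarrow> int ^ 3 \<Rightarrow> nat ^ 3 \<Rightarrow> real ^ 3 \<Rightarrow> complex" where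
  "PhiT N o' m l s x = (\<Prod>i\<in>UNIV. of_real (Phi (N $ i) (o' $ i) m (l $ i) (s $ i) (x $ i)))"

definition PsiT :: "nat ^ 3 \<Rightarrow> real ^ 3 \<Rightarrow> nat \<Rightarrow> int ^ 3 \<Rightarrow> nat ^ 3 \<Rightarrow> real ^ 3 \<Rightarrow> complex" where
  "PsiT N o' m l s x = (\<Prod>i\<in>UNIV. of_real (Psi (N $ i) (o' $ i) m (l $ i) (s $ i) (x $ i)))"

lemma tensor_bounded:
  fixes f :: "3 \<Rightarrow> real \<Rightarrow> real"
  assumes "\<And>i. \<exists>B. \<forall>t. \<bar>f i t\<bar> \<le> B"
  shows "\<exists>B. \<forall>x :: real ^ 3. cmod (\<Prod>i\<in>UNIV. of_real (f i (x $ i))) \<le> B"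
proof -
  from assms have "\<forall>i. \<exists>B. \<forall>t. \<bar>f i t\<bar> \<le> B" ..
  from choice[OF this] obtain B where "\<And>i t. \<bar>f i t\<bar> \<le> B i" by blast
  then have "cmod (\<Prod>i\<in>UNIV. of_real (f i (x $ i))) \<le> (\<Prod>i\<in>UNIV. B i)" for x :: "real ^ 3"
    by (simp add: prod_norm [symmetric]) (auto intro!: prod_mono)
  then show ?thesis by blast
qed

lemma PhiT_measurable [measurable]: "PhiT N o' m l s \<in> borel_measurable borel"
  unfolding PhiT_def[abs_def] by measurable
lemma PsiT_measurable [measurable]: "PsiT N o' m l s \<in> borel_measurable borel"
  unfolding PsiT_def[abs_def] by measurable

lemma sqi_PhiT: "TM.sqi (PhiT N o' m l s)"
proof -
  obtain B where B: "\<And>x. cmod (PhiT N o' m l s x) \<le> B"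
    using tensor_bounded[of "\<lambda>i. Phi (N $ i) (o' $ i) m (l $ i) (s $ i)", OF Phi_bounded] unfolding PhiT_def by blast
  show ?thesis by (rule TM.sqi_bounded[of _ B]) (auto simp: B)
qed

lemma sqi_PsiT: "TM.sqi (PsiT N o' m l s)"
proof -
  obtain B where B: "\<And>x. cmod (PsiT N o' m l s x) \<le> B"
    using tensor_bounded[of "\<lambda>i. Psi (N $ i) (o' $ i) m (l $ i) (s $ i)", OF Psi_bounded] unfolding PsiT_def by blast
  show ?thesis by (rule TM.sqi_bounded[of _ B]) (auto simp: B)
qed

lemma periodic_PhiT: "(\<And>i. N $ i \<ge> 1) \<Longrightarrow> PhiT N o' m l s (x + axis i (2 * pi)) = PhiT N o' m l s x"
  unfolding PhiT_def by (intro prod.cong refl) (auto simp: axis_def Phi_periodic)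

lemma periodic_PsiT: "(\<And>i. N $ i \<ge> 1) \<Longrightarrow> PsiT N o' m l s (x + axis i (2 * pi)) = PsiT N o' m l s x"
  unfolding PsiT_def by (intro prod.cong refl) (auto simp: axis_def Psi_periodic)

lemma cf_tensor:
  fixes f :: "3 \<Rightarrow> real \<Rightarrow> real"
  assumes [measurable]: "\<And>i. f i \<in> borel_measurable borel" and B: "\<And>i. \<exists>B. \<forall>t. \<bar>f i t\<bar> \<le> B"
  shows "TM.cf (\<lambda>x. \<Prod>i\<in>UNIV. of_real (f i (x $ i))) k = (\<Prod>i\<in>UNIV. mean1 (\<lambda>t. of_real (f i t) * cis (of_int (- (k $ i)) * t)))"
proof -
  have "TM.cf (\<lambda>x. \<Prod>i\<in>UNIV. of_real (f i (x $ i))) k = (\<integral>x. (\<Prod>i\<in>UNIV. of_real (f i (x $ i)) * cis (of_int (- (k $ i)) * x $ i)) \<partial>TM)"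
    unfolding TM.cf_def TM.ip_def wave_uminus [symmetric] unfolding wave_prod by (simp only: prod.distrib vector_uminus_component)
  also have "\<dots> = (\<Prod>i\<in>UNIV. mean1 (\<lambda>t. of_real (f i t) * cis (of_int (- (k $ i)) * t)))"
  proof (rule TM_tensor[of "\<lambda>i t. of_real (f i t) * cis (of_int (- (k $ i)) * t)"])
    fix i
    obtain C where C: "\<And>t. \<bar>f i t\<bar> \<le> C" using B by blast
    show "set_integrable lborel {0..2 * pi} (\<lambda>t. of_real (f i t) * cis (of_int (- (k $ i)) * t))"
      by (rule set_integrable_bounded_interval[of _ C]) (auto simp: norm_mult C)
  qed measurable
  finally show ?thesis .
qed

lemma cf_PhiT: "TM.cf (PhiT N o' m l s) k = (\<Prod>i\<in>UNIV. phi_hat (N $ i) (o' $ i) m (l $ i) (s $ i) (k $ i))"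
  unfolding PhiT_def[abs_def] phi_hat_def by (rule cf_tensor[OF Phi_measurable Phi_bounded])

lemma cf_PsiT:
  assumes N: "\<And>i. N $ i \<ge> 1"
  shows "TM.cf (PsiT N o' m l s) k = top_symbol m k * TM.cf (PhiT N o' m l s) k"
proof -
  have "TM.cf (PsiT N o' m l s) k = (\<Prod>i\<in>UNIV. mean1 (\<lambda>t. of_real (Psi (N $ i) (o' $ i) m (l $ i) (s $ i) t) * cis (of_int (- (k $ i)) * t)))"
    unfolding PsiT_def[abs_def] by (rule cf_tensor[OF Psi_measurable Psi_bounded])
  also have "\<dots> = (\<Prod>i\<in>UNIV. (\<i> * of_int (k $ i)) ^ Suc m * phi_hat (N $ i) (o' $ i) m (l $ i) (s $ i) (k $ i))"
    unfolding phi_hat_def mean1_Psi_Phi[OF N] by simp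
  also have "\<dots> = top_symbol m k * TM.cf (PhiT N o' m l s) k"
    by (simp add: cf_PhiT deriv_symbol_def prod.distrib)
  finally show ?thesis .
qed

definition spline_field :: "nat ^ 3 \<Rightarrow> real ^ 3 \<Rightarrow> nat \<Rightarrow> vertex_data \<Rightarrow> real ^ 3 \<Rightarrow> complex ^ 3" where
  "spline_field N o' m d = complexify (hb_interp N o' m d)"

text \<open>The derivative of order \<open>m + 1\<close> in each variable of \<open>spline_field\<close>.\<close>

definition spline_top :: "nat ^ 3 \<Rightarrow> real ^ 3 \<Rightarrow> nat \<Rightarrow> vertex_data \<Rightarrow> real ^ 3 \<Rightarrow> complex ^ 3" where
  "spline_top N o' m d x = (\<chi> c. \<Sum>l\<in>cells N. \<Sum>s\<in>multi_indices m. of_real (d l s $ c) * PsiT N o' m l s x)"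

lemma spline_field_nth:
  assumes "\<And>i. N $ i \<ge> 1" "periodic_data N m d"
  shows "spline_field N o' m d x $ c = (\<Sum>l\<in>cells N. \<Sum>s\<in>multi_indices m. of_real (d l s $ c) * PhiT N o' m l s x)"
  unfolding spline_field_def complexify_def hb_interp_tensor[OF assms]
  by (simp add: PhiT_def mult.commute)

lemma sqi_double_sum:
  assumes "\<And>l s. TM.sqi (T l s)" "finite A" "finite B"
  shows "TM.sqi (\<lambda>x. \<Sum>l\<in>A. \<Sum>s\<in>B. a l s * T l s x)"
    and "TM.sqi h \<Longrightarrow> TM.ip (\<lambda>x. \<Sum>l\<in>A. \<Sum>s\<in>B. a l s * T l s x) h = (\<Sum>l\<in>A. \<Sum>s\<in>B. a l s * TM.ip (T l s) h)"
  using assms by (auto simp: TM.ip_sum TM.sqi_sum TM.sqi_scale TM.ip_scale)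

context
  fixes N :: "nat ^ 3" and o' :: "real ^ 3" and m :: nat and d :: vertex_data
  assumes N: "\<And>i. N $ i \<ge> 1" and d: "periodic_data N m d"
begin

lemma periodic_L2_spline_field: "periodic_L2 (spline_field N o' m d)"
  and periodic_L2_spline_top: "periodic_L2 (spline_top N o' m d)"
  unfolding periodic_L2_iff
  by (auto simp: periodic_def vec_eq_iff spline_field_nth[OF N d] spline_top_def periodic_PhiT[OF N] periodic_PsiT[OF N]
      intro!: sqi_double_sum sqi_PhiT sqi_PsiT)

lemma fourier_spline_field:
  "fourier_coeff (spline_field N o' m d) k $ c = (\<Sum>l\<in>cells N. \<Sum>s\<in>multi_indices m. of_real (d l s $ c) * TM.cf (PhiT N o' m l s) k)"
  unfolding fourier_coeff_nth[OF periodic_L2_spline_field] spline_field_nth[OF N d] TM.cf_def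
  by (rule sqi_double_sum(2)) (auto intro: sqi_PhiT TM.sqi_e)

lemma fourier_spline_top:
  "fourier_coeff (spline_top N o' m d) k = top_symbol m k *s fourier_coeff (spline_field N o' m d) k"
proof -
  have "TM.cf (\<lambda>x. spline_top N o' m d x $ c) k = (\<Sum>l\<in>cells N. \<Sum>s\<in>multi_indices m. of_real (d l s $ c) * TM.cf (PsiT N o' m l s) k)" for c
    unfolding spline_top_def vec_lambda_beta TM.cf_def
    by (rule sqi_double_sum(2)) (auto intro: sqi_PsiT TM.sqi_e)
  then show ?thesis
    by (simp add: vec_eq_iff fourier_coeff_nth[OF periodic_L2_spline_top] fourier_spline_field cf_PsiT[OF N] sum_distrib_left mult_ac)
qed

lemma hb_regular_spline_field: "hb_regular m (spline_field N o' m d)"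
  unfolding hb_regular_def fourier_spline_top [symmetric]
  using periodic_L2_spline_field square_summable_fourier[OF periodic_L2_spline_top] by blast

text \<open>Every one-dimensional factor decays quadratically, also for \<open>m = 0\<close>, where the spline is merely continuous.\<close>

lemma abs_summable_spline_field:
  "(\<lambda>k. cmod (fourier_coeff (spline_field N o' m d) k $ c)) summable_on UNIV"
proof -
  have "(\<lambda>k. cmod (TM.cf (PhiT N o' m l s) k)) summable_on UNIV" for l s
  proof -
    have "\<exists>C\<ge>0. \<forall>k. cmod (phi_hat (N $ i) (o' $ i) m (l $ i) (s $ i) k) \<le> C / (1 + (of_int k)\<^sup>2)" for i
    proof -
      obtain C where C: "C \<ge> 0" "\<And>k. cmod (mean1 (\<lambda>t. of_real (Phi (N $ i) (o' $ i) m (l $ i) (s $ i) t) * cis (of_int k * t))) \<le> C / (1 + (of_int k)\<^sup>2)"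
        using mean1_Phi_bound[OF N] by metis
      show ?thesis unfolding phi_hat_def
      proof (intro exI[of _ C] conjI allI C(1))
        fix k :: int
        show "cmod (mean1 (\<lambda>t. of_real (Phi (N $ i) (o' $ i) m (l $ i) (s $ i) t) * cis (of_int (- k) * t))) \<le> C / (1 + (of_int k)\<^sup>2)"
          using C(2)[of "- k"] by simp
      qed
    qed
    then have "\<forall>i. \<exists>C\<ge>0. \<forall>k. cmod (phi_hat (N $ i) (o' $ i) m (l $ i) (s $ i) k) \<le> C / (1 + (of_int k)\<^sup>2)" ..
    from choice[OF this] obtain C where C: "\<And>i. C i \<ge> 0" "\<And>i k. cmod (phi_hat (N $ i) (o' $ i) m (l $ i) (s $ i) k) \<le> C i / (1 + (of_int k)\<^sup>2)"
      by blast
    have "(\<lambda>k :: int ^ 3. (\<Prod>i\<in>UNIV. C i) * (\<Prod>i\<in>UNIV. 1 / (1 + (real_of_int (k $ i))\<^sup>2))) summable_on UNIV"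
      by (intro summable_on_cmult_right summable_vec_prod[OF summable_int_quadratic]) auto
    then show ?thesis
    proof (rule summable_on_comparison_test)
      fix k :: "int ^ 3"
      have "cmod (TM.cf (PhiT N o' m l s) k) = (\<Prod>i\<in>UNIV. cmod (phi_hat (N $ i) (o' $ i) m (l $ i) (s $ i) (k $ i)))"
        unfolding cf_PhiT by (simp add: prod_norm)
      also have "\<dots> \<le> (\<Prod>i\<in>UNIV. C i * (1 / (1 + (real_of_int (k $ i))\<^sup>2)))"
        by (intro prod_mono) (use C in auto)
      also have "\<dots> = (\<Prod>i\<in>UNIV. C i) * (\<Prod>i\<in>UNIV. 1 / (1 + (real_of_int (k $ i))\<^sup>2))" by (rule prod.distrib)
      finally show "cmod (TM.cf (PhiT N o' m l s) k) \<le> (\<Prod>i\<in>UNIV. C i) * (\<Prod>i\<in>UNIV. 1 / (1 + (real_of_int (k $ i))\<^sup>2))" .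
    qed auto
  qed
  then have "(\<lambda>k. \<Sum>l\<in>cells N. \<Sum>s\<in>multi_indices m. \<bar>d l s $ c\<bar> * cmod (TM.cf (PhiT N o' m l s) k)) summable_on UNIV"
    by (intro summable_on_fin_sum summable_on_cmult_right) auto
  then show ?thesis
  proof (rule summable_on_comparison_test)
    show "cmod (fourier_coeff (spline_field N o' m d) k $ c) \<le> (\<Sum>l\<in>cells N. \<Sum>s\<in>multi_indices m. \<bar>d l s $ c\<bar> * cmod (TM.cf (PhiT N o' m l s) k))" for k
      unfolding fourier_spline_field
      by (intro order_trans[OF norm_sum] sum_mono) (simp add: norm_mult)
  qed auto
qed

end

subsection \<open>Vertex functionals\<close>

definition tensor_weight :: "nat ^ 3 \<Rightarrow> nat \<Rightarrow> int ^ 3 \<Rightarrow> nat ^ 3 \<Rightarrow> int ^ 3 \<Rightarrow> int ^ 3 \<Rightarrow> nat ^ 3 \<Rightarrow> real" where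
  "tensor_weight N m l s \<kappa> \<beta> j = (\<Prod>i\<in>UNIV. weight (N $ i) m (l $ i) (s $ i) (\<kappa> $ i) (\<beta> $ i) (j $ i))"

lemma sum_lessThan_int: "(\<Sum>\<kappa><n. F (int \<kappa>)) = (\<Sum>\<kappa>\<in>{0..<int n}. F \<kappa>)"
  by (rule sum.reindex_bij_witness[of _ nat int]) auto

lemma prod_sum_cells:
  fixes f :: "3 \<Rightarrow> int \<Rightarrow> int \<Rightarrow> nat \<Rightarrow> complex"
  shows "(\<Prod>i\<in>UNIV. \<Sum>\<kappa><N $ i. \<Sum>\<beta>\<in>{0, 1}. \<Sum>j\<le>m. f i (int \<kappa>) \<beta> j) =
    (\<Sum>\<kappa>\<in>cells N. \<Sum>\<beta>\<in>corners. \<Sum>j\<in>multi_indices m. \<Prod>i\<in>UNIV. f i (\<kappa> $ i) (\<beta> $ i) (j $ i))"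
proof -
  have "(\<Prod>i\<in>UNIV. \<Sum>\<kappa><N $ i. \<Sum>\<beta>\<in>{0, 1}. \<Sum>j\<le>m. f i (int \<kappa>) \<beta> j)
      = (\<Prod>i\<in>UNIV. \<Sum>\<kappa>\<in>{0..<int (N $ i)}. \<Sum>\<beta>\<in>{0, 1}. \<Sum>j\<le>m. f i \<kappa> \<beta> j)"
    by (intro prod.cong refl sum_lessThan_int[of "\<lambda>\<kappa>. \<Sum>\<beta>\<in>{0, 1}. \<Sum>j\<le>m. f _ \<kappa> \<beta> j"])
  also have "\<dots> = (\<Sum>\<kappa>\<in>cells N. \<Prod>i\<in>UNIV. \<Sum>\<beta>\<in>{0, 1}. \<Sum>j\<le>m. f i (\<kappa> $ i) \<beta> j)"
    unfolding cells_def by (rule prod_sum_vec) auto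
  also have "\<dots> = (\<Sum>\<kappa>\<in>cells N. \<Sum>\<beta>\<in>corners. \<Sum>j\<in>multi_indices m. \<Prod>i\<in>UNIV. f i (\<kappa> $ i) (\<beta> $ i) (j $ i))"
    by (intro sum.cong refl prod_sum_corners_indices)
  finally show ?thesis .
qed

text \<open>The symbol of the functional that pairs the top derivative of a function with the top derivative of a basis spline.\<close>

definition Theta :: "nat ^ 3 \<Rightarrow> real ^ 3 \<Rightarrow> nat \<Rightarrow> int ^ 3 \<Rightarrow> nat ^ 3 \<Rightarrow> int ^ 3 \<Rightarrow> complex" where
  "Theta N o' m l s k = top_symbol m k * cnj (TM.cf (PsiT N o' m l s) k)"

lemma mean1_cnj: "cnj (mean1 f) = mean1 (\<lambda>t. cnj (f t))"
  unfolding mean1_def set_lebesgue_integral_def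
  using Bochner_Integration.integral_cnj[of lborel "\<lambda>t. indicator {0..2 * pi} t *\<^sub>R f t"] by (simp add: scaleR_conv_of_real)

text \<open>For a wave the functional evaluates only derivatives of order at most \<open>m\<close> at the vertices.\<close>

lemma Theta_vertex:
  assumes N: "\<And>i. N $ i \<ge> 1"
  shows "Theta N o' m l s k = (\<Sum>\<kappa>\<in>cells N. \<Sum>\<beta>\<in>corners. \<Sum>j\<in>multi_indices m.
    of_real (tensor_weight N m l s \<kappa> \<beta> j) * (deriv_symbol j k * wave k (vertex N o' (\<kappa> + \<beta>))))"
proof -
  have "cnj (TM.cf (PsiT N o' m l s) k) = (\<Prod>i\<in>UNIV. mean1 (\<lambda>t. of_real (Psi (N $ i) (o' $ i) m (l $ i) (s $ i) t) * cis (of_int (k $ i) * t)))"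
    unfolding PsiT_def[abs_def] cf_tensor[OF Psi_measurable Psi_bounded] cnj_prod mean1_cnj
    by (simp add: cis_cnj)
  then have "Theta N o' m l s k = (\<Prod>i\<in>UNIV. (\<i> * of_int (k $ i)) ^ Suc m * mean1 (\<lambda>t. of_real (Psi (N $ i) (o' $ i) m (l $ i) (s $ i) t) * cis (of_int (k $ i) * t)))"
    by (simp add: Theta_def deriv_symbol_def prod.distrib)
  also have "\<dots> = (\<Prod>i\<in>UNIV. \<Sum>\<kappa><N $ i. \<Sum>\<beta>\<in>{0, 1}. \<Sum>j\<le>m. of_real (weight (N $ i) m (l $ i) (s $ i) (int \<kappa>) \<beta> j) *
       ((\<i> * of_int (k $ i)) ^ j * cis (of_int (k $ i) * (o' $ i + step (N $ i) * of_int (int \<kappa> + \<beta>)))))"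
    by (simp only: mean1_Psi_cis[OF N])
  also have "\<dots> = (\<Sum>\<kappa>\<in>cells N. \<Sum>\<beta>\<in>corners. \<Sum>j\<in>multi_indices m. \<Prod>i\<in>UNIV. of_real (weight (N $ i) m (l $ i) (s $ i) (\<kappa> $ i) (\<beta> $ i) (j $ i)) *
       ((\<i> * of_int (k $ i)) ^ (j $ i) * cis (of_int (k $ i) * (o' $ i + step (N $ i) * of_int (\<kappa> $ i + \<beta> $ i)))))"
    by (rule prod_sum_cells)
  also have "\<dots> = (\<Sum>\<kappa>\<in>cells N. \<Sum>\<beta>\<in>corners. \<Sum>j\<in>multi_indices m.
    of_real (tensor_weight N m l s \<kappa> \<beta> j) * (deriv_symbol j k * wave k (vertex N o' (\<kappa> + \<beta>))))"
    unfolding wave_prod tensor_weight_def deriv_symbol_def prod.distrib of_real_prod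
    by (simp add: vertex_def spacing_step mult.commute)
  finally show ?thesis .
qed

lemma sum_swap4:
  "(\<Sum>s\<in>S. \<Sum>a\<in>A. \<Sum>b\<in>B. \<Sum>c\<in>C. F s a b c) = (\<Sum>a\<in>A. \<Sum>b\<in>B. \<Sum>c\<in>C. \<Sum>s\<in>S. F s a b c)"
proof -
  have "(\<Sum>s\<in>S. \<Sum>a\<in>A. \<Sum>b\<in>B. \<Sum>c\<in>C. F s a b c) = (\<Sum>a\<in>A. \<Sum>s\<in>S. \<Sum>b\<in>B. \<Sum>c\<in>C. F s a b c)" by (rule sum.swap)
  also have "\<dots> = (\<Sum>a\<in>A. \<Sum>b\<in>B. \<Sum>s\<in>S. \<Sum>c\<in>C. F s a b c)" by (intro sum.cong refl sum.swap)
  also have "\<dots> = (\<Sum>a\<in>A. \<Sum>b\<in>B. \<Sum>c\<in>C. \<Sum>s\<in>S. F s a b c)" by (intro sum.cong refl sum.swap)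
  finally show ?thesis .
qed

text \<open>The functional evaluates a spline on the same grid by its vertex data, with the weights that occur for waves.\<close>

lemma Theta_spline:
  assumes N: "\<And>i. N $ i \<ge> 1" and d: "periodic_data N m d"
  shows "((\<lambda>k. Theta N o' m l s k * fourier_coeff (spline_field N o' m d) k $ c) has_sum
    (\<Sum>\<kappa>\<in>cells N. \<Sum>\<beta>\<in>corners. \<Sum>j\<in>multi_indices m. of_real (tensor_weight N m l s \<kappa> \<beta> j) * of_real (d (\<kappa> + \<beta>) j $ c))) UNIV"
proof -
  let ?w = "\<lambda>\<kappa> \<beta> j. complex_of_real (tensor_weight N m l s \<kappa> \<beta> j)"
  let ?c = "\<lambda>\<kappa> \<beta> l'. \<Prod>i\<in>UNIV. of_bool (((\<kappa> + \<beta>) $ i - l' $ i) mod int (N $ i) = 0) :: complex"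
  let ?r = "\<lambda>\<kappa> \<beta> l'. \<Prod>i\<in>UNIV. of_bool (((\<kappa> + \<beta>) $ i - l' $ i) mod int (N $ i) = 0) :: real"
  define F where "F x = spline_top N o' m d x $ c" for x
  have F: "TM.sqi F" unfolding F_def by (rule periodic_L2D[OF periodic_L2_spline_top[OF N d]])
  have cf: "TM.cf F k = top_symbol m k * fourier_coeff (spline_field N o' m d) k $ c" for k
  proof -
    have "TM.cf F k = fourier_coeff (spline_top N o' m d) k $ c"
      unfolding F_def by (rule fourier_coeff_nth[OF periodic_L2_spline_top[OF N d], symmetric])
    then show ?thesis by (simp only: fourier_spline_top[OF N d] vector_smult_component)
  qed
  have "((\<lambda>k. TM.cf F k * cnj (TM.cf (PsiT N o' m l s) k)) has_sum TM.ip F (PsiT N o' m l s)) UNIV"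
    by (rule TM.Parseval[OF F sqi_PsiT])
  moreover have "TM.cf F k * cnj (TM.cf (PsiT N o' m l s) k) = Theta N o' m l s k * fourier_coeff (spline_field N o' m d) k $ c" for k
    by (simp add: cf Theta_def)
  moreover have "TM.ip F (PsiT N o' m l s) = (\<Sum>\<kappa>\<in>cells N. \<Sum>\<beta>\<in>corners. \<Sum>j\<in>multi_indices m. ?w \<kappa> \<beta> j * of_real (d (\<kappa> + \<beta>) j $ c))"
  proof -
    have ip: "TM.ip (PsiT N o' m l' s') (PsiT N o' m l s) = (\<Sum>\<kappa>\<in>cells N. \<Sum>\<beta>\<in>corners. \<Sum>j\<in>multi_indices m.
        ?w \<kappa> \<beta> j * (?c \<kappa> \<beta> l' * of_bool (j = s')))"
      if s': "s' \<in> multi_indices m" for l' s'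
    proof -
      have "TM.ip (PsiT N o' m l' s') (PsiT N o' m l s) = (\<integral>x. (\<Prod>i\<in>UNIV. of_real (Psi (N $ i) (o' $ i) m (l $ i) (s $ i) (x $ i)) * of_real (Psi (N $ i) (o' $ i) m (l' $ i) (s' $ i) (x $ i))) \<partial>TM)"
        unfolding TM.ip_def PsiT_def by (simp add: prod.distrib mult.commute)
      also have "\<dots> = (\<Prod>i\<in>UNIV. mean1 (\<lambda>t. of_real (Psi (N $ i) (o' $ i) m (l $ i) (s $ i) t) * of_real (Psi (N $ i) (o' $ i) m (l' $ i) (s' $ i) t)))"
      proof (rule TM_tensor[of "\<lambda>i t. of_real (Psi (N $ i) (o' $ i) m (l $ i) (s $ i) t) * of_real (Psi (N $ i) (o' $ i) m (l' $ i) (s' $ i) t)"])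
        fix i
        obtain B B' where "\<And>t. \<bar>Psi (N $ i) (o' $ i) m (l $ i) (s $ i) t\<bar> \<le> B" "\<And>t. \<bar>Psi (N $ i) (o' $ i) m (l' $ i) (s' $ i) t\<bar> \<le> B'"
          using Psi_bounded by metis
        then show "set_integrable lborel {0..2 * pi} (\<lambda>t. of_real (Psi (N $ i) (o' $ i) m (l $ i) (s $ i) t) * complex_of_real (Psi (N $ i) (o' $ i) m (l' $ i) (s' $ i) t))"
          by (intro set_integrable_bounded_interval[of _ "B * B'"]) (auto simp: norm_mult intro!: mult_mono')
      qed measurable
      also have "\<dots> = (\<Prod>i\<in>UNIV. \<Sum>\<kappa><N $ i. \<Sum>\<beta>\<in>{0, 1}. \<Sum>j\<le>m. of_real (weight (N $ i) m (l $ i) (s $ i) (int \<kappa>) \<beta> j) *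
          of_bool ((int \<kappa> + \<beta> - l' $ i) mod int (N $ i) = 0 \<and> j = s' $ i))"
        using s' by (intro prod.cong refl mean1_Psi_Psi N) (auto simp: multi_indices_def)
      also have "\<dots> = (\<Sum>\<kappa>\<in>cells N. \<Sum>\<beta>\<in>corners. \<Sum>j\<in>multi_indices m. \<Prod>i\<in>UNIV. of_real (weight (N $ i) m (l $ i) (s $ i) (\<kappa> $ i) (\<beta> $ i) (j $ i)) *
          of_bool ((\<kappa> $ i + \<beta> $ i - l' $ i) mod int (N $ i) = 0 \<and> j $ i = s' $ i))"
        by (rule prod_sum_cells)
      also have "\<dots> = (\<Sum>\<kappa>\<in>cells N. \<Sum>\<beta>\<in>corners. \<Sum>j\<in>multi_indices m.
        ?w \<kappa> \<beta> j * (?c \<kappa> \<beta> l' * of_bool (j = s')))"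
      proof -
        have "(\<Prod>i\<in>UNIV. of_bool (j $ i = s' $ i)) = (of_bool (j = s') :: complex)" for j
          by (cases "j = s'") (auto simp: vec_eq_iff prod_zero_iff)
        then show ?thesis by (simp add: prod.distrib tensor_weight_def of_bool_conj)
      qed
      finally show ?thesis .
    qed
    have "TM.ip F (PsiT N o' m l s) = (\<Sum>l'\<in>cells N. \<Sum>s'\<in>multi_indices m. of_real (d l' s' $ c) * TM.ip (PsiT N o' m l' s') (PsiT N o' m l s))"
      unfolding F_def spline_top_def vec_lambda_beta by (rule sqi_double_sum(2)) (auto intro: sqi_PsiT)
    also have "\<dots> = (\<Sum>l'\<in>cells N. \<Sum>s'\<in>multi_indices m. \<Sum>\<kappa>\<in>cells N. \<Sum>\<beta>\<in>corners. \<Sum>j\<in>multi_indices m.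
        of_real (d l' s' $ c) * (?w \<kappa> \<beta> j * (?c \<kappa> \<beta> l' * of_bool (j = s'))))"
      by (intro sum.cong refl) (simp only: ip sum_distrib_left)
    also have "\<dots> = (\<Sum>l'\<in>cells N. \<Sum>\<kappa>\<in>cells N. \<Sum>\<beta>\<in>corners. \<Sum>j\<in>multi_indices m. \<Sum>s'\<in>multi_indices m.
        of_real (d l' s' $ c) * (?w \<kappa> \<beta> j * (?c \<kappa> \<beta> l' * of_bool (j = s'))))"
      by (intro sum.cong refl sum_swap4)
    also have "\<dots> = (\<Sum>l'\<in>cells N. \<Sum>\<kappa>\<in>cells N. \<Sum>\<beta>\<in>corners. \<Sum>j\<in>multi_indices m.
        ?w \<kappa> \<beta> j * (?r \<kappa> \<beta> l' *\<^sub>R of_real (d l' j $ c)))"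
    proof (intro sum.cong refl)
      fix l' \<kappa> \<beta> j assume j: "j \<in> multi_indices m"
      have "(\<Sum>s'\<in>multi_indices m. of_real (d l' s' $ c) * (?w \<kappa> \<beta> j * (?c \<kappa> \<beta> l' * of_bool (j = s'))))
        = (\<Sum>s'\<in>multi_indices m. if s' = j then of_real (d l' s' $ c) * (?w \<kappa> \<beta> j * ?c \<kappa> \<beta> l') else 0)"
        by (intro sum.cong refl) auto
      also have "\<dots> = ?w \<kappa> \<beta> j * (?r \<kappa> \<beta> l' *\<^sub>R of_real (d l' j $ c))"
      proof -
        have "complex_of_real (of_bool P) = of_bool P" for P by (cases P) auto
        then show ?thesis using j by (simp add: scaleR_conv_of_real of_real_prod)
      qed
      finally show "(\<Sum>s'\<in>multi_indices m. of_real (d l' s' $ c) * (?w \<kappa> \<beta> j * (?c \<kappa> \<beta> l' * of_bool (j = s'))))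
        = ?w \<kappa> \<beta> j * (?r \<kappa> \<beta> l' *\<^sub>R of_real (d l' j $ c))" .
    qed
    also have "\<dots> = (\<Sum>\<kappa>\<in>cells N. \<Sum>\<beta>\<in>corners. \<Sum>j\<in>multi_indices m. \<Sum>l'\<in>cells N.
        ?w \<kappa> \<beta> j * (?r \<kappa> \<beta> l' *\<^sub>R of_real (d l' j $ c)))"
      by (rule sum_swap4)
    also have "\<dots> = (\<Sum>\<kappa>\<in>cells N. \<Sum>\<beta>\<in>corners. \<Sum>j\<in>multi_indices m. ?w \<kappa> \<beta> j * of_real (d (vmod (\<kappa> + \<beta>) N) j $ c))"
      by (simp only: sum_distrib_left [symmetric] sum_cells_delta[OF N])
    also have "\<dots> = (\<Sum>\<kappa>\<in>cells N. \<Sum>\<beta>\<in>corners. \<Sum>j\<in>multi_indices m. ?w \<kappa> \<beta> j * of_real (d (\<kappa> + \<beta>) j $ c))"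
      by (intro sum.cong refl) (simp only: periodic_data_mod[OF d])
    finally show ?thesis .
  qed
  ultimately show ?thesis by simp
qed

section \<open>Polynomials and spherical means\<close>

subsection \<open>Spans of powers of linear forms\<close>

text \<open>
  Polynomials, generated by powers of linear forms: the Laplacian and means of translates map such a power to combinations of powers of the same linear form,
  so that identities need only be checked in one variable.
\<close>

inductive ridge_span :: "nat \<Rightarrow> (real ^ 3 \<Rightarrow> real) \<Rightarrow> bool" for d where
  ridge: "n \<le> d \<Longrightarrow> ridge_span d (\<lambda>x. (k \<bullet> x) ^ n)"
| add: "ridge_span d f \<Longrightarrow> ridge_span d g \<Longrightarrow> ridge_span d (\<lambda>x. f x + g x)"
| scale: "ridge_span d f \<Longrightarrow> ridge_span d (\<lambda>x. c * f x)"

lemma ridge_span_0: "ridge_span d (\<lambda>x. 0)"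
  using ridge_span.scale[OF ridge_span.ridge[of 0 d 0], of 0] by simp

lemma ridge_span_diff: "ridge_span d f \<Longrightarrow> ridge_span d g \<Longrightarrow> ridge_span d (\<lambda>x. f x - g x)"
  using ridge_span.add[OF _ ridge_span.scale[of d g "-1"]] by simp

lemma ridge_span_sum: "finite A \<Longrightarrow> (\<And>i. i \<in> A \<Longrightarrow> ridge_span d (f i)) \<Longrightarrow> ridge_span d (\<lambda>x. \<Sum>i\<in>A. f i x)"
  by (induction A rule: finite_induct) (auto intro: ridge_span_0 ridge_span.add)

text \<open>
  Subtracting \<open>2\<^sup>n\<^sup>+\<^sup>1\<close> times the value at \<open>t\<close> from the value at \<open>2t\<close> removes the leading coefficient, and induction yields the others.
\<close>

lemma ridge_span_coefficients:
  assumes "\<And>t :: real. ridge_span d (\<lambda>x. \<Sum>i\<le>n. t ^ i * v i x)" "i \<le> n"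
  shows "ridge_span d (v i)"
  using assms
proof (induction n arbitrary: v i)
  case 0
  then show ?case using 0(1)[of 0] by simp
next
  case (Suc n)
  have low: "ridge_span d (v i)" if i: "i \<le> n" for i
  proof -
    have "ridge_span d (\<lambda>x. \<Sum>i\<le>n. t ^ i * ((2 ^ i - 2 ^ Suc n) * v i x))" for t
    proof -
      have "(\<Sum>i\<le>Suc n. (2 * t) ^ i * v i x) - 2 ^ Suc n * (\<Sum>i\<le>Suc n. t ^ i * v i x) = (\<Sum>i\<le>n. t ^ i * ((2 ^ i - 2 ^ Suc n) * v i x))" for x
        by (simp add: sum_distrib_left sum_subtractf [symmetric] power_mult_distrib algebra_simps)
      moreover have "ridge_span d (\<lambda>x. (\<Sum>i\<le>Suc n. (2 * t) ^ i * v i x) - 2 ^ Suc n * (\<Sum>i\<le>Suc n. t ^ i * v i x))"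
        by (intro ridge_span_diff ridge_span.scale Suc.prems(1))
      ultimately show ?thesis by simp
    qed
    from Suc.IH[OF this i] have "ridge_span d (\<lambda>x. (2 ^ i - 2 ^ Suc n) * v i x)" .
    from ridge_span.scale[OF this, of "1 / (2 ^ i - 2 ^ Suc n)"]
    show ?thesis using i by (simp add: power_inject_exp[of "2::real" i "Suc n", simplified] del: power_Suc)
  qed
  show ?case
  proof (cases "i = Suc n")
    case True
    have "ridge_span d (\<lambda>x. (\<Sum>i\<le>Suc n. 1 ^ i * v i x) - (\<Sum>i\<le>n. v i x))"
      by (intro ridge_span_diff Suc.prems(1) ridge_span_sum low) auto
    then show ?thesis using True by simp
  qed (use Suc.prems low in auto)
qed

text \<open>
  Up to binomial factors the monomial is a coefficient of \<open>(s x\<^sub>3 + t x\<^sub>2 + x\<^sub>1)\<^sup>a\<^sup>+\<^sup>b\<^sup>+\<^sup>c\<close> as a polynomial in \<open>s\<close> and \<open>t\<close>.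
\<close>

lemma ridge_span_monomial:
  assumes "a + b + c \<le> d"
  shows "ridge_span d (\<lambda>x. x $ 1 ^ a * x $ 2 ^ b * x $ 3 ^ c)"
proof -
  define n where "n = a + b + c"
  have 1: "ridge_span d (\<lambda>x. (s * x $ 3 + (t * x $ 2 + x $ 1)) ^ n)" for s t :: real
  proof -
    define k :: "real ^ 3" where "k = (\<chi> i. if i = 1 then 1 else if i = 2 then t else s)"
    have "k \<bullet> x = s * x $ 3 + (t * x $ 2 + x $ 1)" for x
      by (simp add: inner_vec_def sum_3 k_def)
    then show ?thesis using ridge_span.ridge[of n d k] assms by (simp add: n_def)
  qed
  have 2: "ridge_span d (\<lambda>x. of_nat (n choose c) * x $ 3 ^ c * (t * x $ 2 + x $ 1) ^ (a + b))" for t :: real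
  proof -
    have "ridge_span d (\<lambda>x. \<Sum>i\<le>n. s ^ i * (of_nat (n choose i) * x $ 3 ^ i * (t * x $ 2 + x $ 1) ^ (n - i)))" for s :: real
      using 1[of s t] unfolding binomial_ring by (simp add: power_mult_distrib mult_ac)
    from ridge_span_coefficients[OF this, of c] show ?thesis by (simp add: n_def)
  qed
  have "ridge_span d (\<lambda>x. \<Sum>i\<le>a + b. t ^ i * (of_nat (n choose c) * x $ 3 ^ c * (of_nat ((a + b) choose i) * x $ 2 ^ i * x $ 1 ^ (a + b - i))))" for t :: real
    using 2[of t] unfolding binomial_ring by (simp add: power_mult_distrib sum_distrib_left mult_ac)
  from ridge_span_coefficients[OF this, of b]
  have "ridge_span d (\<lambda>x. of_nat (n choose c) * x $ 3 ^ c * (of_nat ((a + b) choose b) * x $ 2 ^ b * x $ 1 ^ a))" by simp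
  from ridge_span.scale[OF this, of "1 / (of_nat (n choose c) * of_nat ((a + b) choose b))"]
  show ?thesis by (simp add: n_def mult_ac)
qed

lemma ridge_span_tensor_poly:
  assumes "tensor_poly d p" shows "ridge_span (3 * d) (\<lambda>x. p x $ c)"
proof -
  obtain a where a: "\<And>x. p x = (\<Sum>\<alpha>\<in>multi_indices d. (\<Prod>i\<in>UNIV. x $ i ^ (\<alpha> $ i)) *\<^sub>R a \<alpha>)"
    using assms by (auto simp: tensor_poly_def)
  have "ridge_span (3 * d) (\<lambda>x. \<Sum>\<alpha>\<in>multi_indices d. a \<alpha> $ c * (x $ 1 ^ (\<alpha> $ 1) * x $ 2 ^ (\<alpha> $ 2) * x $ 3 ^ (\<alpha> $ 3)))"
  proof (cases "finite (multi_indices d)")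
    case True
    then show ?thesis
    proof (rule ridge_span_sum)
      fix \<alpha> assume "\<alpha> \<in> multi_indices d"
      then have "\<alpha> $ i \<le> d" for i by (simp add: multi_indices_def)
      then have "\<alpha> $ 1 + \<alpha> $ 2 + \<alpha> $ 3 \<le> d + d + d" by (intro add_mono)
      then show "ridge_span (3 * d) (\<lambda>x. a \<alpha> $ c * (x $ 1 ^ (\<alpha> $ 1) * x $ 2 ^ (\<alpha> $ 2) * x $ 3 ^ (\<alpha> $ 3)))"
        by (intro ridge_span.scale ridge_span_monomial) simp
    qed
  qed (simp add: ridge_span_0)
  then show ?thesis by (simp add: a prod_3 mult.commute)
qed

subsection \<open>Partial derivatives\<close>

lemma partial_ridge: "((\<lambda>h. (k \<bullet> (x + axis i h)) ^ n) has_real_derivative of_nat n * k $ i * (k \<bullet> x) ^ (n - 1)) (at 0)"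
proof -
  have e: "k \<bullet> (x + axis i h) = k \<bullet> x + k $ i * h" for h by (simp add: inner_add_right inner_axis)
  show ?thesis unfolding e by (auto intro!: derivative_eq_intros)
qed

lemma ridge_span_partial:
  assumes "ridge_span d f"
  shows "ridge_span d (partial i f) \<and> (\<forall>x. ((\<lambda>h. f (x + axis i h)) has_real_derivative partial i f x) (at 0))"
proof -
  have "\<exists>f'. ridge_span d f' \<and> (\<forall>x. ((\<lambda>h. f (x + axis i h)) has_real_derivative f' x) (at 0))"
    using assms
  proof induction
    case (ridge n k)
    have "ridge_span d (\<lambda>x. of_nat n * k $ i * (k \<bullet> x) ^ (n - 1))"
      using ridge by (intro ridge_span.scale ridge_span.ridge) auto
    then show ?case using partial_ridge by blast
  next
    case (add f g)
    then obtain f' g' where "ridge_span d f'" "\<And>x. ((\<lambda>h. f (x + axis i h)) has_real_derivative f' x) (at 0)"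
      "ridge_span d g'" "\<And>x. ((\<lambda>h. g (x + axis i h)) has_real_derivative g' x) (at 0)" by blast
    then show ?case by (intro exI[of _ "\<lambda>x. f' x + g' x"]) (auto intro: ridge_span.add DERIV_add)
  next
    case (scale f c)
    then obtain f' where "ridge_span d f'" "\<And>x. ((\<lambda>h. f (x + axis i h)) has_real_derivative f' x) (at 0)" by blast
    then show ?case by (intro exI[of _ "\<lambda>x. c * f' x"]) (auto intro: ridge_span.scale DERIV_cmult)
  qed
  then obtain f' where f': "ridge_span d f'" "\<And>x. ((\<lambda>h. f (x + axis i h)) has_real_derivative f' x) (at 0)" by blast
  have "partial i f = f'"
    unfolding partial_def using f'(2) by (intro ext vector_derivative_at) (simp add: has_real_derivative_iff_has_vector_derivative)
  with f' show ?thesis by simp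
qed

lemmas ridge_span_partial' = ridge_span_partial[THEN conjunct1]
lemmas ridge_span_deriv = ridge_span_partial[THEN conjunct2, rule_format]

lemma partial_eqI:
  fixes f :: "real ^ 3 \<Rightarrow> real"
  assumes "\<And>x. ((\<lambda>h. f (x + axis i h)) has_real_derivative f' x) (at 0)"
  shows "partial i f = f'"
  unfolding partial_def using assms by (intro ext vector_derivative_at) (simp add: has_real_derivative_iff_has_vector_derivative)

lemma partial_ridge_eq: "partial i (\<lambda>x. (k \<bullet> x) ^ n) = (\<lambda>x. of_nat n * k $ i * (k \<bullet> x) ^ (n - 1))"
  by (rule partial_eqI[OF partial_ridge])

lemma partial_add: "ridge_span d f \<Longrightarrow> ridge_span d g \<Longrightarrow> partial i (\<lambda>x. f x + g x) = (\<lambda>x. partial i f x + partial i g x)"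
  by (intro partial_eqI DERIV_add ridge_span_deriv)

lemma partial_diff: "ridge_span d f \<Longrightarrow> ridge_span d g \<Longrightarrow> partial i (\<lambda>x. f x - g x) = (\<lambda>x. partial i f x - partial i g x)"
  by (intro partial_eqI DERIV_diff ridge_span_deriv)

lemma partial_scale: "ridge_span d f \<Longrightarrow> partial i (\<lambda>x. c * f x) = (\<lambda>x. c * partial i f x)"
  by (intro partial_eqI DERIV_cmult ridge_span_deriv)

lemma partial_commute:
  assumes "ridge_span d f" shows "partial i (partial j f) = partial j (partial i f)"
  using assms
proof induction
  case (ridge n k)
  have "partial i (partial j (\<lambda>x. (k \<bullet> x) ^ n)) = (\<lambda>x. of_nat n * k $ j * (of_nat (n - 1) * k $ i * (k \<bullet> x) ^ (n - 1 - 1)))" for i j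
    unfolding partial_ridge_eq by (subst partial_scale[OF ridge_span.ridge[OF order_refl]]) (simp only: partial_ridge_eq)
  then show ?case by (simp add: mult_ac)
next
  case (add f g)
  then show ?case by (simp add: partial_add[of d] ridge_span_partial')
next
  case (scale f c)
  then show ?case by (simp add: partial_scale[of d] ridge_span_partial')
qed

lemma ridge_span_continuous: "ridge_span d f \<Longrightarrow> continuous_on UNIV f"
  by (induction rule: ridge_span.induct) (auto intro!: continuous_intros)

lemma ridge_span_partial_power: "ridge_span d f \<Longrightarrow> ridge_span d ((partial i ^^ n) f)"
  by (induction n) (auto intro: ridge_span_partial')

lemma ridge_span_mixed_partial: "ridge_span d f \<Longrightarrow> ridge_span d (mixed_partial \<alpha> f)"
  unfolding mixed_partial_def by (intro ridge_span_partial_power)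

lemma partial_power_commute: "ridge_span d f \<Longrightarrow> partial i ((partial j ^^ n) f) = (partial j ^^ n) (partial i f)"
  by (induction n) (auto simp: partial_commute[of d _ i j] ridge_span_partial_power)

lemma mixed_partial_partial:
  assumes f: "ridge_span d f"
  shows "mixed_partial \<alpha> (partial i f) = mixed_partial (\<alpha> + axis i 1) f"
proof -
  have c: "(partial j ^^ n) (partial i f) = partial i ((partial j ^^ n) f)" if "ridge_span d f" for j n f
    by (rule partial_power_commute[OF that, symmetric])
  have s: "(partial i ^^ n) (partial i f) = (partial i ^^ (n + 1)) f" for n f by (simp add: funpow_swap1)
  define g where "g = (partial 3 ^^ (\<alpha> $ 3)) f"
  define h where "h = (partial 2 ^^ (\<alpha> $ 2)) g"
  have g: "ridge_span d g" "ridge_span d h" unfolding g_def h_def by (intro ridge_span_partial_power f)+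
  consider "i = 1" | "i = 2" | "i = 3" using exhaust_3 by auto
  then show ?thesis
  proof cases
    case 1
    have "mixed_partial \<alpha> (partial i f) = (partial 1 ^^ (\<alpha> $ 1)) (partial i h)"
      unfolding mixed_partial_def c[OF f] g_def [symmetric] c[OF g(1)] h_def [symmetric] ..
    then show ?thesis using 1 s[of "\<alpha> $ 1" h] by (simp add: mixed_partial_def axis_def g_def h_def)
  next
    case 2
    have "mixed_partial \<alpha> (partial i f) = (partial 1 ^^ (\<alpha> $ 1)) ((partial 2 ^^ (\<alpha> $ 2)) (partial i g))"
      unfolding mixed_partial_def c[OF f] g_def [symmetric] ..
    then show ?thesis using 2 s[of "\<alpha> $ 2" g] by (simp add: mixed_partial_def axis_def g_def)
  next
    case 3
    then show ?thesis using s[of "\<alpha> $ 3" f] by (simp add: mixed_partial_def axis_def)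
  qed
qed

lemma mixed_partial_linear:
  assumes "ridge_span d f" "ridge_span d g"
  shows "mixed_partial \<alpha> (\<lambda>x. f x - g x) = (\<lambda>x. mixed_partial \<alpha> f x - mixed_partial \<alpha> g x)"
    and "mixed_partial \<alpha> (\<lambda>x. c * f x) = (\<lambda>x. c * mixed_partial \<alpha> f x)"
proof -
  have d: "(partial i ^^ n) (\<lambda>x. f x - g x) = (\<lambda>x. (partial i ^^ n) f x - (partial i ^^ n) g x)"
    if "ridge_span d f" "ridge_span d g" for i n f g
    by (induction n) (auto simp: partial_diff[of d] ridge_span_partial_power that)
  have s: "(partial i ^^ n) (\<lambda>x. c * f x) = (\<lambda>x. c * (partial i ^^ n) f x)" if "ridge_span d f" for i n f
    by (induction n) (auto simp: partial_scale[of d] ridge_span_partial_power that)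
  show "mixed_partial \<alpha> (\<lambda>x. f x - g x) = (\<lambda>x. mixed_partial \<alpha> f x - mixed_partial \<alpha> g x)"
    "mixed_partial \<alpha> (\<lambda>x. c * f x) = (\<lambda>x. c * mixed_partial \<alpha> f x)"
    unfolding mixed_partial_def by (simp_all only: d s assms ridge_span_partial_power)
qed

definition lap :: "(real ^ 3 \<Rightarrow> real) \<Rightarrow> real ^ 3 \<Rightarrow> real" where
  "lap f x = (\<Sum>i\<in>UNIV. partial i (partial i f) x)"

lemma ridge_span_lap: "ridge_span d f \<Longrightarrow> ridge_span d (lap f)"
  unfolding lap_def[abs_def] by (intro ridge_span_sum ridge_span_partial') auto

lemma lap_add: "ridge_span d f \<Longrightarrow> ridge_span d g \<Longrightarrow> lap (\<lambda>x. f x + g x) = (\<lambda>x. lap f x + lap g x)"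
  unfolding lap_def[abs_def] by (simp add: partial_add[of d] ridge_span_partial' sum.distrib)

lemma lap_scale: "ridge_span d f \<Longrightarrow> lap (\<lambda>x. c * f x) = (\<lambda>x. c * lap f x)"
  unfolding lap_def[abs_def] by (simp add: partial_scale[of d] ridge_span_partial' sum_distrib_left)

lemma ridge_span_lap_power: "ridge_span d f \<Longrightarrow> ridge_span d ((lap ^^ n) f)"
  by (induction n) (auto intro: ridge_span_lap)

lemma lap_power_add: "ridge_span d f \<Longrightarrow> ridge_span d g \<Longrightarrow> (lap ^^ n) (\<lambda>x. f x + g x) = (\<lambda>x. (lap ^^ n) f x + (lap ^^ n) g x)"
  by (induction n) (auto simp: lap_add[of d] ridge_span_lap_power)

lemma lap_power_scale: "ridge_span d f \<Longrightarrow> (lap ^^ n) (\<lambda>x. c * f x) = (\<lambda>x. c * (lap ^^ n) f x)"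
  by (induction n) (auto simp: lap_scale[of d] ridge_span_lap_power)

lemma lap_ridge: "lap (\<lambda>x. (k \<bullet> x) ^ n) = (\<lambda>x. of_nat (n * (n - 1)) * (norm k)\<^sup>2 * (k \<bullet> x) ^ (n - 2))"
proof
  fix x
  have "partial i (partial i (\<lambda>x. (k \<bullet> x) ^ n)) x = of_nat (n * (n - 1)) * (k \<bullet> x) ^ (n - 2) * (k $ i * k $ i)" for i
    unfolding partial_ridge_eq
    by (subst partial_scale[OF ridge_span.ridge[OF order_refl]]) (simp add: partial_ridge_eq numeral_2_eq_2)
  then show "lap (\<lambda>x. (k \<bullet> x) ^ n) x = of_nat (n * (n - 1)) * (norm k)\<^sup>2 * (k \<bullet> x) ^ (n - 2)"
    unfolding lap_def by (simp add: sum_distrib_left [symmetric] power2_norm_eq_inner inner_vec_def)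
qed

lemma lap_power_ridge:
  "(lap ^^ l) (\<lambda>x. (k \<bullet> x) ^ n) = (\<lambda>x. of_bool (2 * l \<le> n) * (fact n / fact (n - 2 * l)) * (norm k) ^ (2 * l) * (k \<bullet> x) ^ (n - 2 * l))"
proof (induction l)
  case (Suc l)
  have r: "ridge_span n (\<lambda>x. (k \<bullet> x) ^ (n - 2 * l))" by (rule ridge_span.ridge) simp
  have f: "of_bool (2 * l \<le> n) * (fact n / fact (n - 2 * l)) * real ((n - 2 * l) * (n - 2 * l - 1)) = of_bool (2 * Suc l \<le> n) * (fact n / fact (n - 2 * Suc l))"
  proof (cases "2 * Suc l \<le> n")
    case True
    then obtain p where p: "n = p + 2 * Suc l" using le_Suc_ex by (metis add.commute)
    have e: "p + 2 * Suc l - 2 * l = Suc (Suc p)" by simp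
    have 1: "fact (Suc (Suc p)) = real (Suc (Suc p) * Suc p) * fact p" by (simp add: algebra_simps)
    have 2: "Suc (Suc p) - 1 = Suc p" "p + 2 * Suc l - 2 * Suc l = p" by simp_all
    have "x / (a * b) * a = x / b" if "a \<noteq> 0" for x a b :: real using that by simp
    then show ?thesis using True unfolding p e 2 1 by (simp del: of_nat_mult of_nat_Suc fact_Suc)
  next
    case False
    then have "n - 2 * l = 0 \<or> n - 2 * l - 1 = 0" by arith
    then show ?thesis using False by auto
  qed
  have "(lap ^^ Suc l) (\<lambda>x. (k \<bullet> x) ^ n) = lap (\<lambda>x. (of_bool (2 * l \<le> n) * (fact n / fact (n - 2 * l)) * (norm k) ^ (2 * l)) * (k \<bullet> x) ^ (n - 2 * l))"
    by (simp add: Suc mult_ac)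
  also have "\<dots> = (\<lambda>x. (of_bool (2 * l \<le> n) * (fact n / fact (n - 2 * l)) * (norm k) ^ (2 * l)) *
      (of_nat ((n - 2 * l) * (n - 2 * l - 1)) * (norm k)\<^sup>2 * (k \<bullet> x) ^ (n - 2 * l - 2)))"
    unfolding lap_scale[OF r] lap_ridge ..
  also have "\<dots> = (\<lambda>x. (of_bool (2 * l \<le> n) * (fact n / fact (n - 2 * l)) * real ((n - 2 * l) * (n - 2 * l - 1))) * ((norm k) ^ (2 * l) * (norm k)\<^sup>2) * (k \<bullet> x) ^ (n - 2 * l - 2))"
    by (simp only: mult_ac)
  also have "\<dots> = (\<lambda>x. of_bool (2 * Suc l \<le> n) * (fact n / fact (n - 2 * Suc l)) * (norm k) ^ (2 * Suc l) * (k \<bullet> x) ^ (n - 2 * Suc l))"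
    unfolding f by (simp add: power_add [symmetric] del: power_Suc)
  finally show ?case .
qed simp

subsection \<open>Weighted means of translates\<close>

text \<open>Averages over segments and over spheres are special cases, with the parametrization \<open>Y\<close> of the displacements.\<close>

definition cmean :: "'a::euclidean_space \<Rightarrow> 'a \<Rightarrow> ('a \<Rightarrow> real) \<Rightarrow> ('a \<Rightarrow> real ^ 3) \<Rightarrow> (real ^ 3 \<Rightarrow> 'b::banach) \<Rightarrow> real ^ 3 \<Rightarrow> 'b" where
  "cmean a b w Y f x = integral (cbox a b) (\<lambda>\<omega>. w \<omega> *\<^sub>R f (x + Y \<omega>))"

context
  fixes a b :: "'a::euclidean_space" and w :: "'a \<Rightarrow> real" and Y :: "'a \<Rightarrow> real ^ 3"
  assumes w: "continuous_on (cbox a b) w" and Y: "continuous_on (cbox a b) Y"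
begin

lemma cmean_continuous_integrand:
  fixes f :: "real ^ 3 \<Rightarrow> 'b::banach"
  assumes "continuous_on UNIV f"
  shows "continuous_on (cbox a b) (\<lambda>\<omega>. w \<omega> *\<^sub>R f (x + Y \<omega>))"
  by (rule continuous_on_scaleR[OF w continuous_on_compose2[OF assms continuous_on_add[OF continuous_on_const Y]]]) simp

lemma cmean_add:
  assumes "continuous_on UNIV f" "continuous_on UNIV g"
  shows "cmean a b w Y (\<lambda>x. f x + g x) = (\<lambda>x. cmean a b w Y f x + cmean a b w Y g x)"
proof
  fix x
  show "cmean a b w Y (\<lambda>x. f x + g x) x = cmean a b w Y f x + cmean a b w Y g x"
    unfolding cmean_def scaleR_add_right
    by (intro Henstock_Kurzweil_Integration.integral_add integrable_continuous cmean_continuous_integrand assms)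
qed

lemma cmean_scale: "cmean a b w Y (\<lambda>x. c * f x) = (\<lambda>x. (c::real) * cmean a b w Y f x)"
  unfolding cmean_def by (simp add: mult.left_commute[of _ c])

lemma cmean_of_real:
  assumes "continuous_on UNIV f"
  shows "cmean a b w Y (\<lambda>x. complex_of_real (f x)) x = of_real (cmean a b w Y f x)"
proof -
  have "((\<lambda>\<omega>. w \<omega> *\<^sub>R f (x + Y \<omega>)) has_integral cmean a b w Y f x) (cbox a b)"
    unfolding cmean_def by (intro integrable_integral integrable_continuous cmean_continuous_integrand assms)
  from has_integral_of_real[OF this, where 'b = complex] show ?thesis
    unfolding cmean_def by (intro integral_unique) (simp add: scaleR_conv_of_real)
qed

lemma cmean_ridge:
  "cmean a b w Y (\<lambda>x. (k \<bullet> x) ^ n) x = (\<Sum>j\<le>n. of_nat (n choose j) * integral (cbox a b) (\<lambda>\<omega>. w \<omega> * (k \<bullet> Y \<omega>) ^ j) * (k \<bullet> x) ^ (n - j))"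
proof -
  have "w \<omega> *\<^sub>R (k \<bullet> (x + Y \<omega>)) ^ n = (\<Sum>j\<le>n. (of_nat (n choose j) * (k \<bullet> x) ^ (n - j)) * (w \<omega> * (k \<bullet> Y \<omega>) ^ j))" for \<omega>
    unfolding inner_add_right add.commute[of "k \<bullet> x"] binomial_ring by (simp add: sum_distrib_left mult_ac)
  then have "cmean a b w Y (\<lambda>x. (k \<bullet> x) ^ n) x = (\<Sum>j\<le>n. integral (cbox a b) (\<lambda>\<omega>. (of_nat (n choose j) * (k \<bullet> x) ^ (n - j)) * (w \<omega> * (k \<bullet> Y \<omega>) ^ j)))"
    unfolding cmean_def
    by (simp only:) (intro Henstock_Kurzweil_Integration.integral_sum finite_atMost integrable_continuous continuous_intros w Y)
  then show ?thesis unfolding integral_mult_right by (simp add: mult_ac)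
qed

lemma ridge_span_cmean: "ridge_span d f \<Longrightarrow> ridge_span d (cmean a b w Y f)"
proof (induction rule: ridge_span.induct)
  case (ridge n k)
  show ?case unfolding cmean_ridge[abs_def]
    using ridge by (intro ridge_span_sum ridge_span.scale ridge_span.ridge) auto
next
  case (add f g)
  then show ?case by (simp add: cmean_add ridge_span_continuous[of d] ridge_span.add)
next
  case (scale f c)
  then show ?case by (simp add: cmean_scale ridge_span.scale)
qed

lemma partial_cmean: "ridge_span d f \<Longrightarrow> partial i (cmean a b w Y f) = cmean a b w Y (partial i f)"
proof (induction rule: ridge_span.induct)
  case (ridge n k)
  define \<mu> where "\<mu> j = integral (cbox a b) (\<lambda>\<omega>. w \<omega> * (k \<bullet> Y \<omega>) ^ j)" for j
  have "partial i (cmean a b w Y (\<lambda>x. (k \<bullet> x) ^ n)) = (\<lambda>x. \<Sum>j\<le>n. of_nat (n choose j) * \<mu> j * (of_nat (n - j) * k $ i * (k \<bullet> x) ^ (n - j - 1)))"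
    unfolding cmean_ridge[abs_def] \<mu>_def [symmetric]
    by (intro partial_eqI DERIV_sum DERIV_cmult partial_ridge)
  also have "\<dots> = (\<lambda>x. (of_nat n * k $ i) * cmean a b w Y (\<lambda>x. (k \<bullet> x) ^ (n - 1)) x)"
  proof (cases n)
    case (Suc n')
    have "(\<Sum>j\<le>n. of_nat (n choose j) * \<mu> j * (of_nat (n - j) * k $ i * (k \<bullet> x) ^ (n - j - 1)))
      = (\<Sum>j\<le>n'. of_nat (n choose j) * \<mu> j * (of_nat (n - j) * k $ i * (k \<bullet> x) ^ (n - j - 1)))" for x
      unfolding Suc by simp
    also have "\<dots> x = (\<Sum>j\<le>n'. (of_nat n * k $ i) * (of_nat (n' choose j) * \<mu> j * (k \<bullet> x) ^ (n' - j)))" for x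
    proof (rule sum.cong[OF refl])
      fix j assume "j \<in> {..n'}"
      then have j: "j \<le> n'" by simp
      have "(n choose j) * (n - j) = n * (n' choose j)"
      proof -
        have "(n choose j) * (n - j) = (n choose (n - j)) * (n - j)" using binomial_symmetric[of j n] j Suc by simp
        also have "\<dots> = n * (n' choose (n' - j))"
          using Suc_times_binomial_eq[of n' "n' - j"] j Suc by (simp add: Suc_diff_le mult.commute)
        also have "n' choose (n' - j) = n' choose j" using binomial_symmetric[OF j] by simp
        finally show ?thesis .
      qed
      then have "real (n choose j) * real (n - j) = real n * real (n' choose j)" by (simp flip: of_nat_mult)
      then show "of_nat (n choose j) * \<mu> j * (of_nat (n - j) * k $ i * (k \<bullet> x) ^ (n - j - 1)) = (of_nat n * k $ i) * (of_nat (n' choose j) * \<mu> j * (k \<bullet> x) ^ (n' - j))"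
        using j Suc by (simp add: mult_ac)
    qed
    finally show ?thesis unfolding cmean_ridge[abs_def] \<mu>_def [symmetric] by (simp add: Suc sum_distrib_left)
  qed simp
  also have "\<dots> = cmean a b w Y (partial i (\<lambda>x. (k \<bullet> x) ^ n))"
    unfolding partial_ridge_eq cmean_scale ..
  finally show ?case .
next
  case (add f g)
  then show ?case
    by (simp add: cmean_add ridge_span_continuous[of d] partial_add[of d] ridge_span_cmean ridge_span_partial')
next
  case (scale f c)
  then show ?case by (simp add: cmean_scale partial_scale[of d] ridge_span_cmean)
qed

end

subsection \<open>Moments of the unit sphere\<close>

text \<open>Spherical coordinates of the unit sphere, with polar angle \<open>fst p\<close> and surface element \<open>sin (fst p)\<close>.\<close>

definition omega :: "real \<times> real \<Rightarrow> real ^ 3" where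
  "omega p = (\<chi> i. if i = 1 then sin (fst p) * cos (snd p) else if i = 2 then sin (fst p) * sin (snd p) else cos (fst p))"

abbreviation sphere_box :: "(real \<times> real) set" where
  "sphere_box \<equiv> cbox (0, 0) (pi, 2 * pi)"

lemma continuous_omega: "continuous_on S omega"
  unfolding omega_def
proof (intro continuous_on_vec_lambda)
  fix i :: 3
  show "continuous_on S (\<lambda>p. if i = 1 then sin (fst p) * cos (snd p) else if i = 2 then sin (fst p) * sin (snd p) else cos (fst p) :: real)"
    by (cases "i = 1"; cases "i = 2") (auto intro!: continuous_intros)
qed

lemma omega_bounded: "\<bar>omega p $ i\<bar> \<le> 1"
proof -
  have "\<bar>sin a * cos b\<bar> \<le> 1" "\<bar>sin a * sin b\<bar> \<le> 1" for a b :: real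
    using mult_mono[of "\<bar>sin a\<bar>" 1 "\<bar>cos b\<bar>" 1] mult_mono[of "\<bar>sin a\<bar>" 1 "\<bar>sin b\<bar>" 1] by (auto simp: abs_mult)
  then show ?thesis by (simp add: omega_def)
qed

lemma omega_inner: "k \<bullet> omega (\<theta>, \<phi>) = sin \<theta> * (k $ 1 * cos \<phi> + k $ 2 * sin \<phi>) + cos \<theta> * k $ 3"
  by (simp add: omega_def inner_vec_def sum_3 algebra_simps)

definition moment :: "real ^ 3 \<Rightarrow> nat \<Rightarrow> real" where
  "moment k n = integral sphere_box (\<lambda>p. sin (fst p) * (k \<bullet> omega p) ^ n)"

text \<open>
  The spherical Laplacian of \<open>(k \<bullet> \<omega>)\<^sup>p\<^sup>+\<^sup>1\<close> integrates to zero.  In coordinates, up to the factor \<open>p + 1\<close> and the surface element, it is the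
  sum of the \<open>\<theta>\<close>-derivative \<open>F\<close> and the \<open>\<phi>\<close>-derivative \<open>G\<close> below, and \<open>key\<close> evaluates that sum.
\<close>

lemma moment_recursion: "(real p + 2) * moment k (Suc p) = real p * (norm k)\<^sup>2 * moment k (p - 1)"
proof -
  define u u' where "u \<phi> = k $ 1 * cos \<phi> + k $ 2 * sin \<phi>" and "u' \<phi> = - k $ 1 * sin \<phi> + k $ 2 * cos \<phi>" for \<phi>
  define X X' where "X \<theta> \<phi> = sin \<theta> * u \<phi> + cos \<theta> * k $ 3" and "X' \<theta> \<phi> = cos \<theta> * u \<phi> - sin \<theta> * k $ 3" for \<theta> \<phi>
  define F where "F \<theta> \<phi> = cos \<theta> * X \<theta> \<phi> ^ p * X' \<theta> \<phi> + sin \<theta> * (real p * X \<theta> \<phi> ^ (p - 1) * X' \<theta> \<phi> * X' \<theta> \<phi> + X \<theta> \<phi> ^ p * (- X \<theta> \<phi>))" for \<theta> \<phi>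
  define G where "G \<theta> \<phi> = real p * X \<theta> \<phi> ^ (p - 1) * (sin \<theta> * u' \<phi>) * u' \<phi> + X \<theta> \<phi> ^ p * (- u \<phi>)" for \<theta> \<phi>
  have u: "(u has_real_derivative u' \<phi>) (at \<phi> within S)" "(u' has_real_derivative - u \<phi>) (at \<phi> within S)" for \<phi> S
    unfolding u_def u'_def by (auto intro!: derivative_eq_intros)
  have X: "((\<lambda>\<theta>. X \<theta> \<phi>) has_real_derivative X' \<theta> \<phi>) (at \<theta> within S)" "((\<lambda>\<theta>. X' \<theta> \<phi>) has_real_derivative - X \<theta> \<phi>) (at \<theta> within S)"
    "((\<lambda>\<phi>. X \<theta> \<phi>) has_real_derivative sin \<theta> * u' \<phi>) (at \<phi> within S)" for \<theta> \<phi> S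
    unfolding X_def X'_def by (auto intro!: derivative_eq_intros u)
  have cu: "continuous_on S u" "continuous_on S u'" for S unfolding u_def u'_def by (intro continuous_intros)+
  have cont: "continuous_on sphere_box (\<lambda>(\<theta>, \<phi>). F \<theta> \<phi>)" "continuous_on sphere_box (\<lambda>(\<theta>, \<phi>). G \<theta> \<phi>)"
    unfolding F_def G_def X_def X'_def u_def u'_def case_prod_unfold by (intro continuous_intros)+
  have F0: "integral (cbox 0 pi) (\<lambda>\<theta>. F \<theta> \<phi>) = 0" for \<phi>
  proof -
    have "((\<lambda>\<theta>. F \<theta> \<phi>) has_integral sin pi * X pi \<phi> ^ p * X' pi \<phi> - sin 0 * X 0 \<phi> ^ p * X' 0 \<phi>) {0..pi}"
    proof (rule fundamental_theorem_of_calculus)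
      show "((\<lambda>\<theta>. sin \<theta> * X \<theta> \<phi> ^ p * X' \<theta> \<phi>) has_vector_derivative F \<theta> \<phi>) (at \<theta> within {0..pi})" for \<theta>
        unfolding has_real_derivative_iff_has_vector_derivative [symmetric] F_def
        by (rule derivative_eq_intros X refl)+ (simp add: algebra_simps)
    qed simp
    then show ?thesis by (simp add: integral_unique)
  qed
  have G0: "integral (cbox 0 (2 * pi)) (\<lambda>\<phi>. G \<theta> \<phi>) = 0" for \<theta>
  proof -
    have "((\<lambda>\<phi>. G \<theta> \<phi>) has_integral X \<theta> (2 * pi) ^ p * u' (2 * pi) - X \<theta> 0 ^ p * u' 0) {0..2 * pi}"
    proof (rule fundamental_theorem_of_calculus)
      show "((\<lambda>\<phi>. X \<theta> \<phi> ^ p * u' \<phi>) has_vector_derivative G \<theta> \<phi>) (at \<phi> within {0..2 * pi})" for \<phi>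
        unfolding has_real_derivative_iff_has_vector_derivative [symmetric] G_def
        by (rule derivative_eq_intros X u refl)+ (simp add: algebra_simps)
    qed simp
    moreover have "X \<theta> (2 * pi) ^ p * u' (2 * pi) = X \<theta> 0 ^ p * u' 0" by (simp add: X_def u_def u'_def)
    ultimately show ?thesis by (simp add: integral_unique)
  qed
  have iF: "integral sphere_box (\<lambda>(\<theta>, \<phi>). F \<theta> \<phi>) = 0"
  proof -
    have "integral sphere_box (\<lambda>(\<theta>, \<phi>). F \<theta> \<phi>) = integral (cbox 0 pi) (\<lambda>\<theta>. integral (cbox 0 (2 * pi)) (\<lambda>\<phi>. F \<theta> \<phi>))"
      using integral_prod_continuous[OF cont(1)] by simp
    also have "\<dots> = integral (cbox 0 (2 * pi)) (\<lambda>\<phi>. integral (cbox 0 pi) (\<lambda>\<theta>. F \<theta> \<phi>))"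
      by (rule integral_swap_continuous[OF cont(1)])
    finally show ?thesis unfolding F0 by simp
  qed
  have iG: "integral sphere_box (\<lambda>(\<theta>, \<phi>). G \<theta> \<phi>) = 0"
    using integral_prod_continuous[OF cont(2)] unfolding prod.case G0 by simp
  have key: "F \<theta> \<phi> + G \<theta> \<phi> = real p * (norm k)\<^sup>2 * (sin \<theta> * X \<theta> \<phi> ^ (p - 1)) - (real p + 2) * (sin \<theta> * X \<theta> \<phi> ^ Suc p)" for \<theta> \<phi>
  proof -
    have n: "(norm k)\<^sup>2 = X' \<theta> \<phi> * X' \<theta> \<phi> + u' \<phi> * u' \<phi> + X \<theta> \<phi> * X \<theta> \<phi>"
    proof -
      have "X' \<theta> \<phi> * X' \<theta> \<phi> + X \<theta> \<phi> * X \<theta> \<phi> = ((sin \<theta>)\<^sup>2 + (cos \<theta>)\<^sup>2) * (u \<phi> * u \<phi> + k $ 3 * k $ 3)"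
        unfolding X_def X'_def by algebra
      moreover have "u \<phi> * u \<phi> + u' \<phi> * u' \<phi> = ((sin \<phi>)\<^sup>2 + (cos \<phi>)\<^sup>2) * (k $ 1 * k $ 1 + k $ 2 * k $ 2)"
        unfolding u_def u'_def by algebra
      ultimately show ?thesis by (simp add: power2_norm_eq_inner inner_vec_def sum_3)
    qed
    have c: "cos \<theta> * X' \<theta> \<phi> - u \<phi> = - sin \<theta> * X \<theta> \<phi>"
    proof -
      have "(sin \<theta>)\<^sup>2 + (cos \<theta>)\<^sup>2 = 1" by simp
      then show ?thesis unfolding X_def X'_def by algebra
    qed
    have pp: "real p * X \<theta> \<phi> ^ (p - 1) * (X \<theta> \<phi> * X \<theta> \<phi>) = real p * X \<theta> \<phi> ^ Suc p" by (cases p) auto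
    have "F \<theta> \<phi> + G \<theta> \<phi> = X \<theta> \<phi> ^ p * (cos \<theta> * X' \<theta> \<phi> - u \<phi>) + sin \<theta> * (real p * X \<theta> \<phi> ^ (p - 1) * (X' \<theta> \<phi> * X' \<theta> \<phi> + u' \<phi> * u' \<phi>)) - sin \<theta> * X \<theta> \<phi> ^ Suc p"
      unfolding F_def G_def by (simp add: algebra_simps)
    also have "X' \<theta> \<phi> * X' \<theta> \<phi> + u' \<phi> * u' \<phi> = (norm k)\<^sup>2 - X \<theta> \<phi> * X \<theta> \<phi>" unfolding n by simp
    also have "real p * X \<theta> \<phi> ^ (p - 1) * ((norm k)\<^sup>2 - X \<theta> \<phi> * X \<theta> \<phi>) = real p * (norm k)\<^sup>2 * X \<theta> \<phi> ^ (p - 1) - real p * X \<theta> \<phi> ^ Suc p"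
      unfolding right_diff_distrib pp by (simp add: mult_ac)
    finally show ?thesis unfolding c by (simp add: algebra_simps)
  qed
  have ii: "(\<lambda>q. sin (fst q) * (k \<bullet> omega q) ^ n) integrable_on sphere_box" for n
    by (intro integrable_continuous continuous_intros continuous_omega)
  have "0 = integral sphere_box (\<lambda>q. (case q of (\<theta>, \<phi>) \<Rightarrow> F \<theta> \<phi>) + (case q of (\<theta>, \<phi>) \<Rightarrow> G \<theta> \<phi>))"
    by (subst Henstock_Kurzweil_Integration.integral_add) (auto intro!: integrable_continuous cont simp: iF iG)
  also have "\<dots> = integral sphere_box (\<lambda>q. real p * (norm k)\<^sup>2 * (sin (fst q) * (k \<bullet> omega q) ^ (p - 1)) - (real p + 2) * (sin (fst q) * (k \<bullet> omega q) ^ Suc p))"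
  proof (rule integral_cong)
    fix q :: "real \<times> real"
    obtain \<theta> \<phi> where q: "q = (\<theta>, \<phi>)" by (cases q)
    have "k \<bullet> omega q = X \<theta> \<phi>" unfolding q omega_inner X_def u_def by simp
    then show "(case q of (\<theta>, \<phi>) \<Rightarrow> F \<theta> \<phi>) + (case q of (\<theta>, \<phi>) \<Rightarrow> G \<theta> \<phi>) = real p * (norm k)\<^sup>2 * (sin (fst q) * (k \<bullet> omega q) ^ (p - 1)) - (real p + 2) * (sin (fst q) * (k \<bullet> omega q) ^ Suc p)"
      using key[of \<theta> \<phi>] by (simp add: q del: power_Suc)
  qed
  also have "\<dots> = real p * (norm k)\<^sup>2 * moment k (p - 1) - (real p + 2) * moment k (Suc p)"
    unfolding moment_def
    by (subst Henstock_Kurzweil_Integration.integral_diff) (auto intro!: integrable_continuous continuous_intros continuous_omega simp del: power_Suc)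
  finally show ?thesis by simp
qed

lemma moment_0: "moment k 0 = 4 * pi"
proof -
  have "integral sphere_box (\<lambda>p. sin (fst p) :: real) = integral (cbox 0 pi) (\<lambda>\<theta>. integral (cbox 0 (2 * pi)) (\<lambda>\<phi>. sin \<theta>))"
    using integral_prod_continuous[of 0 0 pi "2 * pi" "\<lambda>p. sin (fst p) :: real"] by (simp add: continuous_intros)
  also have "\<dots> = integral {0..pi} (\<lambda>\<theta>. 2 * pi * sin \<theta>)" by simp
  also have "((\<lambda>\<theta>. 2 * pi * sin \<theta>) has_integral (- (2 * pi * cos pi)) - (- (2 * pi * cos 0))) {0..pi}"
    by (rule fundamental_theorem_of_calculus)
       (auto simp: has_real_derivative_iff_has_vector_derivative [symmetric] intro!: derivative_eq_intros)
  then have "integral {0..pi} (\<lambda>\<theta>. 2 * pi * sin \<theta>) = 4 * pi" by (simp add: integral_unique)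
  finally show ?thesis by (simp add: moment_def)
qed

lemma moment_eq: "moment k (2 * l) = 4 * pi * norm k ^ (2 * l) / (2 * real l + 1) \<and> moment k (Suc (2 * l)) = 0"
proof (induction l)
  case 0
  show ?case using moment_recursion[of 0 k] by (simp add: moment_0)
next
  case (Suc l)
  have "(real (Suc (2 * l)) + 2) * moment k (2 * Suc l) = real (Suc (2 * l)) * (norm k)\<^sup>2 * moment k (2 * l)"
    using moment_recursion[of "Suc (2 * l)" k] by simp
  moreover have "real (Suc (2 * l)) + 2 = 2 * real l + 3" "real (Suc (2 * l)) = 2 * real l + 1" by simp_all
  ultimately have "(2 * real l + 3) * moment k (2 * Suc l) = (2 * real l + 1) * (norm k)\<^sup>2 * (4 * pi * norm k ^ (2 * l) / (2 * real l + 1))"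
    unfolding conjunct1[OF Suc] by (simp only:)
  also have "\<dots> = 4 * pi * norm k ^ (2 * Suc l)" by (simp add: field_simps power2_eq_square)
  finally have "moment k (2 * Suc l) = 4 * pi * norm k ^ (2 * Suc l) / (2 * real (Suc l) + 1)"
    by (simp add: field_simps)
  moreover have "moment k (Suc (2 * Suc l)) = 0"
    using moment_recursion[of "2 * Suc l" k] Suc by simp
  ultimately show ?case by blast
qed

text \<open>The mean over the sphere of radius \<open>|\<tau>|\<close> around the argument.\<close>

definition sph :: "real \<Rightarrow> (real ^ 3 \<Rightarrow> 'b::banach) \<Rightarrow> real ^ 3 \<Rightarrow> 'b" where
  "sph \<tau> = cmean (0, 0) (pi, 2 * pi) (\<lambda>p. sin (fst p) / (4 * pi)) (\<lambda>p. \<tau> *\<^sub>R omega p)"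

lemma sph_continuous: "continuous_on sphere_box (\<lambda>p. sin (fst p) / (4 * pi) :: real)" "continuous_on sphere_box (\<lambda>p. \<tau> *\<^sub>R omega p)"
  by (intro continuous_intros continuous_omega; simp)+

lemma sph_moment: "integral sphere_box (\<lambda>p. sin (fst p) / (4 * pi) * (k \<bullet> \<tau> *\<^sub>R omega p) ^ j) = \<tau> ^ j * moment k j / (4 * pi)"
proof -
  have "sin (fst p) / (4 * pi) * (k \<bullet> \<tau> *\<^sub>R omega p) ^ j = (\<tau> ^ j / (4 * pi)) * (sin (fst p) * (k \<bullet> omega p) ^ j)" for p
    by (simp add: power_mult_distrib)
  then have "integral sphere_box (\<lambda>p. sin (fst p) / (4 * pi) * (k \<bullet> \<tau> *\<^sub>R omega p) ^ j) = (\<tau> ^ j / (4 * pi)) * moment k j"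
    unfolding moment_def by (simp only: integral_mult_right)
  then show ?thesis by simp
qed

lemma sum_even:
  fixes f :: "nat \<Rightarrow> real" and n :: nat
  shows "(\<Sum>j\<le>n. if even j then f (j div 2) else (0::real)) = (\<Sum>l | 2 * l \<le> n. f l)"
proof -
  have "(\<Sum>j\<le>n. if even j then f (j div 2) else 0) = (\<Sum>j | j \<le> n \<and> even j. f (j div 2))"
    by (rule sum.mono_neutral_cong_right) auto
  also have "\<dots> = (\<Sum>l | 2 * l \<le> n. f l)"
    by (rule sum.reindex_bij_witness[of _ "\<lambda>l. 2 * l" "\<lambda>j. j div 2"]) auto
  finally show ?thesis .
qed

text \<open>
  For a power of \<open>k \<bullet> x\<close> expand the binomial in the integral: odd moments vanish, and the even ones produce the iterated Laplacians.
\<close>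

lemma Pizzetti:
  assumes "ridge_span d f" "d \<le> 2 * L + 1"
  shows "sph \<tau> f x = (\<Sum>l\<le>L. \<tau> ^ (2 * l) / fact (2 * l + 1) * (lap ^^ l) f x)"
  using assms(1)
proof (induction arbitrary: x)
  case (ridge n k)
  have "sph \<tau> (\<lambda>x. (k \<bullet> x) ^ n) x = (\<Sum>j\<le>n. of_nat (n choose j) * (\<tau> ^ j * moment k j / (4 * pi)) * (k \<bullet> x) ^ (n - j))"
    unfolding sph_def cmean_ridge[OF sph_continuous] sph_moment ..
  also have "\<dots> = (\<Sum>j\<le>n. if even j then of_nat (n choose (2 * (j div 2))) * (\<tau> ^ (2 * (j div 2)) * norm k ^ (2 * (j div 2)) / (2 * real (j div 2) + 1)) * (k \<bullet> x) ^ (n - 2 * (j div 2)) else 0)"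
  proof (rule sum.cong[OF refl])
    fix j
    show "of_nat (n choose j) * (\<tau> ^ j * moment k j / (4 * pi)) * (k \<bullet> x) ^ (n - j) = (if even j then of_nat (n choose (2 * (j div 2))) * (\<tau> ^ (2 * (j div 2)) * norm k ^ (2 * (j div 2)) / (2 * real (j div 2) + 1)) * (k \<bullet> x) ^ (n - 2 * (j div 2)) else 0)"
      using moment_eq[of k "j div 2"] by (cases "even j") (auto elim!: evenE oddE)
  qed
  also have "\<dots> = (\<Sum>l | 2 * l \<le> n. of_nat (n choose (2 * l)) * (\<tau> ^ (2 * l) * norm k ^ (2 * l) / (2 * real l + 1)) * (k \<bullet> x) ^ (n - 2 * l))"
    by (rule sum_even[of "\<lambda>l. of_nat (n choose (2 * l)) * (\<tau> ^ (2 * l) * norm k ^ (2 * l) / (2 * real l + 1)) * (k \<bullet> x) ^ (n - 2 * l)"])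
  also have "\<dots> = (\<Sum>l\<le>L. \<tau> ^ (2 * l) / fact (2 * l + 1) * (lap ^^ l) (\<lambda>x. (k \<bullet> x) ^ n) x)"
  proof (rule sum.mono_neutral_cong_left)
    show "{l. 2 * l \<le> n} \<subseteq> {..L}" using ridge assms(2) by auto
    show "\<forall>l\<in>{..L} - {l. 2 * l \<le> n}. \<tau> ^ (2 * l) / fact (2 * l + 1) * (lap ^^ l) (\<lambda>x. (k \<bullet> x) ^ n) x = 0"
      by (auto simp: lap_power_ridge)
    fix l assume "l \<in> {l. 2 * l \<le> n}"
    then have l: "2 * l \<le> n" by simp
    have b: "real (n choose (2 * l)) = fact n / (fact (2 * l) * fact (n - 2 * l))" by (rule binomial_fact[OF l])
    have f: "(fact (2 * l + 1) :: real) = (2 * real l + 1) * fact (2 * l)" by simp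
    show "of_nat (n choose (2 * l)) * (\<tau> ^ (2 * l) * norm k ^ (2 * l) / (2 * real l + 1)) * (k \<bullet> x) ^ (n - 2 * l) = \<tau> ^ (2 * l) / fact (2 * l + 1) * (lap ^^ l) (\<lambda>x. (k \<bullet> x) ^ n) x"
      unfolding lap_power_ridge b f using l by (simp add: mult_ac)
  qed simp
  finally show ?case .
next
  case (add f g)
  then show ?case
    unfolding sph_def cmean_add[OF sph_continuous ridge_span_continuous[OF add.hyps(1)] ridge_span_continuous[OF add.hyps(2)]] lap_power_add[OF add.hyps]
    by (simp only: add.IH[unfolded sph_def] sum.distrib distrib_left)
next
  case (scale f c)
  then show ?case
    unfolding sph_def cmean_scale[OF sph_continuous] lap_power_scale[OF scale.hyps]
    by (simp only: scale.IH[unfolded sph_def] sum_distrib_left mult_ac)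
qed

subsection \<open>The temporal Taylor polynomial of a polynomial field\<close>

definition ridge_field :: "nat \<Rightarrow> (real ^ 3 \<Rightarrow> real ^ 3) \<Rightarrow> bool" where
  "ridge_field d F \<longleftrightarrow> (\<forall>c. ridge_span d (\<lambda>x. F x $ c))"

lemma partial_component:
  assumes "ridge_field d F" shows "partial i F x $ c = partial i (\<lambda>x. F x $ c) x"
proof -
  have e: "F y = (\<Sum>c\<in>UNIV. (F y $ c) *\<^sub>R axis c 1)" for y
    by (simp add: vec_eq_iff axis_def if_distrib cong: if_cong)
  have "((\<lambda>h. (F (x + axis i h) $ c) *\<^sub>R axis c 1) has_vector_derivative partial i (\<lambda>x. F x $ c) x *\<^sub>R (axis c 1 :: real ^ 3)) (at 0)" for c
    using assms unfolding ridge_field_def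
    by (intro bounded_linear.has_vector_derivative[OF bounded_linear_scaleR_left])
       (simp only: has_real_derivative_iff_has_vector_derivative [symmetric], rule ridge_span_deriv, blast)
  then have "((\<lambda>h. \<Sum>c\<in>UNIV. (F (x + axis i h) $ c) *\<^sub>R axis c 1) has_vector_derivative (\<Sum>c\<in>UNIV. partial i (\<lambda>x. F x $ c) x *\<^sub>R (axis c 1 :: real ^ 3))) (at 0)"
    by (intro has_vector_derivative_sum)
  then have "((\<lambda>h. F (x + axis i h)) has_vector_derivative (\<Sum>c\<in>UNIV. partial i (\<lambda>x. F x $ c) x *\<^sub>R (axis c 1 :: real ^ 3))) (at 0)"
    unfolding e [symmetric] .
  then have "partial i F x = (\<Sum>c\<in>UNIV. partial i (\<lambda>x. F x $ c) x *\<^sub>R axis c 1)"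
    unfolding partial_def[of i F] by (rule vector_derivative_at)
  then show ?thesis by (simp add: axis_def if_distrib cong: if_cong)
qed

lemma ridge_field_partial: "ridge_field d F \<Longrightarrow> ridge_field d (partial i F)"
  unfolding ridge_field_def using partial_component[of d F] ridge_span_partial'
  by (metis (no_types, lifting) ext ridge_field_def)

lemma curl_component:
  assumes "ridge_field d F"
  shows "(\<lambda>x. curl F x $ 1) = (\<lambda>x. partial 2 (\<lambda>x. F x $ 3) x - partial 3 (\<lambda>x. F x $ 2) x)"
    "(\<lambda>x. curl F x $ 2) = (\<lambda>x. partial 3 (\<lambda>x. F x $ 1) x - partial 1 (\<lambda>x. F x $ 3) x)"
    "(\<lambda>x. curl F x $ 3) = (\<lambda>x. partial 1 (\<lambda>x. F x $ 2) x - partial 2 (\<lambda>x. F x $ 1) x)"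
  unfolding curl_def by (simp_all add: partial_component[OF assms])

lemma ridge_field_curl: "ridge_field d F \<Longrightarrow> ridge_field d (curl F)"
proof -
  assume F: "ridge_field d F"
  then have "ridge_span d (\<lambda>x. F x $ c)" for c by (simp add: ridge_field_def)
  then have "ridge_span d (\<lambda>x. curl F x $ 1)" "ridge_span d (\<lambda>x. curl F x $ 2)" "ridge_span d (\<lambda>x. curl F x $ 3)"
    unfolding curl_component[OF F] by (auto intro!: ridge_span_diff ridge_span_partial')
  then show ?thesis unfolding ridge_field_def using exhaust_3 by metis
qed

lemma ridge_field_scale: "ridge_field d F \<Longrightarrow> ridge_field d (\<lambda>x. a *\<^sub>R F x)"
  unfolding ridge_field_def by (auto intro: ridge_span.scale)

definition div_free :: "(real ^ 3 \<Rightarrow> real ^ 3) \<Rightarrow> bool" where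
  "div_free F \<longleftrightarrow> (\<forall>x. partial 1 (\<lambda>x. F x $ 1) x + partial 2 (\<lambda>x. F x $ 2) x + partial 3 (\<lambda>x. F x $ 3) x = 0)"

lemma div_free_curl: "ridge_field d F \<Longrightarrow> div_free (curl F)"
proof -
  assume F: "ridge_field d F"
  then have r: "ridge_span d (\<lambda>x. F x $ c)" for c by (simp add: ridge_field_def)
  show ?thesis
    unfolding div_free_def curl_component[OF F]
    using partial_commute[OF r, of 1 2 3] partial_commute[OF r, of 1 3 2] partial_commute[OF r, of 2 3 1]
    by (simp add: partial_diff[of d] ridge_span_partial' r)
qed

lemma div_free_scale: "ridge_field d F \<Longrightarrow> div_free F \<Longrightarrow> div_free (\<lambda>x. a *\<^sub>R F x)"
  unfolding div_free_def ridge_field_def by (simp add: partial_scale[of d] distrib_left [symmetric])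

lemma curl_curl_div_free:
  assumes F: "ridge_field d F" and 0: "div_free F"
  shows "curl (curl F) x $ c = - lap (\<lambda>x. F x $ c) x"
proof -
  have r: "ridge_span d (\<lambda>x. F x $ c)" for c using F by (simp add: ridge_field_def)
  note rp = ridge_span_partial'[OF r]
  have z: "partial i (partial 1 (\<lambda>x. F x $ 1)) x + partial i (partial 2 (\<lambda>x. F x $ 2)) x + partial i (partial 3 (\<lambda>x. F x $ 3)) x = 0" for i
  proof -
    have "partial i (\<lambda>x. partial 1 (\<lambda>x. F x $ 1) x + partial 2 (\<lambda>x. F x $ 2) x + partial 3 (\<lambda>x. F x $ 3) x) = (\<lambda>x. partial i (partial 1 (\<lambda>x. F x $ 1)) x + partial i (partial 2 (\<lambda>x. F x $ 2)) x + partial i (partial 3 (\<lambda>x. F x $ 3)) x)"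
      by (simp add: partial_add[of d] ridge_span.add rp)
    moreover have "(\<lambda>x. partial 1 (\<lambda>x. F x $ 1) x + partial 2 (\<lambda>x. F x $ 2) x + partial 3 (\<lambda>x. F x $ 3) x) = (\<lambda>x. 0)"
      using 0 by (simp add: div_free_def)
    moreover have "partial i (\<lambda>x. 0 :: real) = (\<lambda>x. 0)" by (rule partial_eqI) simp
    ultimately show ?thesis by (metis (no_types, lifting))
  qed
  have C: "curl (curl F) x $ 1 = partial 2 (\<lambda>x. curl F x $ 3) x - partial 3 (\<lambda>x. curl F x $ 2) x"
    "curl (curl F) x $ 2 = partial 3 (\<lambda>x. curl F x $ 1) x - partial 1 (\<lambda>x. curl F x $ 3) x"
    "curl (curl F) x $ 3 = partial 1 (\<lambda>x. curl F x $ 2) x - partial 2 (\<lambda>x. curl F x $ 1) x"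
    using fun_cong[OF curl_component(1)[OF ridge_field_curl[OF F]]] fun_cong[OF curl_component(2)[OF ridge_field_curl[OF F]]]
      fun_cong[OF curl_component(3)[OF ridge_field_curl[OF F]]] by blast+
  have "curl (curl F) x $ 1 = - lap (\<lambda>x. F x $ 1) x" "curl (curl F) x $ 2 = - lap (\<lambda>x. F x $ 2) x" "curl (curl F) x $ 3 = - lap (\<lambda>x. F x $ 3) x"
    unfolding C curl_component[OF F] lap_def sum_3
    using z[of 1] z[of 2] z[of 3] partial_commute[OF r, of 1 2] partial_commute[OF r, of 1 3] partial_commute[OF r, of 2 3]
    by (simp_all add: partial_diff[of d] rp)
  then show ?thesis using exhaust_3[of c] by metis
qed

text \<open>
  On divergence-free fields \<open>- \<nabla> \<times> \<nabla> \<times>\<close> is the Laplacian, and all the iterates stay divergence-free because the starting field is.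
\<close>

lemma taylor_term_lap:
  assumes F: "ridge_field d F" and 0: "div_free F"
  shows "ridge_field d (taylor_term c F (Suc l)) \<and> div_free (taylor_term c F (Suc l)) \<and>
    (\<forall>j. (\<lambda>x. taylor_term c F (Suc l) x $ j) = (\<lambda>x. (c\<^sup>2) ^ l * (lap ^^ l) (\<lambda>x. F x $ j) x))"
proof (induction l)
  case 0
  then show ?case using assms by (simp add: taylor_term_def)
next
  case (Suc l)
  define G where "G = taylor_term c F (Suc l)"
  have G: "ridge_field d G" "div_free G" "\<And>j. (\<lambda>x. G x $ j) = (\<lambda>x. (c\<^sup>2) ^ l * (lap ^^ l) (\<lambda>x. F x $ j) x)"
    using Suc by (auto simp: G_def)
  have n: "taylor_term c F (Suc (Suc l)) = (\<lambda>x. - (c\<^sup>2) *\<^sub>R curl (curl G) x)"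
    by (simp add: G_def taylor_term_def)
  have r: "ridge_span d (\<lambda>x. F x $ j)" for j using F by (simp add: ridge_field_def)
  have "(\<lambda>x. (- (c\<^sup>2) *\<^sub>R curl (curl G) x) $ j) = (\<lambda>x. (c\<^sup>2) ^ Suc l * (lap ^^ Suc l) (\<lambda>x. F x $ j) x)" for j
    using lap_scale[OF ridge_span_lap_power[OF r], of "(c\<^sup>2) ^ l" l j]
    by (simp add: curl_curl_div_free[OF G(1,2)] G(3) mult_ac)
  then show ?case unfolding n
    using ridge_field_scale[OF ridge_field_curl[OF ridge_field_curl[OF G(1)]]]
      div_free_scale[OF ridge_field_curl[OF ridge_field_curl[OF G(1)]] div_free_curl[OF ridge_field_curl[OF G(1)]]] by blast
qed

text \<open>
  The Taylor coefficients of the update are those of Pizzetti's formula with radius \<open>c \<Delta>t / 2\<close>, and there are enough of them for the degree.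
\<close>

lemma increment_eq_sph:
  assumes W: "ridge_field d W" and d: "d \<le> 2 * L + 1"
  shows "(\<lambda>x. increment c \<Delta>t (Suc L) (\<lambda>x. c *\<^sub>R curl W x) x $ j) = (\<lambda>x. (c * \<Delta>t) * sph (c * \<Delta>t / 2) (\<lambda>x. curl W x $ j) x)"
proof
  fix x
  define F where "F x = c *\<^sub>R curl W x" for x
  have F: "ridge_field d F" "div_free F"
    unfolding F_def by (rule ridge_field_scale[OF ridge_field_curl[OF W]], rule div_free_scale[OF ridge_field_curl[OF W] div_free_curl[OF W]])
  have r: "ridge_span d (\<lambda>x. curl W x $ j)" using ridge_field_curl[OF W] by (simp add: ridge_field_def)
  have "increment c \<Delta>t (Suc L) F x $ j = 2 * (\<Sum>l = 1..Suc L. (\<Delta>t / 2) ^ (2 * l - 1) / fact (2 * l - 1) * taylor_term c F l x $ j)"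
    by (simp add: increment_def)
  also have "\<dots> = 2 * (\<Sum>l\<le>L. (\<Delta>t / 2) ^ (2 * Suc l - 1) / fact (2 * Suc l - 1) * taylor_term c F (Suc l) x $ j)"
    by (rule arg_cong[where f = "(*) 2"], rule sum.reindex_bij_witness[of _ Suc "\<lambda>l. l - 1"]) auto
  also have "\<dots> = (\<Sum>l\<le>L. (c * \<Delta>t) * ((c * \<Delta>t / 2) ^ (2 * l) / fact (2 * l + 1) * (lap ^^ l) (\<lambda>x. curl W x $ j) x))"
    unfolding sum_distrib_left
  proof (rule sum.cong[OF refl])
    fix l
    have "taylor_term c F (Suc l) x $ j = (c\<^sup>2) ^ l * (lap ^^ l) (\<lambda>x. F x $ j) x"
      by (rule taylor_term_lap[OF F, THEN conjunct2, THEN conjunct2, THEN spec, THEN fun_cong])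
    also have "(lap ^^ l) (\<lambda>x. F x $ j) x = c * (lap ^^ l) (\<lambda>x. curl W x $ j) x"
      unfolding F_def using fun_cong[OF lap_power_scale[OF r, of l c], of x] by simp
    finally have t: "taylor_term c F (Suc l) x $ j = (c\<^sup>2) ^ l * (c * (lap ^^ l) (\<lambda>x. curl W x $ j) x)" .
    have "2 * Suc l - 1 = Suc (2 * l)" by simp
    then show "2 * ((\<Delta>t / 2) ^ (2 * Suc l - 1) / fact (2 * Suc l - 1) * taylor_term c F (Suc l) x $ j)
        = (c * \<Delta>t) * ((c * \<Delta>t / 2) ^ (2 * l) / fact (2 * l + 1) * (lap ^^ l) (\<lambda>x. curl W x $ j) x)"
      unfolding t by (simp add: power_mult power_mult_distrib power_divide del: fact_Suc)
  qed
  also have "\<dots> = (c * \<Delta>t) * sph (c * \<Delta>t / 2) (\<lambda>x. curl W x $ j) x"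
    unfolding Pizzetti[OF r d] sum_distrib_left ..
  finally show "increment c \<Delta>t (Suc L) (\<lambda>x. c *\<^sub>R curl W x) x $ j = (c * \<Delta>t) * sph (c * \<Delta>t / 2) (\<lambda>x. curl W x $ j) x"
    unfolding F_def .
qed

lemma ridge_span_sph: "ridge_span d f \<Longrightarrow> ridge_span d (sph \<tau> f)"
  unfolding sph_def by (rule ridge_span_cmean[OF sph_continuous])

lemma partial_sph: "ridge_span d f \<Longrightarrow> partial i (sph \<tau> f) = sph \<tau> (partial i f)"
  unfolding sph_def by (rule partial_cmean[OF sph_continuous])

lemma mixed_partial_component:
  fixes \<alpha> :: "nat ^ 3"
  assumes "ridge_field d F" shows "mixed_partial \<alpha> F x $ c = mixed_partial \<alpha> (\<lambda>x. F x $ c) x"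
proof -
  have p: "ridge_field d ((partial i ^^ n) F) \<and> (\<lambda>x. (partial i ^^ n) F x $ c) = (partial i ^^ n) (\<lambda>x. F x $ c)"
    if "ridge_field d F" for i n F
    by (induction n) (auto simp: that ridge_field_partial partial_component[of d])
  define g where "g = (partial 3 ^^ (\<alpha> $ 3)) F"
  define h where "h = (partial 2 ^^ (\<alpha> $ 2)) g"
  have g: "ridge_field d g" "(\<lambda>x. g x $ c) = (partial 3 ^^ (\<alpha> $ 3)) (\<lambda>x. F x $ c)" unfolding g_def using p[OF assms] by blast+
  have h: "ridge_field d h" "(\<lambda>x. h x $ c) = (partial 2 ^^ (\<alpha> $ 2)) (\<lambda>x. g x $ c)" unfolding h_def using p[OF g(1)] by blast+
  have "mixed_partial \<alpha> F x $ c = (partial 1 ^^ (\<alpha> $ 1)) (\<lambda>x. h x $ c) x"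
    using p[OF h(1), where i = 1 and n = "\<alpha> $ 1"] fun_cong unfolding mixed_partial_def h_def g_def by fastforce
  then show ?thesis unfolding h(2) g(2) mixed_partial_def .
qed

section \<open>Fourier multipliers that act locally\<close>

subsection \<open>Absolutely convergent Fourier series\<close>

lemma infsum_continuous:
  fixes f :: "'k \<Rightarrow> 'a::topological_space \<Rightarrow> complex"
  assumes B: "B summable_on UNIV" "\<And>k x. cmod (f k x) \<le> B k" and c: "\<And>k. continuous_on UNIV (f k)"
  shows "uniform_limit UNIV (\<lambda>X x. \<Sum>k\<in>X. f k x) (\<lambda>x. \<Sum>\<^sub>\<infinity>k. f k x) (finite_subsets_at_top UNIV)"
    and "continuous_on UNIV (\<lambda>x. \<Sum>\<^sub>\<infinity>k. f k x)"
proof -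
  show u: "uniform_limit UNIV (\<lambda>X x. \<Sum>k\<in>X. f k x) (\<lambda>x. \<Sum>\<^sub>\<infinity>k. f k x) (finite_subsets_at_top UNIV)"
    by (rule Weierstrass_m_test_general[OF B(2) B(1)])
  show "continuous_on UNIV (\<lambda>x. \<Sum>\<^sub>\<infinity>k. f k x)"
    by (rule uniform_limit_theorem[OF _ u]) (auto intro!: always_eventually continuous_on_sum c)
qed

definition fseries :: "(int ^ 3 \<Rightarrow> complex) \<Rightarrow> real ^ 3 \<Rightarrow> complex" where
  "fseries a x = (\<Sum>\<^sub>\<infinity>k. a k * wave k x)"

definition bounded_cont :: "(real ^ 3 \<Rightarrow> complex) \<Rightarrow> bool" where
  "bounded_cont f \<longleftrightarrow> continuous_on UNIV f \<and> (\<exists>B. \<forall>x. cmod (f x) \<le> B)"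

lemma bounded_cont_wave: "bounded_cont (wave k)"
  unfolding bounded_cont_def by (auto intro!: continuous_intros exI[of _ 1])

lemma bounded_cont_scale: "bounded_cont f \<Longrightarrow> bounded_cont (\<lambda>x. z * f x)"
  unfolding bounded_cont_def by (auto intro!: continuous_intros simp: norm_mult) (meson mult_left_mono norm_ge_zero)

lemma bounded_cont_add: "bounded_cont f \<Longrightarrow> bounded_cont g \<Longrightarrow> bounded_cont (\<lambda>x. f x + g x)"
  unfolding bounded_cont_def by (auto intro!: continuous_intros) (meson norm_add_rule_thm)

lemma bounded_cont_sum: "finite A \<Longrightarrow> (\<And>k. k \<in> A \<Longrightarrow> bounded_cont (f k)) \<Longrightarrow> bounded_cont (\<lambda>x. \<Sum>k\<in>A. f k x)"
  by (induction A rule: finite_induct) (auto intro!: bounded_cont_add exI[of _ 0] simp: bounded_cont_def[of "\<lambda>x. 0"])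

definition abs_summable :: "(int ^ 3 \<Rightarrow> complex) \<Rightarrow> bool" where
  "abs_summable a \<longleftrightarrow> (\<lambda>k. cmod (a k)) summable_on UNIV"

lemma bounded_cont_fseries:
  assumes a: "abs_summable a" shows "bounded_cont (fseries a)"
proof -
  have s: "(\<lambda>k. cmod (a k)) summable_on UNIV" using a by (simp add: abs_summable_def)
  have "cmod (fseries a x) \<le> (\<Sum>\<^sub>\<infinity>k. cmod (a k))" for x
    unfolding fseries_def using norm_infsum_bound[of "\<lambda>k. a k * wave k x" UNIV] s by (simp add: norm_mult)
  moreover have "continuous_on UNIV (fseries a)"
    unfolding fseries_def[abs_def]
    by (rule infsum_continuous(2)[OF s]) (auto simp: norm_mult intro!: continuous_intros)
  ultimately show ?thesis unfolding bounded_cont_def by blast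
qed

text \<open>A linear functional that is bounded for the supremum norm may be applied to an absolutely convergent Fourier series term by term.\<close>

lemma has_sum_functional:
  fixes L :: "(real ^ 3 \<Rightarrow> complex) \<Rightarrow> complex"
  assumes a: "abs_summable a"
    and add: "\<And>f g. bounded_cont f \<Longrightarrow> bounded_cont g \<Longrightarrow> L (\<lambda>x. f x + g x) = L f + L g"
    and scale: "\<And>z f. bounded_cont f \<Longrightarrow> L (\<lambda>x. z * f x) = z * L f"
    and bound: "\<And>f B. bounded_cont f \<Longrightarrow> (\<And>x. cmod (f x) \<le> B) \<Longrightarrow> cmod (L f) \<le> C * B"
  shows "((\<lambda>k. a k * L (wave k)) has_sum L (fseries a)) UNIV"
proof -
  have s: "(\<lambda>k. cmod (a k)) summable_on UNIV" using a by (simp add: abs_summable_def)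
  have bt: "bounded_cont (\<lambda>x. a k * wave k x)" for k by (rule bounded_cont_scale[OF bounded_cont_wave])
  have fin: "L (\<lambda>x. \<Sum>k\<in>X. a k * wave k x) = (\<Sum>k\<in>X. a k * L (wave k))" if "finite X" for X
    using that
  proof (induction X rule: finite_induct)
    case empty
    have "L (\<lambda>x. 0 * wave 0 x) = 0" by (subst scale[OF bounded_cont_wave]) simp
    then show ?case by simp
  next
    case (insert k X)
    then show ?case by (simp add: add[OF bt bounded_cont_sum[OF _ bt]] scale[OF bounded_cont_wave])
  qed
  have u: "uniform_limit UNIV (\<lambda>X x. \<Sum>k\<in>X. a k * wave k x) (fseries a) (finite_subsets_at_top UNIV)"
    unfolding fseries_def[abs_def]
    by (rule infsum_continuous(1)[OF s]) (auto simp: norm_mult intro!: continuous_intros)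
  have "((\<lambda>X. \<Sum>k\<in>X. a k * L (wave k)) \<longlongrightarrow> L (fseries a)) (finite_subsets_at_top UNIV)"
  proof (rule tendstoI)
    fix e :: real assume e: "0 < e"
    define e' where "e' = e / (\<bar>C\<bar> + 1)"
    have e': "e' > 0" using e by (simp add: e'_def)
    have "\<forall>\<^sub>F X in finite_subsets_at_top UNIV. \<forall>x\<in>UNIV. dist (\<Sum>k\<in>X. a k * wave k x) (fseries a x) < e'"
      using u e' unfolding uniform_limit_iff by blast
    moreover have "\<forall>\<^sub>F X in finite_subsets_at_top (UNIV :: (int ^ 3) set). finite X"
      by (auto simp: eventually_finite_subsets_at_top)
    ultimately show "\<forall>\<^sub>F X in finite_subsets_at_top UNIV. dist (\<Sum>k\<in>X. a k * L (wave k)) (L (fseries a)) < e"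
    proof eventually_elim
      case (elim X)
      have bX: "bounded_cont (\<lambda>x. \<Sum>k\<in>X. a k * wave k x)" using elim by (intro bounded_cont_sum bt)
      have bF: "bounded_cont (\<lambda>x. (-1) * fseries a x)" by (intro bounded_cont_scale bounded_cont_fseries a)
      have "L (\<lambda>x. (\<Sum>k\<in>X. a k * wave k x) + (-1) * fseries a x) = (\<Sum>k\<in>X. a k * L (wave k)) - L (fseries a)"
        unfolding add[OF bX bF] scale[OF bounded_cont_fseries[OF a]] fin[OF elim(2)] by simp
      moreover have "cmod (L (\<lambda>x. (\<Sum>k\<in>X. a k * wave k x) + (-1) * fseries a x)) \<le> C * e'"
        using elim by (intro bound bounded_cont_add[OF bX bF]) (auto simp: dist_norm less_imp_le)
      moreover have "C * e' < e"
      proof -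
        have "C * e' < (\<bar>C\<bar> + 1) * e'" using e' by (intro mult_strict_right_mono) auto
        also have "\<dots> = e" by (simp add: e'_def)
        finally show ?thesis .
      qed
      ultimately show ?case by (simp add: dist_norm)
    qed
  qed
  then show ?thesis by (simp add: has_sum_def)
qed

text \<open>The operator \<open>T\<close> acts on functions, the symbol \<open>s\<close> on the coefficients of their absolutely convergent Fourier series.\<close>

definition multiplier_op :: "((real ^ 3 \<Rightarrow> complex) \<Rightarrow> real ^ 3 \<Rightarrow> complex) \<Rightarrow> (int ^ 3 \<Rightarrow> complex) \<Rightarrow> bool" where
  "multiplier_op T s \<longleftrightarrow> (\<forall>a. abs_summable a \<longrightarrow> abs_summable (\<lambda>k. s k * a k) \<and> T (fseries a) = fseries (\<lambda>k. s k * a k))"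

lemma multiplier_op_comp: "multiplier_op T s \<Longrightarrow> multiplier_op U u \<Longrightarrow> multiplier_op (\<lambda>f. T (U f)) (\<lambda>k. s k * u k)"
  unfolding multiplier_op_def by (simp add: mult.assoc)

lemma multiplier_op_power: "multiplier_op T s \<Longrightarrow> multiplier_op (T ^^ n) (\<lambda>k. s k ^ n)"
proof (induction n)
  case 0
  then show ?case by (simp add: multiplier_op_def)
next
  case (Suc n)
  then show ?case using multiplier_op_comp[of T s "T ^^ n" "\<lambda>k. s k ^ n"] by (simp add: comp_def)
qed

lemma multiplier_op_functional:
  fixes T :: "(real ^ 3 \<Rightarrow> complex) \<Rightarrow> real ^ 3 \<Rightarrow> complex"
  assumes "\<And>f g x. bounded_cont f \<Longrightarrow> bounded_cont g \<Longrightarrow> T (\<lambda>x. f x + g x) x = T f x + T g x"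
    and "\<And>z f x. bounded_cont f \<Longrightarrow> T (\<lambda>x. z * f x) x = z * T f x"
    and bound: "\<And>f B x. bounded_cont f \<Longrightarrow> (\<And>x. cmod (f x) \<le> B) \<Longrightarrow> cmod (T f x) \<le> C * B"
    and s: "\<And>k x. T (wave k) x = s k * wave k x"
  shows "multiplier_op T s"
  unfolding multiplier_op_def
proof (intro allI impI conjI ext)
  fix a assume a: "abs_summable a"
  have "cmod (s k) \<le> C" for k
    using bound[OF bounded_cont_wave, of k 1 0] s[of k 0] by (simp add: norm_mult)
  then show "abs_summable (\<lambda>k. s k * a k)"
    unfolding abs_summable_def
    by (intro summable_on_comparison_test[OF summable_on_cmult_right[OF a[unfolded abs_summable_def], of C]])
       (auto simp: norm_mult intro!: mult_right_mono)
  fix x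
  have "((\<lambda>k. a k * T (wave k) x) has_sum T (fseries a) x) UNIV"
    by (rule has_sum_functional[OF a, of "\<lambda>f. T f x" C]) (use assms in auto)
  then show "T (fseries a) x = fseries (\<lambda>k. s k * a k) x"
    unfolding fseries_def s by (simp add: infsumI mult_ac)
qed

lemma multiplier_op_cmean:
  fixes a b :: "'a::euclidean_space"
  assumes w: "continuous_on (cbox a b) w" and Y: "continuous_on (cbox a b) Y"
  shows "multiplier_op (cmean a b w Y) (\<lambda>k. integral (cbox a b) (\<lambda>\<omega>. w \<omega> *\<^sub>R wave k (Y \<omega>)))"
proof (rule multiplier_op_functional[where C = "integral (cbox a b) (\<lambda>\<omega>. \<bar>w \<omega>\<bar>)"])
  fix f g :: "real ^ 3 \<Rightarrow> complex" and x
  assume "bounded_cont f" "bounded_cont g"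
  then show "cmean a b w Y (\<lambda>x. f x + g x) x = cmean a b w Y f x + cmean a b w Y g x"
    by (simp add: bounded_cont_def cmean_add[OF w Y])
next
  fix f :: "real ^ 3 \<Rightarrow> complex" and z x
  show "cmean a b w Y (\<lambda>x. z * f x) x = z * cmean a b w Y f x"
    unfolding cmean_def mult_scaleR_right [symmetric] by (rule integral_mult_right)
next
  fix f :: "real ^ 3 \<Rightarrow> complex" and B x
  assume f: "bounded_cont f" and B: "\<And>x. cmod (f x) \<le> B"
  have "cmod (cmean a b w Y f x) \<le> integral (cbox a b) (\<lambda>\<omega>. \<bar>w \<omega>\<bar> * B)"
    unfolding cmean_def using f w B
    by (intro integral_norm_bound_integral integrable_continuous cmean_continuous_integrand[OF w Y] continuous_intros)
       (auto simp: bounded_cont_def mult_left_mono)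
  then show "cmod (cmean a b w Y f x) \<le> integral (cbox a b) (\<lambda>\<omega>. \<bar>w \<omega>\<bar>) * B" by simp
next
  fix k x
  show "cmean a b w Y (wave k) x = integral (cbox a b) (\<lambda>\<omega>. w \<omega> *\<^sub>R wave k (Y \<omega>)) * wave k x"
    unfolding cmean_def wave_shift mult_scaleR_right [symmetric] mult.commute[of _ "wave k x"] by (rule integral_mult_right)
qed

subsection \<open>Symbols of axis means, difference quotients and spherical means\<close>

definition sinc :: "real \<Rightarrow> real" where "sinc x = (if x = 0 then 1 else sin x / x)"

lemma sinc_0 [simp]: "sinc 0 = 1" by (simp add: sinc_def)

lemma mult_sinc: "x * sinc x = sin x" by (simp add: sinc_def)

lemma abs_sinc_le: "\<bar>sinc x\<bar> \<le> 1"
  using abs_sin_x_le_abs_x[of x] by (simp add: sinc_def)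

lemma continuous_sinc: "continuous_on UNIV sinc"
proof -
  have "isCont sinc x" for x
  proof (cases "x = 0")
    case True
    have "(\<lambda>h. (sin (0 + h) - sin 0) / h) \<midarrow>0\<rightarrow> cos (0 :: real)" using DERIV_sin[of "0::real"] by (simp add: DERIV_def)
    then have "(\<lambda>h. sin h / h) \<midarrow>0\<rightarrow> (1 :: real)" by simp
    then have "sinc \<midarrow>0\<rightarrow> 1" by (rule Lim_transform_eventually) (auto simp: sinc_def eventually_at intro!: exI[of _ 1])
    then show ?thesis using True by (simp add: isCont_def)
  next
    case False
    have "\<forall>\<^sub>F y in nhds x. sinc y = sin y / y"
      by (rule eventually_mono[OF t1_space_nhds[OF False]]) (auto simp: sinc_def)
    from isCont_cong[OF this] show ?thesis using False by (auto intro!: continuous_intros)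
  qed
  then show ?thesis by (simp add: continuous_on_eq_continuous_at)
qed

definition avg :: "3 \<Rightarrow> real \<Rightarrow> (real ^ 3 \<Rightarrow> 'b::banach) \<Rightarrow> real ^ 3 \<Rightarrow> 'b" where
  "avg i \<epsilon> = cmean (-1) 1 (\<lambda>s :: real. 1 / 2) (\<lambda>s. axis i (\<epsilon> * s))"

definition dif :: "3 \<Rightarrow> real \<Rightarrow> (real ^ 3 \<Rightarrow> 'b::real_normed_vector) \<Rightarrow> real ^ 3 \<Rightarrow> 'b" where
  "dif i \<epsilon> f x = (1 / (2 * \<epsilon>)) *\<^sub>R (f (x + axis i \<epsilon>) - f (x - axis i \<epsilon>))"

lemma avg_continuous: "continuous_on S (\<lambda>s :: real. 1 / 2 :: real)" "continuous_on S (\<lambda>s. axis i (\<epsilon> * s))"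
proof -
  have "continuous_on S (\<lambda>s. (\<epsilon> * s) *\<^sub>R axis i (1 :: real))" by (intro continuous_intros)
  then show "continuous_on S (\<lambda>s. axis i (\<epsilon> * s))" by (metis (no_types, lifting) ext axis_scaleR)
qed simp

lemma multiplier_op_avg: "multiplier_op (avg i \<epsilon>) (\<lambda>k. of_real (sinc (\<epsilon> * of_int (k $ i))))"
proof -
  have "integral (cbox (-1) 1) (\<lambda>s. (1 / 2) *\<^sub>R wave k (axis i (\<epsilon> * s))) = of_real (sinc (\<epsilon> * of_int (k $ i)))" for k
  proof -
    define a where "a = \<epsilon> * of_int (k $ i)"
    have e: "wave k (axis i (\<epsilon> * s)) = cis (a * s)" for s by (simp add: wave_axis a_def mult_ac)
    show ?thesis
    proof (cases "a = 0")
      case True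
      then show ?thesis unfolding e a_def [symmetric] by simp
    next
      case False
      have "((\<lambda>s. (1 / (2 * \<i> * of_real a)) * cis (a * s)) has_vector_derivative (1 / (2 * \<i> * of_real a)) * (\<i> * of_real a * cis (a * s))) (at s within {-1..1})" for s
        by (intro has_vector_derivative_mult_right has_vector_derivative_cis)
      then have "((\<lambda>s. (1 / (2 * \<i> * of_real a)) * (\<i> * of_real a * cis (a * s))) has_integral
          (1 / (2 * \<i> * of_real a)) * cis (a * 1) - (1 / (2 * \<i> * of_real a)) * cis (a * (-1))) {-1..1}"
        by (intro fundamental_theorem_of_calculus) auto
      moreover have C: "(1 / (2 * \<i> * of_real a)) * (\<i> * of_real a * cis (a * s)) = (1 / 2) *\<^sub>R cis (a * s)" for s
        using False by (simp add: scaleR_conv_of_real)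
      moreover have "(1 / (2 * \<i> * of_real a)) * cis (a * 1) - (1 / (2 * \<i> * of_real a)) * cis (a * (-1)) = of_real (sinc a)"
        using False by (simp add: complex_eq_iff sinc_def Re_divide Im_divide power2_eq_square)
      ultimately show ?thesis unfolding e a_def [symmetric] cbox_interval C by (simp only: integral_unique)
    qed
  qed
  then show ?thesis using multiplier_op_cmean[OF avg_continuous, of "-1" 1 i \<epsilon>] unfolding avg_def by simp
qed

lemma multiplier_op_dif:
  assumes \<epsilon>: "\<epsilon> > 0"
  shows "multiplier_op (dif i \<epsilon>) (\<lambda>k. \<i> * of_int (k $ i) * of_real (sinc (\<epsilon> * of_int (k $ i))))"
proof (rule multiplier_op_functional[where C = "1 / \<epsilon>"])
  fix f :: "real ^ 3 \<Rightarrow> complex" and B x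
  assume f: "bounded_cont f" and B: "\<And>x. cmod (f x) \<le> B"
  have "cmod (f (x + axis i \<epsilon>) - f (x - axis i \<epsilon>)) \<le> 2 * B"
    using B[of "x + axis i \<epsilon>"] B[of "x - axis i \<epsilon>"] norm_triangle_ineq4[of "f (x + axis i \<epsilon>)" "f (x - axis i \<epsilon>)"] by linarith
  then have "(1 / (2 * \<epsilon>)) * cmod (f (x + axis i \<epsilon>) - f (x - axis i \<epsilon>)) \<le> (1 / (2 * \<epsilon>)) * (2 * B)"
    using \<epsilon> by (intro mult_left_mono) auto
  then show "cmod (dif i \<epsilon> f x) \<le> 1 / \<epsilon> * B" using \<epsilon> by (simp add: dif_def)
next
  fix k x
  have 1: "x - axis i \<epsilon> = x + axis i (- \<epsilon>)" by (simp add: vec_eq_iff axis_def)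
  define a where "a = \<epsilon> * of_int (k $ i)"
  have "dif i \<epsilon> (wave k) x = (1 / (2 * \<epsilon>)) *\<^sub>R (cis a - cis (- a)) * wave k x"
    unfolding dif_def 1 wave_shift wave_axis a_def by (simp add: algebra_simps)
  also have "(1 / (2 * \<epsilon>)) *\<^sub>R (cis a - cis (- a)) = \<i> * of_real (sin a / \<epsilon>)" by (simp add: complex_eq_iff)
  also have "sin a / \<epsilon> = of_int (k $ i) * sinc a"
    unfolding mult_sinc [symmetric] using \<epsilon> by (simp add: a_def)
  finally show "dif i \<epsilon> (wave k) x = \<i> * of_int (k $ i) * of_real (sinc (\<epsilon> * of_int (k $ i))) * wave k x"
    by (simp add: a_def)
qed (auto simp: dif_def algebra_simps)

text \<open>Expand the wave into its power series and integrate term by term: the moments of the sphere turn it into the power series of \<open>sinc\<close>.\<close>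

lemma sph_symbol:
  "integral sphere_box (\<lambda>p. (sin (fst p) / (4 * pi)) *\<^sub>R wave k (\<tau> *\<^sub>R omega p)) = of_real (sinc (\<tau> * norm (wavevec k)))"
proof -
  define y where "y p = wavevec k \<bullet> (\<tau> *\<^sub>R omega p)" for p
  define R where "R = \<bar>\<tau>\<bar> * (\<Sum>i\<in>UNIV. \<bar>wavevec k $ i\<bar>)"
  define f where "f n p = (sin (fst p) / (4 * pi)) *\<^sub>R ((\<i> * of_real (y p)) ^ n /\<^sub>R fact n)" for n and p :: "real \<times> real"
  define K where "K = norm (wavevec k)"
  have yR: "\<bar>y p\<bar> \<le> R" for p
  proof -
    have "\<bar>y p\<bar> \<le> (\<Sum>i\<in>UNIV. \<bar>wavevec k $ i * (\<tau> * omega p $ i)\<bar>)"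
      unfolding y_def inner_vec_def by (rule order_trans[OF sum_abs]) simp
    also have "\<dots> \<le> (\<Sum>i\<in>UNIV. \<bar>wavevec k $ i\<bar> * (\<bar>\<tau>\<bar> * 1))"
      by (intro sum_mono) (auto simp: abs_mult omega_bounded intro!: mult_left_mono mult_left_le)
    finally show ?thesis unfolding R_def sum_distrib_left by (simp add: mult.commute)
  qed
  have w1: "\<bar>sin t / (4 * pi)\<bar> \<le> 1" for t :: real
  proof -
    have "\<bar>sin t\<bar> \<le> 4 * pi" using abs_sin_le_one[of t] pi_gt3 by linarith
    then show ?thesis by simp
  qed
  have bound: "norm (f n p) \<le> R ^ n /\<^sub>R fact n" for n p
  proof -
    have "norm ((\<i> * complex_of_real (y p)) ^ n /\<^sub>R fact n) = \<bar>y p\<bar> ^ n / fact n"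
      by (simp add: norm_power norm_mult field_simps)
    then have "norm (f n p) = \<bar>sin (fst p) / (4 * pi)\<bar> * (\<bar>y p\<bar> ^ n / fact n)"
      unfolding f_def norm_scaleR by (simp only:)
    also have "\<dots> \<le> 1 * (R ^ n / fact n)"
      using yR w1 by (intro mult_mono divide_right_mono power_mono) auto
    finally show ?thesis by (simp add: field_simps)
  qed
  have u: "uniform_limit sphere_box (\<lambda>n p. \<Sum>i<n. f i p) (\<lambda>p. suminf (\<lambda>i. f i p)) sequentially"
    by (rule Weierstrass_m_test[OF bound summable_exp_generic])
  have lim: "suminf (\<lambda>i. f i p) = (sin (fst p) / (4 * pi)) *\<^sub>R wave k (\<tau> *\<^sub>R omega p)" for p
  proof -
    have "(\<lambda>n. (\<i> * of_real (y p)) ^ n /\<^sub>R fact n) sums cis (y p)"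
      using exp_converges[of "\<i> * of_real (y p)"] by (simp add: cis_conv_exp)
    from sums_scaleR_right[OF this, of "sin (fst p) / (4 * pi)"] show ?thesis
      unfolding f_def wave_def y_def [symmetric] by (simp add: sums_iff)
  qed
  have fc: "continuous_on sphere_box (f n)" for n
    unfolding f_def y_def by (intro continuous_intros continuous_omega) simp
  have cs: "continuous_on sphere_box (\<lambda>p. \<Sum>i<n. f i p)" for n by (intro continuous_on_sum fc)
  obtain I J where IJ: "\<And>n. ((\<lambda>p. \<Sum>i<n. f i p) has_integral I n) sphere_box"
    "((\<lambda>p. suminf (\<lambda>i. f i p)) has_integral J) sphere_box" "I \<longlonglongrightarrow> J"
    by (rule uniform_limit_integral_cbox[OF u cs]) auto
  have fi: "(f n has_integral (\<i> ^ n /\<^sub>R fact n) * of_real (\<tau> ^ n * moment (wavevec k) n / (4 * pi))) sphere_box" for n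
  proof -
    have "((\<lambda>p. sin (fst p) / (4 * pi) * y p ^ n) has_integral \<tau> ^ n * moment (wavevec k) n / (4 * pi)) sphere_box"
      unfolding sph_moment [symmetric] y_def
      by (intro integrable_integral integrable_continuous continuous_intros continuous_omega) simp
    from has_integral_mult_right[OF has_integral_of_real[OF this, where 'b = complex], of "\<i> ^ n /\<^sub>R fact n"]
    show ?thesis unfolding f_def power_mult_distrib scaleR_conv_of_real of_real_mult of_real_power by (simp only: mult_ac)
  qed
  have In: "I n = (\<Sum>j<n. (\<i> ^ j /\<^sub>R fact j) * of_real (\<tau> ^ j * moment (wavevec k) j / (4 * pi)))" for n
    by (rule has_integral_unique[OF IJ(1)]) (intro has_integral_sum fi finite_lessThan)
  have sJ: "(\<lambda>j. (\<i> ^ j /\<^sub>R fact j) * of_real (\<tau> ^ j * moment (wavevec k) j / (4 * pi))) sums J"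
    using IJ(3) unfolding sums_def In[abs_def] .
  have t: "of_real (\<tau> * K) * ((\<i> ^ j /\<^sub>R fact j) * of_real (\<tau> ^ j * moment (wavevec k) j / (4 * pi))) = complex_of_real (sin_coeff (Suc j) *\<^sub>R (\<tau> * K) ^ Suc j)" for j
  proof (cases "even j")
    case True
    then obtain l where l: "j = 2 * l" by (elim evenE)
    have m: "moment (wavevec k) j = 4 * pi * K ^ j / (real j + 1)" using moment_eq[of "wavevec k" l] by (simp add: l K_def)
    have s: "sin_coeff (Suc j) = (-1) ^ l / (fact j * (real j + 1))" by (simp add: sin_coeff_def l mult.commute)
    have i: "\<i> ^ j = of_real ((-1) ^ l)" by (simp add: l power_mult)
    have r: "\<tau> * K * (inverse F * s * (\<tau> ^ j * (4 * pi * K ^ j / D) / (4 * pi))) = s / (F * D) * (\<tau> * K) ^ Suc j"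
      if "F \<noteq> 0" "D \<noteq> 0" for F D s :: real
      using that by (simp add: power_mult_distrib field_simps)
    have "of_real (\<tau> * K) * ((of_real ((-1) ^ l) /\<^sub>R fact j) * of_real (\<tau> ^ j * (4 * pi * K ^ j / (real j + 1)) / (4 * pi)))
        = complex_of_real (\<tau> * K * (inverse (fact j) * (-1) ^ l * (\<tau> ^ j * (4 * pi * K ^ j / (real j + 1)) / (4 * pi))))"
      unfolding scaleR_conv_of_real of_real_mult ..
    also have "\<tau> * K * (inverse (fact j) * (-1) ^ l * (\<tau> ^ j * (4 * pi * K ^ j / (real j + 1)) / (4 * pi))) = (-1) ^ l / (fact j * (real j + 1)) * (\<tau> * K) ^ Suc j"
      by (rule r) auto
    finally show ?thesis unfolding m s i real_scaleR_def .
  next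
    case False
    then obtain l where l: "j = Suc (2 * l)" by (elim oddE) simp
    then show ?thesis using moment_eq[of "wavevec k" l] by (simp add: sin_coeff_def)
  qed
  have "(\<lambda>j. complex_of_real (sin_coeff (Suc j) *\<^sub>R (\<tau> * K) ^ Suc j)) sums (of_real (\<tau> * K) * J)"
    unfolding t [symmetric] by (rule sums_mult[OF sJ])
  moreover have "(\<lambda>j. complex_of_real (sin_coeff (Suc j) *\<^sub>R (\<tau> * K) ^ Suc j)) sums of_real (sin (\<tau> * K))"
  proof -
    have "(\<lambda>j. sin_coeff j *\<^sub>R (\<tau> * K) ^ j) sums (sin (\<tau> * K) + sin_coeff 0 *\<^sub>R (\<tau> * K) ^ 0)"
      using sin_converges[of "\<tau> * K"] by simp
    then have "(\<lambda>j. sin_coeff (Suc j) *\<^sub>R (\<tau> * K) ^ Suc j) sums sin (\<tau> * K)"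
      by (subst sums_Suc_iff)  simp
    then show ?thesis by (rule sums_of_real)
  qed
  ultimately have "of_real (\<tau> * K) * J = of_real (sin (\<tau> * K))" by (rule sums_unique2)
  have "J = of_real (sinc (\<tau> * K))"
  proof (cases "\<tau> * K = 0")
    case False
    have "of_real (\<tau> * K) * J = complex_of_real (\<tau> * K) * of_real (sinc (\<tau> * K))"
      using \<open>of_real (\<tau> * K) * J = of_real (sin (\<tau> * K))\<close> mult_sinc[of "\<tau> * K"] by (metis of_real_mult)
    then show ?thesis using False by simp
  next
    case True
    have "(\<lambda>j. if j = 0 then 1 else (0::complex)) sums 1" using sums_single[of 0 "\<lambda>_. 1 :: complex"] by simp
    moreover have "(\<i> ^ j /\<^sub>R fact j) * of_real (\<tau> ^ j * moment (wavevec k) j / (4 * pi)) = (if j = 0 then 1 else 0)" for j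
    proof (cases "j = 0")
      case False
      have "\<tau> ^ j * moment (wavevec k) j = 0"
      proof (cases "\<tau> = 0")
        case F: False
        then have "K = 0" using True by simp
        obtain l where "j = 2 * l \<or> j = Suc (2 * l)" by (metis evenE oddE Suc_eq_plus1)
        then show ?thesis using moment_eq[of "wavevec k" l] \<open>K = 0\<close> False by (auto simp: K_def)
      qed (use False in simp)
      then show ?thesis using False by simp
    qed (simp add: moment_0)
    ultimately have "J = 1" using sums_unique2[OF sJ] by simp
    then show ?thesis unfolding True by simp
  qed
  then show ?thesis using IJ(2) unfolding lim K_def by (simp add: integral_unique)
qed

lemma multiplier_op_sph: "multiplier_op (sph \<tau>) (\<lambda>k. of_real (sinc (\<tau> * norm (wavevec k))))"
  using multiplier_op_cmean[OF sph_continuous, of \<tau>] unfolding sph_symbol sph_def by (simp add: sph_symbol)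

subsection \<open>Locality\<close>

text \<open>Membership in the closed cube; cubes rather than balls because cells are boxes.\<close>

definition near :: "real ^ 3 \<Rightarrow> real \<Rightarrow> real ^ 3 \<Rightarrow> bool" where
  "near x r y \<longleftrightarrow> (\<forall>i. \<bar>y $ i - x $ i\<bar> \<le> r)"

lemma near_add:
  assumes "near x r y" "\<And>i. \<bar>z $ i\<bar> \<le> \<rho>" shows "near x (r + \<rho>) (y + z)"
  unfolding near_def
proof
  fix i
  show "\<bar>(y + z) $ i - x $ i\<bar> \<le> r + \<rho>"
    using assms(1)[unfolded near_def, rule_format, of i] assms(2)[of i] by simp
qed

lemma near_mono: "near x r y \<Longrightarrow> r \<le> s \<Longrightarrow> near x s y"
  unfolding near_def by (blast intro: order_trans)

text \<open>The value of \<open>T f\<close> at a point depends only on \<open>f\<close> in the cube of radius \<open>\<rho>\<close> around it.\<close>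

definition local_op :: "((real ^ 3 \<Rightarrow> complex) \<Rightarrow> real ^ 3 \<Rightarrow> complex) \<Rightarrow> real \<Rightarrow> bool" where
  "local_op T \<rho> \<longleftrightarrow> (\<forall>f g x r. (\<forall>y. near x (r + \<rho>) y \<longrightarrow> f y = g y) \<longrightarrow> (\<forall>y. near x r y \<longrightarrow> T f y = T g y))"

lemma local_opD:
  assumes "local_op T \<rho>" "\<And>y. near x (r + \<rho>) y \<Longrightarrow> f y = g y" "near x r y" shows "T f y = T g y"
  using assms unfolding local_op_def by blast

lemma local_op_comp:
  assumes "local_op T \<rho>" "local_op U \<sigma>" shows "local_op (\<lambda>f. T (U f)) (\<rho> + \<sigma>)"
  unfolding local_op_def
proof (intro allI impI)
  fix f g :: "real ^ 3 \<Rightarrow> complex" and x r y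
  assume a: "\<forall>y. near x (r + (\<rho> + \<sigma>)) y \<longrightarrow> f y = g y" and y: "near x r y"
  show "T (U f) y = T (U g) y"
    by (rule local_opD[OF assms(1) local_opD[OF assms(2)] y]) (use a in \<open>auto simp: add.assoc\<close>)
qed

lemma local_op_power: "local_op T \<rho> \<Longrightarrow> local_op (T ^^ n) (of_nat n * \<rho>)"
proof (induction n)
  case 0
  then show ?case by (simp add: local_op_def)
next
  case (Suc n)
  then show ?case using local_op_comp[of T \<rho> "T ^^ n" "of_nat n * \<rho>"] by (simp add: comp_def algebra_simps)
qed

lemma local_op_cmean:
  fixes a b :: "'a::euclidean_space"
  assumes "\<And>\<omega> i. \<omega> \<in> cbox a b \<Longrightarrow> \<bar>Y \<omega> $ i\<bar> \<le> \<rho>" shows "local_op (cmean a b w Y) \<rho>"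
  unfolding local_op_def cmean_def
proof (intro allI impI integral_cong)
  fix f g :: "real ^ 3 \<Rightarrow> complex" and x r y \<omega>
  assume a: "\<forall>y. near x (r + \<rho>) y \<longrightarrow> f y = g y" and y: "near x r y" and \<omega>: "\<omega> \<in> cbox a b"
  have "near x (r + \<rho>) (y + Y \<omega>)" by (rule near_add[OF y assms[OF \<omega>]])
  then show "w \<omega> *\<^sub>R f (y + Y \<omega>) = w \<omega> *\<^sub>R g (y + Y \<omega>)" using a by simp
qed

lemma axis_bound: "\<bar>t\<bar> \<le> \<epsilon> \<Longrightarrow> \<bar>axis i t $ j\<bar> \<le> \<epsilon>" for t \<epsilon> :: real
  by (auto simp: axis_def)

lemma avg_range: "0 \<le> \<epsilon> \<Longrightarrow> s \<in> cbox (-1) 1 \<Longrightarrow> \<bar>axis i (\<epsilon> * s) $ j\<bar> \<le> \<epsilon>" for s \<epsilon> :: real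
  by (rule axis_bound) (auto simp: abs_mult intro!: mult_left_le)

lemma local_op_avg: "0 \<le> \<epsilon> \<Longrightarrow> local_op (avg i \<epsilon>) \<epsilon>"
  unfolding avg_def by (rule local_op_cmean) (rule avg_range)

lemma local_op_sph: "local_op (sph \<tau>) \<bar>\<tau>\<bar>"
  unfolding sph_def by (rule local_op_cmean) (auto simp: abs_mult intro!: mult_left_le omega_bounded)

lemma local_op_dif: "0 \<le> \<epsilon> \<Longrightarrow> local_op (dif i \<epsilon>) \<epsilon>"
  unfolding local_op_def dif_def
proof (intro allI impI)
  fix f g :: "real ^ 3 \<Rightarrow> complex" and x r y
  assume \<epsilon>: "0 \<le> \<epsilon>" and a: "\<forall>y. near x (r + \<epsilon>) y \<longrightarrow> f y = g y" and y: "near x r y"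
  have "near x (r + \<epsilon>) (y + axis i \<epsilon>)" by (rule near_add[OF y]) (use \<epsilon> in \<open>auto intro: axis_bound\<close>)
  moreover have "near x (r + \<epsilon>) (y + (- axis i \<epsilon>))" by (rule near_add[OF y]) (use \<epsilon> in \<open>auto intro: axis_bound\<close>)
  ultimately show "(1 / (2 * \<epsilon>)) *\<^sub>R (f (y + axis i \<epsilon>) - f (y - axis i \<epsilon>)) = (1 / (2 * \<epsilon>)) *\<^sub>R (g (y + axis i \<epsilon>) - g (y - axis i \<epsilon>))"
    using a by simp
qed

subsection \<open>Regularized differentiation\<close>

lemma ridge_span_avg: "ridge_span d f \<Longrightarrow> ridge_span d (avg i \<epsilon> f)"
  unfolding avg_def by (rule ridge_span_cmean[OF avg_continuous])

lemma partial_avg: "ridge_span d f \<Longrightarrow> partial j (avg i \<epsilon> f) = avg i \<epsilon> (partial j f)"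
  unfolding avg_def by (rule partial_cmean[OF avg_continuous])

lemma avg_of_real: "ridge_span d f \<Longrightarrow> avg i \<epsilon> (\<lambda>x. complex_of_real (f x)) = (\<lambda>x. of_real (avg i \<epsilon> f x))"
  unfolding avg_def by (intro ext cmean_of_real[OF avg_continuous] ridge_span_continuous)

lemma sph_of_real: "ridge_span d f \<Longrightarrow> sph \<tau> (\<lambda>x. complex_of_real (f x)) = (\<lambda>x. of_real (sph \<tau> f x))"
  unfolding sph_def by (intro ext cmean_of_real[OF sph_continuous] ridge_span_continuous)

lemma dif_of_real: "dif i \<epsilon> (\<lambda>x. complex_of_real (f x)) = (\<lambda>x. of_real (dif i \<epsilon> f x))"
  by (rule ext) (simp add: dif_def scaleR_conv_of_real)

text \<open>The fundamental theorem of calculus along a segment.\<close>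

lemma dif_eq_avg_partial:
  assumes f: "ridge_span d f" and \<epsilon>: "\<epsilon> > 0"
  shows "dif i \<epsilon> f = avg i \<epsilon> (partial i f)"
proof
  fix x
  have "((\<lambda>s. f (x + axis i (\<epsilon> * s))) has_real_derivative \<epsilon> * partial i f (x + axis i (\<epsilon> * s))) (at s within {-1..1})" for s
  proof -
    have "((\<lambda>h. f ((x + axis i (\<epsilon> * s)) + axis i h)) has_real_derivative partial i f (x + axis i (\<epsilon> * s))) (at 0)"
      by (rule ridge_span_deriv[OF f])
    moreover have "(x + axis i (\<epsilon> * s)) + axis i h = x + axis i (h + \<epsilon> * s)" for h
      by (simp add: vec_eq_iff axis_def)
    ultimately have "((\<lambda>h. f (x + axis i (h + \<epsilon> * s))) has_real_derivative partial i f (x + axis i (\<epsilon> * s))) (at 0)"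
      by simp
    then have A: "((\<lambda>h. f (x + axis i h)) has_real_derivative partial i f (x + axis i (\<epsilon> * s))) (at (\<epsilon> * s))"
      using DERIV_shift[of "\<lambda>h. f (x + axis i h)" "partial i f (x + axis i (\<epsilon> * s))" 0 "\<epsilon> * s"] by simp
    have B: "((\<lambda>s. \<epsilon> * s) has_real_derivative \<epsilon>) (at s within {-1..1})" by (auto intro!: derivative_eq_intros)
    show ?thesis
      using DERIV_chain2[OF A B] by (simp only: mult.commute[of "partial i f (x + axis i (\<epsilon> * s))" \<epsilon>])
  qed
  then have I: "((\<lambda>s. \<epsilon> * partial i f (x + axis i (\<epsilon> * s))) has_integral f (x + axis i (\<epsilon> * 1)) - f (x + axis i (\<epsilon> * (-1)))) {-1..1}"
    by (intro fundamental_theorem_of_calculus) (auto simp: has_real_derivative_iff_has_vector_derivative)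
  have i: "((\<lambda>s. 1 / (2 * \<epsilon>) * (\<epsilon> * partial i f (x + axis i (\<epsilon> * s)))) has_integral
      1 / (2 * \<epsilon>) * (f (x + axis i (\<epsilon> * 1)) - f (x + axis i (\<epsilon> * (-1))))) {-1..1}"
    by (rule has_integral_mult_right[OF I])
  have "1 / (2 * \<epsilon>) * (\<epsilon> * v) = (1 / 2) *\<^sub>R v" for v using \<epsilon> by simp
  moreover have "1 / (2 * \<epsilon>) * (f (x + axis i (\<epsilon> * 1)) - f (x + axis i (\<epsilon> * (-1)))) = dif i \<epsilon> f x"
  proof -
    have "x - axis i \<epsilon> = x + axis i (\<epsilon> * (-1))" by (simp add: vec_eq_iff axis_def)
    then show ?thesis unfolding dif_def by (simp only: mult_1_right real_scaleR_def)
  qed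
  ultimately have "((\<lambda>s. (1 / 2) *\<^sub>R partial i f (x + axis i (\<epsilon> * s))) has_integral dif i \<epsilon> f x) {-1..1}"
    using i by (simp only:)
  then show "dif i \<epsilon> f x = avg i \<epsilon> (partial i f) x"
    unfolding avg_def cmean_def cbox_interval by (simp only: integral_unique)
qed

lemma ridge_span_avg_power: "ridge_span d f \<Longrightarrow> ridge_span d ((avg i \<epsilon> ^^ n) f)"
  by (induction n) (auto intro: ridge_span_avg)

lemma partial_avg_power: "ridge_span d f \<Longrightarrow> partial j ((avg i \<epsilon> ^^ n) f) = (avg i \<epsilon> ^^ n) (partial j f)"
  by (induction n) (auto simp: partial_avg[of d] ridge_span_avg_power)

lemma partial_power_avg_power:
  "ridge_span d f \<Longrightarrow> (partial j ^^ b) ((avg i \<epsilon> ^^ n) f) = (avg i \<epsilon> ^^ n) ((partial j ^^ b) f)"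
  by (induction b) (auto simp: partial_avg_power[of d] ridge_span_partial_power)

lemma dif_power:
  assumes f: "ridge_span d f" and \<epsilon>: "\<epsilon> > 0"
  shows "(dif i \<epsilon> ^^ b) f = (avg i \<epsilon> ^^ b) ((partial i ^^ b) f)"
proof (induction b)
  case (Suc b)
  have "(dif i \<epsilon> ^^ Suc b) f = dif i \<epsilon> ((avg i \<epsilon> ^^ b) ((partial i ^^ b) f))" by (simp add: Suc)
  also have "\<dots> = avg i \<epsilon> (partial i ((avg i \<epsilon> ^^ b) ((partial i ^^ b) f)))"
    by (rule dif_eq_avg_partial[OF ridge_span_avg_power[OF ridge_span_partial_power[OF f]] \<epsilon>])
  also have "\<dots> = (avg i \<epsilon> ^^ Suc b) ((partial i ^^ Suc b) f)"
    by (simp add: partial_avg_power[OF ridge_span_partial_power[OF f]])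
  finally show ?case .
qed simp

text \<open>
  A derivative of order \<open>b\<close> in direction \<open>i\<close>, smoothed by \<open>M\<close> averages altogether: \<open>b\<close> of them are contained in the difference quotients.
  Thus the damping factor of the symbol is the same for all \<open>b\<close>.
\<close>

definition axis_op :: "3 \<Rightarrow> real \<Rightarrow> nat \<Rightarrow> nat \<Rightarrow> (real ^ 3 \<Rightarrow> 'b::banach) \<Rightarrow> real ^ 3 \<Rightarrow> 'b" where
  "axis_op i \<epsilon> M b f = (avg i \<epsilon> ^^ (M - b)) ((dif i \<epsilon> ^^ b) f)"

lemma axis_op_ridge:
  assumes f: "ridge_span d f" and \<epsilon>: "\<epsilon> > 0" and b: "b \<le> M"
  shows "axis_op i \<epsilon> M b f = (avg i \<epsilon> ^^ M) ((partial i ^^ b) f)"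
proof -
  have "(avg i \<epsilon> ^^ (M - b)) ((avg i \<epsilon> ^^ b) g) = (avg i \<epsilon> ^^ M) g" for g :: "real ^ 3 \<Rightarrow> real"
    using b by (simp flip: funpow_add[unfolded fun_eq_iff comp_def, rule_format])
  then show ?thesis unfolding axis_op_def dif_power[OF f \<epsilon>] .
qed

lemma axis_op_of_real:
  assumes f: "ridge_span d f" and \<epsilon>: "\<epsilon> > 0"
  shows "axis_op i \<epsilon> M b (\<lambda>x. complex_of_real (f x)) = (\<lambda>x. of_real (axis_op i \<epsilon> M b f x))"
proof -
  have "(dif i \<epsilon> ^^ b) (\<lambda>x. complex_of_real (f x)) = (\<lambda>x. of_real ((dif i \<epsilon> ^^ b) f x))"
    by (induction b) (auto simp: dif_of_real)
  moreover have "(avg i \<epsilon> ^^ n) (\<lambda>x. complex_of_real (g x)) = (\<lambda>x. of_real ((avg i \<epsilon> ^^ n) g x))" if "ridge_span d g" for g n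
    by (induction n) (auto simp: avg_of_real[of d] ridge_span_avg_power that)
  moreover have "ridge_span d ((dif i \<epsilon> ^^ b) f)"
    unfolding dif_power[OF f \<epsilon>] by (intro ridge_span_avg_power ridge_span_partial_power f)
  ultimately show ?thesis unfolding axis_op_def by simp
qed

lemma multiplier_op_axis:
  assumes \<epsilon>: "\<epsilon> > 0" and b: "b \<le> M"
  shows "multiplier_op (axis_op i \<epsilon> M b) (\<lambda>k. (\<i> * of_int (k $ i)) ^ b * of_real (sinc (\<epsilon> * of_int (k $ i))) ^ M)"
proof -
  have e: "z ^ (M - b) * (w * z) ^ b = w ^ b * z ^ M" for z w :: complex
  proof -
    have "z ^ (M - b) * z ^ b = z ^ M" using b by (simp flip: power_add)
    then show ?thesis by (simp add: power_mult_distrib)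
  qed
  show ?thesis
    using multiplier_op_comp[OF multiplier_op_power[OF multiplier_op_avg, of "M - b" i \<epsilon>] multiplier_op_power[OF multiplier_op_dif[OF \<epsilon>], of b i]]
    unfolding e axis_op_def[abs_def] .
qed

lemma local_op_axis:
  assumes \<epsilon>: "\<epsilon> \<ge> 0" and b: "b \<le> M"
  shows "local_op (axis_op i \<epsilon> M b) (of_nat M * \<epsilon>)"
proof -
  have "of_nat M * \<epsilon> = of_nat (M - b) * \<epsilon> + of_nat b * \<epsilon>" using b by (simp add: of_nat_diff algebra_simps)
  then show ?thesis
    using local_op_comp[OF local_op_power[OF local_op_avg[OF \<epsilon>], of "M - b" i] local_op_power[OF local_op_dif[OF \<epsilon>], of b i]]
    unfolding axis_op_def[abs_def] by simp
qed

definition reg_op :: "real \<Rightarrow> nat \<Rightarrow> nat ^ 3 \<Rightarrow> (real ^ 3 \<Rightarrow> 'b::banach) \<Rightarrow> real ^ 3 \<Rightarrow> 'b" where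
  "reg_op \<epsilon> M \<beta> f = axis_op 1 \<epsilon> M (\<beta> $ 1) (axis_op 2 \<epsilon> M (\<beta> $ 2) (axis_op 3 \<epsilon> M (\<beta> $ 3) f))"

definition smooth :: "real \<Rightarrow> nat \<Rightarrow> (real ^ 3 \<Rightarrow> real) \<Rightarrow> real ^ 3 \<Rightarrow> real" where
  "smooth \<epsilon> M f = (avg 1 \<epsilon> ^^ M) ((avg 2 \<epsilon> ^^ M) ((avg 3 \<epsilon> ^^ M) f))"

lemma reg_op_ridge:
  fixes \<beta> :: "nat ^ 3"
  assumes f: "ridge_span d f" and \<epsilon>: "\<epsilon> > 0" and \<beta>: "\<And>i. \<beta> $ i \<le> M"
  shows "reg_op \<epsilon> M \<beta> f = smooth \<epsilon> M (mixed_partial \<beta> f)"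
    and "reg_op \<epsilon> M \<beta> (\<lambda>x. complex_of_real (f x)) = (\<lambda>x. of_real (reg_op \<epsilon> M \<beta> f x))"
proof -
  define g where "g = (partial 3 ^^ (\<beta> $ 3)) f"
  have g: "ridge_span d g" unfolding g_def by (rule ridge_span_partial_power[OF f])
  have 3: "axis_op 3 \<epsilon> M (\<beta> $ 3) f = (avg 3 \<epsilon> ^^ M) g" unfolding g_def by (rule axis_op_ridge[OF f \<epsilon> \<beta>])
  have r3: "ridge_span d ((avg 3 \<epsilon> ^^ M) g)" by (rule ridge_span_avg_power[OF g])
  define h where "h = (partial 2 ^^ (\<beta> $ 2)) g"
  have h: "ridge_span d h" unfolding h_def by (rule ridge_span_partial_power[OF g])
  have 2: "axis_op 2 \<epsilon> M (\<beta> $ 2) ((avg 3 \<epsilon> ^^ M) g) = (avg 2 \<epsilon> ^^ M) ((avg 3 \<epsilon> ^^ M) h)"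
    unfolding h_def axis_op_ridge[OF r3 \<epsilon> \<beta>] partial_power_avg_power[OF g] ..
  have r2: "ridge_span d ((avg 2 \<epsilon> ^^ M) ((avg 3 \<epsilon> ^^ M) h))" by (intro ridge_span_avg_power h)
  have 1: "axis_op 1 \<epsilon> M (\<beta> $ 1) ((avg 2 \<epsilon> ^^ M) ((avg 3 \<epsilon> ^^ M) h)) = smooth \<epsilon> M (mixed_partial \<beta> f)"
    unfolding axis_op_ridge[OF r2 \<epsilon> \<beta>] partial_power_avg_power[OF ridge_span_avg_power[OF h]] partial_power_avg_power[OF h]
    by (simp add: smooth_def mixed_partial_def g_def h_def)
  show "reg_op \<epsilon> M \<beta> f = smooth \<epsilon> M (mixed_partial \<beta> f)" unfolding reg_op_def 3 2 1 ..
  show "reg_op \<epsilon> M \<beta> (\<lambda>x. complex_of_real (f x)) = (\<lambda>x. of_real (reg_op \<epsilon> M \<beta> f x))"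
    unfolding reg_op_def axis_op_of_real[OF f \<epsilon>] 3 axis_op_of_real[OF r3 \<epsilon>] 2 axis_op_of_real[OF r2 \<epsilon>] ..
qed

lemma multiplier_op_reg:
  fixes \<beta> :: "nat ^ 3"
  assumes \<epsilon>: "\<epsilon> > 0" and \<beta>: "\<And>i. \<beta> $ i \<le> M"
  shows "multiplier_op (reg_op \<epsilon> M \<beta>) (\<lambda>k. deriv_symbol \<beta> k * (\<Prod>i\<in>UNIV. of_real (sinc (\<epsilon> * of_int (k $ i)))) ^ M)"
proof -
  have e: "(\<lambda>k. (\<i> * of_int (k $ 1)) ^ (\<beta> $ 1) * of_real (sinc (\<epsilon> * of_int (k $ 1))) ^ M *
     ((\<i> * of_int (k $ 2)) ^ (\<beta> $ 2) * of_real (sinc (\<epsilon> * of_int (k $ 2))) ^ M *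
      ((\<i> * of_int (k $ 3)) ^ (\<beta> $ 3) * of_real (sinc (\<epsilon> * of_int (k $ 3))) ^ M)))
    = (\<lambda>k :: int ^ 3. deriv_symbol \<beta> k * (\<Prod>i\<in>UNIV. of_real (sinc (\<epsilon> * of_int (k $ i)))) ^ M)"
    by (simp add: deriv_symbol_def prod_3 power_mult_distrib mult_ac)
  show ?thesis
    using multiplier_op_comp[OF multiplier_op_axis[OF \<epsilon> \<beta>] multiplier_op_comp[OF multiplier_op_axis[OF \<epsilon> \<beta>] multiplier_op_axis[OF \<epsilon> \<beta>]], of 1 1 2 2 3 3]
    unfolding e reg_op_def[abs_def] .
qed

lemma local_op_reg:
  fixes \<beta> :: "nat ^ 3"
  assumes \<epsilon>: "\<epsilon> \<ge> 0" and \<beta>: "\<And>i. \<beta> $ i \<le> M"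
  shows "local_op (reg_op \<epsilon> M \<beta>) (3 * of_nat M * \<epsilon>)"
proof -
  have "3 * of_nat M * \<epsilon> = of_nat M * \<epsilon> + (of_nat M * \<epsilon> + of_nat M * \<epsilon>)" by simp
  then show ?thesis
    using local_op_comp[OF local_op_axis[OF \<epsilon> \<beta>] local_op_comp[OF local_op_axis[OF \<epsilon> \<beta>] local_op_axis[OF \<epsilon> \<beta>]], of 1 1 2 2 3 3]
    unfolding reg_op_def[abs_def] by (simp only:)
qed

text \<open>An average lies within the range of the averaged values.\<close>

lemma avg_close:
  assumes f: "ridge_span d f" and \<epsilon>: "\<epsilon> \<ge> 0"
    and c: "\<And>y. near x (r + \<epsilon>) y \<Longrightarrow> \<bar>f y - c\<bar> \<le> e" and y: "near x r y"
  shows "\<bar>avg i \<epsilon> f y - c\<bar> \<le> e"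
proof -
  have co: "continuous_on (cbox (-1) 1) (\<lambda>s :: real. (1 / 2) *\<^sub>R f (y + axis i (\<epsilon> * s)))"
    by (rule cmean_continuous_integrand[OF avg_continuous ridge_span_continuous[OF f]])
  have "avg i \<epsilon> f y - c = integral (cbox (-1) 1) (\<lambda>s :: real. (1 / 2) *\<^sub>R f (y + axis i (\<epsilon> * s))) - integral (cbox (-1) 1) (\<lambda>s :: real. c / 2)"
    by (simp add: avg_def cmean_def)
  also have "\<dots> = integral (cbox (-1) 1) (\<lambda>s. (1 / 2) *\<^sub>R f (y + axis i (\<epsilon> * s)) - c / 2)"
    by (rule Henstock_Kurzweil_Integration.integral_diff[symmetric]) (intro integrable_continuous co continuous_intros)+
  also have "norm \<dots> \<le> integral (cbox (-1) (1::real)) (\<lambda>s. e / 2)"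
  proof (rule integral_norm_bound_integral)
    fix s :: real assume s: "s \<in> cbox (-1) 1"
    have "near x (r + \<epsilon>) (y + axis i (\<epsilon> * s))" by (rule near_add[OF y avg_range[OF \<epsilon> s]])
    from c[OF this] show "norm ((1 / 2) *\<^sub>R f (y + axis i (\<epsilon> * s)) - c / 2) \<le> e / 2"
      by (simp add: abs_if split: if_splits)
  qed (intro integrable_continuous co continuous_intros)+
  finally show ?thesis by simp
qed

lemma avg_power_close:
  assumes f: "ridge_span d f" and \<epsilon>: "\<epsilon> \<ge> 0"
    and c: "\<And>y. near x (r + of_nat n * \<epsilon>) y \<Longrightarrow> \<bar>f y - c\<bar> \<le> e" and y: "near x r y"
  shows "\<bar>(avg i \<epsilon> ^^ n) f y - c\<bar> \<le> e"
  using c y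
proof (induction n arbitrary: r y)
  case (Suc n)
  have "\<bar>avg i \<epsilon> ((avg i \<epsilon> ^^ n) f) y - c\<bar> \<le> e"
  proof (rule avg_close[OF ridge_span_avg_power[OF f] \<epsilon> _ Suc.prems(2)])
    fix z assume z: "near x (r + \<epsilon>) z"
    show "\<bar>(avg i \<epsilon> ^^ n) f z - c\<bar> \<le> e"
      by (rule Suc.IH[OF _ z]) (use Suc.prems(1) in \<open>auto simp: algebra_simps\<close>)
  qed
  then show ?case by simp
qed simp

lemma tendsto_smooth:
  assumes f: "ridge_span d f"
  shows "((\<lambda>\<epsilon>. smooth \<epsilon> M f x) \<longlongrightarrow> f x) (at_right 0)"
proof (rule tendstoI)
  fix e :: real assume e: "0 < e"
  have "isCont f x" using ridge_span_continuous[OF f] by (simp add: continuous_on_eq_continuous_at)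
  then obtain \<delta> where \<delta>: "\<delta> > 0" "\<And>y. dist y x < \<delta> \<Longrightarrow> dist (f y) (f x) < e / 2"
    using e unfolding continuous_at_eps_delta by (meson half_gt_zero)
  \<comment> \<open>the cube of radius \<open>3 M \<epsilon>\<close> lies in the ball of radius \<open>9 M \<epsilon>\<close>\<close>
  define B where "B = \<delta> / (9 * of_nat M + 1)"
  have B: "B > 0" using \<delta> by (simp add: B_def add_nonneg_pos)
  have "eventually (\<lambda>\<epsilon>. \<epsilon> < B) (at_right 0)" using eventually_at_right_less B by (simp add: eventually_at_right[OF B] exI[of _ B])
  moreover have "eventually (\<lambda>\<epsilon>::real. 0 < \<epsilon>) (at_right 0)" by (rule eventually_at_right_less)
  ultimately show "\<forall>\<^sub>F \<epsilon> in at_right 0. dist (smooth \<epsilon> M f x) (f x) < e"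
  proof eventually_elim
    case (elim \<epsilon>)
    have close: "\<bar>f y - f x\<bar> \<le> e / 2" if "near x (0 + of_nat M * \<epsilon> + of_nat M * \<epsilon> + of_nat M * \<epsilon>) y" for y
    proof -
      have "norm (y - x) \<le> (\<Sum>i\<in>UNIV. \<bar>(y - x) $ i\<bar>)" by (rule norm_le_l1_cart)
      also have "\<dots> \<le> (\<Sum>i\<in>(UNIV :: 3 set). 3 * of_nat M * \<epsilon>)"
        using that by (intro sum_mono) (simp add: near_def algebra_simps)
      also have "\<dots> = 9 * of_nat M * \<epsilon>" by simp
      also have "\<dots> < (9 * of_nat M + 1) * B"
        using elim by (intro mult_strict_mono') auto
      also have "\<dots> = \<delta>" unfolding B_def by (simp add: add_nonneg_pos less_imp_neq[symmetric])
      finally show ?thesis using \<delta>(2)[of y] by (simp add: dist_norm less_imp_le)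
    qed
    have \<epsilon>: "0 \<le> \<epsilon>" using elim by simp
    have c3: "\<bar>(avg 3 \<epsilon> ^^ M) f y - f x\<bar> \<le> e / 2" if "near x (0 + of_nat M * \<epsilon> + of_nat M * \<epsilon>) y" for y
      by (rule avg_power_close[OF f \<epsilon> close that])
    have c2: "\<bar>(avg 2 \<epsilon> ^^ M) ((avg 3 \<epsilon> ^^ M) f) y - f x\<bar> \<le> e / 2" if "near x (0 + of_nat M * \<epsilon>) y" for y
      by (rule avg_power_close[OF ridge_span_avg_power[OF f] \<epsilon> c3 that])
    have "\<bar>smooth \<epsilon> M f x - f x\<bar> \<le> e / 2"
      unfolding smooth_def
      by (rule avg_power_close[where r = 0 and x = x, OF ridge_span_avg_power[OF ridge_span_avg_power[OF f]] \<epsilon> c2]) (simp_all add: near_def)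
    then show ?case using e by (simp add: dist_norm)
  qed
qed

lemma has_sum_fseries: "abs_summable a \<Longrightarrow> ((\<lambda>k. a k * wave k x) has_sum fseries a x) UNIV"
  unfolding fseries_def
proof (rule has_sum_infsum)
  assume "abs_summable a"
  then have "(\<lambda>k. cmod (a k * wave k x)) summable_on UNIV" by (simp add: abs_summable_def norm_mult)
  then show "(\<lambda>k. a k * wave k x) summable_on UNIV" by (rule abs_summable_summable)
qed

text \<open>
  Both sides are the value at \<open>x\<close> of a regularized derivative of the spherical mean.  On the left it is computed from the symbols; on the
  right from the polynomial \<open>p\<close>, with which the series agrees on the domain of dependence.
\<close>

lemma regularized_derivative:
  fixes \<beta> :: "nat ^ 3"
  assumes a: "abs_summable a" and p: "ridge_span d p"
    and agree: "\<And>y. near x R y \<Longrightarrow> fseries a y = of_real (p y)"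
    and R: "\<bar>\<tau>\<bar> + 3 * of_nat M * \<epsilon> \<le> R" and \<epsilon>: "\<epsilon> > 0" and \<beta>: "\<And>i. \<beta> $ i \<le> M"
  shows "((\<lambda>k. (\<Prod>i\<in>UNIV. of_real (sinc (\<epsilon> * of_int (k $ i)))) ^ M *
      (deriv_symbol \<beta> k * wave k x * (of_real (sinc (\<tau> * norm (wavevec k))) * a k))) has_sum
      of_real (smooth \<epsilon> M (mixed_partial \<beta> (sph \<tau> p)) x)) UNIV"
proof -
  define s where "s k = deriv_symbol \<beta> k * (\<Prod>i\<in>UNIV. of_real (sinc (\<epsilon> * of_int (k $ i)))) ^ M * of_real (sinc (\<tau> * norm (wavevec k)))" for k
  have m: "multiplier_op (\<lambda>f. reg_op \<epsilon> M \<beta> (sph \<tau> f)) s"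
    unfolding s_def by (rule multiplier_op_comp[OF multiplier_op_reg[OF \<epsilon> \<beta>] multiplier_op_sph])
  have "reg_op \<epsilon> M \<beta> (sph \<tau> (fseries a)) x = reg_op \<epsilon> M \<beta> (sph \<tau> (\<lambda>y. complex_of_real (p y))) x"
  proof (rule local_opD[OF local_op_comp[OF local_op_reg[OF _ \<beta>] local_op_sph]])
    show "0 \<le> \<epsilon>" using \<epsilon> by simp
    show "near x 0 x" by (simp add: near_def)
    fix y assume "near x (0 + (3 * of_nat M * \<epsilon> + \<bar>\<tau>\<bar>)) y"
    then have "near x R y" by (rule near_mono) (use R in simp)
    then show "fseries a y = of_real (p y)" by (rule agree)
  qed
  also have "\<dots> = of_real (smooth \<epsilon> M (mixed_partial \<beta> (sph \<tau> p)) x)"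
    unfolding sph_of_real[OF p] reg_op_ridge(2)[OF ridge_span_sph[OF p] \<epsilon> \<beta>] reg_op_ridge(1)[OF ridge_span_sph[OF p] \<epsilon> \<beta>] ..
  finally have e: "fseries (\<lambda>k. s k * a k) x = of_real (smooth \<epsilon> M (mixed_partial \<beta> (sph \<tau> p)) x)"
    using m a unfolding multiplier_op_def by simp
  have "((\<lambda>k. s k * a k * wave k x) has_sum fseries (\<lambda>k. s k * a k) x) UNIV"
    by (rule has_sum_fseries) (use m a in \<open>simp add: multiplier_op_def\<close>)
  then show ?thesis unfolding e unfolding s_def by (simp add: mult_ac)
qed

section \<open>Orthogonality of the update residual\<close>

subsection \<open>Splines and their Fourier series\<close>

text \<open>Taking a Fourier coefficient is one of the functionals that may be applied term by term.\<close>

lemma cf_fseries: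
  assumes a: "abs_summable a" shows "TM.sqi (fseries a)" and "TM.cf (fseries a) k = a k"
proof -
  have sq: "TM.sqi f" if "bounded_cont f" for f
  proof -
    obtain B where "\<And>x. cmod (f x) \<le> B" using \<open>bounded_cont f\<close> by (auto simp: bounded_cont_def)
    moreover have "f \<in> borel_measurable TM"
      using \<open>bounded_cont f\<close> by (auto simp: bounded_cont_def intro: borel_measurable_continuous_onI)
    ultimately show ?thesis by (intro TM.sqi_bounded)
  qed
  show "TM.sqi (fseries a)" by (rule sq[OF bounded_cont_fseries[OF a]])
  have "((\<lambda>l. a l * TM.cf (wave l) k) has_sum TM.cf (fseries a) k) UNIV"
  proof (rule has_sum_functional[OF a, where L = "\<lambda>f. TM.cf f k" and C = "measure TM UNIV"])
    show "TM.cf (\<lambda>x. f x + g x) k = TM.cf f k + TM.cf g k" if "bounded_cont f" "bounded_cont g" for f g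
      unfolding TM.cf_def by (intro TM.ip_add sq that TM.sqi_e)
    show "TM.cf (\<lambda>x. z * f x) k = z * TM.cf f k" for z f
      unfolding TM.cf_def by (rule TM.ip_scale)
    fix f B assume f: "bounded_cont f" and B: "\<And>x. cmod (f x) \<le> B"
    have i: "integrable TM (\<lambda>x. f x * cnj (wave k x))" by (rule TM.sqi_prod[OF sq[OF f] TM.sqi_e])
    have "cmod (TM.cf f k) \<le> (\<integral>x. cmod (f x * cnj (wave k x)) \<partial>TM)"
      unfolding TM.cf_def TM.ip_def by (rule integral_norm_bound)
    also have "\<dots> \<le> (\<integral>x. B \<partial>TM)"
      by (rule integral_mono) (use integrable_norm[OF i] B in \<open>auto simp: norm_mult\<close>)
    finally show "cmod (TM.cf f k) \<le> measure TM UNIV * B" by (simp add: mult.commute)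
  qed
  moreover have "((\<lambda>l. a l * TM.cf (wave l) k) has_sum a k) UNIV"
  proof -
    have e: "a l * TM.cf (wave l) k = (if l = k then a k else 0)" for l
      unfolding TM.cf_def TM.ip_def TM.e_orth by simp
    have "((\<lambda>l. a k) has_sum a k) {k}" using has_sum_finite[of "{k}" "\<lambda>l. a k"] by simp
    then show ?thesis unfolding e
      by (subst has_sum_cong_neutral[where T = "{k}" and g = "\<lambda>l. a k"]) auto
  qed
  ultimately show "TM.cf (fseries a) k = a k" by (rule has_sum_unique)
qed

lemma periodic_fseries: "periodic (fseries a)"
  by (simp add: periodic_def fseries_def wave_periodic)

lemma cell_of_box:
  assumes N: "\<And>i. N $ i \<ge> 1" and x: "x \<in> box (vertex N o' j) (vertex N o' (j + 1))"
  shows "cell_of N o' x = j"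
  unfolding vec_eq_iff
proof
  fix i
  have h: "spacing N $ i > 0" using N[of i] by (simp add: spacing_def)
  have "vertex N o' j $ i < x $ i" "x $ i < vertex N o' (j + 1) $ i"
    using x by (auto simp: mem_box_cart)
  then have "of_int (j $ i) * spacing N $ i < x $ i - o' $ i" "x $ i - o' $ i < (of_int (j $ i) + 1) * spacing N $ i"
    by (simp_all add: vertex_def)
  then show "cell_of N o' x $ i = j $ i"
    using h by (simp add: cell_of_def floor_eq_iff pos_le_divide_eq pos_divide_less_eq less_imp_le)
qed

lemma negligible_open:
  fixes U :: "(real ^ 3) set"
  assumes "negligible U" "open U" shows "U = {}"
proof (rule ccontr)
  assume "U \<noteq> {}"
  then obtain x where "x \<in> U" by blast
  then obtain a b where ab: "box a b \<subseteq> U" "x \<in> box a b"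
    using open_contains_box[OF assms(2)] by metis
  have "negligible (box a b)" by (rule negligible_subset[OF assms(1) ab(1)])
  then show False using ab(2) by (auto simp: negligible_interval)
qed

context
  fixes N :: "nat ^ 3" and o' :: "real ^ 3" and m :: nat and d :: vertex_data
  assumes N: "\<And>i. N $ i \<ge> 1" and d: "periodic_data N m d"
begin

lemma abs_summable_coeff: "abs_summable (\<lambda>k. fourier_coeff (spline_field N o' m d) k $ c)"
  unfolding abs_summable_def by (rule abs_summable_spline_field[OF N d])

text \<open>Spline and series have the same Fourier coefficients, so they agree almost everywhere in one period cell, hence everywhere up to a null set.\<close>

lemma spline_series_negligible:
  "negligible {x. fseries (\<lambda>k. fourier_coeff (spline_field N o' m d) k $ c) x \<noteq> spline_field N o' m d x $ c}"
proof -
  define D where "D x = fseries (\<lambda>k. fourier_coeff (spline_field N o' m d) k $ c) x - spline_field N o' m d x $ c" for x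
  note S = periodic_L2D[OF periodic_L2_spline_field[OF N d, of o'], of c]
  note G = cf_fseries[OF abs_summable_coeff]
  have "TM.sqi D" unfolding D_def by (rule TM.sqi_diff[OF G(1) S])
  moreover have "TM.cf D k = 0" for k
    unfolding D_def TM.cf_diff[OF G(1) S] G(2)
    by (simp add: fourier_coeff_nth[OF periodic_L2_spline_field[OF N d]])
  ultimately have "AE x in TM. D x = 0" by (rule TM.e_complete)
  moreover have [measurable]: "D \<in> borel_measurable borel" using \<open>TM.sqi D\<close> by (simp add: TM.sqi_def)
  ultimately have "AE x in lborel. x \<in> torus \<longrightarrow> D x = 0" by (simp add: AE_TM)
  then have "{x \<in> space lborel. \<not> (x \<in> torus \<longrightarrow> D x = 0)} \<in> null_sets lborel"
    by (subst (asm) AE_iff_null) measurable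
  then have neg: "negligible {x \<in> torus. D x \<noteq> 0}"
    unfolding negligible_iff_null_sets by (intro null_sets_completionI) simp
  have per: "periodic D"
    using periodic_fseries periodic_L2_periodic[OF periodic_L2_spline_field[OF N d, of o']]
    by (auto simp: periodic_def D_def)
  define \<T> where "\<T> n = (+) (\<chi> i. 2 * pi * of_int (n $ i)) ` {x \<in> torus. D x \<noteq> 0}" for n :: "int ^ 3"
  have "{x. D x \<noteq> 0} \<subseteq> \<Union> (range \<T>)"
  proof
    fix x assume x: "x \<in> {x. D x \<noteq> 0}"
    have "x = (\<chi> i. 2 * pi * of_int ((\<chi> i. \<lfloor>x $ i / (2 * pi)\<rfloor>) $ i)) + pmod x"
      by (simp add: vec_eq_iff pmod_def)
    moreover have "pmod x \<in> {x \<in> torus. D x \<noteq> 0}" using x pmod_torus pmod_periodic[OF per] by simp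
    ultimately have "x \<in> \<T> (\<chi> i. \<lfloor>x $ i / (2 * pi)\<rfloor>)" unfolding \<T>_def by blast
    then show "x \<in> \<Union> (range \<T>)" by blast
  qed
  moreover have "negligible (\<Union> (range \<T>))"
    by (rule negligible_countable_Union) (auto simp: \<T>_def intro!: negligible_translation neg)
  ultimately have "negligible {x. D x \<noteq> 0}" using negligible_subset by blast
  then show ?thesis by (simp add: D_def)
qed

text \<open>Both sides are continuous and agree almost everywhere in the open cell.\<close>

lemma spline_series:
  assumes x: "x \<in> cbox (vertex N o' j) (vertex N o' (j + 1))"
  shows "fseries (\<lambda>k. fourier_coeff (spline_field N o' m d) k $ c) x = of_real (cell_poly N o' m d j x $ c)"
proof -
  define G where "G = fseries (\<lambda>k. fourier_coeff (spline_field N o' m d) k $ c)"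
  define p where "p x = complex_of_real (cell_poly N o' m d j x $ c)" for x
  define B where "B = box (vertex N o' j) (vertex N o' (j + 1))"
  have cG: "continuous_on UNIV G" using bounded_cont_fseries[OF abs_summable_coeff] by (simp add: G_def bounded_cont_def)
  have cp: "continuous_on UNIV p"
    unfolding p_def by (intro continuous_on_of_real ridge_span_continuous[OF ridge_span_tensor_poly[OF tensor_poly_cell_poly[OF N]]])
  have "B \<inter> {x. G x \<noteq> p x} \<subseteq> {x. G x \<noteq> spline_field N o' m d x $ c}"
    using cell_of_box[OF N] by (auto simp: B_def p_def spline_field_def complexify_def hb_interp_def)
  then have "negligible (B \<inter> {x. G x \<noteq> p x})" using spline_series_negligible negligible_subset unfolding G_def by blast
  moreover have "open (B \<inter> {x. G x \<noteq> p x})" unfolding B_def by (intro open_Int open_box open_Collect_neq cG cp)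
  ultimately have "B \<inter> {x. G x \<noteq> p x} = {}" by (rule negligible_open)
  then have "B \<subseteq> {x. G x = p x}" by auto
  then have "closure B \<subseteq> {x. G x = p x}" by (rule closure_minimal) (rule closed_Collect_eq[OF cG cp])
  moreover have "B \<noteq> {}"
  proof -
    have "vertex N o' j $ i < vertex N o' (j + 1) $ i" for i using N[of i] by (simp add: vertex_def spacing_def divide_simps)
    then show ?thesis unfolding B_def interval_ne_empty_cart by blast
  qed
  ultimately have "x \<in> {x. G x = p x}" using x unfolding B_def by auto
  then show ?thesis by (simp add: G_def p_def)
qed

lemma spline_series_center:
  assumes R: "\<And>i. 2 * R \<le> spacing N $ i" and y: "near (vertex N (dual_origin N o') j) R y"
  shows "fseries (\<lambda>k. fourier_coeff (spline_field N o' m d) k $ c) y = of_real (cell_poly N o' m d j y $ c)"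
proof (rule spline_series)
  have "vertex N o' j $ i \<le> y $ i \<and> y $ i \<le> vertex N o' (j + 1) $ i" for i
  proof -
    have "\<bar>y $ i - (o' $ i + spacing N $ i / 2 + of_int (j $ i) * spacing N $ i)\<bar> \<le> spacing N $ i / 2"
      using y[unfolded near_def, rule_format, of i] R[of i] by (simp add: vertex_def dual_origin_def)
    from abs_le_D1[OF this] abs_le_D2[OF this] show ?thesis by (simp add: vertex_def algebra_simps)
  qed
  then show "y \<in> cbox (vertex N o' j) (vertex N o' (j + 1))" by (simp add: mem_box_cart)
qed

end

subsection \<open>The update as a Fourier multiplier seen by splines on the dual grid\<close>

lemma deriv_symbol_axis: "deriv_symbol (\<alpha> + axis i 1) k = deriv_symbol \<alpha> k * (\<i> * of_int (k $ i))"
proof -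
  have "deriv_symbol (\<alpha> + axis i 1) k = (\<Prod>j\<in>UNIV. (\<i> * of_int (k $ j)) ^ (\<alpha> $ j) * (if j = i then \<i> * of_int (k $ i) else 1))"
    unfolding deriv_symbol_def by (intro prod.cong refl) (auto simp: axis_def)
  then show ?thesis by (simp add: prod.distrib deriv_symbol_def)
qed

text \<open>The spherical mean gains one derivative; this keeps the terms in \<open>Theta_derivative\<close> summable.\<close>

lemma sinc_bound:
  assumes \<tau>: "\<tau> \<noteq> 0"
  shows "cmod (\<i> * of_int (k $ i) * of_real (sinc (\<tau> * norm (wavevec k)))) \<le> 1 / \<bar>\<tau>\<bar>"
proof -
  have k: "\<bar>of_int (k $ i)\<bar> \<le> norm (wavevec k)" using component_le_norm_cart[of "wavevec k" i] by (simp add: wavevec_def)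
  have "\<bar>\<tau>\<bar> * (\<bar>of_int (k $ i)\<bar> * \<bar>sinc (\<tau> * norm (wavevec k))\<bar>) \<le> \<bar>\<tau>\<bar> * (norm (wavevec k) * \<bar>sinc (\<tau> * norm (wavevec k))\<bar>)"
    using k by (intro mult_left_mono mult_right_mono) auto
  also have "\<dots> = \<bar>sin (\<tau> * norm (wavevec k))\<bar>" unfolding mult_sinc[symmetric] by (simp add: abs_mult)
  also have "\<dots> \<le> 1" by simp
  finally have "\<bar>\<tau>\<bar> * (\<bar>of_int (k $ i)\<bar> * \<bar>sinc (\<tau> * norm (wavevec k))\<bar>) \<le> 1" .
  then show ?thesis using \<tau> by (simp add: norm_mult pos_le_divide_eq mult.commute)
qed

text \<open>
  By locality the functional of the differentiated spherical mean of a spline on the grid \<open>o'\<close> is evaluated on the cell polynomials around the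
  vertices of the dual grid.  For the regularized derivatives this is \<open>regularized_derivative\<close>, summed over the vertices; the limit
  \<open>\<epsilon> \<rightarrow> 0\<close> is taken on the left by the Weierstrass test and on the right by continuity of polynomials.
\<close>

lemma Theta_derivative:
  assumes N: "\<And>i. N $ i \<ge> 1" and d: "periodic_data N m d"
    and \<tau>: "\<tau> \<noteq> 0" "\<bar>\<tau>\<bar> < R" and R: "\<And>i. 2 * R \<le> spacing N $ i"
  shows "((\<lambda>k. Theta N (dual_origin N o') m l s k *
      (\<i> * of_int (k $ i) * of_real (sinc (\<tau> * norm (wavevec k))) * fourier_coeff (spline_field N o' m d) k $ c)) has_sum
    (\<Sum>\<kappa>\<in>cells N. \<Sum>\<beta>\<in>corners. \<Sum>j\<in>multi_indices m. of_real (tensor_weight N m l s \<kappa> \<beta> j) *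
      of_real (mixed_partial (j + axis i 1) (sph \<tau> (\<lambda>x. cell_poly N o' m d (\<kappa> + \<beta>) x $ c)) (vertex N (dual_origin N o') (\<kappa> + \<beta>))))) UNIV"
proof -
  define a where "a k = fourier_coeff (spline_field N o' m d) k $ c" for k
  define F where "F k = Theta N (dual_origin N o') m l s k * (\<i> * of_int (k $ i) * of_real (sinc (\<tau> * norm (wavevec k))) * a k)" for k
  define reg where "reg \<epsilon> k = (\<Prod>i\<in>UNIV. complex_of_real (sinc (\<epsilon> * of_int (k $ i)))) ^ Suc m" for \<epsilon> and k :: "int ^ 3"
  define X where "X \<kappa> \<beta> = vertex N (dual_origin N o') (\<kappa> + \<beta>)" for \<kappa> \<beta>
  define p where "p \<kappa> \<beta> = (\<lambda>x. cell_poly N o' m d (\<kappa> + \<beta>) x $ c)" for \<kappa> \<beta>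
  let ?D = "\<lambda>\<kappa> \<beta> j. mixed_partial (j + axis i 1) (sph \<tau> (p \<kappa> \<beta>))"
  have p: "ridge_span (3 * (2 * m + 1)) (p \<kappa> \<beta>)" for \<kappa> \<beta>
    unfolding p_def by (rule ridge_span_tensor_poly[OF tensor_poly_cell_poly[OF N]])
  have aa: "abs_summable a" unfolding a_def by (rule abs_summable_coeff[OF N d])
  define b where "b k = cmod (TM.cf (PsiT N (dual_origin N o') m l s) k)" for k
  define u where "u k = norm (fourier_coeff (spline_top N o' m d) k)" for k
  have Fb: "cmod (F k) \<le> 1 / \<bar>\<tau>\<bar> * ((b k)\<^sup>2 + (u k)\<^sup>2)" for k
  proof -
    have "cmod (top_symbol m k * a k) \<le> u k"
      using Finite_Cartesian_Product.norm_nth_le[of "fourier_coeff (spline_top N o' m d) k" c]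
      unfolding u_def a_def fourier_spline_top[OF N d] by simp
    then have "b k * cmod (top_symbol m k * a k) \<le> b k * u k" by (intro mult_left_mono) (auto simp: b_def)
    also have "\<dots> \<le> (b k)\<^sup>2 + (u k)\<^sup>2"
    proof -
      have "0 \<le> b k * u k" by (simp add: b_def u_def)
      then show ?thesis using sum_squares_bound[of "b k" "u k"] by linarith
    qed
    finally have bu: "b k * cmod (top_symbol m k * a k) \<le> (b k)\<^sup>2 + (u k)\<^sup>2" .
    have "cmod (F k) = cmod (\<i> * of_int (k $ i) * of_real (sinc (\<tau> * norm (wavevec k)))) * (b k * cmod (top_symbol m k * a k))"
      unfolding F_def Theta_def b_def norm_mult complex_mod_cnj by (simp only: mult_ac)
    also have "\<dots> \<le> 1 / \<bar>\<tau>\<bar> * ((b k)\<^sup>2 + (u k)\<^sup>2)"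
      by (rule mult_mono[OF sinc_bound[OF \<tau>(1)] bu]) (auto simp: b_def)
    finally show ?thesis .
  qed
  have bs: "(\<lambda>k. 1 / \<bar>\<tau>\<bar> * ((b k)\<^sup>2 + (u k)\<^sup>2)) summable_on UNIV"
    using TM.cf_square_summable[OF sqi_PsiT[of N "dual_origin N o'" m l s]] square_summable_fourier[OF periodic_L2_spline_top[OF N d, of o']]
    unfolding b_def u_def square_summable_def by (intro summable_on_cmult_right summable_on_add)
  have reg1: "cmod (reg \<epsilon> k) \<le> 1" for \<epsilon> k
    unfolding reg_def norm_power prod_norm[symmetric]
    by (intro power_le_one prod_nonneg prod_le_1) (auto simp: abs_sinc_le)
  define G where "G \<epsilon> = (\<Sum>\<^sub>\<infinity>k. reg \<epsilon> k * F k)" for \<epsilon>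
  have cG: "continuous_on UNIV G"
    unfolding G_def
  proof (rule infsum_continuous(2)[OF bs])
    fix k and \<epsilon> :: real
    have "cmod (reg \<epsilon> k * F k) \<le> 1 * cmod (F k)" unfolding norm_mult by (intro mult_right_mono reg1) simp
    then show "cmod (reg \<epsilon> k * F k) \<le> 1 / \<bar>\<tau>\<bar> * ((b k)\<^sup>2 + (u k)\<^sup>2)" using Fb[of k] by linarith
    have "continuous_on UNIV (\<lambda>\<epsilon>. sinc (\<epsilon> * of_int (k $ i)))" for i
      by (rule continuous_on_compose2[OF continuous_sinc]) (auto intro!: continuous_intros)
    then show "continuous_on UNIV (\<lambda>\<epsilon>. reg \<epsilon> k * F k)"
      unfolding reg_def by (intro continuous_intros) auto
  qed
  have "isCont G 0" using cG by (simp add: continuous_on_eq_continuous_at)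
  then have "(G \<longlongrightarrow> G 0) (at_right 0)" unfolding isCont_def by (rule tendsto_within_subset) simp
  moreover have "G 0 = (\<Sum>\<^sub>\<infinity>k. F k)" by (simp add: G_def reg_def)
  ultimately have lim1: "(G \<longlongrightarrow> (\<Sum>\<^sub>\<infinity>k. F k)) (at_right 0)" by simp
  define V where "V g = (\<Sum>\<kappa>\<in>cells N. \<Sum>\<beta>\<in>corners. \<Sum>j\<in>multi_indices m. of_real (tensor_weight N m l s \<kappa> \<beta> j) * complex_of_real (g \<kappa> \<beta> j))" for g
  have Geq: "G \<epsilon> = V (\<lambda>\<kappa> \<beta> j. smooth \<epsilon> (Suc m) (?D \<kappa> \<beta> j) (X \<kappa> \<beta>))"
    if \<epsilon>: "0 < \<epsilon>" and small: "\<bar>\<tau>\<bar> + 3 * of_nat (Suc m) * \<epsilon> \<le> R" for \<epsilon>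
  proof -
    have e: "reg \<epsilon> k * F k = (\<Sum>\<kappa>\<in>cells N. \<Sum>\<beta>\<in>corners. \<Sum>j\<in>multi_indices m. of_real (tensor_weight N m l s \<kappa> \<beta> j) *
       (reg \<epsilon> k * (deriv_symbol (j + axis i 1) k * wave k (X \<kappa> \<beta>) * (of_real (sinc (\<tau> * norm (wavevec k))) * a k))))" for k
      unfolding F_def Theta_vertex[OF N] deriv_symbol_axis X_def sum_distrib_left sum_distrib_right
      by (intro sum.cong refl) (simp only: mult_ac)
    have "((\<lambda>k. reg \<epsilon> k * F k) has_sum V (\<lambda>\<kappa> \<beta> j. smooth \<epsilon> (Suc m) (?D \<kappa> \<beta> j) (X \<kappa> \<beta>))) UNIV"
      unfolding e V_def
    proof (intro has_sum_fin_sum finite_cells finite_corners finite_multi_indices has_sum_cmult_right)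
      fix \<kappa> \<beta> j assume j: "j \<in> multi_indices m"
      show "((\<lambda>k. reg \<epsilon> k * (deriv_symbol (j + axis i 1) k * wave k (X \<kappa> \<beta>) * (of_real (sinc (\<tau> * norm (wavevec k))) * a k))) has_sum
        of_real (smooth \<epsilon> (Suc m) (mixed_partial (j + axis i 1) (sph \<tau> (p \<kappa> \<beta>))) (X \<kappa> \<beta>))) UNIV"
        unfolding reg_def
      proof (rule regularized_derivative[OF aa p _ small \<epsilon>])
        show "fseries a y = of_real (p \<kappa> \<beta> y)" if "near (X \<kappa> \<beta>) R y" for y
          unfolding a_def p_def by (rule spline_series_center[OF N d R that[unfolded X_def]])
        show "(j + axis i 1) $ i' \<le> Suc m" for i'
          using j by (auto simp: multi_indices_def axis_def intro: le_SucI)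
      qed
    qed
    then show ?thesis unfolding G_def by (rule infsumI)
  qed
  \<comment> \<open>for smaller \<open>\<epsilon>\<close> the sphere and the \<open>3 (m + 1)\<close> averages stay within the cell\<close>
  define B where "B = (R - \<bar>\<tau>\<bar>) / (3 * of_nat (Suc m))"
  have B: "B > 0" using \<tau> by (simp add: B_def)
  have small: "\<bar>\<tau>\<bar> + 3 * of_nat (Suc m) * \<epsilon> \<le> R" if "\<epsilon> < B" for \<epsilon>
  proof -
    have "3 * of_nat (Suc m) * \<epsilon> \<le> 3 * of_nat (Suc m) * B" using that by (intro mult_left_mono) auto
    also have "\<dots> = R - \<bar>\<tau>\<bar>" by (simp add: B_def del: of_nat_Suc)
    finally show ?thesis by simp
  qed
  have "\<forall>\<^sub>F \<epsilon> in at_right 0. G \<epsilon> = V (\<lambda>\<kappa> \<beta> j. smooth \<epsilon> (Suc m) (?D \<kappa> \<beta> j) (X \<kappa> \<beta>))"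
    unfolding eventually_at_right_field using B Geq small by blast
  moreover have "((\<lambda>\<epsilon>. V (\<lambda>\<kappa> \<beta> j. smooth \<epsilon> (Suc m) (?D \<kappa> \<beta> j) (X \<kappa> \<beta>))) \<longlongrightarrow>
     V (\<lambda>\<kappa> \<beta> j. ?D \<kappa> \<beta> j (X \<kappa> \<beta>))) (at_right 0)"
    unfolding V_def
    by (intro tendsto_sum tendsto_mult_left tendsto_of_real tendsto_smooth[OF ridge_span_mixed_partial[OF ridge_span_sph[OF p]]])
  ultimately have "(G \<longlongrightarrow> V (\<lambda>\<kappa> \<beta> j. ?D \<kappa> \<beta> j (X \<kappa> \<beta>))) (at_right 0)"
    using tendsto_cong by fast
  then have "(\<Sum>\<^sub>\<infinity>k. F k) = V (\<lambda>\<kappa> \<beta> j. ?D \<kappa> \<beta> j (X \<kappa> \<beta>))"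
    using lim1 tendsto_unique[OF trivial_limit_at_right_real] by blast
  moreover have "F summable_on UNIV"
    by (rule abs_summable_summable[OF summable_on_comparison_test[OF bs]]) (use Fb in auto)
  ultimately show ?thesis
    using has_sum_infsum[of F UNIV] unfolding F_def a_def V_def p_def X_def by simp
qed

subsection \<open>Symbols of the curl updates\<close>

lemma has_sum_diff:
  fixes f g :: "'k \<Rightarrow> 'b::topological_ab_group_add"
  assumes "(f has_sum a) A" "(g has_sum b) A" shows "((\<lambda>x. f x - g x) has_sum (a - b)) A"
  using has_sum_add[OF assms(1), of "\<lambda>x. - g x" "- b"] assms(2) by (simp add: has_sum_uminus)

text \<open>The cyclic permutations of the axes, so that the components of a curl are treated at once.\<close>

definition cyclic :: "(3 \<times> 3 \<times> 3) set" where "cyclic = {(1, 2, 3), (2, 3, 1), (3, 1, 2)}"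

lemma cyclic_ex: "\<exists>a b. (i, a, b) \<in> cyclic"
  using exhaust_3[of i] by (auto simp: cyclic_def)

lemma complex_cross_cyclic: "(i, a, b) \<in> cyclic \<Longrightarrow> complex_cross u v $ i = u $ a * v $ b - u $ b * v $ a"
  by (auto simp: cyclic_def complex_cross_def)

lemma curl_cyclic:
  "ridge_field d F \<Longrightarrow> (i, a, b) \<in> cyclic \<Longrightarrow> (\<lambda>x. curl F x $ i) = (\<lambda>x. partial a (\<lambda>x. F x $ b) x - partial b (\<lambda>x. F x $ a) x)"
  by (auto simp: cyclic_def curl_component)

text \<open>
  What the exact evolution adds to one field over a time step, in terms of the other field at half the step; \<open>\<tau>\<close> is \<open>c \<Delta>t / 2\<close>.
\<close>

definition update_symbol :: "real \<Rightarrow> int ^ 3 \<Rightarrow> complex ^ 3 \<Rightarrow> complex ^ 3" where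
  "update_symbol \<tau> k u = (2 * \<i> * of_real (sin (\<tau> * norm (wavevec k)))) *s complex_cross (unit_wavevec k) u"

lemma update_symbol_cyclic:
  assumes "(i, a, b) \<in> cyclic"
  shows "update_symbol \<tau> k u $ i = of_real (2 * \<tau>) *
    (\<i> * of_int (k $ a) * of_real (sinc (\<tau> * norm (wavevec k))) * u $ b - \<i> * of_int (k $ b) * of_real (sinc (\<tau> * norm (wavevec k))) * u $ a)"
proof -
  have e: "sin (\<tau> * norm (wavevec k)) * (wavevec k $ j / norm (wavevec k)) = \<tau> * (of_int (k $ j) * sinc (\<tau> * norm (wavevec k)))" for j
  proof (cases "wavevec k = 0")
    case True
    then have "wavevec k $ j = 0" by simp
    then show ?thesis by (simp add: wavevec_def)
  next
    case False
    then show ?thesis unfolding mult_sinc [symmetric] by (simp add: wavevec_def)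
  qed
  have c: "complex_of_real (sin (\<tau> * norm (wavevec k))) * unit_wavevec k $ j = of_real (\<tau> * (of_int (k $ j) * sinc (\<tau> * norm (wavevec k))))" for j
    unfolding e [symmetric] by (simp add: unit_wavevec_def)
  have "update_symbol \<tau> k u $ i = 2 * \<i> * (of_real (sin (\<tau> * norm (wavevec k))) * unit_wavevec k $ a) * u $ b
      - 2 * \<i> * (of_real (sin (\<tau> * norm (wavevec k))) * unit_wavevec k $ b) * u $ a"
    by (simp add: update_symbol_def complex_cross_cyclic[OF assms] algebra_simps)
  then show ?thesis unfolding c by (simp add: algebra_simps)
qed

lemma sph_diff: "ridge_span d f \<Longrightarrow> ridge_span d g \<Longrightarrow> sph \<tau> (\<lambda>x. f x - g x) = (\<lambda>x. sph \<tau> f x - sph \<tau> g x)"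
  using cmean_add[OF sph_continuous, of f "\<lambda>x. (-1) * g x" \<tau>] cmean_scale[OF sph_continuous, of \<tau> "-1" g]
  by (simp add: sph_def ridge_span_continuous[of d] continuous_intros)

text \<open>The degrees fit exactly: a cell polynomial has total degree at most \<open>6m + 3 = 2 (3m + 1) + 1\<close>.\<close>

lemma increment_cyclic:
  assumes N: "\<And>i. N $ i \<ge> 1" and cyc: "(i, a, b) \<in> cyclic"
  shows "mixed_partial \<alpha> (increment c \<Delta>t (3 * m + 2) (\<lambda>x. c *\<^sub>R curl (cell_poly N o' m d j) x)) X $ i =
    c * \<Delta>t * (mixed_partial (\<alpha> + axis a 1) (sph (c * \<Delta>t / 2) (\<lambda>x. cell_poly N o' m d j x $ b)) X
      - mixed_partial (\<alpha> + axis b 1) (sph (c * \<Delta>t / 2) (\<lambda>x. cell_poly N o' m d j x $ a)) X)"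
proof -
  define W where "W = cell_poly N o' m d j"
  \<comment> \<open>the total degree of a tensor-product polynomial of degree \<open>2m + 1\<close> in each of the three variables\<close>
  define D where "D = 3 * (2 * m + 1)"
  define \<tau> where "\<tau> = c * \<Delta>t / 2"
  define I where "I = increment c \<Delta>t (3 * m + 2) (\<lambda>x. c *\<^sub>R curl W x)"
  have r: "ridge_span D (\<lambda>x. W x $ i)" for i
    unfolding W_def D_def by (rule ridge_span_tensor_poly[OF tensor_poly_cell_poly[OF N]])
  then have W: "ridge_field D W" by (simp add: ridge_field_def)
  have Ie: "(\<lambda>x. I x $ i) = (\<lambda>x. (c * \<Delta>t) * sph \<tau> (\<lambda>x. curl W x $ i) x)" for i
    using increment_eq_sph[OF W, of "3 * m + 1" c \<Delta>t i] by (simp add: I_def \<tau>_def D_def)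
  have rc: "ridge_span D (\<lambda>x. curl W x $ i)" for i using ridge_field_curl[OF W] by (simp add: ridge_field_def)
  have I: "ridge_field D I"
    unfolding ridge_field_def Ie by (intro allI ridge_span.scale ridge_span_sph rc)
  note rp = ridge_span_partial'[OF r]
  have "mixed_partial \<alpha> I X $ i = mixed_partial \<alpha> (\<lambda>x. (c * \<Delta>t) * sph \<tau> (\<lambda>x. curl W x $ i) x) X"
    unfolding mixed_partial_component[OF I] Ie ..
  also have "\<dots> = (c * \<Delta>t) * mixed_partial \<alpha> (sph \<tau> (\<lambda>x. curl W x $ i)) X"
    unfolding mixed_partial_linear(2)[OF ridge_span_sph[OF rc] ridge_span_sph[OF rc]] ..
  also have "sph \<tau> (\<lambda>x. curl W x $ i) = (\<lambda>x. partial a (sph \<tau> (\<lambda>x. W x $ b)) x - partial b (sph \<tau> (\<lambda>x. W x $ a)) x)"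
    unfolding curl_cyclic[OF W cyc] sph_diff[OF rp rp] partial_sph[OF r] ..
  also have "mixed_partial \<alpha> \<dots> = (\<lambda>x. mixed_partial (\<alpha> + axis a 1) (sph \<tau> (\<lambda>x. W x $ b)) x - mixed_partial (\<alpha> + axis b 1) (sph \<tau> (\<lambda>x. W x $ a)) x)"
    unfolding mixed_partial_linear(1)[OF ridge_span_partial'[OF ridge_span_sph[OF r]] ridge_span_partial'[OF ridge_span_sph[OF r]]]
      mixed_partial_partial[OF ridge_span_sph[OF r]] ..
  finally show ?thesis by (simp add: W_def I_def \<tau>_def)
qed

text \<open>Increment and exact evolution have the same vertex data, so every functional \<open>Theta\<close> of the updated grid gives them the same value.\<close>

lemma Theta_increment:
  assumes N: "\<And>i. N $ i \<ge> 1" and d: "periodic_data N m d" and f: "periodic_data N m f"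
    and \<tau>: "c * \<Delta>t \<noteq> 0" "\<bar>c * \<Delta>t\<bar> < 2 * R" and R: "\<And>i. 2 * R \<le> spacing N $ i"
    and upd: "\<And>j \<alpha>. \<alpha> \<in> multi_indices m \<Longrightarrow> f j \<alpha> =
       mixed_partial \<alpha> (increment c \<Delta>t (3 * m + 2) (\<lambda>x. c *\<^sub>R curl (cell_poly N o' m d j) x)) (vertex N (dual_origin N o') j)"
  shows "((\<lambda>k. Theta N (dual_origin N o') m l s k *
      (fourier_coeff (spline_field N (dual_origin N o') m f) k - update_symbol (c * \<Delta>t / 2) k (fourier_coeff (spline_field N o' m d) k)) $ i) has_sum 0) UNIV"
proof -
  obtain a b where cyc: "(i, a, b) \<in> cyclic" using cyclic_ex by blast
  define \<tau> where "\<tau> = c * \<Delta>t / 2"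
  have t: "\<tau> \<noteq> 0" "\<bar>\<tau>\<bar> < R" using \<tau> by (auto simp: \<tau>_def abs_mult)
  define A where "A i c = (\<lambda>\<kappa> \<beta> j. mixed_partial (j + axis i 1) (sph \<tau> (\<lambda>x. cell_poly N o' m d (\<kappa> + \<beta>) x $ c)) (vertex N (dual_origin N o') (\<kappa> + \<beta>)))" for i c
  define V where "V g = (\<Sum>\<kappa>\<in>cells N. \<Sum>\<beta>\<in>corners. \<Sum>j\<in>multi_indices m. of_real (tensor_weight N m l s \<kappa> \<beta> j) * complex_of_real (g \<kappa> \<beta> j))" for g
  define T where "T k i c = Theta N (dual_origin N o') m l s k *
      (\<i> * of_int (k $ i) * of_real (sinc (\<tau> * norm (wavevec k))) * fourier_coeff (spline_field N o' m d) k $ c)" for k i c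
  have hT: "((\<lambda>k. T k i c) has_sum V (A i c)) UNIV" for i c
    using Theta_derivative[OF N d t R, where l = l and s = s and i = i and c = c] unfolding T_def V_def A_def .
  have "((\<lambda>k. of_real (2 * \<tau>) * (T k a b - T k b a)) has_sum of_real (2 * \<tau>) * (V (A a b) - V (A b a))) UNIV"
    by (intro has_sum_cmult_right has_sum_diff hT)
  moreover have "((\<lambda>k. Theta N (dual_origin N o') m l s k * fourier_coeff (spline_field N (dual_origin N o') m f) k $ i) has_sum
      V (\<lambda>\<kappa> \<beta> j. f (\<kappa> + \<beta>) j $ i)) UNIV"
    unfolding V_def by (rule Theta_spline[OF N f])
  moreover have "V (\<lambda>\<kappa> \<beta> j. f (\<kappa> + \<beta>) j $ i) = of_real (2 * \<tau>) * (V (A a b) - V (A b a))"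
  proof -
    have "f (\<kappa> + \<beta>) j $ i = 2 * \<tau> * (A a b \<kappa> \<beta> j - A b a \<kappa> \<beta> j)" if "j \<in> multi_indices m" for \<kappa> \<beta> j
      unfolding upd[OF that] increment_cyclic[OF N cyc] A_def \<tau>_def by simp
    then have "V (\<lambda>\<kappa> \<beta> j. f (\<kappa> + \<beta>) j $ i) = V (\<lambda>\<kappa> \<beta> j. 2 * \<tau> * (A a b \<kappa> \<beta> j - A b a \<kappa> \<beta> j))"
      unfolding V_def by (intro sum.cong refl) simp
    also have "\<dots> = of_real (2 * \<tau>) * (V (A a b) - V (A b a))"
      unfolding V_def sum_subtractf [symmetric] sum_distrib_left
      by (intro sum.cong refl) (simp add: algebra_simps)
    finally show ?thesis .
  qed
  ultimately have "((\<lambda>k. Theta N (dual_origin N o') m l s k * fourier_coeff (spline_field N (dual_origin N o') m f) k $ i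
      - of_real (2 * \<tau>) * (T k a b - T k b a)) has_sum (of_real (2 * \<tau>) * (V (A a b) - V (A b a)) - of_real (2 * \<tau>) * (V (A a b) - V (A b a)))) UNIV"
    by (intro has_sum_diff) simp_all
  moreover have "Theta N (dual_origin N o') m l s k * fourier_coeff (spline_field N (dual_origin N o') m f) k $ i - of_real (2 * \<tau>) * (T k a b - T k b a)
    = Theta N (dual_origin N o') m l s k *
      (fourier_coeff (spline_field N (dual_origin N o') m f) k - update_symbol \<tau> k (fourier_coeff (spline_field N o' m d) k)) $ i" for k
    by (simp add: update_symbol_cyclic[OF cyc] T_def algebra_simps)
  ultimately show ?thesis by (simp add: \<tau>_def)
qed

text \<open>A spline \<open>v\<close> is a combination of basis splines, and pairing with a basis spline is the functional \<open>Theta\<close>.\<close>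

lemma update_residual_orthogonal:
  assumes N: "\<And>i. N $ i \<ge> 1" and d: "periodic_data N m d" and f: "periodic_data N m f" and v: "periodic_data N m v"
    and \<tau>: "c * \<Delta>t \<noteq> 0" "\<bar>c * \<Delta>t\<bar> < 2 * R" and R: "\<And>i. 2 * R \<le> spacing N $ i"
    and upd: "\<And>j \<alpha>. \<alpha> \<in> multi_indices m \<Longrightarrow> f j \<alpha> =
       mixed_partial \<alpha> (increment c \<Delta>t (3 * m + 2) (\<lambda>x. c *\<^sub>R curl (cell_poly N o' m d j) x)) (vertex N (dual_origin N o') j)"
  shows "((\<lambda>k. hip (top_symbol m k *s (fourier_coeff (spline_field N (dual_origin N o') m f) k -
        update_symbol (c * \<Delta>t / 2) k (fourier_coeff (spline_field N o' m d) k)))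
      (top_symbol m k *s fourier_coeff (spline_field N (dual_origin N o') m v) k)) has_sum 0) UNIV"
proof -
  define g where "g k = fourier_coeff (spline_field N (dual_origin N o') m f) k - update_symbol (c * \<Delta>t / 2) k (fourier_coeff (spline_field N o' m d) k)" for k
  have "((\<lambda>k. \<Sum>i\<in>UNIV. \<Sum>l\<in>cells N. \<Sum>s\<in>multi_indices m. of_real (v l s $ i) * (Theta N (dual_origin N o') m l s k * g k $ i)) has_sum
     (\<Sum>i\<in>(UNIV :: 3 set). \<Sum>l\<in>cells N. \<Sum>s\<in>multi_indices m. of_real (v l s $ i) * 0)) UNIV"
    unfolding g_def by (intro has_sum_fin_sum has_sum_cmult_right Theta_increment[OF N d f \<tau> R upd]) auto
  moreover have "(\<Sum>i\<in>UNIV. \<Sum>l\<in>cells N. \<Sum>s\<in>multi_indices m. of_real (v l s $ i) * (Theta N (dual_origin N o') m l s k * g k $ i))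
     = hip (top_symbol m k *s g k) (top_symbol m k *s fourier_coeff (spline_field N (dual_origin N o') m v) k)" for k
    unfolding hip_def
  proof (rule sum.cong[OF refl])
    fix i
    have "cnj ((top_symbol m k *s fourier_coeff (spline_field N (dual_origin N o') m v) k) $ i) =
        (\<Sum>l\<in>cells N. \<Sum>s\<in>multi_indices m. of_real (v l s $ i) * cnj (TM.cf (PsiT N (dual_origin N o') m l s) k))"
      unfolding vector_smult_component fourier_spline_field[OF N v] cf_PsiT[OF N] by (simp add: sum_distrib_left mult_ac)
    then show "(\<Sum>l\<in>cells N. \<Sum>s\<in>multi_indices m. of_real (v l s $ i) * (Theta N (dual_origin N o') m l s k * g k $ i))
      = (top_symbol m k *s g k) $ i * cnj ((top_symbol m k *s fourier_coeff (spline_field N (dual_origin N o') m v) k) $ i)"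
      by (simp add: Theta_def sum_distrib_left mult_ac)
  qed
  ultimately show ?thesis by (simp add: g_def)
qed

subsection \<open>Translating the index of a grid\<close>

text \<open>Dualizing a grid twice translates it by one cell.  Re-indexing the data makes both updates instances of one statement about a grid and its dual.\<close>

lemma vertex_shift: "vertex N (o' + spacing N) j = vertex N o' (j + 1)"
  by (simp add: vertex_def vec_eq_iff algebra_simps)

lemma dual_dual: "dual_origin N (dual_origin N o') = o' + spacing N"
  by (simp add: dual_origin_def vec_eq_iff)

lemma cell_poly_shift: "cell_poly N (o' + spacing N) m (\<lambda>j. d (j + 1)) j = cell_poly N o' m d (j + 1)"
proof -
  have "j + \<beta> + 1 = j + 1 + \<beta>" for \<beta> :: "int ^ 3" by simp
  then show ?thesis unfolding cell_poly_def vertex_shift by (simp only:)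
qed

lemma spline_field_shift:
  assumes N: "\<And>i. N $ i \<ge> 1"
  shows "spline_field N (o' + spacing N) m (\<lambda>j. d (j + 1)) = spline_field N o' m d"
proof -
  have "cell_of N (o' + spacing N) x + 1 = cell_of N o' x" for x
  proof -
    have "(x $ i - o' $ i) / spacing N $ i = (x $ i - (o' $ i + spacing N $ i)) / spacing N $ i + 1" for i
      using N[of i] by (simp add: spacing_def field_simps)
    then show ?thesis by (simp add: cell_of_def vec_eq_iff)
  qed
  then show ?thesis unfolding spline_field_def hb_interp_def cell_poly_shift by simp
qed

lemma periodic_data_shift: "periodic_data N m d \<Longrightarrow> periodic_data N m (\<lambda>j. d (j + 1))"
  unfolding periodic_data_def
proof (intro allI ballI)
  fix i j \<alpha> assume "\<forall>i j. \<forall>\<alpha>\<in>multi_indices m. d (j + axis i (int (N $ i))) \<alpha> = d j \<alpha>" "\<alpha> \<in> multi_indices m"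
  moreover have "j + axis i (int (N $ i)) + 1 = (j + 1) + axis i (int (N $ i))" by simp
  ultimately show "d (j + axis i (int (N $ i)) + 1) \<alpha> = d (j + 1) \<alpha>" by metis
qed

lemma fourier_spline_diff:
  assumes N: "\<And>i. N $ i \<ge> 1" and f: "periodic_data N m f" and g: "periodic_data N m g"
  shows "periodic_data N m (\<lambda>j \<alpha>. f j \<alpha> - g j \<alpha>)"
    and "fourier_coeff (spline_field N o' m (\<lambda>j \<alpha>. f j \<alpha> - g j \<alpha>)) k =
      fourier_coeff (spline_field N o' m f) k - fourier_coeff (spline_field N o' m g) k"
proof -
  show fg: "periodic_data N m (\<lambda>j \<alpha>. f j \<alpha> - g j \<alpha>)" using f g by (simp add: periodic_data_def)
  show "fourier_coeff (spline_field N o' m (\<lambda>j \<alpha>. f j \<alpha> - g j \<alpha>)) k =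
      fourier_coeff (spline_field N o' m f) k - fourier_coeff (spline_field N o' m g) k"
    by (simp add: vec_eq_iff fourier_spline_field[OF N fg] fourier_spline_field[OF N f] fourier_spline_field[OF N g]
        sum_subtractf [symmetric] left_diff_distrib)
qed

section \<open>Conservation of energy\<close>

subsection \<open>Energy identities for a single wave vector\<close>

lemma hip_linear:
  "hip (u + v) w = hip u w + hip v w" "hip (u - v) w = hip u w - hip v w" "hip w (u + v) = hip w u + hip w v"
  "hip w (u - v) = hip w u - hip w v" "hip (z *s u) w = z * hip u w" "hip w (z *s u) = cnj z * hip w u"
  "hip 0 w = 0" "hip w 0 = 0"
  by (simp_all add: hip_def sum_3 algebra_simps)

lemma hip_cnj: "cnj (hip u v) = hip v u"
  by (simp add: hip_def mult.commute)

lemma norm_sq_hip: "(norm u)\<^sup>2 = Re (hip u u)"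
  by (simp add: hip_self)

lemma norm_diff_sq: "(norm (u - v))\<^sup>2 = (norm u)\<^sup>2 + (norm v)\<^sup>2 - 2 * Re (hip u v)"
proof -
  have "Re (hip v u) = Re (hip u v)" using hip_cnj[of u v] by (metis cnj.simps(1))
  then show ?thesis unfolding norm_sq_hip hip_linear by simp
qed

lemma norm_smult: "norm (z *s u) = cmod z * norm (u :: complex ^ 3)"
proof -
  have "(norm (z *s u))\<^sup>2 = (cmod z * norm u)\<^sup>2"
    unfolding norm_vec_sq power_mult_distrib by (simp add: norm_mult power_mult_distrib sum_distrib_left)
  then show ?thesis by (simp add: power2_eq_iff_nonneg)
qed

lemma scaleR_smult: "r *\<^sub>R (u :: complex ^ 3) = complex_of_real r *s u"
  by (simp add: vec_eq_iff scaleR_conv_of_real[where 'a = complex])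

definition N_symbol :: "int ^ 3 \<Rightarrow> complex ^ 3 \<Rightarrow> complex ^ 3" where
  "N_symbol k u = (if k = 0 then u else (\<Sum>i\<in>UNIV. unit_wavevec k $ i * u $ i) *s unit_wavevec k)"

definition C_symbol :: "int ^ 3 \<Rightarrow> complex ^ 3 \<Rightarrow> complex ^ 3" where
  "C_symbol k u = (if k = 0 then 0 else complex_cross (unit_wavevec k) u)"

lemma unit_wavevec_cnj: "cnj (unit_wavevec k $ i) = unit_wavevec k $ i"
  by (simp add: unit_wavevec_def)

lemma unit_wavevec_norm: "k \<noteq> 0 \<Longrightarrow> (\<Sum>i\<in>UNIV. unit_wavevec k $ i * unit_wavevec k $ i) = 1"
proof -
  assume "k \<noteq> 0"
  then have "wavevec k \<noteq> 0" by (auto simp: wavevec_def vec_eq_iff)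
  then have "wavevec k \<bullet> wavevec k / (norm (wavevec k) * norm (wavevec k)) = 1"
    unfolding power2_norm_eq_inner [symmetric] power2_eq_square by simp
  then have "(\<Sum>i\<in>UNIV. (wavevec k $ i / norm (wavevec k)) * (wavevec k $ i / norm (wavevec k))) = 1"
    by (simp add: sum_divide_distrib inner_vec_def)
  then show ?thesis unfolding unit_wavevec_def vec_lambda_beta of_real_mult [symmetric] of_real_sum [symmetric] by simp
qed

lemma complex_cross_3:
  "complex_cross u v $ 1 = u $ 2 * v $ 3 - u $ 3 * v $ 2" "complex_cross u v $ 2 = u $ 3 * v $ 1 - u $ 1 * v $ 3"
  "complex_cross u v $ 3 = u $ 1 * v $ 2 - u $ 2 * v $ 1"
  by (simp_all add: complex_cross_def)

lemma update_symbol_C: "update_symbol \<tau> k u = (2 * \<i> * of_real (sin (\<tau> * norm (wavevec k)))) *s C_symbol k u"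
  by (cases "k = 0") (simp_all add: update_symbol_def C_symbol_def)

text \<open>
  For \<open>k \<noteq> 0\<close>, \<open>N_symbol\<close> is the orthogonal projection onto the direction of \<open>k\<close>, and \<open>C_symbol\<close> rotates the orthogonal complement isometrically.
\<close>

lemma symbol_energy:
  shows norm_N: "(norm (N_symbol k u))\<^sup>2 = (norm u)\<^sup>2 - (norm (u - N_symbol k u))\<^sup>2"
    and norm_C: "(norm (C_symbol k u))\<^sup>2 = (norm (u - N_symbol k u))\<^sup>2"
    and C_N: "C_symbol k (u - N_symbol k u) = C_symbol k u"
    and N_C: "hip (N_symbol k v) (C_symbol k u) = 0"
proof -
  have "(norm (N_symbol k u))\<^sup>2 = (norm u)\<^sup>2 - (norm (u - N_symbol k u))\<^sup>2 \<and>
    (norm (C_symbol k u))\<^sup>2 = (norm (u - N_symbol k u))\<^sup>2 \<and> C_symbol k (u - N_symbol k u) = C_symbol k u \<and>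
    hip (N_symbol k v) (C_symbol k u) = 0"
  proof (cases "k = 0")
    case True
    then show ?thesis by (simp add: N_symbol_def C_symbol_def hip_linear)
  next
    case False
    define n where "n = unit_wavevec k"
    define z where "z = n $ 1 * u $ 1 + n $ 2 * u $ 2 + n $ 3 * u $ 3"
    have c: "cnj (n $ i) = n $ i" for i by (simp add: n_def unit_wavevec_cnj)
    have nn: "n $ 1 * n $ 1 + n $ 2 * n $ 2 + n $ 3 * n $ 3 = 1" using unit_wavevec_norm[OF False] by (simp add: n_def sum_3)
    have N: "N_symbol k u = z *s n" "C_symbol k w = complex_cross n w" for w
      using False by (simp_all add: N_symbol_def C_symbol_def n_def z_def sum_3)
    have zn: "hip (z *s n) (z *s n) = z * cnj z"
      unfolding hip_linear using nn by (simp add: hip_def sum_3 c)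
    have un: "hip u (z *s n) = z * cnj z"
      unfolding hip_linear by (simp add: hip_def sum_3 c z_def algebra_simps)
    have nu: "hip (z *s n) u = z * cnj z" using hip_cnj[of u "z *s n"] un by (simp add: mult.commute)
    have "hip (u - z *s n) (u - z *s n) = hip u u - z * cnj z"
      unfolding hip_linear(2,4) zn un nu by simp
    then have 1: "(norm (z *s n))\<^sup>2 = (norm u)\<^sup>2 - (norm (u - z *s n))\<^sup>2"
      unfolding norm_sq_hip zn by simp
    have lagrange: "(n2 * u3 - n3 * u2) * (n2 * v3 - n3 * v2) + (n3 * u1 - n1 * u3) * (n3 * v1 - n1 * v3) + (n1 * u2 - n2 * u1) * (n1 * v2 - n2 * v1)
      = (n1 * n1 + n2 * n2 + n3 * n3) * (u1 * v1 + u2 * v2 + u3 * v3) - (n1 * u1 + n2 * u2 + n3 * u3) * (n1 * v1 + n2 * v2 + n3 * v3)"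
      for n1 n2 n3 u1 u2 u3 v1 v2 v3 :: complex by (simp add: algebra_simps)
    have "hip (complex_cross n u) (complex_cross n u) = hip u u - z * cnj z"
      unfolding hip_def sum_3 complex_cross_3 z_def complex_cnj_diff complex_cnj_mult complex_cnj_add c lagrange nn by simp
    then have 2: "(norm (complex_cross n u))\<^sup>2 = (norm (u - z *s n))\<^sup>2"
      using \<open>hip (u - z *s n) (u - z *s n) = hip u u - z * cnj z\<close> unfolding norm_sq_hip by simp
    have 3: "complex_cross n (u - z *s n) = complex_cross n u"
      by (simp add: vec_eq_iff forall_3 complex_cross_3 algebra_simps)
    have 4: "hip (w *s n) (complex_cross n u) = 0" for w
      unfolding hip_linear by (simp add: hip_def sum_3 complex_cross_3 c algebra_simps)
    have "\<exists>w. N_symbol k v = w *s n" using False by (auto simp: N_symbol_def n_def)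
    then show ?thesis unfolding N using 1 2 3 4 by auto
  qed
  then show "(norm (N_symbol k u))\<^sup>2 = (norm u)\<^sup>2 - (norm (u - N_symbol k u))\<^sup>2"
    "(norm (C_symbol k u))\<^sup>2 = (norm (u - N_symbol k u))\<^sup>2" "C_symbol k (u - N_symbol k u) = C_symbol k u"
    "hip (N_symbol k v) (C_symbol k u) = 0" by blast+
qed

text \<open>The triple product is alternating; conjugation enters through the sesquilinear pairing.\<close>

lemma hip_C: "hip v (C_symbol k u) = - cnj (hip u (C_symbol k v))"
proof (cases "k = 0")
  case False
  have "cnj (unit_wavevec k $ i) = unit_wavevec k $ i" for i by (rule unit_wavevec_cnj)
  then show ?thesis using False by (simp add: hip_def sum_3 C_symbol_def complex_cross_3 algebra_simps)
qed (simp add: C_symbol_def hip_linear)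

lemma hip_update_symbol: "Re (hip u (update_symbol \<tau> k v)) = Re (hip v (update_symbol \<tau> k u))"
  unfolding update_symbol_C hip_linear hip_C[of u k v] by simp

definition PQ_symbol :: "real \<Rightarrow> real \<Rightarrow> int ^ 3 \<Rightarrow> complex ^ 3 \<Rightarrow> complex ^ 3 \<Rightarrow> complex ^ 3" where
  "PQ_symbol \<tau> \<sigma> k u v = (u - N_symbol k u) - of_real \<sigma> *s (cis (\<sigma> * (\<tau> * norm (wavevec k))) *s C_symbol k (v - N_symbol k v))"

lemma norm_PQ:
  assumes "\<sigma> = 1 \<or> \<sigma> = -1"
  shows "(norm (PQ_symbol \<tau> \<sigma> k u v))\<^sup>2 = (norm (u - N_symbol k u))\<^sup>2 + (norm (v - N_symbol k v))\<^sup>2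
     - 2 * \<sigma> * Re (cis (- (\<sigma> * (\<tau> * norm (wavevec k)))) * hip u (C_symbol k v))"
proof -
  have n: "(norm (of_real \<sigma> *s (cis (\<sigma> * (\<tau> * norm (wavevec k))) *s C_symbol k v)))\<^sup>2 = (norm (v - N_symbol k v))\<^sup>2"
  proof -
    have "norm (of_real \<sigma> *s (cis (\<sigma> * (\<tau> * norm (wavevec k))) *s C_symbol k v)) = norm (C_symbol k v)"
      using assms by (auto simp: norm_smult)
    then show ?thesis unfolding norm_C [symmetric] by simp
  qed
  have h: "hip (u - N_symbol k u) (of_real \<sigma> *s (cis (\<sigma> * (\<tau> * norm (wavevec k))) *s C_symbol k v))
      = of_real \<sigma> * (cis (- (\<sigma> * (\<tau> * norm (wavevec k)))) * hip u (C_symbol k v))"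
    unfolding hip_linear N_C by (simp add: cis_cnj)
  show ?thesis unfolding PQ_symbol_def C_N norm_diff_sq n h by simp
qed

text \<open>
  The mixed terms of the two signs combine to the difference of \<open>e\<^sup>\<plusminus>\<^sup>\<i>\<^sup>\<theta>\<close>, that is, to \<open>2 \<i> sin \<theta>\<close>.  For \<open>k = 0\<close> the identity holds because
  both variables and the update symbol vanish.
\<close>

lemma PQ_energy:
  "(norm (PQ_symbol \<tau> 1 k u v))\<^sup>2 + (norm (PQ_symbol \<tau> (-1) k u v))\<^sup>2 + 2 * (norm (N_symbol k u))\<^sup>2 + 2 * (norm (N_symbol k v))\<^sup>2
    = 2 * (norm u)\<^sup>2 + 2 * (norm v)\<^sup>2 - 2 * Re (hip u (update_symbol \<tau> k v))"
proof -
  define \<theta> where "\<theta> = \<tau> * norm (wavevec k)"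
  have "Re (hip u (update_symbol \<tau> k v)) = Re (cis (- \<theta>) * hip u (C_symbol k v)) - Re (cis \<theta> * hip u (C_symbol k v))"
    unfolding update_symbol_C hip_linear \<theta>_def by (simp add: algebra_simps)
  then show ?thesis
    unfolding norm_N using norm_PQ[of 1 \<tau> k u v] norm_PQ[of "-1" \<tau> k u v] by (simp add: \<theta>_def)
qed

lemma update_symbol_linear:
  "update_symbol \<tau> k (u - v) = update_symbol \<tau> k u - update_symbol \<tau> k v" "update_symbol (- \<tau>) k u = - update_symbol \<tau> k u"
  by (simp_all add: vec_eq_iff forall_3 update_symbol_def complex_cross_3 algebra_simps)

subsection \<open>Fourier coefficients of the characteristic variables\<close>

lemma norm_le_sq: "(norm a)\<^sup>2 \<le> (norm b)\<^sup>2 \<Longrightarrow> norm a \<le> norm b"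
  by (rule power2_le_imp_le) auto

lemma N_symbol_le: "norm (N_symbol k u) \<le> norm u"
  by (rule norm_le_sq) (simp add: norm_N)

lemma S_symbol_le: "norm (u - N_symbol k u) \<le> norm u"
  by (rule norm_le_sq) (use norm_N[of k u] zero_le_power2[of "norm (N_symbol k u)"] in linarith)

lemma C_symbol_le: "norm (C_symbol k u) \<le> norm u"
  using norm_C[of k u] norm_le_sq[of "C_symbol k u" "u - N_symbol k u"] S_symbol_le[of u k] by simp

lemma N_part_coeff:
  assumes "periodic_L2 U"
  shows "periodic_L2 (N_part U)" "fourier_coeff (N_part U) k = N_symbol k (fourier_coeff U k)"
proof -
  have e: "N_part = fourier_multiplier N_symbol" unfolding N_part_def N_symbol_def[abs_def] ..
  show "periodic_L2 (N_part U)" "fourier_coeff (N_part U) k = N_symbol k (fourier_coeff U k)"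
    unfolding e using fourier_multiplier[OF assms N_symbol_le] by auto
qed

lemma S_part_coeff:
  assumes "periodic_L2 U"
  shows "periodic_L2 (S_part U)" "fourier_coeff (S_part U) k = fourier_coeff U k - N_symbol k (fourier_coeff U k)"
proof -
  have e: "S_part U = (\<lambda>x. U x - 1 *\<^sub>R N_part U x)" by (simp add: S_part_def)
  show "periodic_L2 (S_part U)" "fourier_coeff (S_part U) k = fourier_coeff U k - N_symbol k (fourier_coeff U k)"
    unfolding e using periodic_L2_combine[OF assms N_part_coeff(1)[OF assms], of 1] by (simp_all add: N_part_coeff(2)[OF assms])
qed

lemma C_op_coeff:
  assumes "periodic_L2 U"
  shows "periodic_L2 (C_op U)" "fourier_coeff (C_op U) k = C_symbol k (fourier_coeff U k)"
proof -
  have e: "C_op = fourier_multiplier C_symbol" unfolding C_op_def C_symbol_def[abs_def] ..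
  show "periodic_L2 (C_op U)" "fourier_coeff (C_op U) k = C_symbol k (fourier_coeff U k)"
    unfolding e using fourier_multiplier[OF assms C_symbol_le] by auto
qed

lemma S_op_coeff:
  assumes "periodic_L2 U"
  shows "periodic_L2 (S_op c \<Delta>t \<sigma> U)" "fourier_coeff (S_op c \<Delta>t \<sigma> U) k = cis (\<sigma> * (c * \<Delta>t / 2 * norm (wavevec k))) *s fourier_coeff U k"
proof -
  have e: "S_op c \<Delta>t \<sigma> = fourier_multiplier (\<lambda>k u. cis (\<sigma> * (c * \<Delta>t / 2 * norm (wavevec k))) *s u)"
    unfolding S_op_def by (simp add: mult_ac)
  have "norm (cis (\<sigma> * (c * \<Delta>t / 2 * norm (wavevec k))) *s u) \<le> norm u" for k and u :: "complex ^ 3"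
    by (simp add: norm_smult)
  from fourier_multiplier[OF assms this]
  show "periodic_L2 (S_op c \<Delta>t \<sigma> U)" "fourier_coeff (S_op c \<Delta>t \<sigma> U) k = cis (\<sigma> * (c * \<Delta>t / 2 * norm (wavevec k))) *s fourier_coeff U k"
    unfolding e by auto
qed

lemma characteristic_coeff:
  assumes U: "periodic_L2 U" and V: "periodic_L2 V"
  shows "periodic_L2 (P_var c \<Delta>t \<sigma> U V)"
    and "fourier_coeff (P_var c \<Delta>t \<sigma> U V) k = PQ_symbol (c * \<Delta>t / 2) \<sigma> k (fourier_coeff U k) (fourier_coeff V k)"
  unfolding P_var_def PQ_symbol_def
  using periodic_L2_combine[OF S_part_coeff(1)[OF U] S_op_coeff(1)[OF C_op_coeff(1)[OF S_part_coeff(1)[OF V]]], of \<sigma> c \<Delta>t \<sigma>]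
  by (simp_all add: S_part_coeff U V C_op_coeff S_op_coeff scaleR_smult)

lemma hb_regular_dominated:
  assumes U: "hb_regular m U" and V: "hb_regular m V" and W: "periodic_L2 W"
    and le: "\<And>k. norm (fourier_coeff W k) \<le> norm (fourier_coeff U k) + norm (fourier_coeff V k)"
  shows "hb_regular m W"
  unfolding hb_regular_def square_summable_def
proof (intro conjI W)
  have "(\<lambda>k. 2 * (norm (top_symbol m k *s fourier_coeff U k))\<^sup>2 + 2 * (norm (top_symbol m k *s fourier_coeff V k))\<^sup>2) summable_on UNIV"
    using U V unfolding hb_regular_def square_summable_def by (intro summable_on_add summable_on_cmult_right) auto
  then show "(\<lambda>k. (norm (top_symbol m k *s fourier_coeff W k))\<^sup>2) summable_on UNIV"
  proof (rule summable_on_comparison_test)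
    fix k
    have "norm (top_symbol m k *s fourier_coeff W k) \<le> norm (top_symbol m k *s fourier_coeff U k) + norm (top_symbol m k *s fourier_coeff V k)"
      unfolding norm_smult distrib_left [symmetric] by (intro mult_left_mono le) simp
    then have "(norm (top_symbol m k *s fourier_coeff W k))\<^sup>2 \<le> (norm (top_symbol m k *s fourier_coeff U k) + norm (top_symbol m k *s fourier_coeff V k))\<^sup>2"
      by (intro power_mono) auto
    also have "\<dots> \<le> 2 * (norm (top_symbol m k *s fourier_coeff U k))\<^sup>2 + 2 * (norm (top_symbol m k *s fourier_coeff V k))\<^sup>2"
      using sum_squares_bound[of "norm (top_symbol m k *s fourier_coeff U k)" "norm (top_symbol m k *s fourier_coeff V k)"]
      by (simp add: power2_sum)
    finally show "(norm (top_symbol m k *s fourier_coeff W k))\<^sup>2 \<le> 2 * (norm (top_symbol m k *s fourier_coeff U k))\<^sup>2 + 2 * (norm (top_symbol m k *s fourier_coeff V k))\<^sup>2" .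
  qed auto
qed

lemma hb_has_sum:
  assumes "hb_regular m U"
  shows "((\<lambda>k. (cmod (top_symbol m k))\<^sup>2 * (norm (fourier_coeff U k))\<^sup>2) has_sum (hb_seminorm m U)\<^sup>2 / (2 * pi) ^ 3) UNIV"
proof -
  have "(\<lambda>k. (norm (top_symbol m k *s fourier_coeff U k))\<^sup>2) summable_on UNIV"
    using assms by (simp add: hb_regular_def square_summable_def)
  then show ?thesis
    unfolding hb_seminorm_sq[OF assms] by (simp add: norm_smult power_mult_distrib)
qed

lemma characteristic_energy:
  assumes U: "hb_regular m U" and V: "hb_regular m V"
  shows "((\<lambda>k. (cmod (top_symbol m k))\<^sup>2 * (2 * (norm (fourier_coeff U k))\<^sup>2 + 2 * (norm (fourier_coeff V k))\<^sup>2
       - 2 * Re (hip (fourier_coeff U k) (update_symbol (c * \<Delta>t / 2) k (fourier_coeff V k))))) has_sum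
     ((hb_seminorm m (P_var c \<Delta>t 1 U V))\<^sup>2 + (hb_seminorm m (P_var c \<Delta>t (-1) U V))\<^sup>2
        + 2 * (hb_seminorm m (N_part U))\<^sup>2 + 2 * (hb_seminorm m (N_part V))\<^sup>2) / (2 * pi) ^ 3) UNIV"
proof -
  have U2: "periodic_L2 U" and V2: "periodic_L2 V" using U V by (auto simp: hb_regular_def)
  have P: "hb_regular m (P_var c \<Delta>t \<sigma> U V)" if \<sigma>: "\<sigma> = 1 \<or> \<sigma> = -1" for \<sigma>
  proof (rule hb_regular_dominated[OF U V characteristic_coeff(1)[OF U2 V2]])
    fix k
    show "norm (fourier_coeff (P_var c \<Delta>t \<sigma> U V) k) \<le> norm (fourier_coeff U k) + norm (fourier_coeff V k)"
      unfolding characteristic_coeff(2)[OF U2 V2] PQ_symbol_def C_N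
      by (rule order_trans[OF norm_triangle_ineq4 add_mono[OF S_symbol_le]])
         (use \<sigma> C_symbol_le in \<open>auto simp: norm_smult\<close>)
  qed
  have Nr: "hb_regular m (N_part U)" if "hb_regular m U" for U
    using that by (intro hb_regular_dominated[OF that that]) (auto simp: hb_regular_def N_part_coeff intro: order_trans[OF N_symbol_le])
  have "((\<lambda>k. (cmod (top_symbol m k))\<^sup>2 * (norm (fourier_coeff (P_var c \<Delta>t 1 U V) k))\<^sup>2 + (cmod (top_symbol m k))\<^sup>2 * (norm (fourier_coeff (P_var c \<Delta>t (-1) U V) k))\<^sup>2
      + 2 * ((cmod (top_symbol m k))\<^sup>2 * (norm (fourier_coeff (N_part U) k))\<^sup>2) + 2 * ((cmod (top_symbol m k))\<^sup>2 * (norm (fourier_coeff (N_part V) k))\<^sup>2)) has_sum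
     ((hb_seminorm m (P_var c \<Delta>t 1 U V))\<^sup>2 / (2 * pi) ^ 3 + (hb_seminorm m (P_var c \<Delta>t (-1) U V))\<^sup>2 / (2 * pi) ^ 3
        + 2 * ((hb_seminorm m (N_part U))\<^sup>2 / (2 * pi) ^ 3) + 2 * ((hb_seminorm m (N_part V))\<^sup>2 / (2 * pi) ^ 3))) UNIV"
    by (intro has_sum_add has_sum_cmult_right hb_has_sum P Nr U V) auto
  moreover have "(cmod (top_symbol m k))\<^sup>2 * (norm (fourier_coeff (P_var c \<Delta>t 1 U V) k))\<^sup>2 + (cmod (top_symbol m k))\<^sup>2 * (norm (fourier_coeff (P_var c \<Delta>t (-1) U V) k))\<^sup>2
      + 2 * ((cmod (top_symbol m k))\<^sup>2 * (norm (fourier_coeff (N_part U) k))\<^sup>2) + 2 * ((cmod (top_symbol m k))\<^sup>2 * (norm (fourier_coeff (N_part V) k))\<^sup>2)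
    = (cmod (top_symbol m k))\<^sup>2 * (2 * (norm (fourier_coeff U k))\<^sup>2 + 2 * (norm (fourier_coeff V k))\<^sup>2
       - 2 * Re (hip (fourier_coeff U k) (update_symbol (c * \<Delta>t / 2) k (fourier_coeff V k))))" for k
    unfolding PQ_energy [symmetric] characteristic_coeff(2)[OF U2 V2] N_part_coeff(2)[OF U2] N_part_coeff(2)[OF V2]
    by (simp add: algebra_simps)
  ultimately show ?thesis by (simp add: add_divide_distrib)
qed

text \<open>
  Reversing the time step and \<open>\<sigma>\<close> together keeps the multiplier \<open>S\<^sup>\<plusminus>\<close> and flips the sign in front of it.  So \<open>characteristic_energy\<close> also covers \<open>Q\<close>.
\<close>

lemma Q_var_eq: "Q_var c \<Delta>t \<sigma> V U = P_var c (- \<Delta>t) (- \<sigma>) V U"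
  by (simp add: Q_var_def P_var_def S_op_def)

subsection \<open>Conservation\<close>

text \<open>
  The difference of the summands is twice the real part of the pairing of the residual with \<open>X + X'\<close>, since
  \<open>|X'|\<^sup>2 - |X|\<^sup>2 = Re \<langle>X' - X, X' + X\<rangle>\<close> and the update symbol is symmetric with respect to the real part of the pairing.
\<close>

lemma energy_balance:
  fixes X X' Y :: "int ^ 3 \<Rightarrow> complex ^ 3"
  assumes o: "\<And>Z. Z = X \<or> Z = X' \<Longrightarrow>
      ((\<lambda>k. hip (top_symbol m k *s ((X' k - X k) - update_symbol \<tau> k (Y k))) (top_symbol m k *s Z k)) has_sum 0) UNIV"
    and a: "((\<lambda>k. (cmod (top_symbol m k))\<^sup>2 * (2 * (norm (X' k))\<^sup>2 + 2 * (norm (Y k))\<^sup>2 - 2 * Re (hip (X' k) (update_symbol \<tau> k (Y k))))) has_sum a) UNIV"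
    and b: "((\<lambda>k. (cmod (top_symbol m k))\<^sup>2 * (2 * (norm (Y k))\<^sup>2 + 2 * (norm (X k))\<^sup>2 - 2 * Re (hip (Y k) (update_symbol (- \<tau>) k (X k))))) has_sum b) UNIV"
  shows "a = b"
proof -
  let ?A = "\<lambda>k. 2 * (norm (X' k))\<^sup>2 + 2 * (norm (Y k))\<^sup>2 - 2 * Re (hip (X' k) (update_symbol \<tau> k (Y k)))"
  let ?B = "\<lambda>k. 2 * (norm (Y k))\<^sup>2 + 2 * (norm (X k))\<^sup>2 - 2 * Re (hip (Y k) (update_symbol (- \<tau>) k (X k)))"
  define g where "g k = (X' k - X k) - update_symbol \<tau> k (Y k)" for k
  have "((\<lambda>k. 2 * Re (hip (top_symbol m k *s g k) (top_symbol m k *s X' k) + hip (top_symbol m k *s g k) (top_symbol m k *s X k))) has_sum 2 * Re (0 + 0)) UNIV"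
    unfolding g_def by (intro has_sum_cmult_right has_sum_Re has_sum_add o) auto
  moreover have "2 * Re (hip (top_symbol m k *s g k) (top_symbol m k *s X' k) + hip (top_symbol m k *s g k) (top_symbol m k *s X k))
    = (cmod (top_symbol m k))\<^sup>2 * ?A k
      - (cmod (top_symbol m k))\<^sup>2 * ?B k" for k
  proof -
    have 1: "hip (top_symbol m k *s u) (top_symbol m k *s v) = of_real ((cmod (top_symbol m k))\<^sup>2) * hip u v" for u v
      unfolding hip_linear complex_norm_square by (simp add: mult_ac)
    have r: "Re (hip u v) = Re (hip v u)" for u v using hip_cnj[of u v] by (metis cnj.simps(1))
    have "Re (hip (g k) (X' k)) + Re (hip (g k) (X k)) = (norm (X' k))\<^sup>2 - (norm (X k))\<^sup>2
        - Re (hip (X' k) (update_symbol \<tau> k (Y k))) - Re (hip (X k) (update_symbol \<tau> k (Y k)))"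
      unfolding g_def hip_linear norm_sq_hip using r[of "X' k" "X k"] r[of "update_symbol \<tau> k (Y k)"] by simp
    moreover have "Re (hip (Y k) (update_symbol (- \<tau>) k (X k))) = - Re (hip (X k) (update_symbol \<tau> k (Y k)))"
      using hip_update_symbol[of "Y k" \<tau> k "X k"] hip_linear(6)[of "Y k" "-1" "update_symbol \<tau> k (X k)"]
      unfolding update_symbol_linear(2) by simp
    ultimately have "2 * (Re (hip (g k) (X' k)) + Re (hip (g k) (X k))) = ?A k
      - ?B k"
      by simp
    moreover have "2 * Re (of_real K * x + of_real K * y) = K * (2 * (Re x + Re y))" for K x y
      by (simp add: algebra_simps)
    ultimately show ?thesis unfolding 1 right_diff_distrib [symmetric] by (simp only:)
  qed
  ultimately have "((\<lambda>k. (cmod (top_symbol m k))\<^sup>2 * ?A k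
      - (cmod (top_symbol m k))\<^sup>2 * ?B k) has_sum 0) UNIV"
    by (simp only: add_0 zero_complex.simps mult_zero_right)
  from has_sum_unique[OF this has_sum_diff[OF a b]] show ?thesis by simp
qed

text \<open>Only the square of \<open>c\<close> enters, so the magnetic update is the electric one for \<open>- c\<close>.\<close>

lemma increment_minus: "increment (- c) \<Delta>t q G = increment c \<Delta>t q G"
  unfolding increment_def taylor_term_def by simp

theorem theorem1:
  fixes \<epsilon> \<mu> c \<Delta>t :: real
    and m n :: nat
    and N :: "nat ^ 3"
    and x\<^sub>0 :: "real ^ 3"
    and Edata Hdata :: "nat \<Rightarrow> vertex_data"
  assumes "\<epsilon> > 0" and "\<mu> > 0" and "c = (\<epsilon> * \<mu>) powr (- 1 / 2)"
    and "\<And>i. N $ i \<ge> 1"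
    and "\<Delta>t > 0"
    and "c * \<Delta>t < Min (range (\<lambda>i. spacing N $ i))"
    and "hermite_method c \<Delta>t (3 * m + 2) N x\<^sub>0 m Edata Hdata"
  shows
    "let E = (\<lambda>n. complexify (hb_interp N x\<^sub>0 m (Edata n)));
         H = (\<lambda>n. complexify (hb_interp N (dual_origin N x\<^sub>0) m (Hdata n)));
         P = (\<lambda>\<sigma> n. P_var c \<Delta>t \<sigma> (E n) (H n));
         Q = (\<lambda>\<sigma> n. Q_var c \<Delta>t \<sigma> (H (Suc n)) (E n))
     in (hb_seminorm m (P 1 (Suc n)))\<^sup>2 + (hb_seminorm m (P (- 1) (Suc n)))\<^sup>2
          + 2 * (hb_seminorm m (N_part (E (Suc n))))\<^sup>2 + 2 * (hb_seminorm m (N_part (H (Suc n))))\<^sup>2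
        = (hb_seminorm m (Q 1 n))\<^sup>2 + (hb_seminorm m (Q (- 1) n))\<^sup>2
          + 2 * (hb_seminorm m (N_part (H (Suc n))))\<^sup>2 + 2 * (hb_seminorm m (N_part (E n)))\<^sup>2
      \<and> (hb_seminorm m (Q 1 n))\<^sup>2 + (hb_seminorm m (Q (- 1) n))\<^sup>2
          + 2 * (hb_seminorm m (N_part (H (Suc n))))\<^sup>2 + 2 * (hb_seminorm m (N_part (E n)))\<^sup>2
        = (hb_seminorm m (P 1 n))\<^sup>2 + (hb_seminorm m (P (- 1) n))\<^sup>2
          + 2 * (hb_seminorm m (N_part (E n)))\<^sup>2 + 2 * (hb_seminorm m (N_part (H n)))\<^sup>2"
proof -
  note N = assms(4)
  define o' where "o' = dual_origin N x\<^sub>0"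
  define E where "E n = spline_field N x\<^sub>0 m (Edata n)" for n
  define H where "H n = spline_field N o' m (Hdata n)" for n
  \<comment> \<open>the cube of radius \<open>R\<close> around its center is contained in every cell\<close>
  define R where "R = Min (range (\<lambda>i. spacing N $ i)) / 2"
  have cpos: "c > 0" using assms by simp
  have R: "2 * R \<le> spacing N $ i" for i unfolding R_def by simp
  have cfl: "c * \<Delta>t \<noteq> 0" "\<bar>c * \<Delta>t\<bar> < 2 * R" "- c * \<Delta>t \<noteq> 0" "\<bar>- c * \<Delta>t\<bar> < 2 * R"
    using cpos assms(5,6) by (auto simp: R_def)
  have dE: "periodic_data N m (Edata n)" and dH: "periodic_data N m (Hdata n)" for n
    using assms(7) by (auto simp: hermite_method_def)
  have updH: "Hdata (Suc n) j \<alpha> - Hdata n j \<alpha> =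
      mixed_partial \<alpha> (increment (- c) \<Delta>t (3 * m + 2) (\<lambda>x. (- c) *\<^sub>R curl (cell_poly N x\<^sub>0 m (Edata n) j) x)) (vertex N (dual_origin N x\<^sub>0) j)"
    if "\<alpha> \<in> multi_indices m" for n j \<alpha>
    using assms(7) that unfolding hermite_method_def Let_def increment_minus by simp
  \<comment> \<open>primal vertex \<open>j + 1\<close> is the center of dual cell \<open>j\<close>\<close>
  have updE: "Edata (Suc n) (j + 1) \<alpha> - Edata n (j + 1) \<alpha> =
      mixed_partial \<alpha> (increment c \<Delta>t (3 * m + 2) (\<lambda>x. c *\<^sub>R curl (cell_poly N o' m (Hdata (Suc n)) j) x)) (vertex N (dual_origin N o') j)"
    if "\<alpha> \<in> multi_indices m" for n j \<alpha>
  proof -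
    have "Edata (Suc n) (j + 1) \<alpha> = Edata n (j + 1) \<alpha> +
      mixed_partial \<alpha> (increment c \<Delta>t (3 * m + 2) (\<lambda>x. c *\<^sub>R curl (cell_poly N (dual_origin N x\<^sub>0) m (Hdata (Suc n)) (j + 1 - 1)) x)) (vertex N x\<^sub>0 (j + 1))"
      using assms(7) that unfolding hermite_method_def Let_def by blast
    moreover have "vertex N (dual_origin N o') j = vertex N x\<^sub>0 (j + 1)" unfolding o'_def dual_dual vertex_shift ..
    ultimately show ?thesis by (simp add: o'_def)
  qed
  have E_shift: "spline_field N (dual_origin N o') m (\<lambda>j. Edata n (j + 1)) = E n" for n
    unfolding E_def o'_def dual_dual by (rule spline_field_shift[OF N])
  have oH: "((\<lambda>k. hip (top_symbol m k *s (fourier_coeff (H (Suc n)) k - fourier_coeff (H n) k - update_symbol (- (c * \<Delta>t / 2)) k (fourier_coeff (E n) k)))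
      (top_symbol m k *s fourier_coeff (H p) k)) has_sum 0) UNIV" for n p
    using update_residual_orthogonal[OF N dE fourier_spline_diff(1)[OF N dH dH] dH cfl(3,4) R updH, of n p]
    unfolding fourier_spline_diff(2)[OF N dH dH] by (simp add: H_def E_def o'_def)
  note pE = periodic_data_shift[OF dE]
  have oE: "((\<lambda>k. hip (top_symbol m k *s (fourier_coeff (E (Suc n)) k - fourier_coeff (E n) k - update_symbol (c * \<Delta>t / 2) k (fourier_coeff (H (Suc n)) k)))
      (top_symbol m k *s fourier_coeff (E p) k)) has_sum 0) UNIV" for n p
    using update_residual_orthogonal[OF N dH fourier_spline_diff(1)[OF N pE pE] pE cfl(1,2) R updE, of n p]
    unfolding fourier_spline_diff(2)[OF N pE pE] E_shift by (simp add: H_def)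
  have rE: "hb_regular m (E n)" and rH: "hb_regular m (H n)" for n
    unfolding E_def H_def by (rule hb_regular_spline_field[OF N dE], rule hb_regular_spline_field[OF N dH])
  let ?P = "\<lambda>n. (hb_seminorm m (P_var c \<Delta>t 1 (E n) (H n)))\<^sup>2 + (hb_seminorm m (P_var c \<Delta>t (-1) (E n) (H n)))\<^sup>2
        + 2 * (hb_seminorm m (N_part (E n)))\<^sup>2 + 2 * (hb_seminorm m (N_part (H n)))\<^sup>2"
  let ?Q = "\<lambda>n. (hb_seminorm m (Q_var c \<Delta>t 1 (H (Suc n)) (E n)))\<^sup>2 + (hb_seminorm m (Q_var c \<Delta>t (-1) (H (Suc n)) (E n)))\<^sup>2
        + 2 * (hb_seminorm m (N_part (H (Suc n))))\<^sup>2 + 2 * (hb_seminorm m (N_part (E n)))\<^sup>2"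
  have eP: "((\<lambda>k. (cmod (top_symbol m k))\<^sup>2 * (2 * (norm (fourier_coeff (E n) k))\<^sup>2 + 2 * (norm (fourier_coeff (H n) k))\<^sup>2
       - 2 * Re (hip (fourier_coeff (E n) k) (update_symbol (c * \<Delta>t / 2) k (fourier_coeff (H n) k))))) has_sum
     ?P n / (2 * pi) ^ 3) UNIV" for n
    by (rule characteristic_energy[OF rE rH])
  have eQ: "((\<lambda>k. (cmod (top_symbol m k))\<^sup>2 * (2 * (norm (fourier_coeff (H (Suc n)) k))\<^sup>2 + 2 * (norm (fourier_coeff (E n) k))\<^sup>2
       - 2 * Re (hip (fourier_coeff (H (Suc n)) k) (update_symbol (- (c * \<Delta>t / 2)) k (fourier_coeff (E n) k))))) has_sum
     ?Q n / (2 * pi) ^ 3) UNIV" for n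
    using characteristic_energy[OF rH[of "Suc n"] rE[of n], where c = c and \<Delta>t = "- \<Delta>t"] by (simp add: Q_var_eq add.commute)
  have 1: "?P (Suc n) / (2 * pi) ^ 3
     = ?Q n / (2 * pi) ^ 3"
    by (rule energy_balance[OF _ eP[of "Suc n"] eQ[of n]]) (use oE in blast)
  have 2: "?Q n / (2 * pi) ^ 3
     = ?P n / (2 * pi) ^ 3"
    by (rule energy_balance[OF _ eQ[of n], where X = "\<lambda>k. fourier_coeff (H n) k"])
       (use oH eP[of n] in auto)
  have "(2 * pi) ^ 3 \<noteq> (0 :: real)" by simp
  then show ?thesis
    using 1 2 unfolding Let_def E_def H_def o'_def spline_field_def by simp
qed

end
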